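(* Let $F : (\mathbf{Cat}/I,S) \to (\mathbf{Cat}/J,T)$ be a polynomial adjunction of 2-monads, $A$ a pseudo $T$-algebra, and $g : X \to Y$ a morphism of $\mathbf{Cat}/I$. Suppose that (1) $I$ and $J$ are discrete, (2) $B_T$ is a groupoid, and (3) $p_T : E_T \to B_T$ has the structure of a split fibration. If $A$ is algebraically cocomplete relative to $F_!g$, then $\overline FA$ is algebraically cocomplete relative to $g$.
   Context: **Kan extensions.** In a 2-category with comma objects, a 2-cell $\psi : g \to hf$ (with $f : X \to Y$, $g : X \to A$, $h : Y \to A$) exhibits $h$ as a left Kan extension of $g$ along $f$ if for every $k : Y \to A$, pasting with $\psi$ is a bijection between 2-cells $h \to k$ and 2-cells $g \to kf$. It is pointwise if for every $k : Z \to Y$, with comma square $p : f\downarrow k \to X$, $q : f \downarrow k \to Z$, $\lambda : fp \to kq$, the 2-cell $(h\lambda)(\psi p) : gp \to hkq$ exhibits $hk$ as a left Kan extension of $gp$ along $q$. **Algebraic cocompleteness.** Let $T$ be a 2-monad on a 2-category $\mathcal K$ with comma objects and $f : X \to Y$ an arrow of $\mathcal K$. A pseudo $T$-algebra $(A,a)$ ($a : TA \to A$ satisfying the algebra axioms up to coherent invertible 2-cells) is algebraically cocomplete relative to $f$ if (i) for all $g : X \to A$ the pointwise left Kan extension of $g$ along $f$ exists in $\mathcal K$, and (ii) whenever $\psi$ exhibits $h$ as a pointwise left Kan extension of $g$ along $f$, $aT(\psi)$ exhibits $aT(h)$ as a pointwise left Kan extension of $aT(g)$ along $T(f)$. **Adjunctions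 of 2-monads.** An adjunction of 2-monads $F : (\mathcal L,S) \to (\mathcal K,T)$ consists of a 2-functor $F_! : \mathcal L \to \mathcal K$, a 2-natural transformation $F^c : F_!S \to TF_!$ making $(F_!,F^c)$ a colax morphism of 2-monads, and a right adjoint $F^*$ of $F_!$. The mate of $F^c$ is $F^l : SF^* \to F^*T$, and for a pseudo $T$-algebra $(A,a)$, $\overline FA$ is the pseudo $S$-algebra with underlying object $F^*A$ and action $F^*(a)F^l_A : SF^*A \to F^*A$. **Polynomials.** For a category $I$, $\mathbf{Cat}/I$ is the slice 2-category. A polynomial from $I$ to $J$ is a diagram $I \xleftarrow{s} E \xrightarrow{p} B \xrightarrow{t} J$ of categories with $p$ exponentiable; its associated 2-functor is $\Sigma_t\Pi_p\Delta_s : \mathbf{Cat}/I \to \mathbf{Cat}/J$, where $\Delta_s$ is pullback along $s$, $\Pi_p$ is right adjoint to pullback along $p$, and $\Sigma_t$ is composition with $t$. A 2-cell $(s_1,p_1,t_1) \to (s_2,p_2,t_2)$ of polynomials is a pair $f_1 : B_1 \to B_2$, $f_2 : E_1 \to E_2$ with $s_2f_2 = s_1$, $t_2f_1 = t_1$ and $p_2f_2 = f_1p_1$ a pullback square; it induces a 2-natural transformation. Polynomials form a 2-bicategory, and taking associated 2-functors is a homomorphism. A polynomial 2-monad $(\mathbf{Cat}/J,T)$ is one obtained (up to isomorphism) from a monad on $J$ in this bicategory; its underlying polynomial is written $J \xleftarrow{s_T} E_T \xrightarrow{p_T} B_T \xrightarrow{t_T} J$. A morphism from a polynomial monad $(I,S)$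 to $(J,T)$ consists of functors $f : I \to J$, $F_1 : B_S \to B_T$, $F_2 : E_S \to E_T$ with $fs_S = s_TF_2$, $ft_S = t_TF_1$ and $F_1p_S = p_TF_2$ a pullback square, compatibly with the monad structures. It induces an adjunction of 2-monads $F : (\mathbf{Cat}/I,S) \to (\mathbf{Cat}/J,T)$ with $F_! = \Sigma_f$, $F^* = \Delta_f$ and $F^c$ induced by $(F_1,F_2)$; adjunctions arising in this way (up to isomorphism) are called polynomial adjunctions of 2-monads. *)

theory Defs
  imports Main "HOL-Library.FuncSet" "HOL-Library.Equipollence"
begin

section \<open>2-categories, 2-functors, 2-natural transformations\<close>

text \<open>
  Strict 2-categories are records with explicit carriers.  Composition of 1-cells
  (\<open>g \<cdot> f\<close> is \<open>f\<close> followed by \<open>g\<close>), vertical and horizontal composition of 2-cells are only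
  meaningful on composable arguments.
\<close>

record ('o, 'f, 't) two_cat =
  Ob :: "'o set"
  Mor :: "'f set"
  Cell :: "'t set"
  src :: "'f \<Rightarrow> 'o"
  tgt :: "'f \<Rightarrow> 'o"
  one :: "'o \<Rightarrow> 'f"
  cmp :: "'f \<Rightarrow> 'f \<Rightarrow> 'f" (infixr "\<cdot>\<index>" 75)
  dom2 :: "'t \<Rightarrow> 'f"
  cod2 :: "'t \<Rightarrow> 'f"
  id2 :: "'f \<Rightarrow> 't"
  vcmp :: "'t \<Rightarrow> 't \<Rightarrow> 't" (infixr "\<bullet>\<index>" 65)
  hcmp :: "'t \<Rightarrow> 't \<Rightarrow> 't" (infixr "\<star>\<index>" 70)

definition hom :: "('o, 'f, 't, 'z) two_cat_scheme \<Rightarrow> 'o \<Rightarrow> 'o \<Rightarrow> 'f set" where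
  "hom K X Y = {f \<in> Mor K. src K f = X \<and> tgt K f = Y}"

definition cells :: "('o, 'f, 't, 'z) two_cat_scheme \<Rightarrow> 'f \<Rightarrow> 'f \<Rightarrow> 't set" where
  "cells K f g = {\<alpha> \<in> Cell K. dom2 K \<alpha> = f \<and> cod2 K \<alpha> = g}"

locale two_category =
  fixes K :: "('o, 'f, 't, 'z) two_cat_scheme" (structure)
  assumes src_Ob: "f \<in> Mor K \<Longrightarrow> src K f \<in> Ob K"
    and tgt_Ob: "f \<in> Mor K \<Longrightarrow> tgt K f \<in> Ob K"
    and one_hom: "X \<in> Ob K \<Longrightarrow> one K X \<in> hom K X X"
    and cmp_hom: "f \<in> hom K X Y \<Longrightarrow> g \<in> hom K Y Z \<Longrightarrow> g \<cdot> f \<in> hom K X Z"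
    and cmp_one: "f \<in> hom K X Y \<Longrightarrow> f \<cdot> one K X = f"
    and one_cmp: "f \<in> hom K X Y \<Longrightarrow> one K Y \<cdot> f = f"
    and cmp_assoc: "f \<in> hom K W X \<Longrightarrow> g \<in> hom K X Y \<Longrightarrow> h \<in> hom K Y Z \<Longrightarrow>
      (h \<cdot> g) \<cdot> f = h \<cdot> (g \<cdot> f)"
    and dom2_Mor: "\<alpha> \<in> Cell K \<Longrightarrow> dom2 K \<alpha> \<in> Mor K"
    and cod2_Mor: "\<alpha> \<in> Cell K \<Longrightarrow> cod2 K \<alpha> \<in> Mor K"
    and src_parallel: "\<alpha> \<in> Cell K \<Longrightarrow> src K (dom2 K \<alpha>) = src K (cod2 K \<alpha>)"
    and tgt_parallel: "\<alpha> \<in> Cell K \<Longrightarrow> tgt K (dom2 K \<alpha>) = tgt K (cod2 K \<alpha>)"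
    and id2_cells: "f \<in> Mor K \<Longrightarrow> id2 K f \<in> cells K f f"
    and vcmp_cells: "\<alpha> \<in> cells K f g \<Longrightarrow> \<beta> \<in> cells K g h \<Longrightarrow> \<beta> \<bullet> \<alpha> \<in> cells K f h"
    and vcmp_id2: "\<alpha> \<in> cells K f g \<Longrightarrow> \<alpha> \<bullet> id2 K f = \<alpha>"
    and id2_vcmp: "\<alpha> \<in> cells K f g \<Longrightarrow> id2 K g \<bullet> \<alpha> = \<alpha>"
    and vcmp_assoc: "\<alpha> \<in> cells K f g \<Longrightarrow> \<beta> \<in> cells K g h \<Longrightarrow> \<gamma> \<in> cells K h k \<Longrightarrow>
      (\<gamma> \<bullet> \<beta>) \<bullet> \<alpha> = \<gamma> \<bullet> (\<beta> \<bullet> \<alpha>)"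
    and hcmp_cells: "f \<in> hom K X Y \<Longrightarrow> g \<in> hom K Y Z \<Longrightarrow> \<alpha> \<in> cells K f f' \<Longrightarrow>
      \<beta> \<in> cells K g g' \<Longrightarrow> \<beta> \<star> \<alpha> \<in> cells K (g \<cdot> f) (g' \<cdot> f')"
    and hcmp_id2: "f \<in> hom K X Y \<Longrightarrow> g \<in> hom K Y Z \<Longrightarrow> id2 K g \<star> id2 K f = id2 K (g \<cdot> f)"
    and hcmp_one: "f \<in> hom K X Y \<Longrightarrow> \<alpha> \<in> cells K f f' \<Longrightarrow> \<alpha> \<star> id2 K (one K X) = \<alpha>"
    and one_hcmp: "f \<in> hom K X Y \<Longrightarrow> \<alpha> \<in> cells K f f' \<Longrightarrow> id2 K (one K Y) \<star> \<alpha> = \<alpha>"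
    and hcmp_assoc: "f \<in> hom K W X \<Longrightarrow> g \<in> hom K X Y \<Longrightarrow> h \<in> hom K Y Z \<Longrightarrow>
      \<alpha> \<in> cells K f f' \<Longrightarrow> \<beta> \<in> cells K g g' \<Longrightarrow> \<gamma> \<in> cells K h h' \<Longrightarrow>
      (\<gamma> \<star> \<beta>) \<star> \<alpha> = \<gamma> \<star> (\<beta> \<star> \<alpha>)"
    and interchange: "f \<in> hom K X Y \<Longrightarrow> g \<in> hom K Y Z \<Longrightarrow>
      \<alpha> \<in> cells K f f' \<Longrightarrow> \<alpha>' \<in> cells K f' f'' \<Longrightarrow> \<beta> \<in> cells K g g' \<Longrightarrow> \<beta>' \<in> cells K g' g'' \<Longrightarrow>
      (\<beta>' \<bullet> \<beta>) \<star> (\<alpha>' \<bullet> \<alpha>) = (\<beta>' \<star> \<alpha>') \<bullet> (\<beta> \<star> \<alpha>)"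

definition invertible1 :: "('o, 'f, 't, 'z) two_cat_scheme \<Rightarrow> 'f \<Rightarrow> bool" where
  "invertible1 K f \<longleftrightarrow> f \<in> Mor K \<and> (\<exists>g \<in> hom K (tgt K f) (src K f).
     g \<cdot>\<^bsub>K\<^esub> f = one K (src K f) \<and> f \<cdot>\<^bsub>K\<^esub> g = one K (tgt K f))"

definition invertible2 :: "('o, 'f, 't, 'z) two_cat_scheme \<Rightarrow> 't \<Rightarrow> bool" where
  "invertible2 K \<alpha> \<longleftrightarrow> \<alpha> \<in> Cell K \<and> (\<exists>\<beta> \<in> cells K (cod2 K \<alpha>) (dom2 K \<alpha>).
     \<beta> \<bullet>\<^bsub>K\<^esub> \<alpha> = id2 K (dom2 K \<alpha>) \<and> \<alpha> \<bullet>\<^bsub>K\<^esub> \<beta> = id2 K (cod2 K \<alpha>))"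

record ('o, 'f, 't, 'p, 'g, 'u) two_fun =
  onob :: "'o \<Rightarrow> 'p"
  onmor :: "'f \<Rightarrow> 'g"
  oncell :: "'t \<Rightarrow> 'u"

definition two_functor ::
  "('o, 'f, 't) two_cat \<Rightarrow> ('p, 'g, 'u) two_cat \<Rightarrow> ('o, 'f, 't, 'p, 'g, 'u) two_fun \<Rightarrow> bool" where
  "two_functor K L F \<longleftrightarrow>
     (\<forall>X\<in>Ob K. onob F X \<in> Ob L) \<and>
     (\<forall>f\<in>Mor K. onmor F f \<in> hom L (onob F (src K f)) (onob F (tgt K f))) \<and>
     (\<forall>\<alpha>\<in>Cell K. oncell F \<alpha> \<in> cells L (onmor F (dom2 K \<alpha>)) (onmor F (cod2 K \<alpha>))) \<and>
     (\<forall>X\<in>Ob K. onmor F (one K X) = one L (onob F X)) \<and>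
     (\<forall>f\<in>Mor K. \<forall>g\<in>Mor K. tgt K f = src K g \<longrightarrow>
        onmor F (g \<cdot>\<^bsub>K\<^esub> f) = onmor F g \<cdot>\<^bsub>L\<^esub> onmor F f) \<and>
     (\<forall>f\<in>Mor K. oncell F (id2 K f) = id2 L (onmor F f)) \<and>
     (\<forall>\<alpha>\<in>Cell K. \<forall>\<beta>\<in>Cell K. cod2 K \<alpha> = dom2 K \<beta> \<longrightarrow>
        oncell F (\<beta> \<bullet>\<^bsub>K\<^esub> \<alpha>) = oncell F \<beta> \<bullet>\<^bsub>L\<^esub> oncell F \<alpha>) \<and>
     (\<forall>\<alpha>\<in>Cell K. \<forall>\<beta>\<in>Cell K. tgt K (dom2 K \<alpha>) = src K (dom2 K \<beta>) \<longrightarrow>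
        oncell F (\<beta> \<star>\<^bsub>K\<^esub> \<alpha>) = oncell F \<beta> \<star>\<^bsub>L\<^esub> oncell F \<alpha>)"

definition id_fun :: "('o, 'f, 't, 'o, 'f, 't) two_fun" where
  "id_fun = \<lparr>onob = (\<lambda>x. x), onmor = (\<lambda>x. x), oncell = (\<lambda>x. x)\<rparr>"

definition comp_fun ::
  "('p, 'g, 'u, 'q, 'h, 'v) two_fun \<Rightarrow> ('o, 'f, 't, 'p, 'g, 'u) two_fun \<Rightarrow>
   ('o, 'f, 't, 'q, 'h, 'v) two_fun" (infixr "\<odot>" 75) where
  "G \<odot> F = \<lparr>onob = onob G \<circ> onob F, onmor = onmor G \<circ> onmor F, oncell = oncell G \<circ> oncell F\<rparr>"

definition two_natural ::
  "('o, 'f, 't) two_cat \<Rightarrow> ('p, 'g, 'u) two_cat \<Rightarrow> ('o, 'f, 't, 'p, 'g, 'u) two_fun \<Rightarrow>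
   ('o, 'f, 't, 'p, 'g, 'u) two_fun \<Rightarrow> ('o \<Rightarrow> 'g) \<Rightarrow> bool" where
  "two_natural K L F G \<tau> \<longleftrightarrow>
     (\<forall>X\<in>Ob K. \<tau> X \<in> hom L (onob F X) (onob G X)) \<and>
     (\<forall>f\<in>Mor K. \<tau> (tgt K f) \<cdot>\<^bsub>L\<^esub> onmor F f = onmor G f \<cdot>\<^bsub>L\<^esub> \<tau> (src K f)) \<and>
     (\<forall>\<alpha>\<in>Cell K. id2 L (\<tau> (tgt K (dom2 K \<alpha>))) \<star>\<^bsub>L\<^esub> oncell F \<alpha> =
        oncell G \<alpha> \<star>\<^bsub>L\<^esub> id2 L (\<tau> (src K (dom2 K \<alpha>))))"


section \<open>Comma objects, pullbacks and Kan extensions in a 2-category\<close>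

definition comma_square ::
  "('o, 'f, 't) two_cat \<Rightarrow> 'f \<Rightarrow> 'f \<Rightarrow> 'f \<Rightarrow> 'f \<Rightarrow> 't \<Rightarrow> bool" where
  "comma_square K f k p q l \<longleftrightarrow>
     f \<in> Mor K \<and> k \<in> Mor K \<and> tgt K f = tgt K k \<and>
     (\<exists>P. p \<in> hom K P (src K f) \<and> q \<in> hom K P (src K k) \<and>
       l \<in> cells K (f \<cdot>\<^bsub>K\<^esub> p) (k \<cdot>\<^bsub>K\<^esub> q) \<and>
       (\<forall>W\<in>Ob K. \<forall>u\<in>hom K W (src K f). \<forall>v\<in>hom K W (src K k).
          \<forall>\<theta>\<in>cells K (f \<cdot>\<^bsub>K\<^esub> u) (k \<cdot>\<^bsub>K\<^esub> v).
          \<exists>!w. w \<in> hom K W P \<and> p \<cdot>\<^bsub>K\<^esub> w = u \<and> q \<cdot>\<^bsub>K\<^esub> w = v \<and> l \<star>\<^bsub>K\<^esub> id2 K w = \<theta>) \<and>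
       (\<forall>W\<in>Ob K. \<forall>w\<in>hom K W P. \<forall>w'\<in>hom K W P.
          \<forall>\<alpha>\<in>cells K (p \<cdot>\<^bsub>K\<^esub> w) (p \<cdot>\<^bsub>K\<^esub> w'). \<forall>\<beta>\<in>cells K (q \<cdot>\<^bsub>K\<^esub> w) (q \<cdot>\<^bsub>K\<^esub> w').
          (id2 K k \<star>\<^bsub>K\<^esub> \<beta>) \<bullet>\<^bsub>K\<^esub> (l \<star>\<^bsub>K\<^esub> id2 K w) = (l \<star>\<^bsub>K\<^esub> id2 K w') \<bullet>\<^bsub>K\<^esub> (id2 K f \<star>\<^bsub>K\<^esub> \<alpha>) \<longrightarrow>
          (\<exists>!\<gamma>. \<gamma> \<in> cells K w w' \<and> id2 K p \<star>\<^bsub>K\<^esub> \<gamma> = \<alpha> \<and> id2 K q \<star>\<^bsub>K\<^esub> \<gamma> = \<beta>)))"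

definition pullback ::
  "('o, 'f, 't) two_cat \<Rightarrow> 'f \<Rightarrow> 'f \<Rightarrow> 'f \<Rightarrow> 'f \<Rightarrow> bool" where
  "pullback K f g p q \<longleftrightarrow>
     f \<in> Mor K \<and> g \<in> Mor K \<and> tgt K f = tgt K g \<and>
     (\<exists>P. p \<in> hom K P (src K f) \<and> q \<in> hom K P (src K g) \<and> f \<cdot>\<^bsub>K\<^esub> p = g \<cdot>\<^bsub>K\<^esub> q \<and>
       (\<forall>W\<in>Ob K. \<forall>u\<in>hom K W (src K f). \<forall>v\<in>hom K W (src K g). f \<cdot>\<^bsub>K\<^esub> u = g \<cdot>\<^bsub>K\<^esub> v \<longrightarrow>
          (\<exists>!w. w \<in> hom K W P \<and> p \<cdot>\<^bsub>K\<^esub> w = u \<and> q \<cdot>\<^bsub>K\<^esub> w = v)) \<and>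
       (\<forall>W\<in>Ob K. \<forall>w\<in>hom K W P. \<forall>w'\<in>hom K W P.
          \<forall>\<alpha>\<in>cells K (p \<cdot>\<^bsub>K\<^esub> w) (p \<cdot>\<^bsub>K\<^esub> w'). \<forall>\<beta>\<in>cells K (q \<cdot>\<^bsub>K\<^esub> w) (q \<cdot>\<^bsub>K\<^esub> w').
          id2 K f \<star>\<^bsub>K\<^esub> \<alpha> = id2 K g \<star>\<^bsub>K\<^esub> \<beta> \<longrightarrow>
          (\<exists>!\<gamma>. \<gamma> \<in> cells K w w' \<and> id2 K p \<star>\<^bsub>K\<^esub> \<gamma> = \<alpha> \<and> id2 K q \<star>\<^bsub>K\<^esub> \<gamma> = \<beta>)))"

definition left_kan ::
  "('o, 'f, 't) two_cat \<Rightarrow> 'f \<Rightarrow> 'f \<Rightarrow> 'f \<Rightarrow> 't \<Rightarrow> bool" where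
  "left_kan K f g h \<psi> \<longleftrightarrow>
     (\<exists>X Y A. f \<in> hom K X Y \<and> g \<in> hom K X A \<and> h \<in> hom K Y A \<and> \<psi> \<in> cells K g (h \<cdot>\<^bsub>K\<^esub> f) \<and>
       (\<forall>k\<in>hom K Y A. bij_betw (\<lambda>\<beta>. (\<beta> \<star>\<^bsub>K\<^esub> id2 K f) \<bullet>\<^bsub>K\<^esub> \<psi>)
          (cells K h k) (cells K g (k \<cdot>\<^bsub>K\<^esub> f))))"

definition pointwise_left_kan ::
  "('o, 'f, 't) two_cat \<Rightarrow> 'f \<Rightarrow> 'f \<Rightarrow> 'f \<Rightarrow> 't \<Rightarrow> bool" where
  "pointwise_left_kan K f g h \<psi> \<longleftrightarrow>
     left_kan K f g h \<psi> \<and>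
     (\<forall>k p q l. comma_square K f k p q l \<longrightarrow>
        left_kan K q (g \<cdot>\<^bsub>K\<^esub> p) (h \<cdot>\<^bsub>K\<^esub> k) ((id2 K h \<star>\<^bsub>K\<^esub> l) \<bullet>\<^bsub>K\<^esub> (\<psi> \<star>\<^bsub>K\<^esub> id2 K p)))"


section \<open>2-monads, pseudo algebras, algebraic cocompleteness\<close>

record ('o, 'f, 't) monad2 =
  endo :: "('o, 'f, 't, 'o, 'f, 't) two_fun"
  eta :: "'o \<Rightarrow> 'f"
  mu :: "'o \<Rightarrow> 'f"

definition two_monad :: "('o, 'f, 't) two_cat \<Rightarrow> ('o, 'f, 't) monad2 \<Rightarrow> bool" where
  "two_monad K T \<longleftrightarrow>
     two_functor K K (endo T) \<and>
     two_natural K K id_fun (endo T) (eta T) \<and>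
     two_natural K K (endo T \<odot> endo T) (endo T) (mu T) \<and>
     (\<forall>X\<in>Ob K.
        mu T X \<cdot>\<^bsub>K\<^esub> eta T (onob (endo T) X) = one K (onob (endo T) X) \<and>
        mu T X \<cdot>\<^bsub>K\<^esub> onmor (endo T) (eta T X) = one K (onob (endo T) X) \<and>
        mu T X \<cdot>\<^bsub>K\<^esub> mu T (onob (endo T) X) = mu T X \<cdot>\<^bsub>K\<^esub> onmor (endo T) (mu T X))"

definition two_monad_iso ::
  "('o, 'f, 't) two_cat \<Rightarrow> ('o, 'f, 't) monad2 \<Rightarrow> ('o, 'f, 't) monad2 \<Rightarrow> ('o \<Rightarrow> 'f) \<Rightarrow> bool" where
  "two_monad_iso K T T' \<tau> \<longleftrightarrow>
     two_natural K K (endo T) (endo T') \<tau> \<and>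
     (\<forall>X\<in>Ob K.
        invertible1 K (\<tau> X) \<and>
        \<tau> X \<cdot>\<^bsub>K\<^esub> eta T X = eta T' X \<and>
        \<tau> X \<cdot>\<^bsub>K\<^esub> mu T X =
          mu T' X \<cdot>\<^bsub>K\<^esub> \<tau> (onob (endo T') X) \<cdot>\<^bsub>K\<^esub> onmor (endo T) (\<tau> X))"

text \<open>
  The coherence cells of a pseudo algebra are \<open>unit_cell : 1 \<Rightarrow> a \<eta>\<close> and
  \<open>assoc_cell : a T(a) \<Rightarrow> a \<mu>\<close>.
\<close>

record ('o, 'f, 't) pseudo_alg =
  carrier :: 'o
  act :: 'f
  unit_cell :: 't
  assoc_cell :: 't

definition pseudo_algebra ::
  "('o, 'f, 't) two_cat \<Rightarrow> ('o, 'f, 't) monad2 \<Rightarrow> ('o, 'f, 't) pseudo_alg \<Rightarrow> bool" where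
  "pseudo_algebra K T \<A> \<longleftrightarrow>
     (let A = carrier \<A>; a = act \<A>; \<alpha> = unit_cell \<A>; \<beta> = assoc_cell \<A>;
          TA = onob (endo T) A; Ta = onmor (endo T) a; TTa = onmor (endo T) Ta
      in A \<in> Ob K \<and> a \<in> hom K TA A \<and>
         invertible2 K \<alpha> \<and> \<alpha> \<in> cells K (one K A) (a \<cdot>\<^bsub>K\<^esub> eta T A) \<and>
         invertible2 K \<beta> \<and> \<beta> \<in> cells K (a \<cdot>\<^bsub>K\<^esub> Ta) (a \<cdot>\<^bsub>K\<^esub> mu T A) \<and>
         (\<beta> \<star>\<^bsub>K\<^esub> id2 K (eta T TA)) \<bullet>\<^bsub>K\<^esub> (\<alpha> \<star>\<^bsub>K\<^esub> id2 K a) = id2 K a \<and>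
         (\<beta> \<star>\<^bsub>K\<^esub> id2 K (onmor (endo T) (eta T A))) \<bullet>\<^bsub>K\<^esub> (id2 K a \<star>\<^bsub>K\<^esub> oncell (endo T) \<alpha>) = id2 K a \<and>
         (\<beta> \<star>\<^bsub>K\<^esub> id2 K (mu T TA)) \<bullet>\<^bsub>K\<^esub> (\<beta> \<star>\<^bsub>K\<^esub> id2 K TTa) =
           (\<beta> \<star>\<^bsub>K\<^esub> id2 K (onmor (endo T) (mu T A))) \<bullet>\<^bsub>K\<^esub> (id2 K a \<star>\<^bsub>K\<^esub> oncell (endo T) \<beta>))"

definition alg_cocomplete ::
  "('o, 'f, 't) two_cat \<Rightarrow> ('o, 'f, 't) monad2 \<Rightarrow> ('o, 'f, 't) pseudo_alg \<Rightarrow> 'f \<Rightarrow> bool" where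
  "alg_cocomplete K T \<A> f \<longleftrightarrow>
     (\<forall>g\<in>hom K (src K f) (carrier \<A>). \<exists>h \<psi>. pointwise_left_kan K f g h \<psi>) \<and>
     (\<forall>g\<in>hom K (src K f) (carrier \<A>). \<forall>h \<psi>. pointwise_left_kan K f g h \<psi> \<longrightarrow>
        pointwise_left_kan K (onmor (endo T) f)
          (act \<A> \<cdot>\<^bsub>K\<^esub> onmor (endo T) g) (act \<A> \<cdot>\<^bsub>K\<^esub> onmor (endo T) h)
          (id2 K (act \<A>) \<star>\<^bsub>K\<^esub> oncell (endo T) \<psi>))"


section \<open>Adjunctions of 2-monads\<close>

record ('o, 'f, 't, 'p, 'g, 'u) two_adj =
  ladj :: "('o, 'f, 't, 'p, 'g, 'u) two_fun"
  radj :: "('p, 'g, 'u, 'o, 'f, 't) two_fun"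
  adj_unit :: "'o \<Rightarrow> 'f"
  adj_counit :: "'p \<Rightarrow> 'g"

definition two_adjunction ::
  "('o, 'f, 't) two_cat \<Rightarrow> ('p, 'g, 'u) two_cat \<Rightarrow>
   ('o, 'f, 't, 'p, 'g, 'u, 'z) two_adj_scheme \<Rightarrow> bool" where
  "two_adjunction L K F \<longleftrightarrow>
     two_functor L K (ladj F) \<and> two_functor K L (radj F) \<and>
     two_natural L L id_fun (radj F \<odot> ladj F) (adj_unit F) \<and>
     two_natural K K (ladj F \<odot> radj F) id_fun (adj_counit F) \<and>
     (\<forall>X\<in>Ob L. adj_counit F (onob (ladj F) X) \<cdot>\<^bsub>K\<^esub> onmor (ladj F) (adj_unit F X)
        = one K (onob (ladj F) X)) \<and>
     (\<forall>Y\<in>Ob K. onmor (radj F) (adj_counit F Y) \<cdot>\<^bsub>L\<^esub> adj_unit F (onob (radj F) Y)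
        = one L (onob (radj F) Y))"

record ('o, 'f, 't, 'p, 'g, 'u) monad_adj = "('o, 'f, 't, 'p, 'g, 'u) two_adj" +
  colax :: "'o \<Rightarrow> 'g"

definition monad_adjunction ::
  "('o, 'f, 't) two_cat \<Rightarrow> ('o, 'f, 't) monad2 \<Rightarrow> ('p, 'g, 'u) two_cat \<Rightarrow> ('p, 'g, 'u) monad2 \<Rightarrow>
   ('o, 'f, 't, 'p, 'g, 'u) monad_adj \<Rightarrow> bool" where
  "monad_adjunction L S K T F \<longleftrightarrow>
     two_monad L S \<and> two_monad K T \<and> two_adjunction L K F \<and>
     two_natural L K (ladj F \<odot> endo S) (endo T \<odot> ladj F) (colax F) \<and>
     (\<forall>X\<in>Ob L.
        colax F X \<cdot>\<^bsub>K\<^esub> onmor (ladj F) (eta S X) = eta T (onob (ladj F) X) \<and>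
        colax F X \<cdot>\<^bsub>K\<^esub> onmor (ladj F) (mu S X) =
          mu T (onob (ladj F) X) \<cdot>\<^bsub>K\<^esub> onmor (endo T) (colax F X) \<cdot>\<^bsub>K\<^esub> colax F (onob (endo S) X))"

text \<open>The mate \<open>S F\<^sup>* \<rightarrow> F\<^sup>* T\<close> of the colax structure.\<close>

definition lax_mate ::
  "('o, 'f, 't) two_cat \<Rightarrow> ('o, 'f, 't) monad2 \<Rightarrow> ('p, 'g, 'u) monad2 \<Rightarrow>
   ('o, 'f, 't, 'p, 'g, 'u) monad_adj \<Rightarrow> 'p \<Rightarrow> 'f" where
  "lax_mate L S T F Y =
     onmor (radj F) (onmor (endo T) (adj_counit F Y)) \<cdot>\<^bsub>L\<^esub>
     onmor (radj F) (colax F (onob (radj F) Y)) \<cdot>\<^bsub>L\<^esub>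
     adj_unit F (onob (endo S) (onob (radj F) Y))"

definition Fbar ::
  "('o, 'f, 't) two_cat \<Rightarrow> ('o, 'f, 't) monad2 \<Rightarrow> ('p, 'g, 'u) monad2 \<Rightarrow>
   ('o, 'f, 't, 'p, 'g, 'u) monad_adj \<Rightarrow> ('p, 'g, 'u) pseudo_alg \<Rightarrow> ('o, 'f, 't) pseudo_alg" where
  "Fbar L S T F \<A> =
     \<lparr>carrier = onob (radj F) (carrier \<A>),
      act = onmor (radj F) (act \<A>) \<cdot>\<^bsub>L\<^esub> lax_mate L S T F (carrier \<A>),
      unit_cell = oncell (radj F) (unit_cell \<A>),
      assoc_cell = oncell (radj F) (assoc_cell \<A>) \<star>\<^bsub>L\<^esub>
        id2 L (lax_mate L S T F (onob (endo T) (carrier \<A>)) \<cdot>\<^bsub>L\<^esub>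
               onmor (endo S) (lax_mate L S T F (carrier \<A>)))\<rparr>"


section \<open>Slices and the 2-functors \<open>\<Sigma>\<close>, \<open>\<Delta>\<close>, \<open>\<Pi>\<close>\<close>

text \<open>
  An object \<open>(X, x : X \<rightarrow> I)\<close> of the slice is represented by the 1-cell \<open>x\<close>.
  A 1-cell \<open>f : (X, x) \<rightarrow> (Y, y)\<close> is represented by the pair \<open>(f, y)\<close>; the condition \<open>x = y \<cdot> f\<close>
  determines \<open>x\<close>.  Likewise a 2-cell is a pair \<open>(\<alpha>, y)\<close> such that \<open>y \<star> \<alpha>\<close> is an identity.
\<close>

definition slice :: "('o, 'f, 't) two_cat \<Rightarrow> 'o \<Rightarrow> ('f, 'f \<times> 'f, 't \<times> 'f) two_cat" where
  "slice K I =
     \<lparr>Ob = {y \<in> Mor K. tgt K y = I},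
      Mor = {(f, y). f \<in> Mor K \<and> y \<in> Mor K \<and> tgt K y = I \<and> tgt K f = src K y},
      Cell = {(\<alpha>, y). \<alpha> \<in> Cell K \<and> y \<in> Mor K \<and> tgt K y = I \<and> tgt K (dom2 K \<alpha>) = src K y \<and>
                id2 K y \<star>\<^bsub>K\<^esub> \<alpha> = id2 K (y \<cdot>\<^bsub>K\<^esub> dom2 K \<alpha>)},
      src = (\<lambda>(f, y). y \<cdot>\<^bsub>K\<^esub> f),
      tgt = (\<lambda>(f, y). y),
      one = (\<lambda>y. (one K (src K y), y)),
      cmp = (\<lambda>(g, z) (f, y). (g \<cdot>\<^bsub>K\<^esub> f, z)),
      dom2 = (\<lambda>(\<alpha>, y). (dom2 K \<alpha>, y)),
      cod2 = (\<lambda>(\<alpha>, y). (cod2 K \<alpha>, y)),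
      id2 = (\<lambda>(f, y). (id2 K f, y)),
      vcmp = (\<lambda>(\<beta>, z) (\<alpha>, y). (\<beta> \<bullet>\<^bsub>K\<^esub> \<alpha>, z)),
      hcmp = (\<lambda>(\<beta>, z) (\<alpha>, y). (\<beta> \<star>\<^bsub>K\<^esub> \<alpha>, z))\<rparr>"

definition pb :: "('o, 'f, 't) two_cat \<Rightarrow> 'f \<Rightarrow> 'f \<Rightarrow> 'f \<times> 'f" where
  "pb K f g = (SOME pq. pullback K f g (fst pq) (snd pq))"

abbreviation pb1 :: "('o, 'f, 't) two_cat \<Rightarrow> 'f \<Rightarrow> 'f \<Rightarrow> 'f" where
  "pb1 K f g \<equiv> fst (pb K f g)"

abbreviation pb2 :: "('o, 'f, 't) two_cat \<Rightarrow> 'f \<Rightarrow> 'f \<Rightarrow> 'f" where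
  "pb2 K f g \<equiv> snd (pb K f g)"

text \<open>The 1-cell into the chosen pullback of \<open>f\<close> and \<open>g\<close> with components \<open>u\<close> and \<open>v\<close>.\<close>

definition pb_pair :: "('o, 'f, 't) two_cat \<Rightarrow> 'f \<Rightarrow> 'f \<Rightarrow> 'f \<Rightarrow> 'f \<Rightarrow> 'f" where
  "pb_pair K f g u v = (THE w. w \<in> hom K (src K u) (src K (pb1 K f g)) \<and>
     pb1 K f g \<cdot>\<^bsub>K\<^esub> w = u \<and> pb2 K f g \<cdot>\<^bsub>K\<^esub> w = v)"

definition Sigma_fun ::
  "('o, 'f, 't) two_cat \<Rightarrow> 'f \<Rightarrow> ('f, 'f \<times> 'f, 't \<times> 'f, 'f, 'f \<times> 'f, 't \<times> 'f) two_fun" where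
  "Sigma_fun K f =
     \<lparr>onob = (\<lambda>x. f \<cdot>\<^bsub>K\<^esub> x), onmor = (\<lambda>(u, y). (u, f \<cdot>\<^bsub>K\<^esub> y)), oncell = (\<lambda>(\<alpha>, y). (\<alpha>, f \<cdot>\<^bsub>K\<^esub> y))\<rparr>"

definition Delta_mor :: "('o, 'f, 't) two_cat \<Rightarrow> 'f \<Rightarrow> 'f \<Rightarrow> 'f \<Rightarrow> 'f" where
  "Delta_mor K f u y = pb_pair K f y (pb1 K f (y \<cdot>\<^bsub>K\<^esub> u)) (u \<cdot>\<^bsub>K\<^esub> pb2 K f (y \<cdot>\<^bsub>K\<^esub> u))"

definition Delta_cell :: "('o, 'f, 't) two_cat \<Rightarrow> 'f \<Rightarrow> 't \<Rightarrow> 'f \<Rightarrow> 't" where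
  "Delta_cell K f \<alpha> y =
     (THE \<gamma>. \<gamma> \<in> cells K (Delta_mor K f (dom2 K \<alpha>) y) (Delta_mor K f (cod2 K \<alpha>) y) \<and>
        id2 K (pb1 K f y) \<star>\<^bsub>K\<^esub> \<gamma> = id2 K (pb1 K f (y \<cdot>\<^bsub>K\<^esub> dom2 K \<alpha>)) \<and>
        id2 K (pb2 K f y) \<star>\<^bsub>K\<^esub> \<gamma> = \<alpha> \<star>\<^bsub>K\<^esub> id2 K (pb2 K f (y \<cdot>\<^bsub>K\<^esub> dom2 K \<alpha>)))"

definition Delta_fun ::
  "('o, 'f, 't) two_cat \<Rightarrow> 'f \<Rightarrow> ('f, 'f \<times> 'f, 't \<times> 'f, 'f, 'f \<times> 'f, 't \<times> 'f) two_fun" where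
  "Delta_fun K f =
     \<lparr>onob = (\<lambda>y. pb1 K f y),
      onmor = (\<lambda>(u, y). (Delta_mor K f u y, pb1 K f y)),
      oncell = (\<lambda>(\<alpha>, y). (Delta_cell K f \<alpha> y, pb1 K f y))\<rparr>"

definition is_Pi_adj ::
  "('o, 'f, 't) two_cat \<Rightarrow> 'f \<Rightarrow> ('f, 'f \<times> 'f, 't \<times> 'f, 'f, 'f \<times> 'f, 't \<times> 'f) two_adj \<Rightarrow> bool" where
  "is_Pi_adj K p R \<longleftrightarrow>
     two_adjunction (slice K (tgt K p)) (slice K (src K p)) R \<and> ladj R = Delta_fun K p"

definition exponentiable :: "('o, 'f, 't) two_cat \<Rightarrow> 'f \<Rightarrow> bool" where
  "exponentiable K p \<longleftrightarrow> p \<in> Mor K \<and> (\<exists>R. is_Pi_adj K p R)"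

definition Pi_adj ::
  "('o, 'f, 't) two_cat \<Rightarrow> 'f \<Rightarrow> ('f, 'f \<times> 'f, 't \<times> 'f, 'f, 'f \<times> 'f, 't \<times> 'f) two_adj" where
  "Pi_adj K p = (SOME R. is_Pi_adj K p R)"

definition Pi_fun ::
  "('o, 'f, 't) two_cat \<Rightarrow> 'f \<Rightarrow> ('f, 'f \<times> 'f, 't \<times> 'f, 'f, 'f \<times> 'f, 't \<times> 'f) two_fun" where
  "Pi_fun K p = radj (Pi_adj K p)"


section \<open>Polynomials and their associated 2-functors\<close>

record 'f poly =
  ps :: 'f
  pp :: 'f
  pt :: 'f

definition polynomial :: "('o, 'f, 't) two_cat \<Rightarrow> 'o \<Rightarrow> 'o \<Rightarrow> 'f poly \<Rightarrow> bool" where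
  "polynomial K I J P \<longleftrightarrow>
     exponentiable K (pp P) \<and> ps P \<in> hom K (src K (pp P)) I \<and> pt P \<in> hom K (tgt K (pp P)) J"

definition poly_fun ::
  "('o, 'f, 't) two_cat \<Rightarrow> 'f poly \<Rightarrow> ('f, 'f \<times> 'f, 't \<times> 'f, 'f, 'f \<times> 'f, 't \<times> 'f) two_fun" where
  "poly_fun K P = Sigma_fun K (pt P) \<odot> Pi_fun K (pp P) \<odot> Delta_fun K (ps P)"

text \<open>
  Write \<open>P\<close> as \<open>I \<leftarrow> E \<rightarrow> B \<rightarrow> J\<close>, and let \<open>x : X \<rightarrow> I\<close>.  The object \<open>\<Pi>\<^sub>p \<Delta>\<^sub>s x\<close> of the slice over \<open>B\<close> is
  \<open>poly_proj K P x : Z \<rightarrow> B\<close>, and the value of the associated 2-functor at \<open>x\<close> is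
  \<open>t \<cdot> poly_proj K P x\<close>.  An element of \<open>Z\<close> over \<open>b\<close> is a functor from the fibre of \<open>E\<close> over \<open>b\<close> to
  \<open>X\<close> (over \<open>I\<close>); \<open>poly_ev\<close>, obtained from the counit of \<open>\<Delta>\<^sub>p \<stileturn> \<Pi>\<^sub>p\<close>, is evaluation
  from the pullback of \<open>E\<close> and \<open>Z\<close> over \<open>B\<close> to \<open>X\<close>.  On generalised elements \<open>e : W \<rightarrow> E\<close> and
  \<open>z : W \<rightarrow> Z\<close> over the same \<open>W \<rightarrow> B\<close>, \<open>poly_app K P x e z : W \<rightarrow> X\<close> is \<open>z\<close> applied to \<open>e\<close>.
\<close>

definition poly_proj :: "('o, 'f, 't) two_cat \<Rightarrow> 'f poly \<Rightarrow> 'f \<Rightarrow> 'f" where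
  "poly_proj K P x = onob (Pi_fun K (pp P)) (onob (Delta_fun K (ps P)) x)"

abbreviation poly_ob :: "('o, 'f, 't) two_cat \<Rightarrow> 'f poly \<Rightarrow> 'f \<Rightarrow> 'o" where
  "poly_ob K P x \<equiv> src K (poly_proj K P x)"

definition poly_ev :: "('o, 'f, 't) two_cat \<Rightarrow> 'f poly \<Rightarrow> 'f \<Rightarrow> 'f" where
  "poly_ev K P x =
     pb2 K (ps P) x \<cdot>\<^bsub>K\<^esub> fst (adj_counit (Pi_adj K (pp P)) (onob (Delta_fun K (ps P)) x))"

definition poly_app :: "('o, 'f, 't) two_cat \<Rightarrow> 'f poly \<Rightarrow> 'f \<Rightarrow> 'f \<Rightarrow> 'f \<Rightarrow> 'f" where
  "poly_app K P x e z = poly_ev K P x \<cdot>\<^bsub>K\<^esub> pb_pair K (pp P) (poly_proj K P x) e z"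

text \<open>
  Let \<open>F1 : B \<rightarrow> B'\<close> and \<open>F2 : E \<rightarrow> E'\<close> form a pullback square between the middle arrows of
  \<open>P\<close> and \<open>Q\<close>, compatibly with the other legs and with 1-cells \<open>I \<rightarrow> I'\<close>, \<open>J \<rightarrow> J'\<close>
  between the end objects, and let \<open>v : x \<rightarrow> y\<close> lie over \<open>I \<rightarrow> I'\<close>.
  The induced map sends \<open>z : E\<^sub>b \<rightarrow> X\<close> to \<open>v \<cdot> z \<cdot> F2\<inverse> : E'\<^sub>F\<^sub>1\<^sub>b \<rightarrow> Y\<close>.
\<close>

definition poly_act ::
  "('o, 'f, 't) two_cat \<Rightarrow> 'f poly \<Rightarrow> 'f poly \<Rightarrow> 'f \<times> 'f \<Rightarrow> 'f \<Rightarrow> 'f \<Rightarrow> 'f \<Rightarrow> 'f" where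
  "poly_act K P Q F x y v =
     (THE m. m \<in> hom K (poly_ob K P x) (poly_ob K Q y) \<and>
        poly_proj K Q y \<cdot>\<^bsub>K\<^esub> m = fst F \<cdot>\<^bsub>K\<^esub> poly_proj K P x \<and>
        (\<forall>W\<in>Ob K. \<forall>e\<in>hom K W (src K (pp P)). \<forall>z\<in>hom K W (poly_ob K P x).
           pp P \<cdot>\<^bsub>K\<^esub> e = poly_proj K P x \<cdot>\<^bsub>K\<^esub> z \<longrightarrow>
           poly_app K Q y (snd F \<cdot>\<^bsub>K\<^esub> e) (m \<cdot>\<^bsub>K\<^esub> z) = v \<cdot>\<^bsub>K\<^esub> poly_app K P x e z))"


section \<open>The bicategory of polynomials\<close>

text \<open>2-cells between polynomials are pairs \<open>(f\<^sub>1, f\<^sub>2)\<close>.\<close>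

definition poly_cell :: "('o, 'f, 't) two_cat \<Rightarrow> 'f poly \<Rightarrow> 'f poly \<Rightarrow> 'f \<times> 'f \<Rightarrow> bool" where
  "poly_cell K P Q \<phi> \<longleftrightarrow>
     fst \<phi> \<in> hom K (tgt K (pp P)) (tgt K (pp Q)) \<and> snd \<phi> \<in> hom K (src K (pp P)) (src K (pp Q)) \<and>
     ps Q \<cdot>\<^bsub>K\<^esub> snd \<phi> = ps P \<and> pt Q \<cdot>\<^bsub>K\<^esub> fst \<phi> = pt P \<and>
     pullback K (pp Q) (fst \<phi>) (snd \<phi>) (pp P)"

definition poly_cell_id :: "('o, 'f, 't) two_cat \<Rightarrow> 'f poly \<Rightarrow> 'f \<times> 'f" where
  "poly_cell_id K P = (one K (tgt K (pp P)), one K (src K (pp P)))"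

definition poly_cell_vcmp :: "('o, 'f, 't) two_cat \<Rightarrow> 'f \<times> 'f \<Rightarrow> 'f \<times> 'f \<Rightarrow> 'f \<times> 'f" where
  "poly_cell_vcmp K \<psi> \<phi> = (fst \<psi> \<cdot>\<^bsub>K\<^esub> fst \<phi>, snd \<psi> \<cdot>\<^bsub>K\<^esub> snd \<phi>)"

definition poly_id :: "('o, 'f, 't) two_cat \<Rightarrow> 'o \<Rightarrow> 'f poly" where
  "poly_id K I = \<lparr>ps = one K I, pp = one K I, pt = one K I\<rparr>"

text \<open>
  Composite of \<open>P : I \<rightarrow> J\<close> followed by \<open>Q : J \<rightarrow> K\<close>.  Its base consists of the pairs of
  \<open>b\<close> in \<open>B\<^sub>Q\<close> and \<open>y\<close> from the fibre of \<open>E\<^sub>Q\<close> over \<open>b\<close> to \<open>B\<^sub>P\<close> over \<open>J\<close>, i.e. it is the value at \<open>t\<^sub>P\<close> of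
  the associated 2-functor of \<open>Q\<close>; its total object consists of \<open>(e\<^sub>Q, y, e\<^sub>P)\<close> with \<open>e\<^sub>P\<close> over \<open>y e\<^sub>Q\<close>.
  This is Weber's composite by pullbacks and a distributivity pullback along \<open>p\<^sub>Q\<close>.
\<close>

definition poly_comp :: "('o, 'f, 't) two_cat \<Rightarrow> 'f poly \<Rightarrow> 'f poly \<Rightarrow> 'f poly" where
  "poly_comp K Q P =
     \<lparr>ps = ps P \<cdot>\<^bsub>K\<^esub> pb2 K (poly_ev K Q (pt P)) (pp P),
      pp = pb2 K (pp Q) (poly_proj K Q (pt P)) \<cdot>\<^bsub>K\<^esub> pb1 K (poly_ev K Q (pt P)) (pp P),
      pt = pt Q \<cdot>\<^bsub>K\<^esub> poly_proj K Q (pt P)\<rparr>"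

text \<open>The projections of \<open>(e\<^sub>Q, y, e\<^sub>P)\<close> to \<open>e\<^sub>Q\<close> and \<open>e\<^sub>P\<close>; the projection to \<open>y\<close> is the middle arrow.\<close>

definition poly_out :: "('o, 'f, 't) two_cat \<Rightarrow> 'f poly \<Rightarrow> 'f poly \<Rightarrow> 'f" where
  "poly_out K Q P =
     pb1 K (pp Q) (poly_proj K Q (pt P)) \<cdot>\<^bsub>K\<^esub> pb1 K (poly_ev K Q (pt P)) (pp P)"

definition poly_in :: "('o, 'f, 't) two_cat \<Rightarrow> 'f poly \<Rightarrow> 'f poly \<Rightarrow> 'f" where
  "poly_in K Q P = pb2 K (poly_ev K Q (pt P)) (pp P)"

definition poly_elt :: "('o, 'f, 't) two_cat \<Rightarrow> 'f poly \<Rightarrow> 'f poly \<Rightarrow> 'f \<Rightarrow> 'f \<Rightarrow> 'f \<Rightarrow> 'f" where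
  "poly_elt K Q P eQ y eP =
     pb_pair K (poly_ev K Q (pt P)) (pp P) (pb_pair K (pp Q) (poly_proj K Q (pt P)) eQ y) eP"

text \<open>
  Horizontal composite of \<open>\<psi> : Q \<Rightarrow> Q'\<close> with \<open>\<phi> : P \<Rightarrow> P'\<close>; as in \<open>poly_act\<close>,
  the end objects of the polynomials are allowed to vary.
\<close>

definition poly_cell_hcmp ::
  "('o, 'f, 't) two_cat \<Rightarrow> 'f poly \<Rightarrow> 'f poly \<Rightarrow> 'f poly \<Rightarrow> 'f poly \<Rightarrow>
   'f \<times> 'f \<Rightarrow> 'f \<times> 'f \<Rightarrow> 'f \<times> 'f" where
  "poly_cell_hcmp K Q Q' P P' \<psi> \<phi> =
     (let m = poly_act K Q Q' \<psi> (pt P) (pt P') (fst \<phi>)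
      in (m, poly_elt K Q' P' (snd \<psi> \<cdot>\<^bsub>K\<^esub> poly_out K Q P) (m \<cdot>\<^bsub>K\<^esub> pp (poly_comp K Q P))
               (snd \<phi> \<cdot>\<^bsub>K\<^esub> poly_in K Q P)))"

text \<open>
  The component at \<open>x\<close> of the coherence isomorphism from the composite of the associated 2-functors
  of \<open>Q\<close> and \<open>R\<close> to the associated 2-functor of the composite.  An element \<open>z\<close> of the source
  over \<open>b\<close> in \<open>B\<^sub>R\<close> is sent to the element over \<open>y = poly_comp_base z\<close> given by
  \<open>(e\<^sub>R, y, e\<^sub>Q) \<mapsto> (z e\<^sub>R) e\<^sub>Q\<close>, where \<open>y e\<^sub>R\<close> is the image of \<open>z e\<^sub>R\<close> in \<open>B\<^sub>Q\<close>.
\<close>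

definition poly_comp_base :: "('o, 'f, 't) two_cat \<Rightarrow> 'f poly \<Rightarrow> 'f poly \<Rightarrow> 'f \<Rightarrow> 'f" where
  "poly_comp_base K R Q x =
     poly_act K R R (poly_cell_id K R) (pt Q \<cdot>\<^bsub>K\<^esub> poly_proj K Q x) (pt Q) (poly_proj K Q x)"

definition poly_comp_cmp :: "('o, 'f, 't) two_cat \<Rightarrow> 'f poly \<Rightarrow> 'f poly \<Rightarrow> 'f \<Rightarrow> 'f" where
  "poly_comp_cmp K R Q x =
     (let RQ = poly_comp K R Q; Qx = pt Q \<cdot>\<^bsub>K\<^esub> poly_proj K Q x; k = poly_comp_base K R Q x
      in (THE n. n \<in> hom K (poly_ob K R Qx) (poly_ob K RQ x) \<and>
            poly_proj K RQ x \<cdot>\<^bsub>K\<^esub> n = k \<and>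
            (\<forall>W\<in>Ob K. \<forall>eR\<in>hom K W (src K (pp R)). \<forall>z\<in>hom K W (poly_ob K R Qx).
               \<forall>eQ\<in>hom K W (src K (pp Q)).
               pp R \<cdot>\<^bsub>K\<^esub> eR = poly_proj K R Qx \<cdot>\<^bsub>K\<^esub> z \<and>
               pp Q \<cdot>\<^bsub>K\<^esub> eQ = poly_proj K Q x \<cdot>\<^bsub>K\<^esub> poly_app K R Qx eR z \<longrightarrow>
               poly_app K RQ x (poly_elt K R Q eR (k \<cdot>\<^bsub>K\<^esub> z) eQ) (n \<cdot>\<^bsub>K\<^esub> z) =
                 poly_app K Q x eQ (poly_app K R Qx eR z))))"

text \<open>The component at \<open>x\<close> of the coherence isomorphism from the identity to \<open>poly_fun K (poly_id K J)\<close>.\<close>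

definition poly_id_cmp :: "('o, 'f, 't) two_cat \<Rightarrow> 'f \<Rightarrow> 'f" where
  "poly_id_cmp K x =
     (let U = poly_id K (tgt K x)
      in (THE n. n \<in> hom K (src K x) (poly_ob K U x) \<and> poly_proj K U x \<cdot>\<^bsub>K\<^esub> n = x \<and>
            poly_app K U x x n = one K (src K x)))"

text \<open>
  The associativity isomorphism \<open>R \<circ> (Q \<circ> P) \<Rightarrow> (R \<circ> Q) \<circ> P\<close> and the unit isomorphisms
  \<open>P \<Rightarrow> 1 \<circ> P\<close> and \<open>P \<Rightarrow> P \<circ> 1\<close>.
\<close>

definition poly_assoc ::
  "('o, 'f, 't) two_cat \<Rightarrow> 'f poly \<Rightarrow> 'f poly \<Rightarrow> 'f poly \<Rightarrow> 'f \<times> 'f" where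
  "poly_assoc K R Q P =
     (let QP = poly_comp K Q P; RQ = poly_comp K R Q;
          k = poly_comp_base K R Q (pt P); n = poly_comp_cmp K R Q (pt P);
          z = pp (poly_comp K R QP);
          eR = poly_out K R QP;
          eQ = poly_out K Q P \<cdot>\<^bsub>K\<^esub> poly_in K R QP;
          eP = poly_in K Q P \<cdot>\<^bsub>K\<^esub> poly_in K R QP
      in (n, poly_elt K RQ P (poly_elt K R Q eR (k \<cdot>\<^bsub>K\<^esub> z) eQ) (n \<cdot>\<^bsub>K\<^esub> z) eP))"

definition poly_lunit :: "('o, 'f, 't) two_cat \<Rightarrow> 'f poly \<Rightarrow> 'f \<times> 'f" where
  "poly_lunit K P =
     (let n = poly_id_cmp K (pt P)
      in (n, poly_elt K (poly_id K (tgt K (pt P))) P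
               (pt P \<cdot>\<^bsub>K\<^esub> pp P) (n \<cdot>\<^bsub>K\<^esub> pp P) (one K (src K (pp P)))))"

definition poly_runit :: "('o, 'f, 't) two_cat \<Rightarrow> 'f poly \<Rightarrow> 'f \<times> 'f" where
  "poly_runit K P =
     (let I = tgt K (ps P);
          m = (THE m. m \<in> hom K (tgt K (pp P)) (poly_ob K P (one K I)) \<and>
                 poly_proj K P (one K I) \<cdot>\<^bsub>K\<^esub> m = one K (tgt K (pp P)) \<and>
                 poly_app K P (one K I) (one K (src K (pp P))) (m \<cdot>\<^bsub>K\<^esub> pp P) = ps P)
      in (m, poly_elt K P (poly_id K I) (one K (src K (pp P))) (m \<cdot>\<^bsub>K\<^esub> pp P) (ps P)))"


section \<open>Polynomial 2-monads and polynomial adjunctions\<close>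

record 'f poly_mnd =
  mpoly :: "'f poly"
  meta :: "'f \<times> 'f"
  mmu :: "'f \<times> 'f"

definition polynomial_monad :: "('o, 'f, 't) two_cat \<Rightarrow> 'o \<Rightarrow> 'f poly_mnd \<Rightarrow> bool" where
  "polynomial_monad K J M \<longleftrightarrow>
     (let P = mpoly M; U = poly_id K J; PP = poly_comp K P P; \<iota> = poly_cell_id K P
      in polynomial K J J P \<and>
         poly_cell K U P (meta M) \<and> poly_cell K PP P (mmu M) \<and>
         poly_cell_vcmp K (mmu M) (poly_cell_vcmp K (poly_cell_hcmp K PP P P P (mmu M) \<iota>)
             (poly_assoc K P P P))
           = poly_cell_vcmp K (mmu M) (poly_cell_hcmp K P P PP P \<iota> (mmu M)) \<and>
         poly_cell_vcmp K (mmu M) (poly_cell_vcmp K (poly_cell_hcmp K U P P P (meta M) \<iota>)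
             (poly_lunit K P)) = \<iota> \<and>
         poly_cell_vcmp K (mmu M) (poly_cell_vcmp K (poly_cell_hcmp K P P U P \<iota> (meta M))
             (poly_runit K P)) = \<iota>)"

text \<open>The 2-monad on the slice over \<open>J\<close> associated to a monad on \<open>J\<close> in the bicategory of polynomials.\<close>

definition assoc_monad ::
  "('o, 'f, 't) two_cat \<Rightarrow> 'f poly_mnd \<Rightarrow> ('f, 'f \<times> 'f, 't \<times> 'f) monad2" where
  "assoc_monad K M =
     (let P = mpoly M
      in \<lparr>endo = poly_fun K P,
          eta = (\<lambda>x. (poly_act K (poly_id K (tgt K x)) P (meta M) x x (one K (src K x)) \<cdot>\<^bsub>K\<^esub>
                        poly_id_cmp K x,
                      pt P \<cdot>\<^bsub>K\<^esub> poly_proj K P x)),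
          mu = (\<lambda>x. (poly_act K (poly_comp K P P) P (mmu M) x x (one K (src K x)) \<cdot>\<^bsub>K\<^esub>
                       poly_comp_cmp K P P x,
                     pt P \<cdot>\<^bsub>K\<^esub> poly_proj K P x))\<rparr>)"

text \<open>Morphisms \<open>(f, (F1, F2))\<close> of polynomial monads, from \<open>M\<close> on \<open>I\<close> to \<open>N\<close> on \<open>J\<close>.\<close>

definition polynomial_monad_morphism ::
  "('o, 'f, 't) two_cat \<Rightarrow> 'o \<Rightarrow> 'f poly_mnd \<Rightarrow> 'o \<Rightarrow> 'f poly_mnd \<Rightarrow> 'f \<Rightarrow> 'f \<times> 'f \<Rightarrow> bool" where
  "polynomial_monad_morphism K I M J N f F \<longleftrightarrow>
     (let P = mpoly M; Q = mpoly N; FF = poly_cell_hcmp K P Q P Q F F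
      in f \<in> hom K I J \<and>
         fst F \<in> hom K (tgt K (pp P)) (tgt K (pp Q)) \<and>
         snd F \<in> hom K (src K (pp P)) (src K (pp Q)) \<and>
         f \<cdot>\<^bsub>K\<^esub> ps P = ps Q \<cdot>\<^bsub>K\<^esub> snd F \<and> f \<cdot>\<^bsub>K\<^esub> pt P = pt Q \<cdot>\<^bsub>K\<^esub> fst F \<and>
         pullback K (pp Q) (fst F) (snd F) (pp P) \<and>
         poly_cell_vcmp K F (meta M) = poly_cell_vcmp K (meta N) (f, f) \<and>
         poly_cell_vcmp K F (mmu M) = poly_cell_vcmp K (mmu N) FF)"

definition assoc_colax ::
  "('o, 'f, 't) two_cat \<Rightarrow> 'f poly_mnd \<Rightarrow> 'f poly_mnd \<Rightarrow> 'f \<Rightarrow> 'f \<times> 'f \<Rightarrow> 'f \<Rightarrow> 'f \<times> 'f" where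
  "assoc_colax K M N f F x =
     (poly_act K (mpoly M) (mpoly N) F x (f \<cdot>\<^bsub>K\<^esub> x) (one K (src K x)),
      pt (mpoly N) \<cdot>\<^bsub>K\<^esub> poly_proj K (mpoly N) (f \<cdot>\<^bsub>K\<^esub> x))"

text \<open>
  \<open>F\<close> is, up to isomorphism, the adjunction of 2-monads induced by a morphism \<open>M \<rightarrow> N\<close> of
  polynomial monads.  The isomorphism consists of isomorphisms of 2-monads \<open>\<sigma>\<close>, \<open>\<tau>\<close> and of the left
  adjoints \<open>\<phi>\<close>, compatible with the colax structures.  The right adjoint needs no separate
  clause: both \<open>radj F\<close> and \<open>\<Delta>\<^sub>f\<close> are right adjoint to \<open>ladj F \<cong> \<Sigma>\<^sub>f\<close>, hence are
  canonically isomorphic.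
\<close>

definition polynomial_adjunction ::
  "('o, 'f, 't) two_cat \<Rightarrow>
   'o \<Rightarrow> ('f, 'f \<times> 'f, 't \<times> 'f) monad2 \<Rightarrow> 'f poly_mnd \<Rightarrow>
   'o \<Rightarrow> ('f, 'f \<times> 'f, 't \<times> 'f) monad2 \<Rightarrow> 'f poly_mnd \<Rightarrow>
   ('f, 'f \<times> 'f, 't \<times> 'f, 'f, 'f \<times> 'f, 't \<times> 'f) monad_adj \<Rightarrow> bool" where
  "polynomial_adjunction K I S M J T N F \<longleftrightarrow>
     monad_adjunction (slice K I) S (slice K J) T F \<and>
     polynomial_monad K I M \<and> polynomial_monad K J N \<and>
     (\<exists>f G \<sigma> \<tau> \<phi>.
        polynomial_monad_morphism K I M J N f G \<and>
        two_monad_iso (slice K I) S (assoc_monad K M) \<sigma> \<and>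
        two_monad_iso (slice K J) T (assoc_monad K N) \<tau> \<and>
        two_natural (slice K I) (slice K J) (ladj F) (Sigma_fun K f) \<phi> \<and>
        (\<forall>x\<in>Ob (slice K I).
           invertible1 (slice K J) (\<phi> x) \<and>
           \<tau> (f \<cdot>\<^bsub>K\<^esub> x) \<cdot>\<^bsub>slice K J\<^esub> onmor (endo T) (\<phi> x) \<cdot>\<^bsub>slice K J\<^esub> colax F x =
             assoc_colax K M N f G x \<cdot>\<^bsub>slice K J\<^esub> onmor (Sigma_fun K f) (\<sigma> x) \<cdot>\<^bsub>slice K J\<^esub>
             \<phi> (onob (endo S) x)))"


section \<open>The 2-category of small categories\<close>

text \<open>
  The type \<open>'u\<close> plays the role of the universe: a set is small when it is a subset of \<open>'u\<close> of smaller
  cardinality than \<open>'u\<close>.  The cardinality of \<open>'u\<close> is required to be an infinite strong limit,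
  which makes \<open>Cat\<close> cartesian closed, with comma objects and with all the limits and exponentials
  used here.  Every Grothendieck universe (an inaccessible cardinality of \<open>'u\<close>) is covered.
\<close>

class universe =
  assumes infinite_universe: "infinite (UNIV :: 'a set)"
    and strong_limit: "\<And>A :: 'a set. A \<prec> (UNIV :: 'a set) \<Longrightarrow> Pow A \<prec> (UNIV :: 'a set)"

instance nat :: universe
proof
  show "infinite (UNIV :: nat set)" by simp
  fix A :: "nat set"
  assume "A \<prec> (UNIV :: nat set)"
  then have "finite (Pow A)"
    by (metis finite_Pow_iff infinite_le_lepoll lesspoll_def lepoll_antisym)
  then show "Pow A \<prec> (UNIV :: nat set)" by (simp add: finite_lesspoll_infinite)
qed

record 'u cat =
  Objs :: "'u set"
  Arrs :: "'u set"
  Dom :: "'u \<Rightarrow> 'u"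
  Cod :: "'u \<Rightarrow> 'u"
  Id :: "'u \<Rightarrow> 'u"
  Comp :: "'u \<Rightarrow> 'u \<Rightarrow> 'u"

definition category :: "'u cat \<Rightarrow> bool" where
  "category C \<longleftrightarrow>
     Dom C \<in> Arrs C \<rightarrow> Objs C \<and> Cod C \<in> Arrs C \<rightarrow> Objs C \<and>
     (\<forall>x\<in>Objs C. Id C x \<in> Arrs C \<and> Dom C (Id C x) = x \<and> Cod C (Id C x) = x) \<and>
     (\<forall>f\<in>Arrs C. \<forall>g\<in>Arrs C. Cod C f = Dom C g \<longrightarrow>
        Comp C g f \<in> Arrs C \<and> Dom C (Comp C g f) = Dom C f \<and> Cod C (Comp C g f) = Cod C g) \<and>
     (\<forall>f\<in>Arrs C. Comp C f (Id C (Dom C f)) = f \<and> Comp C (Id C (Cod C f)) f = f) \<and>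
     (\<forall>f\<in>Arrs C. \<forall>g\<in>Arrs C. \<forall>h\<in>Arrs C. Cod C f = Dom C g \<and> Cod C g = Dom C h \<longrightarrow>
        Comp C (Comp C h g) f = Comp C h (Comp C g f))"

definition small_category :: "'u cat \<Rightarrow> bool" where
  "small_category C \<longleftrightarrow>
     category C \<and> Objs C \<prec> (UNIV :: 'u set) \<and> Arrs C \<prec> (UNIV :: 'u set)"

text \<open>
  Functors and natural transformations carry their source and target, and their maps are extensional
  (\<open>undefined\<close> off the carriers), so that HOL equality is equality of functors and transformations.
\<close>

record 'u func =
  fsrc :: "'u cat"
  ftgt :: "'u cat"
  fobj :: "'u \<Rightarrow> 'u"
  farr :: "'u \<Rightarrow> 'u"

definition functorial :: "'u func \<Rightarrow> bool" where
  "functorial F \<longleftrightarrow>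
     (let C = fsrc F; D = ftgt F
      in fobj F \<in> Objs C \<rightarrow>\<^sub>E Objs D \<and> farr F \<in> Arrs C \<rightarrow>\<^sub>E Arrs D \<and>
         (\<forall>f\<in>Arrs C. Dom D (farr F f) = fobj F (Dom C f) \<and> Cod D (farr F f) = fobj F (Cod C f)) \<and>
         (\<forall>x\<in>Objs C. farr F (Id C x) = Id D (fobj F x)) \<and>
         (\<forall>f\<in>Arrs C. \<forall>g\<in>Arrs C. Cod C f = Dom C g \<longrightarrow>
            farr F (Comp C g f) = Comp D (farr F g) (farr F f)))"

record 'u ntrans =
  ndom :: "'u func"
  ncod :: "'u func"
  ncomp :: "'u \<Rightarrow> 'u"

definition ntransformation :: "'u ntrans \<Rightarrow> bool" where
  "ntransformation \<alpha> \<longleftrightarrow>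
     (let F = ndom \<alpha>; G = ncod \<alpha>; C = fsrc F; D = ftgt F
      in fsrc G = C \<and> ftgt G = D \<and>
         ncomp \<alpha> \<in> Objs C \<rightarrow>\<^sub>E Arrs D \<and>
         (\<forall>x\<in>Objs C. Dom D (ncomp \<alpha> x) = fobj F x \<and> Cod D (ncomp \<alpha> x) = fobj G x) \<and>
         (\<forall>f\<in>Arrs C. Comp D (ncomp \<alpha> (Cod C f)) (farr F f) =
            Comp D (farr G f) (ncomp \<alpha> (Dom C f))))"

definition is_func :: "'u func \<Rightarrow> bool" where
  "is_func F \<longleftrightarrow> small_category (fsrc F) \<and> small_category (ftgt F) \<and> functorial F"

definition func_comp :: "'u func \<Rightarrow> 'u func \<Rightarrow> 'u func" where
  "func_comp G F =
     \<lparr>fsrc = fsrc F, ftgt = ftgt G,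
      fobj = (\<lambda>x\<in>Objs (fsrc F). fobj G (fobj F x)),
      farr = (\<lambda>f\<in>Arrs (fsrc F). farr G (farr F f))\<rparr>"

definition Cat :: "('u::universe cat, 'u func, 'u ntrans) two_cat" where
  "Cat =
     \<lparr>Ob = {C. small_category C},
      Mor = {F. is_func F},
      Cell = {\<alpha>. is_func (ndom \<alpha>) \<and> is_func (ncod \<alpha>) \<and> ntransformation \<alpha>},
      src = fsrc,
      tgt = ftgt,
      one = (\<lambda>C. \<lparr>fsrc = C, ftgt = C, fobj = (\<lambda>x\<in>Objs C. x), farr = (\<lambda>f\<in>Arrs C. f)\<rparr>),
      cmp = func_comp,
      dom2 = ndom,
      cod2 = ncod,
      id2 = (\<lambda>F. \<lparr>ndom = F, ncod = F,
                  ncomp = (\<lambda>x\<in>Objs (fsrc F). Id (ftgt F) (fobj F x))\<rparr>),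
      vcmp = (\<lambda>\<beta> \<alpha>. \<lparr>ndom = ndom \<alpha>, ncod = ncod \<beta>,
                    ncomp = (\<lambda>x\<in>Objs (fsrc (ndom \<alpha>)).
                      Comp (ftgt (ndom \<alpha>)) (ncomp \<beta> x) (ncomp \<alpha> x))\<rparr>),
      hcmp = (\<lambda>\<beta> \<alpha>. \<lparr>ndom = func_comp (ndom \<beta>) (ndom \<alpha>), ncod = func_comp (ncod \<beta>) (ncod \<alpha>),
                    ncomp = (\<lambda>x\<in>Objs (fsrc (ndom \<alpha>)).
                      Comp (ftgt (ndom \<beta>)) (ncomp \<beta> (fobj (ncod \<alpha>) x))
                        (farr (ndom \<beta>) (ncomp \<alpha> x)))\<rparr>)\<rparr>"

definition discrete :: "'u cat \<Rightarrow> bool" where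
  "discrete C \<longleftrightarrow> (\<forall>f\<in>Arrs C. f = Id C (Dom C f))"

definition groupoid :: "'u cat \<Rightarrow> bool" where
  "groupoid C \<longleftrightarrow> (\<forall>f\<in>Arrs C. \<exists>g\<in>Arrs C. Dom C g = Cod C f \<and> Cod C g = Dom C f \<and>
     Comp C g f = Id C (Dom C f) \<and> Comp C f g = Id C (Cod C f))"

definition cartesian_arr :: "'u func \<Rightarrow> 'u \<Rightarrow> bool" where
  "cartesian_arr p c \<longleftrightarrow>
     (let E = fsrc p; B = ftgt p
      in c \<in> Arrs E \<and>
         (\<forall>h\<in>Arrs E. \<forall>\<gamma>\<in>Arrs B. Cod E h = Cod E c \<and> Dom B \<gamma> = fobj p (Dom E h) \<and>
            Cod B \<gamma> = fobj p (Dom E c) \<and> farr p h = Comp B (farr p c) \<gamma> \<longrightarrow>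
            (\<exists>!k. k \<in> Arrs E \<and> Dom E k = Dom E h \<and> Cod E k = Dom E c \<and>
               farr p k = \<gamma> \<and> Comp E c k = h)))"

text \<open>\<open>c e \<beta>\<close> is the chosen cartesian lift with codomain \<open>e\<close> of \<open>\<beta> : b \<rightarrow> p e\<close>.\<close>

definition split_fibration :: "'u func \<Rightarrow> bool" where
  "split_fibration p \<longleftrightarrow>
     (let E = fsrc p; B = ftgt p
      in \<exists>c.
         (\<forall>e\<in>Objs E. \<forall>\<beta>\<in>Arrs B. Cod B \<beta> = fobj p e \<longrightarrow>
            cartesian_arr p (c e \<beta>) \<and> Cod E (c e \<beta>) = e \<and> farr p (c e \<beta>) = \<beta>) \<and>
         (\<forall>e\<in>Objs E. c e (Id B (fobj p e)) = Id E e) \<and>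
         (\<forall>e\<in>Objs E. \<forall>\<beta>\<in>Arrs B. \<forall>\<gamma>\<in>Arrs B. Cod B \<beta> = fobj p e \<and> Cod B \<gamma> = Dom B \<beta> \<longrightarrow>
            c e (Comp B \<beta> \<gamma>) = Comp E (c e \<beta>) (c (Dom E (c e \<beta>)) \<gamma>)))"


section \<open>Slices and \<open>Cat\<close> are 2-categories\<close>

lemma two_category_slice:
  fixes K :: "('o, 'f, 't) two_cat" (structure)
  assumes "two_category K"
  shows "two_category (slice K I)"
proof -
  interpret two_category K by fact
  have D: "tgt K (cod2 K a) = tgt K (dom2 K a)" "src K (cod2 K a) = src K (dom2 K a)" if "a \<in> Cell K" for a
    using src_parallel tgt_parallel that by auto
  have C1: "g \<cdot> f \<in> Mor K" "src K (g \<cdot> f) = src K f" "tgt K (g \<cdot> f) = tgt K g"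
    if "f \<in> Mor K" "g \<in> Mor K" "tgt K f = src K g" for f g
    using cmp_hom that unfolding hom_def by auto
  have O1: "one K X \<in> Mor K" "src K (one K X) = X" "tgt K (one K X) = X" if "X \<in> Ob K" for X
    using one_hom that unfolding hom_def by auto
  have I1: "id2 K f \<in> Cell K" "dom2 K (id2 K f) = f" "cod2 K (id2 K f) = f" if "f \<in> Mor K" for f
    using id2_cells that unfolding cells_def by auto
  have V1: "b \<bullet> a \<in> Cell K" "dom2 K (b \<bullet> a) = dom2 K a" "cod2 K (b \<bullet> a) = cod2 K b"
    if "a \<in> Cell K" "b \<in> Cell K" "cod2 K a = dom2 K b" for a b
    using vcmp_cells that unfolding cells_def by auto
  have H1: "b \<star> a \<in> Cell K" "dom2 K (b \<star> a) = dom2 K b \<cdot> dom2 K a" "cod2 K (b \<star> a) = cod2 K b \<cdot> cod2 K a"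
    if "a \<in> Cell K" "b \<in> Cell K" "tgt K (dom2 K a) = src K (dom2 K b)" for a b
    using hcmp_cells[of "dom2 K a" _ _ "dom2 K b" _ a _ b] that dom2_Mor unfolding cells_def hom_def by auto
  have A1: "(h \<cdot> g) \<cdot> f = h \<cdot> (g \<cdot> f)" if "f \<in> Mor K" "g \<in> Mor K" "h \<in> Mor K" "tgt K f = src K g" "tgt K g = src K h" for f g h
    using cmp_assoc that unfolding hom_def by auto
  have U1: "f \<cdot> one K (src K f) = f" "one K (tgt K f) \<cdot> f = f" if "f \<in> Mor K" for f
    using cmp_one one_cmp that unfolding hom_def by auto
  have VU: "a \<bullet> id2 K (dom2 K a) = a" "id2 K (cod2 K a) \<bullet> a = a" if "a \<in> Cell K" for a
    using vcmp_id2 id2_vcmp that unfolding cells_def by auto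
  have VA: "(c \<bullet> b) \<bullet> a = c \<bullet> (b \<bullet> a)" if "a \<in> Cell K" "b \<in> Cell K" "c \<in> Cell K" "cod2 K a = dom2 K b" "cod2 K b = dom2 K c" for a b c
    using vcmp_assoc that unfolding cells_def by auto
  have HI: "id2 K g \<star> id2 K f = id2 K (g \<cdot> f)" if "f \<in> Mor K" "g \<in> Mor K" "tgt K f = src K g" for f g
    using hcmp_id2 that unfolding hom_def by auto
  have HU: "a \<star> id2 K (one K (src K (dom2 K a))) = a" "id2 K (one K (tgt K (dom2 K a))) \<star> a = a" if "a \<in> Cell K" for a
    using hcmp_one[of "dom2 K a" _ _ a] one_hcmp[of "dom2 K a" _ _ a] that dom2_Mor unfolding hom_def cells_def by auto
  have HA: "(c \<star> b) \<star> a = c \<star> (b \<star> a)" if "a \<in> Cell K" "b \<in> Cell K" "c \<in> Cell K" "tgt K (dom2 K a) = src K (dom2 K b)" "tgt K (dom2 K b) = src K (dom2 K c)" for a b c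
    using hcmp_assoc[of "dom2 K a" _ _ "dom2 K b" _ "dom2 K c" _ a _ b _ c] that dom2_Mor unfolding hom_def cells_def by auto
  have IC: "(d \<bullet> c) \<star> (b \<bullet> a) = (d \<star> b) \<bullet> (c \<star> a)"
    if "a \<in> Cell K" "b \<in> Cell K" "c \<in> Cell K" "d \<in> Cell K" "cod2 K a = dom2 K b" "cod2 K c = dom2 K d" "tgt K (dom2 K a) = src K (dom2 K c)" for a b c d
    using interchange[of "dom2 K a" _ _ "dom2 K c" _ a _ b _ c _ d] that dom2_Mor unfolding hom_def cells_def by auto
  have cod: "y \<cdot> cod2 K a = y \<cdot> dom2 K a" if "a \<in> Cell K" "y \<in> Mor K" "tgt K (dom2 K a) = src K y"
    "id2 K y \<star> a = id2 K (y \<cdot> dom2 K a)" for a y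
  proof -
    have "cod2 K (id2 K y \<star> a) = y \<cdot> cod2 K a" using that H1(3)[of a "id2 K y"] I1[of y] by simp
    moreover have "cod2 K (id2 K (y \<cdot> dom2 K a)) = y \<cdot> dom2 K a" using that C1 dom2_Mor I1 by simp
    ultimately show ?thesis using that(4) by simp
  qed
  have SV: "id2 K y \<star> (b \<bullet> a) = id2 K (y \<cdot> dom2 K a)"
    if "a \<in> Cell K" "b \<in> Cell K" "cod2 K a = dom2 K b" "y \<in> Mor K" "tgt K (dom2 K a) = src K y"
    "id2 K y \<star> a = id2 K (y \<cdot> dom2 K a)" "id2 K y \<star> b = id2 K (y \<cdot> dom2 K b)" for a b y
  proof -
    have yy: "id2 K y \<bullet> id2 K y = id2 K y" using VU(1)[of "id2 K y"] I1 that by simp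
    have d: "y \<cdot> dom2 K b = y \<cdot> dom2 K a" using cod[of a y] that by simp
    have "id2 K y \<star> (b \<bullet> a) = (id2 K y \<star> b) \<bullet> (id2 K y \<star> a)"
      using IC[of a b "id2 K y" "id2 K y"] that I1 yy by simp
    also have "\<dots> = id2 K (y \<cdot> dom2 K a) \<bullet> id2 K (y \<cdot> dom2 K a)" using that d by simp
    also have "\<dots> = id2 K (y \<cdot> dom2 K a)" using VU(1)[of "id2 K (y \<cdot> dom2 K a)"] I1 C1 dom2_Mor that by simp
    finally show ?thesis .
  qed
  have SH: "id2 K z \<star> (b \<star> a) = id2 K (z \<cdot> dom2 K b \<cdot> dom2 K a)"
    if "a \<in> Cell K" "b \<in> Cell K" "z \<in> Mor K" "tgt K (dom2 K a) = src K (dom2 K b)" "tgt K (dom2 K b) = src K z"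
    "id2 K (z \<cdot> dom2 K b) \<star> a = id2 K ((z \<cdot> dom2 K b) \<cdot> dom2 K a)" "id2 K z \<star> b = id2 K (z \<cdot> dom2 K b)" for a b z
  proof -
    have "id2 K z \<star> (b \<star> a) = (id2 K z \<star> b) \<star> a" using HA[of a b "id2 K z"] that I1 by simp
    also have "\<dots> = id2 K ((z \<cdot> dom2 K b) \<cdot> dom2 K a)" using that by simp
    also have "\<dots> = id2 K (z \<cdot> dom2 K b \<cdot> dom2 K a)" using A1 that dom2_Mor by simp
    finally show ?thesis .
  qed
  show ?thesis
    apply unfold_locales
    apply (simp_all add: hom_def cells_def slice_def split_paired_all)
    apply (simp_all add: C1 O1 I1 V1 H1 U1 HI dom2_Mor cod2_Mor src_Ob tgt_Ob)
    subgoal by (simp add: A1)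
    subgoal for a b using U1(2)[of a] by simp
    subgoal by (rule A1) simp_all
    subgoal by (metis D(1))
    subgoal by (rule cod[symmetric]) simp_all
    subgoal by (rule SV) simp_all
    subgoal by (metis VU(1))
    subgoal by (metis VU(2))
    subgoal by (rule VA) simp_all
    subgoal for b a aa using SH[of a aa b] H1[of a aa] by simp
    subgoal by (metis HU(1))
    subgoal by (metis HU(2))
    subgoal by (rule HA) simp_all
    subgoal by (rule IC) (simp_all add: D)
    done
qed

definition func_betw :: "'u func \<Rightarrow> 'u cat \<Rightarrow> 'u cat \<Rightarrow> bool" where
 "func_betw F C D \<longleftrightarrow> is_func F \<and> fsrc F = C \<and> ftgt F = D"

lemma func_betw_facts: "func_betw F C D \<Longrightarrow> x \<in> Objs C \<Longrightarrow> fobj F x \<in> Objs D"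
  "func_betw F C D \<Longrightarrow> x \<in> Arrs C \<Longrightarrow> farr F x \<in> Arrs D"
  "func_betw F C D \<Longrightarrow> x \<in> Arrs C \<Longrightarrow> Dom D (farr F x) = fobj F (Dom C x)"
  "func_betw F C D \<Longrightarrow> x \<in> Arrs C \<Longrightarrow> Cod D (farr F x) = fobj F (Cod C x)"
  "func_betw F C D \<Longrightarrow> x \<in> Objs C \<Longrightarrow> farr F (Id C x) = Id D (fobj F x)"
  "func_betw F C D \<Longrightarrow> x \<in> Arrs C \<Longrightarrow> y \<in> Arrs C \<Longrightarrow> Cod C x = Dom C y \<Longrightarrow>
     farr F (Comp C y x) = Comp D (farr F y) (farr F x)"
  "func_betw F C D \<Longrightarrow> small_category C" "func_betw F C D \<Longrightarrow> small_category D"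
  "func_betw F C D \<Longrightarrow> fsrc F = C"  "func_betw F C D \<Longrightarrow> ftgt F = D" "func_betw F C D \<Longrightarrow> is_func F"
  by (auto simp: func_betw_def is_func_def functorial_def Let_def)

lemma func_eqI: assumes a: "func_betw F C D" "func_betw G C D"
  and e: "\<And>x. x \<in> Objs C \<Longrightarrow> fobj F x = fobj G x"
  "\<And>x. x \<in> Arrs C \<Longrightarrow> farr F x = farr G x" shows "F = (G :: 'u func)"
proof (rule func.equality)
  have p: "fobj F \<in> Objs C \<rightarrow>\<^sub>E Objs D" "fobj G \<in> Objs C \<rightarrow>\<^sub>E Objs D"
    "farr F \<in> Arrs C \<rightarrow>\<^sub>E Arrs D" "farr G \<in> Arrs C \<rightarrow>\<^sub>E Arrs D"
    using a unfolding func_betw_def is_func_def functorial_def Let_def by auto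
  show "fobj F = fobj G" by (rule PiE_ext[OF p(1,2) e(1)])
  show "farr F = farr G" by (rule PiE_ext[OF p(3,4) e(2)])
qed (use a in \<open>auto simp: func_betw_def\<close>)

lemma category_facts: "small_category C \<Longrightarrow> f \<in> Arrs C \<Longrightarrow> Dom C f \<in> Objs C"
  "small_category C \<Longrightarrow> f \<in> Arrs C \<Longrightarrow> Cod C f \<in> Objs C"
  "small_category C \<Longrightarrow> x \<in> Objs C \<Longrightarrow> Id C x \<in> Arrs C"
  "small_category C \<Longrightarrow> x \<in> Objs C \<Longrightarrow> Dom C (Id C x) = x"
  "small_category C \<Longrightarrow> x \<in> Objs C \<Longrightarrow> Cod C (Id C x) = x"
  "small_category C \<Longrightarrow> f \<in> Arrs C \<Longrightarrow> g \<in> Arrs C \<Longrightarrow> Cod C f = Dom C g \<Longrightarrow> Comp C g f \<in> Arrs C"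
  "small_category C \<Longrightarrow> f \<in> Arrs C \<Longrightarrow> g \<in> Arrs C \<Longrightarrow> Cod C f = Dom C g \<Longrightarrow> Dom C (Comp C g f) = Dom C f"
  "small_category C \<Longrightarrow> f \<in> Arrs C \<Longrightarrow> g \<in> Arrs C \<Longrightarrow> Cod C f = Dom C g \<Longrightarrow> Cod C (Comp C g f) = Cod C g"
  "small_category C \<Longrightarrow> f \<in> Arrs C \<Longrightarrow> x = Dom C f \<Longrightarrow> Comp C f (Id C x) = f"
  "small_category C \<Longrightarrow> f \<in> Arrs C \<Longrightarrow> x = Cod C f \<Longrightarrow> Comp C (Id C x) f = f"
  "small_category C \<Longrightarrow> f \<in> Arrs C \<Longrightarrow> g \<in> Arrs C \<Longrightarrow> h \<in> Arrs C \<Longrightarrow> Cod C f = Dom C g \<Longrightarrow> Cod C g = Dom C h \<Longrightarrow>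
    Comp C (Comp C h g) f = Comp C h (Comp C g f)"
  unfolding small_category_def category_def by auto

lemma func_comp_betw: assumes "func_betw F C D" "func_betw G D E" shows "func_betw (func_comp G F) C E"
  unfolding func_betw_def[of "func_comp G F"] is_func_def functorial_def Let_def
  using func_betw_facts[OF assms(1)] func_betw_facts[OF assms(2)] by (auto simp: func_comp_def category_facts)

definition func_one :: "'u cat \<Rightarrow> 'u func" where "func_one C = \<lparr>fsrc = C, ftgt = C, fobj = (\<lambda>x\<in>Objs C. x), farr = (\<lambda>f\<in>Arrs C. f)\<rparr>"
lemma func_one_betw: "small_category C \<Longrightarrow> func_betw (func_one C) C C"
  unfolding func_betw_def is_func_def functorial_def func_one_def Let_def by (auto simp: category_facts)

definition ntrans_betw :: "'u ntrans \<Rightarrow> 'u func \<Rightarrow> 'u func \<Rightarrow> 'u cat \<Rightarrow> 'u cat \<Rightarrow> bool" where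
 "ntrans_betw a F G C D \<longleftrightarrow> ndom a = F \<and> ncod a = G \<and> func_betw F C D \<and> func_betw G C D \<and> ntransformation a"

lemma ntrans_betw_facts: "ntrans_betw a F G C D \<Longrightarrow> x \<in> Objs C \<Longrightarrow> ncomp a x \<in> Arrs D"
  "ntrans_betw a F G C D \<Longrightarrow> x \<in> Objs C \<Longrightarrow> Dom D (ncomp a x) = fobj F x"
  "ntrans_betw a F G C D \<Longrightarrow> x \<in> Objs C \<Longrightarrow> Cod D (ncomp a x) = fobj G x"
  "ntrans_betw a F G C D \<Longrightarrow> func_betw F C D" "ntrans_betw a F G C D \<Longrightarrow> func_betw G C D" "ntrans_betw a F G C D \<Longrightarrow> ndom a = F" "ntrans_betw a F G C D \<Longrightarrow> ncod a = G"
  by (auto simp: ntrans_betw_def func_betw_def ntransformation_def Let_def)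
lemma ntrans_betw_natural: "ntrans_betw a F G C D \<Longrightarrow> f \<in> Arrs C \<Longrightarrow> x = Dom C f \<Longrightarrow> y = Cod C f \<Longrightarrow>
     Comp D (ncomp a y) (farr F f) = Comp D (farr G f) (ncomp a x)"
  by (auto simp: ntrans_betw_def func_betw_def ntransformation_def Let_def)

lemma ntrans_eqI: assumes a: "ntrans_betw a F G C D" "ntrans_betw b F G C D"
  and e: "\<And>x. x \<in> Objs C \<Longrightarrow> ncomp a x = ncomp b x" shows "a = (b :: 'u ntrans)"
proof (rule ntrans.equality)
  have p: "ncomp a \<in> Objs C \<rightarrow>\<^sub>E Arrs D" "ncomp b \<in> Objs C \<rightarrow>\<^sub>E Arrs D"
    using a unfolding ntrans_betw_def ntransformation_def Let_def func_betw_def by auto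
  show "ncomp a = ncomp b" by (rule PiE_ext[OF p e])
qed (use a in \<open>auto simp: ntrans_betw_def\<close>)

lemma ntrans_betwI: "func_betw F C D \<Longrightarrow> func_betw G C D \<Longrightarrow> ndom a = F \<Longrightarrow> ncod a = G \<Longrightarrow> ncomp a \<in> extensional (Objs C) \<Longrightarrow>
  (\<And>x. x \<in> Objs C \<Longrightarrow> ncomp a x \<in> Arrs D \<and> Dom D (ncomp a x) = fobj F x \<and> Cod D (ncomp a x) = fobj G x) \<Longrightarrow>
  (\<And>f. f \<in> Arrs C \<Longrightarrow> Comp D (ncomp a (Cod C f)) (farr F f) = Comp D (farr G f) (ncomp a (Dom C f))) \<Longrightarrow> ntrans_betw a F G C D"
  apply (frule func_betw_facts(9)[of F]) apply (frule func_betw_facts(10)[of F]) apply (frule func_betw_facts(9)[of G]) apply (frule func_betw_facts(10)[of G])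
  by (auto simp: ntrans_betw_def ntransformation_def Let_def PiE_def)

lemma id2_betw: assumes "func_betw F C D" shows "ntrans_betw (id2 Cat F) F F C D"
  by (rule ntrans_betwI) (use assms func_betw_facts[OF assms] in \<open>auto simp: Cat_def category_facts\<close>)

lemma vcmp_betw: assumes "ntrans_betw a F G C D" "ntrans_betw b G H C D" shows "ntrans_betw (vcmp Cat b a) F H C D"
proof (rule ntrans_betwI)
  note n = ntrans_betw_facts[OF assms(1)] ntrans_betw_facts[OF assms(2)]
  note ff = func_betw_facts[OF n(4)] func_betw_facts[OF n(5)] func_betw_facts[OF n(12)]
  show "func_betw F C D" "func_betw H C D" using n by auto
  fix f assume f: "f \<in> Arrs C"
  let ?x = "Dom C f" and ?y = "Cod C f"
  have o: "?x \<in> Objs C" "?y \<in> Objs C" using f ff category_facts by auto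
  have "Comp D (Comp D (ncomp b ?y) (ncomp a ?y)) (farr F f) = Comp D (ncomp b ?y) (Comp D (ncomp a ?y) (farr F f))"
    using n o ff f by (intro category_facts) auto
  also have "\<dots> = Comp D (ncomp b ?y) (Comp D (farr G f) (ncomp a ?x))" using ntrans_betw_natural[OF assms(1) f] by simp
  also have "\<dots> = Comp D (Comp D (ncomp b ?y) (farr G f)) (ncomp a ?x)"  using n o ff f by (intro category_facts(11)[symmetric]) auto
  also have "\<dots> = Comp D (Comp D (farr H f) (ncomp b ?x)) (ncomp a ?x)" using ntrans_betw_natural[OF assms(2) f] by simp
  also have "\<dots> = Comp D (farr H f) (Comp D (ncomp b ?x) (ncomp a ?x))" using n o ff f by (intro category_facts) auto
  finally show "Comp D (ncomp (vcmp Cat b a) (Cod C f)) (farr F f) = Comp D (farr H f) (ncomp (vcmp Cat b a) (Dom C f))"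
    using o n ff by (simp add: Cat_def)
qed (use ntrans_betw_facts[OF assms(1)] ntrans_betw_facts[OF assms(2)] func_betw_facts[OF ntrans_betw_facts(4)[OF assms(1)]] in \<open>auto simp: Cat_def category_facts\<close>)

lemma hcmp_betw: assumes "ntrans_betw a F F' C D" "ntrans_betw b G G' D E" shows "ntrans_betw (hcmp Cat b a) (func_comp G F) (func_comp G' F') C E"
proof (rule ntrans_betwI)
  note n = ntrans_betw_facts[OF assms(1)] ntrans_betw_facts[OF assms(2)]
  note ff = func_betw_facts[OF n(4)] func_betw_facts[OF n(5)] func_betw_facts[OF n(11)] func_betw_facts[OF n(12)]
  show "func_betw (func_comp G F) C E" "func_betw (func_comp G' F') C E" using n func_comp_betw by blast+
  show "\<And>x. x \<in> Objs C \<Longrightarrow> ncomp (hcmp Cat b a) x \<in> Arrs E \<and>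
      Dom E (ncomp (hcmp Cat b a) x) = fobj (func_comp G F) x \<and> Cod E (ncomp (hcmp Cat b a) x) = fobj (func_comp G' F') x"
    using n ff by (auto simp: Cat_def func_comp_def category_facts)
  fix f assume f: "f \<in> Arrs C"
  let ?x = "Dom C f" and ?y = "Cod C f"
  have o: "?x \<in> Objs C" "?y \<in> Objs C" using f ff category_facts by auto
  have "Comp E (Comp E (ncomp b (fobj F' ?y)) (farr G (ncomp a ?y))) (farr G (farr F f))
     = Comp E (ncomp b (fobj F' ?y)) (Comp E (farr G (ncomp a ?y)) (farr G (farr F f)))"
    using n o ff f by (intro category_facts) auto
  also have "\<dots> = Comp E (ncomp b (fobj F' ?y)) (farr G (Comp D (ncomp a ?y) (farr F f)))" using n o ff f by simp
  also have "\<dots> = Comp E (ncomp b (fobj F' ?y)) (farr G (Comp D (farr F' f) (ncomp a ?x)))" using ntrans_betw_natural[OF assms(1) f] by simp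
  also have "\<dots> = Comp E (ncomp b (fobj F' ?y)) (Comp E (farr G (farr F' f)) (farr G (ncomp a ?x)))" using n o ff f by simp
  also have "\<dots> = Comp E (Comp E (ncomp b (fobj F' ?y)) (farr G (farr F' f))) (farr G (ncomp a ?x))"
    using n o ff f by (intro category_facts(11)[symmetric]) auto
  also have "\<dots> = Comp E (Comp E (farr G' (farr F' f)) (ncomp b (fobj F' ?x))) (farr G (ncomp a ?x))"
    using ntrans_betw_natural[OF assms(2), of "farr F' f"] f ff by simp
  also have "\<dots> = Comp E (farr G' (farr F' f)) (Comp E (ncomp b (fobj F' ?x)) (farr G (ncomp a ?x)))"
    using n o ff f by (intro category_facts) auto
  finally show "Comp E (ncomp (hcmp Cat b a) (Cod C f)) (farr (func_comp G F) f) = Comp E (farr (func_comp G' F') f) (ncomp (hcmp Cat b a) (Dom C f))"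
    using o n ff f by (simp add: Cat_def func_comp_def)
qed (use ntrans_betw_facts[OF assms(1)] ntrans_betw_facts[OF assms(2)] func_betw_facts[OF ntrans_betw_facts(4)[OF assms(1)]] in \<open>auto simp: Cat_def\<close>)

lemma homCat: "f \<in> hom Cat X Y \<longleftrightarrow> func_betw f X Y"
  by (auto simp: hom_def Cat_def func_betw_def)
lemma cellsCat: "a \<in> cells Cat f g \<longleftrightarrow> ntrans_betw a f g (fsrc f) (ftgt f)"
  by (auto simp: cells_def Cat_def func_betw_def ntrans_betw_def ntransformation_def Let_def)
lemma oneCat: "one Cat X = func_one X" by (simp add: Cat_def func_one_def)
lemma cmpCat: "cmp Cat = func_comp" by (simp add: Cat_def)
lemma ntrans_betw_cod: "ntrans_betw a f f' C D \<Longrightarrow> func_betw f' C D" by (rule ntrans_betw_facts)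

lemma func_comp_one: assumes "func_betw f X Y" shows "func_comp f (func_one X) = f" "func_comp (func_one Y) f = f"
proof -
  note F = func_betw_facts[OF assms]
  show "func_comp f (func_one X) = f" by (rule func_eqI[OF func_comp_betw[OF func_one_betw assms] assms]) (use F in \<open>auto simp: func_comp_def func_one_def category_facts\<close>)
  show "func_comp (func_one Y) f = f" by (rule func_eqI[OF func_comp_betw[OF assms func_one_betw] assms]) (use F in \<open>auto simp: func_comp_def func_one_def category_facts\<close>)
qed
lemma func_comp_assoc: assumes "func_betw f W X" "func_betw g X Y" "func_betw h Y Z" shows "func_comp (func_comp h g) f = func_comp h (func_comp g f)"
  by (rule func_eqI[OF func_comp_betw[OF assms(1) func_comp_betw[OF assms(2,3)]] func_comp_betw[OF func_comp_betw[OF assms(1,2)] assms(3)]])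
    (use func_betw_facts[OF assms(1)] func_betw_facts[OF assms(2)] in \<open>auto simp: func_comp_def\<close>)

lemma two_category_Cat: "two_category Cat"
proof
  fix f g h :: "'a func" and W X Y Z :: "'a cat"
  show "(f :: 'a func) \<in> Mor Cat \<Longrightarrow> src Cat f \<in> Ob Cat" "f \<in> Mor Cat \<Longrightarrow> tgt Cat f \<in> Ob Cat"
    by (auto simp: Cat_def is_func_def)
  show "X \<in> Ob Cat \<Longrightarrow> one Cat X \<in> hom Cat X X" unfolding homCat oneCat by (rule func_one_betw) (simp add: Cat_def)
  show "(f :: 'a func) \<in> hom Cat X Y \<Longrightarrow> g \<in> hom Cat Y Z \<Longrightarrow> cmp Cat g f \<in> hom Cat X Z"
    unfolding homCat cmpCat by (rule func_comp_betw)
  show "(f :: 'a func) \<in> hom Cat X Y \<Longrightarrow> cmp Cat f (one Cat X) = f" "(f :: 'a func) \<in> hom Cat X Y \<Longrightarrow> cmp Cat (one Cat Y) f = f"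
    unfolding homCat cmpCat oneCat by (simp_all add: func_comp_one)
  show "(f :: 'a func) \<in> hom Cat W X \<Longrightarrow> g \<in> hom Cat X Y \<Longrightarrow> h \<in> hom Cat Y Z \<Longrightarrow> cmp Cat (cmp Cat h g) f = cmp Cat h (cmp Cat g f)"
    unfolding homCat cmpCat by (rule func_comp_assoc)
  show "a \<in> Cell Cat \<Longrightarrow> dom2 Cat a \<in> Mor Cat" "a \<in> Cell Cat \<Longrightarrow> cod2 Cat a \<in> Mor Cat"
    "a \<in> Cell Cat \<Longrightarrow> src Cat (dom2 Cat a) = src Cat (cod2 Cat a)" "a \<in> Cell Cat \<Longrightarrow> tgt Cat (dom2 Cat a) = tgt Cat (cod2 Cat a)"
    for a :: "'a ntrans"
    by (auto simp: Cat_def ntransformation_def Let_def)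
  show "(f :: 'a func) \<in> Mor Cat \<Longrightarrow> id2 Cat f \<in> cells Cat f f"
    unfolding cellsCat by (rule id2_betw) (simp add: Cat_def func_betw_def)
  show V: "\<And>f g h. a \<in> cells Cat f g \<Longrightarrow> b \<in> cells Cat g h \<Longrightarrow> vcmp Cat b a \<in> cells Cat f h" for a b :: "'a ntrans"
    unfolding cellsCat apply (rule vcmp_betw, assumption) by (metis ntrans_betw_cod func_betw_def)
  show "vcmp Cat a (id2 Cat f) = a" "vcmp Cat (id2 Cat g) a = a" if "a \<in> cells Cat f g" for a :: "'a ntrans"
  proof -
    from that obtain C D where n: "ntrans_betw a f g C D" unfolding cellsCat by auto
    note q = ntrans_betw_facts[OF n] func_betw_facts[OF ntrans_betw_facts(4)[OF n]] func_betw_facts[OF ntrans_betw_facts(5)[OF n]]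
    show "vcmp Cat a (id2 Cat f) = a"
      by (rule ntrans_eqI[OF vcmp_betw[OF id2_betw[OF ntrans_betw_facts(4)[OF n]] n] n]) (use q in \<open>auto simp: Cat_def category_facts\<close>)
    show "vcmp Cat (id2 Cat g) a = a"
      by (rule ntrans_eqI[OF vcmp_betw[OF n id2_betw[OF ntrans_betw_facts(5)[OF n]]] n]) (use q in \<open>auto simp: Cat_def category_facts\<close>)
  qed
  show "a \<in> cells Cat f g \<Longrightarrow> b \<in> cells Cat g h \<Longrightarrow> c \<in> cells Cat h k \<Longrightarrow> vcmp Cat (vcmp Cat c b) a = vcmp Cat c (vcmp Cat b a)"
     for a b c :: "'a ntrans" and k
  proof -
    assume "a \<in> cells Cat f g" "b \<in> cells Cat g h" "c \<in> cells Cat h k"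
    then obtain C D where n: "ntrans_betw a f g C D" "ntrans_betw b g h C D" "ntrans_betw c h k C D"
      unfolding cellsCat by (metis ntrans_betw_cod func_betw_def)
    show ?thesis
      by (rule ntrans_eqI[OF vcmp_betw[OF n(1) vcmp_betw[OF n(2,3)]] vcmp_betw[OF vcmp_betw[OF n(1,2)] n(3)]])
       (use ntrans_betw_facts[OF n(1)] ntrans_betw_facts[OF n(2)] ntrans_betw_facts[OF n(3)] func_betw_facts[OF ntrans_betw_facts(4)[OF n(1)]] func_betw_facts[OF ntrans_betw_facts(5)[OF n(1)]] func_betw_facts[OF ntrans_betw_facts(5)[OF n(2)]] in \<open>auto simp: Cat_def category_facts\<close>)
  qed
  have ob: "ntrans_betw a f g X Y" if "func_betw f X Y" "a \<in> cells Cat f g" for a f g and X Y :: "'a cat"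
    using that by (auto simp: cellsCat func_betw_def)
  show "f \<in> hom Cat X Y \<Longrightarrow> g \<in> hom Cat Y Z \<Longrightarrow> a \<in> cells Cat f f' \<Longrightarrow> b \<in> cells Cat g g' \<Longrightarrow> hcmp Cat b a \<in> cells Cat (cmp Cat g f) (cmp Cat g' f')"
    for a b :: "'a ntrans" and f' g'
  proof -
    assume f: "f \<in> hom Cat X Y" "g \<in> hom Cat Y Z" and a: "a \<in> cells Cat f f'" "b \<in> cells Cat g g'"
    note f = f[unfolded homCat]
    have "ntrans_betw (hcmp Cat b a) (func_comp g f) (func_comp g' f') X Z" by (rule hcmp_betw[OF ob[OF f(1) a(1)] ob[OF f(2) a(2)]])
    then show ?thesis using func_betw_facts(9,10)[OF f(1)] func_betw_facts(9,10)[OF f(2)] by (simp add: cellsCat cmpCat func_comp_def)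
  qed
  show "hcmp Cat (id2 Cat g) (id2 Cat f) = id2 Cat (cmp Cat g f)" if "(f :: 'a func) \<in> hom Cat X Y" "g \<in> hom Cat Y Z"
  proof -
    note f = that[unfolded homCat]
    show ?thesis unfolding cmpCat
      by (rule ntrans_eqI[OF hcmp_betw[OF id2_betw[OF f(1)] id2_betw[OF f(2)]] id2_betw[OF func_comp_betw[OF f]]])
        (use func_betw_facts[OF f(1)] func_betw_facts[OF f(2)] in \<open>auto simp: Cat_def category_facts func_comp_def\<close>)
  qed
  show "f \<in> hom Cat X Y \<Longrightarrow> a \<in> cells Cat f f' \<Longrightarrow> hcmp Cat a (id2 Cat (one Cat X)) = a" for a :: "'a ntrans" and f'
    unfolding homCat oneCat
  proof -
    assume f: "func_betw f X Y" and a: "a \<in> cells Cat f f'"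
    note n = ob[OF f a]
    show "hcmp Cat a (id2 Cat (func_one X)) = a"
      apply (rule ntrans_eqI[of _ f f' X Y])
      using hcmp_betw[OF id2_betw n, OF func_one_betw] func_comp_one[OF f] func_comp_one[OF ntrans_betw_facts(5)[OF n]] func_betw_facts[OF f] apply simp
       apply (rule n)
      using n ntrans_betw_facts[OF n] func_betw_facts[OF f] by (auto simp: Cat_def func_one_def category_facts)
  qed
  show "f \<in> hom Cat X Y \<Longrightarrow> a \<in> cells Cat f f' \<Longrightarrow> hcmp Cat (id2 Cat (one Cat Y)) a = a" for a :: "'a ntrans" and f'
    unfolding homCat oneCat
  proof -
    assume f: "func_betw f X Y" and a: "a \<in> cells Cat f f'"
    note n = ob[OF f a]
    show "hcmp Cat (id2 Cat (func_one Y)) a = a"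
      apply (rule ntrans_eqI[of _ f f' X Y])
      using hcmp_betw[OF n id2_betw, OF func_one_betw] func_comp_one[OF f] func_comp_one[OF ntrans_betw_facts(5)[OF n]] func_betw_facts[OF f] apply simp
       apply (rule n)
      using n ntrans_betw_facts[OF n] func_betw_facts[OF f] func_betw_facts[OF ntrans_betw_facts(5)[OF n]] by (auto simp: Cat_def func_one_def category_facts)
  qed
  show "f \<in> hom Cat W X \<Longrightarrow> g \<in> hom Cat X Y \<Longrightarrow> h \<in> hom Cat Y Z \<Longrightarrow> a \<in> cells Cat f f' \<Longrightarrow> b \<in> cells Cat g g' \<Longrightarrow> c \<in> cells Cat h h' \<Longrightarrow>
     hcmp Cat (hcmp Cat c b) a = hcmp Cat c (hcmp Cat b a)" for a b c :: "'a ntrans" and f' g' h'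
    unfolding homCat
  proof -
    assume f: "func_betw f W X" "func_betw g X Y" "func_betw h Y Z" and a: "a \<in> cells Cat f f'" "b \<in> cells Cat g g'" "c \<in> cells Cat h h'"
    note n = ob[OF f(1) a(1)] ob[OF f(2) a(2)] ob[OF f(3) a(3)]
    note q = ntrans_betw_facts(5)[OF n(1)] ntrans_betw_facts(5)[OF n(2)] ntrans_betw_facts(5)[OF n(3)]
    show "hcmp Cat (hcmp Cat c b) a = hcmp Cat c (hcmp Cat b a)"
      apply (rule ntrans_eqI[of _ "func_comp (func_comp h g) f" "func_comp (func_comp h' g') f'" W Z])
      subgoal by (rule hcmp_betw[OF n(1) hcmp_betw[OF n(2,3)]])
      subgoal using func_comp_assoc[OF f] func_comp_assoc[OF q] hcmp_betw[OF hcmp_betw n(3), OF n(1,2)] by simp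
      using n ntrans_betw_facts[OF n(1)] ntrans_betw_facts[OF n(2)] ntrans_betw_facts[OF n(3)] func_betw_facts[OF f(1)] func_betw_facts[OF f(2)] func_betw_facts[OF f(3)] func_betw_facts[OF q(1)] func_betw_facts[OF q(2)] func_betw_facts[OF q(3)]
      by (auto simp: Cat_def func_comp_def category_facts)
  qed
  show "f \<in> hom Cat X Y \<Longrightarrow> g \<in> hom Cat Y Z \<Longrightarrow> a \<in> cells Cat f f' \<Longrightarrow> a' \<in> cells Cat f' f'' \<Longrightarrow> b \<in> cells Cat g g' \<Longrightarrow> b' \<in> cells Cat g' g'' \<Longrightarrow>
     hcmp Cat (vcmp Cat b' b) (vcmp Cat a' a) = vcmp Cat (hcmp Cat b' a') (hcmp Cat b a)" for a b a' b' :: "'a ntrans" and f' g' f'' g''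
    unfolding homCat
  proof -
    assume f: "func_betw f X Y" "func_betw g Y Z" and a: "a \<in> cells Cat f f'" "a' \<in> cells Cat f' f''" "b \<in> cells Cat g g'" "b' \<in> cells Cat g' g''"
    note n0 = ob[OF f(1) a(1)] ob[OF f(2) a(3)]
    note n = n0 ob[OF ntrans_betw_facts(5)[OF n0(1)] a(2)] ob[OF ntrans_betw_facts(5)[OF n0(2)] a(4)]
    note q = ntrans_betw_facts(5)[OF n(1)] ntrans_betw_facts(5)[OF n(2)] ntrans_betw_facts(5)[OF n(3)] ntrans_betw_facts(5)[OF n(4)]
    note all = ntrans_betw_facts[OF n(1)] ntrans_betw_facts[OF n(2)] ntrans_betw_facts[OF n(3)] ntrans_betw_facts[OF n(4)] func_betw_facts[OF f(1)] func_betw_facts[OF f(2)] func_betw_facts[OF q(1)] func_betw_facts[OF q(2)] func_betw_facts[OF q(3)] func_betw_facts[OF q(4)]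
    show "hcmp Cat (vcmp Cat b' b) (vcmp Cat a' a) = vcmp Cat (hcmp Cat b' a') (hcmp Cat b a)"
    proof (rule ntrans_eqI[of _ "func_comp g f" "func_comp g'' f''" X Z])
      show "ntrans_betw (hcmp Cat (vcmp Cat b' b) (vcmp Cat a' a)) (func_comp g f) (func_comp g'' f'') X Z"
        by (rule hcmp_betw[OF vcmp_betw[OF n(1,3)] vcmp_betw[OF n(2,4)]])
      show "ntrans_betw (vcmp Cat (hcmp Cat b' a') (hcmp Cat b a)) (func_comp g f) (func_comp g'' f'') X Z"
        by (rule vcmp_betw[OF hcmp_betw[OF n(1,2)] hcmp_betw[OF n(3,4)]])
      fix x assume x: "x \<in> Objs X"
      let ?u = "ncomp b' (fobj f'' x)" and ?v = "ncomp b (fobj f'' x)" and ?w = "farr g (ncomp a' x)" and ?t = "farr g (ncomp a x)"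
        and ?v' = "farr g' (ncomp a' x)" and ?w' = "ncomp b (fobj f' x)"
      have e: "Comp Z ?v ?w = Comp Z ?v' ?w'" using ntrans_betw_natural[OF n(2), of "ncomp a' x"] x all by auto
      have "Comp Z (Comp Z ?u ?v) (Comp Z ?w ?t) = Comp Z ?u (Comp Z (Comp Z ?v ?w) ?t)"
        using x all by (simp add: category_facts)
      also have "\<dots> = Comp Z (Comp Z ?u ?v') (Comp Z ?w' ?t)" unfolding e using x all by (simp add: category_facts)
      finally show "ncomp (hcmp Cat (vcmp Cat b' b) (vcmp Cat a' a)) x = ncomp (vcmp Cat (hcmp Cat b' a') (hcmp Cat b a)) x"
        using x all by (simp add: Cat_def func_comp_def category_facts)
    qed
  qed
qed

end

theory Submission
  imports Defs
begin

text \<open>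
  Transposition along \<open>F\<^sub>! \<stileturn> F\<^sup>*\<close> matches pointwise left Kan extensions along \<open>g\<close> into \<open>F\<^sup>*A\<close> with
  those along \<open>F\<^sub>!g\<close> into \<open>A\<close>: over discrete bases comma squares in a slice are comma squares of
  underlying categories, so \<open>\<Sigma>\<^sub>f\<close> preserves and reflects them.  The transpose of
  \<open>a' S(u)\<close>, with \<open>a'\<close> the action of \<open>F\<^sup>*A\<close>, is \<open>a T(u') F\<^sup>c\<close>, hence it remains to see that
  pasting with the naturality square of \<open>F\<^sup>c\<close> at \<open>g\<close> preserves pointwise left Kan
  extensions.  Any square through which the 2-cells \<open>f x \<Rightarrow> k y\<close> factor weakly universally has this property.  For the square of a
  morphism of polynomial monads, an element of \<open>T X\<close> over \<open>b\<close> is a functor from the fibre of \<open>E\<^sub>T\<close>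
  over \<open>b\<close>; a normal cleavage of \<open>p\<^sub>T\<close> reindexes these functors covariantly in \<open>b\<close>, and the
  factorization pushes an element forward along the image in \<open>B\<^sub>T\<close> of the given 2-cell.
\<close>

section \<open>Whiskering and restriction of Kan extensions\<close>

text \<open>The right adjoint \<Pi> is a choice known only by its universal property, so an element
  of \<open>T X\<close> is never taken apart into an actual functor on a fibre. Apart from the
  section on small categories, the work is done in an arbitrary 2-category, with comma objects or
  pullbacks where they are needed, and 1-cells \<open>W -> X\<close> serve as elements. Equality is
  tested by evaluation at elements of the fibre, and a construction such as push-forward becomes a
  single 1-cell out of a comma object. This is why a cleavage enters as an operation on 1-cells that
  is stable under restriction. Discreteness is used in one form: a 2-cell into \<open>I\<close> or
  \<open>J\<close> is an identity. Besides comma objects in slices it settles the delicate point of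
  the factorization. An element of \<open>T X\<close> over a point coming from \<open>B_S\<close>
  has values placed correctly over \<open>J\<close> only; it comes from \<open>S X\<close> when they
  are placed correctly over \<open>I\<close>, and a 2-cell to the image of an element of
  \<open>S Y\<close> forces this. The given monads and adjunction match the polynomial ones only up
  to isomorphism, so naturality squares of isomorphisms must be pasted on as well.\<close>

locale twocat = two_category K for K :: "('o, 'f, 't) two_cat" (structure)
begin

text \<open>The axioms are restated with membership in \<open>Mor\<close> and \<open>Cell\<close>
  and with equations for sources and targets, in place of \<open>hom\<close> and
  \<open>cells\<close>. Typing side conditions are then discharged by rewriting.\<close>

lemma Mor_facts [simp]:
  assumes "f \<in> Mor K"
  shows "src K f \<in> Ob K" "tgt K f \<in> Ob K" "f \<cdot> one K (src K f) = f" "one K (tgt K f) \<cdot> f = f"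
    "id2 K f \<in> Cell K" "dom2 K (id2 K f) = f" "cod2 K (id2 K f) = f"
  using assms src_Ob tgt_Ob cmp_one one_cmp id2_cells by (auto simp: hom_def cells_def)

lemma one_facts [simp]:
  assumes "X \<in> Ob K"
  shows "one K X \<in> Mor K" "src K (one K X) = X" "tgt K (one K X) = X"
  using one_hom assms by (auto simp: hom_def)

lemma cmp_facts [simp]:
  assumes "f \<in> Mor K" "g \<in> Mor K" "tgt K f = src K g"
  shows "g \<cdot> f \<in> Mor K" "src K (g \<cdot> f) = src K f" "tgt K (g \<cdot> f) = tgt K g"
  using cmp_hom assms by (auto simp: hom_def)

lemma cmp_one' [simp]: "f \<in> Mor K \<Longrightarrow> src K f = X \<Longrightarrow> f \<cdot> one K X = f"
  and one_cmp' [simp]: "f \<in> Mor K \<Longrightarrow> tgt K f = X \<Longrightarrow> one K X \<cdot> f = f"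
  by auto

lemma cmp_assoc' [simp]:
  assumes "f \<in> Mor K" "g \<in> Mor K" "h \<in> Mor K" "tgt K f = src K g" "tgt K g = src K h"
  shows "(h \<cdot> g) \<cdot> f = h \<cdot> g \<cdot> f"
  using cmp_assoc assms by (auto simp: hom_def)

lemma Cell_facts [simp]:
  assumes "\<alpha> \<in> Cell K"
  shows "dom2 K \<alpha> \<in> Mor K" "cod2 K \<alpha> \<in> Mor K"
    "src K (cod2 K \<alpha>) = src K (dom2 K \<alpha>)" "tgt K (cod2 K \<alpha>) = tgt K (dom2 K \<alpha>)"
  using assms dom2_Mor cod2_Mor src_parallel tgt_parallel by auto

lemma vcmp_facts [simp]:
  assumes "\<alpha> \<in> Cell K" "\<beta> \<in> Cell K" "cod2 K \<alpha> = dom2 K \<beta>"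
  shows "\<beta> \<bullet> \<alpha> \<in> Cell K" "dom2 K (\<beta> \<bullet> \<alpha>) = dom2 K \<alpha>" "cod2 K (\<beta> \<bullet> \<alpha>) = cod2 K \<beta>"
  using vcmp_cells assms by (auto simp: cells_def)

lemma vcmp_id2' [simp]: "\<alpha> \<in> Cell K \<Longrightarrow> dom2 K \<alpha> = f \<Longrightarrow> \<alpha> \<bullet> id2 K f = \<alpha>"
  and id2_vcmp' [simp]: "\<alpha> \<in> Cell K \<Longrightarrow> cod2 K \<alpha> = f \<Longrightarrow> id2 K f \<bullet> \<alpha> = \<alpha>"
  using vcmp_id2 id2_vcmp by (auto simp: cells_def)

lemma vcmp_assoc' [simp]:
  assumes "\<alpha> \<in> Cell K" "\<beta> \<in> Cell K" "\<gamma> \<in> Cell K" "cod2 K \<alpha> = dom2 K \<beta>" "cod2 K \<beta> = dom2 K \<gamma>"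
  shows "(\<gamma> \<bullet> \<beta>) \<bullet> \<alpha> = \<gamma> \<bullet> \<beta> \<bullet> \<alpha>"
  using vcmp_assoc assms by (auto simp: cells_def)

lemma hcmp_facts [simp]:
  assumes "\<alpha> \<in> Cell K" "\<beta> \<in> Cell K" "tgt K (dom2 K \<alpha>) = src K (dom2 K \<beta>)"
  shows "\<beta> \<star> \<alpha> \<in> Cell K" "dom2 K (\<beta> \<star> \<alpha>) = dom2 K \<beta> \<cdot> dom2 K \<alpha>" "cod2 K (\<beta> \<star> \<alpha>) = cod2 K \<beta> \<cdot> cod2 K \<alpha>"
  using hcmp_cells[of "dom2 K \<alpha>" _ _ "dom2 K \<beta>" _ \<alpha> _ \<beta>] assms by (auto simp: cells_def hom_def)

lemma hcmp_id2' [simp]: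
  "f \<in> Mor K \<Longrightarrow> g \<in> Mor K \<Longrightarrow> tgt K f = src K g \<Longrightarrow> id2 K g \<star> id2 K f = id2 K (g \<cdot> f)"
  using hcmp_id2 by (auto simp: hom_def)

lemma hcmp_one' [simp]: "\<alpha> \<in> Cell K \<Longrightarrow> src K (dom2 K \<alpha>) = X \<Longrightarrow> \<alpha> \<star> id2 K (one K X) = \<alpha>"
  and one_hcmp' [simp]: "\<alpha> \<in> Cell K \<Longrightarrow> tgt K (dom2 K \<alpha>) = X \<Longrightarrow> id2 K (one K X) \<star> \<alpha> = \<alpha>"
  using hcmp_one[of "dom2 K \<alpha>" _ _ \<alpha>] one_hcmp[of "dom2 K \<alpha>" _ _ \<alpha>] by (auto simp: cells_def hom_def)

lemma hcmp_assoc' [simp]: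
  assumes "\<alpha> \<in> Cell K" "\<beta> \<in> Cell K" "\<gamma> \<in> Cell K"
    "tgt K (dom2 K \<alpha>) = src K (dom2 K \<beta>)" "tgt K (dom2 K \<beta>) = src K (dom2 K \<gamma>)"
  shows "(\<gamma> \<star> \<beta>) \<star> \<alpha> = \<gamma> \<star> \<beta> \<star> \<alpha>"
  using hcmp_assoc[of "dom2 K \<alpha>" _ _ "dom2 K \<beta>" _ "dom2 K \<gamma>" _ \<alpha> _ \<beta> _ \<gamma>] assms
  by (auto simp: cells_def hom_def)

lemma interchange':
  assumes "\<alpha> \<in> Cell K" "\<alpha>' \<in> Cell K" "\<beta> \<in> Cell K" "\<beta>' \<in> Cell K"
    "cod2 K \<alpha> = dom2 K \<alpha>'" "cod2 K \<beta> = dom2 K \<beta>'" "tgt K (dom2 K \<alpha>) = src K (dom2 K \<beta>)"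
  shows "(\<beta>' \<bullet> \<beta>) \<star> (\<alpha>' \<bullet> \<alpha>) = (\<beta>' \<star> \<alpha>') \<bullet> (\<beta> \<star> \<alpha>)"
  using interchange[of "dom2 K \<alpha>" _ _ "dom2 K \<beta>" _ \<alpha> _ \<alpha>' _ \<beta> _ \<beta>'] assms by (auto simp: cells_def hom_def)

lemma whisker_vcmp [simp]:
  assumes "\<alpha> \<in> Cell K" "\<beta> \<in> Cell K" "cod2 K \<alpha> = dom2 K \<beta>"
  shows "f \<in> Mor K \<Longrightarrow> src K f = tgt K (dom2 K \<alpha>) \<Longrightarrow> id2 K f \<star> (\<beta> \<bullet> \<alpha>) = (id2 K f \<star> \<beta>) \<bullet> (id2 K f \<star> \<alpha>)"
    and "f \<in> Mor K \<Longrightarrow> tgt K f = src K (dom2 K \<alpha>) \<Longrightarrow> (\<beta> \<bullet> \<alpha>) \<star> id2 K f = (\<beta> \<star> id2 K f) \<bullet> (\<alpha> \<star> id2 K f)"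
  using assms interchange'[of \<alpha> \<beta> "id2 K f" "id2 K f"] interchange'[of "id2 K f" "id2 K f" \<alpha> \<beta>] by auto

lemma whisker_whisker [simp]:
  assumes "f \<in> Mor K" "g \<in> Mor K" "tgt K f = src K g" "\<alpha> \<in> Cell K" "tgt K (dom2 K \<alpha>) = src K f"
  shows "id2 K g \<star> id2 K f \<star> \<alpha> = id2 K (g \<cdot> f) \<star> \<alpha>"
  using assms hcmp_assoc'[of \<alpha> "id2 K f" "id2 K g"] by simp

text \<open>Both sides are the horizontal composite of \<open>\<beta>\<close> and \<open>\<alpha>\<close>.\<close>

lemma whisker_exchange:
  assumes "\<alpha> \<in> cells K f f'" "\<beta> \<in> cells K g g'" "tgt K f = src K g"
  shows "(\<beta> \<star> id2 K f') \<bullet> (id2 K g \<star> \<alpha>) = (id2 K g' \<star> \<alpha>) \<bullet> (\<beta> \<star> id2 K f)"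
  using assms interchange'[of \<alpha> "id2 K f'" "id2 K g" \<beta>] interchange'[of "id2 K f" \<alpha> \<beta> "id2 K g'"]
  by (auto simp: cells_def)

lemma whisker_exchange_assoc:
  assumes "\<alpha> \<in> cells K f f'" "\<beta> \<in> cells K g g'" "tgt K f = src K g" "\<gamma> \<in> Cell K" "cod2 K \<gamma> = g \<cdot> f"
  shows "(\<beta> \<star> id2 K f') \<bullet> (id2 K g \<star> \<alpha>) \<bullet> \<gamma> = (id2 K g' \<star> \<alpha>) \<bullet> (\<beta> \<star> id2 K f) \<bullet> \<gamma>"
proof -
  have t: "\<alpha> \<in> Cell K" "dom2 K \<alpha> = f" "cod2 K \<alpha> = f'" "\<beta> \<in> Cell K" "dom2 K \<beta> = g" "cod2 K \<beta> = g'"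
    using assms by (auto simp: cells_def)
  have u: "src K g' = tgt K f'" "f \<in> Mor K" "f' \<in> Mor K" "g \<in> Mor K" "g' \<in> Mor K" "tgt K f' = tgt K f"
    using t assms(3) Cell_facts[of \<alpha>] Cell_facts[of \<beta>] by auto
  have "((\<beta> \<star> id2 K f') \<bullet> (id2 K g \<star> \<alpha>)) \<bullet> \<gamma> = ((id2 K g' \<star> \<alpha>) \<bullet> (\<beta> \<star> id2 K f)) \<bullet> \<gamma>"
    using whisker_exchange[OF assms(1-3)] by simp
  then show ?thesis using t u assms by simp
qed

text \<open>Whiskering with \<open>j\<close> is a bijection from 2-cells \<open>v\<close> to
  \<open>k b\<close> onto 2-cells \<open>v j\<close> to \<open>k b j\<close>. Its inverse sends
  \<theta> to \<theta> \<open>r\<close> after \<open>v\<close> \<eta>: one round trip is the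
  identity because \<open>b\<close> \<eta> is one, the other because \<open>j\<close> \<kappa> =
  \<eta> \<open>j\<close>. Both \<eta> and \<kappa> start at an identity, so this is not an
  adjunction between \<open>j\<close> and \<open>r\<close>.\<close>

lemma left_kan_restrict:
  assumes lk: "left_kan K b v w \<chi>"
    and j: "j \<in> hom K C (src K b)" and r: "r \<in> hom K (src K b) C"
    and eta: "\<eta> \<in> cells K (one K (src K b)) (j \<cdot> r)" and kap: "\<kappa> \<in> cells K (one K C) (r \<cdot> j)"
    and b\<eta>: "id2 K b \<star> \<eta> = id2 K b" and j\<kappa>: "id2 K j \<star> \<kappa> = \<eta> \<star> id2 K j"
  shows "left_kan K (b \<cdot> j) (v \<cdot> j) w (\<chi> \<star> id2 K j)"
proof -
  from lk obtain X Y A where t0: "b \<in> hom K X Y" "v \<in> hom K X A" "w \<in> hom K Y A" "\<chi> \<in> cells K v (w \<cdot> b)"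
    and bij: "\<And>k. k \<in> hom K Y A \<Longrightarrow> bij_betw (\<lambda>\<beta>. (\<beta> \<star> id2 K b) \<bullet> \<chi>) (cells K w k) (cells K v (k \<cdot> b))"
    unfolding left_kan_def by blast
  have t [simp]: "b \<in> Mor K" "src K b = X" "tgt K b = Y" "v \<in> Mor K" "src K v = X" "tgt K v = A"
    "w \<in> Mor K" "src K w = Y" "tgt K w = A" "\<chi> \<in> Cell K" "dom2 K \<chi> = v" "cod2 K \<chi> = w \<cdot> b"
    "j \<in> Mor K" "src K j = C" "tgt K j = X" "r \<in> Mor K" "src K r = X" "tgt K r = C"
    "\<eta> \<in> Cell K" "dom2 K \<eta> = one K X" "cod2 K \<eta> = j \<cdot> r"
    "\<kappa> \<in> Cell K" "dom2 K \<kappa> = one K C" "cod2 K \<kappa> = r \<cdot> j"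
    using t0 j r eta kap by (auto simp: hom_def cells_def)
  have X [simp]: "X \<in> Ob K" "C \<in> Ob K" using Mor_facts[of b] Mor_facts[of j] by auto
  \<comment> \<open>\<open>b\<close> \<eta> is the identity 2-cell of \<open>b\<close>, so its
    codomain is \<open>b\<close> again.\<close>
  have bjr: "b \<cdot> j \<cdot> r = b"
  proof -
    have "cod2 K (id2 K b \<star> \<eta>) = b \<cdot> j \<cdot> r" by simp
    then show ?thesis using b\<eta> by simp
  qed
  show ?thesis unfolding left_kan_def
  proof (intro exI conjI ballI)
    show "b \<cdot> j \<in> hom K C Y" "v \<cdot> j \<in> hom K C A" "w \<in> hom K Y A" "\<chi> \<star> id2 K j \<in> cells K (v \<cdot> j) (w \<cdot> b \<cdot> j)"
      by (auto simp: hom_def cells_def)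
    fix k assume k: "k \<in> hom K Y A"
    then have [simp]: "k \<in> Mor K" "src K k = Y" "tgt K k = A" by (auto simp: hom_def)
    let ?inv = "\<lambda>\<theta>. (\<theta> \<star> id2 K r) \<bullet> (id2 K v \<star> \<eta>)"
    have bij2: "bij_betw (\<lambda>\<theta>. \<theta> \<star> id2 K j) (cells K v (k \<cdot> b)) (cells K (v \<cdot> j) (k \<cdot> b \<cdot> j))"
    proof (rule bij_betw_byWitness[where f' = ?inv]; intro ballI image_subsetI)
      fix \<theta> assume "\<theta> \<in> cells K v (k \<cdot> b)"
      then have th: "\<theta> \<in> Cell K" "dom2 K \<theta> = v" "cod2 K \<theta> = k \<cdot> b" by (auto simp: cells_def)
      have "(\<theta> \<star> id2 K (j \<cdot> r)) \<bullet> (id2 K v \<star> \<eta>) = (id2 K (k \<cdot> b) \<star> \<eta>) \<bullet> (\<theta> \<star> id2 K (one K X))"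
        by (rule whisker_exchange) (auto simp: cells_def th)
      also have "id2 K (k \<cdot> b) \<star> \<eta> = id2 K (k \<cdot> b)"
        using b\<eta> whisker_whisker[of b k \<eta>] by simp
      finally show "?inv (\<theta> \<star> id2 K j) = \<theta>" using th by simp
      show "\<theta> \<star> id2 K j \<in> cells K (v \<cdot> j) (k \<cdot> b \<cdot> j)" using th by (auto simp: cells_def)
    next
      fix \<theta> assume "\<theta> \<in> cells K (v \<cdot> j) (k \<cdot> b \<cdot> j)"
      then have th: "\<theta> \<in> Cell K" "dom2 K \<theta> = v \<cdot> j" "cod2 K \<theta> = k \<cdot> b \<cdot> j" by (auto simp: cells_def)
      show "?inv \<theta> \<in> cells K v (k \<cdot> b)" using th bjr by (auto simp: cells_def)
      have e: "id2 K (b \<cdot> j) \<star> \<kappa> = id2 K (b \<cdot> j)"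
      proof -
        have "id2 K b \<star> (id2 K j \<star> \<kappa>) = (id2 K b \<star> \<eta>) \<star> id2 K j" using j\<kappa> by simp
        then show ?thesis using b\<eta> by simp
      qed
      have "?inv \<theta> \<star> id2 K j = (\<theta> \<star> id2 K (r \<cdot> j)) \<bullet> (id2 K v \<star> \<eta> \<star> id2 K j)" using th bjr by simp
      also have "id2 K v \<star> \<eta> \<star> id2 K j = id2 K (v \<cdot> j) \<star> \<kappa>" using j\<kappa>[symmetric] by simp
      also have "(\<theta> \<star> id2 K (r \<cdot> j)) \<bullet> (id2 K (v \<cdot> j) \<star> \<kappa>) = (id2 K (k \<cdot> b \<cdot> j) \<star> \<kappa>) \<bullet> (\<theta> \<star> id2 K (one K C))"
        by (rule whisker_exchange) (auto simp: cells_def th)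
      also have "id2 K (k \<cdot> b \<cdot> j) \<star> \<kappa> = id2 K (k \<cdot> b \<cdot> j)"
        using e whisker_whisker[of "b \<cdot> j" k \<kappa>] by simp
      finally show "?inv \<theta> \<star> id2 K j = \<theta>" using th by simp
    qed
    have "bij_betw ((\<lambda>\<theta>. \<theta> \<star> id2 K j) \<circ> (\<lambda>\<beta>. (\<beta> \<star> id2 K b) \<bullet> \<chi>)) (cells K w k) (cells K (v \<cdot> j) (k \<cdot> b \<cdot> j))"
      by (rule bij_betw_trans[OF bij[OF k] bij2])
    moreover have "((\<lambda>\<theta>. \<theta> \<star> id2 K j) \<circ> (\<lambda>\<beta>. (\<beta> \<star> id2 K b) \<bullet> \<chi>)) \<beta> = (\<beta> \<star> id2 K (b \<cdot> j)) \<bullet> (\<chi> \<star> id2 K j)"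
      if "\<beta> \<in> cells K w k" for \<beta> using that by (auto simp: cells_def)
    ultimately show "bij_betw (\<lambda>\<beta>. (\<beta> \<star> id2 K (b \<cdot> j)) \<bullet> (\<chi> \<star> id2 K j)) (cells K w k) (cells K (v \<cdot> j) (k \<cdot> b \<cdot> j))"
      using bij_betw_cong by (metis (no_types, lifting))
  qed
qed

end

section \<open>Squares that preserve pointwise Kan extensions\<close>

context twocat begin

lemma comma_squareE:
  assumes "comma_square K f k p q l"
  obtains X Y Z P where "f \<in> Mor K" "src K f = X" "tgt K f = Z" "k \<in> Mor K" "src K k = Y" "tgt K k = Z"
    "p \<in> Mor K" "src K p = P" "tgt K p = X" "q \<in> Mor K" "src K q = P" "tgt K q = Y"
    "l \<in> Cell K" "dom2 K l = f \<cdot> p" "cod2 K l = k \<cdot> q" "P \<in> Ob K" "X \<in> Ob K" "Y \<in> Ob K" "Z \<in> Ob K"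
    "\<And>W u v \<theta>. u \<in> hom K W X \<Longrightarrow> v \<in> hom K W Y \<Longrightarrow> \<theta> \<in> cells K (f \<cdot> u) (k \<cdot> v) \<Longrightarrow>
       \<exists>!w. w \<in> hom K W P \<and> p \<cdot> w = u \<and> q \<cdot> w = v \<and> l \<star> id2 K w = \<theta>"
    "\<And>W w w' \<alpha> \<beta>. w \<in> hom K W P \<Longrightarrow> w' \<in> hom K W P \<Longrightarrow> \<alpha> \<in> cells K (p \<cdot> w) (p \<cdot> w') \<Longrightarrow>
       \<beta> \<in> cells K (q \<cdot> w) (q \<cdot> w') \<Longrightarrow>
       (id2 K k \<star> \<beta>) \<bullet> (l \<star> id2 K w) = (l \<star> id2 K w') \<bullet> (id2 K f \<star> \<alpha>) \<Longrightarrow>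
       \<exists>!\<gamma>. \<gamma> \<in> cells K w w' \<and> id2 K p \<star> \<gamma> = \<alpha> \<and> id2 K q \<star> \<gamma> = \<beta>"
proof -
  have H: "hom K W P' \<noteq> {} \<Longrightarrow> W \<in> Ob K" for W P' by (auto simp: hom_def)
  obtain P where P: "p \<in> hom K P (src K f)" "q \<in> hom K P (src K k)" "l \<in> cells K (f \<cdot> p) (k \<cdot> q)"
    "f \<in> Mor K" "k \<in> Mor K" "tgt K f = tgt K k" and
    u: "\<forall>W\<in>Ob K. \<forall>u\<in>hom K W (src K f). \<forall>v\<in>hom K W (src K k).
          \<forall>\<theta>\<in>cells K (f \<cdot>\<^bsub>K\<^esub> u) (k \<cdot>\<^bsub>K\<^esub> v).
          \<exists>!w. w \<in> hom K W P \<and> p \<cdot>\<^bsub>K\<^esub> w = u \<and> q \<cdot>\<^bsub>K\<^esub> w = v \<and> l \<star>\<^bsub>K\<^esub> id2 K w = \<theta>" and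
    v: "\<forall>W\<in>Ob K. \<forall>w\<in>hom K W P. \<forall>w'\<in>hom K W P.
          \<forall>\<alpha>\<in>cells K (p \<cdot>\<^bsub>K\<^esub> w) (p \<cdot>\<^bsub>K\<^esub> w'). \<forall>\<beta>\<in>cells K (q \<cdot>\<^bsub>K\<^esub> w) (q \<cdot>\<^bsub>K\<^esub> w').
          (id2 K k \<star>\<^bsub>K\<^esub> \<beta>) \<bullet>\<^bsub>K\<^esub> (l \<star>\<^bsub>K\<^esub> id2 K w) = (l \<star>\<^bsub>K\<^esub> id2 K w') \<bullet>\<^bsub>K\<^esub> (id2 K f \<star>\<^bsub>K\<^esub> \<alpha>) \<longrightarrow>
          (\<exists>!\<gamma>. \<gamma> \<in> cells K w w' \<and> id2 K p \<star>\<^bsub>K\<^esub> \<gamma> = \<alpha> \<and> id2 K q \<star>\<^bsub>K\<^esub> \<gamma> = \<beta>)"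
    using assms unfolding comma_square_def by blast
  have Q: "p \<in> Mor K" "src K p = P" "tgt K p = src K f" "q \<in> Mor K" "src K q = P" "tgt K q = src K k"
    "l \<in> Cell K" "dom2 K l = f \<cdot> p" "cod2 K l = k \<cdot> q"
    using P by (auto simp: hom_def cells_def)
  show thesis
  proof (rule that[of "src K f" "tgt K f" "src K k" P])
    show "P \<in> Ob K" "src K f \<in> Ob K" "src K k \<in> Ob K" "tgt K f \<in> Ob K" using P Q Mor_facts[of p] by auto
    show "\<exists>!w. w \<in> hom K W P \<and> p \<cdot> w = u \<and> q \<cdot> w = v \<and> l \<star> id2 K w = \<theta>"
      if "u \<in> hom K W (src K f)" "v \<in> hom K W (src K k)" "\<theta> \<in> cells K (f \<cdot> u) (k \<cdot> v)" for W u v \<theta>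
      using u that H[of W "src K f"] by blast
    show "\<exists>!\<gamma>. \<gamma> \<in> cells K w w' \<and> id2 K p \<star> \<gamma> = \<alpha> \<and> id2 K q \<star> \<gamma> = \<beta>"
      if "w \<in> hom K W P" "w' \<in> hom K W P" "\<alpha> \<in> cells K (p \<cdot> w) (p \<cdot> w')"
       "\<beta> \<in> cells K (q \<cdot> w) (q \<cdot> w')"
       "(id2 K k \<star> \<beta>) \<bullet> (l \<star> id2 K w) = (l \<star> id2 K w') \<bullet> (id2 K f \<star> \<alpha>)" for W w w' \<alpha> \<beta>
      using v that H[of W P] by blast
  qed (use P Q in auto)
qed

text \<open>The pointwise condition for the identity of the target already contains the plain one.
  Pasting a 2-cell \<open>u\<close> to \<open>k f\<close> with the comma cell \<open>l\<close> is
  injective, since restriction along the section \<open>i\<close> undoes it; and pasting with \<psi>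
  followed by pasting with \<open>l\<close> is the bijection given by \<open>lk\<close>. So pasting
  with \<psi> is bijective too.\<close>

lemma left_kan_from_comma_one:
  assumes u: "u \<in> hom K (src K f) A" and h: "h \<in> hom K (tgt K f) A" and psi: "\<psi> \<in> cells K u (h \<cdot> f)"
    and com: "comma_square K f (one K (tgt K f)) p q l"
    and lk: "left_kan K q (u \<cdot> p) h ((id2 K h \<star> l) \<bullet> (\<psi> \<star> id2 K p))"
  shows "left_kan K f u h \<psi>"
proof -
  obtain X Y P where t0: "f \<in> Mor K" "src K f = X" "tgt K f = Y" "p \<in> hom K P X" "q \<in> hom K P Y"
    "l \<in> cells K (f \<cdot> p) (one K Y \<cdot> q)"
    and up: "\<And>W u v \<theta>. u \<in> hom K W X \<Longrightarrow> v \<in> hom K W Y \<Longrightarrow> \<theta> \<in> cells K (f \<cdot> u) (one K Y \<cdot> v) \<Longrightarrow>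
       \<exists>!w. w \<in> hom K W P \<and> p \<cdot> w = u \<and> q \<cdot> w = v \<and> l \<star> id2 K w = \<theta>"
    using com
  proof (rule comma_squareE)
    fix X Y Z P
    assume a: "f \<in> Mor K" "src K f = X" "tgt K f = Z" "src K (one K (tgt K f)) = Y"
    "p \<in> Mor K" "src K p = P" "tgt K p = X" "q \<in> Mor K" "src K q = P" "tgt K q = Y"
    "l \<in> Cell K" "dom2 K l = f \<cdot> p" "cod2 K l = one K (tgt K f) \<cdot> q"
    "\<And>W u v \<theta>. u \<in> hom K W X \<Longrightarrow> v \<in> hom K W Y \<Longrightarrow> \<theta> \<in> cells K (f \<cdot> u) (one K (tgt K f) \<cdot> v) \<Longrightarrow>
       \<exists>!w. w \<in> hom K W P \<and> p \<cdot> w = u \<and> q \<cdot> w = v \<and> l \<star> id2 K w = \<theta>"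
    then have "Z = Y" by auto
    then show thesis using a by (intro that[of X Y P]) (simp_all add: hom_def cells_def)
  qed
  have X [simp]: "X \<in> Ob K" "Y \<in> Ob K" using t0 Mor_facts[of f] by auto
  have t [simp]: "f \<in> Mor K" "src K f = X" "tgt K f = Y" "p \<in> Mor K" "src K p = P" "tgt K p = X"
     "q \<in> Mor K" "src K q = P" "tgt K q = Y" "l \<in> Cell K" "dom2 K l = f \<cdot> p" "cod2 K l = q"
     "u \<in> Mor K" "src K u = X" "tgt K u = A" "h \<in> Mor K" "src K h = Y" "tgt K h = A"
     "\<psi> \<in> Cell K" "dom2 K \<psi> = u" "cod2 K \<psi> = h \<cdot> f"
    using t0 u h psi by (auto simp: hom_def cells_def)
  \<comment> \<open>\<open>i\<close> is the 1-cell into the comma object classified by the identity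
    2-cell of \<open>f\<close>.\<close>
  obtain i where i0: "i \<in> hom K X P" "p \<cdot> i = one K X" "q \<cdot> i = f" and li: "l \<star> id2 K i = id2 K f"
    using up[of "one K X" X f "id2 K f"] by (auto simp: hom_def cells_def)
  then have i [simp]: "i \<in> Mor K" "src K i = X" "tgt K i = P" by (auto simp: hom_def)
  note i' [simp] = i0(2,3)
  let ?L = "(id2 K h \<star> l) \<bullet> (\<psi> \<star> id2 K p)"
  have bij: "bij_betw (\<lambda>\<beta>. (\<beta> \<star> id2 K q) \<bullet> ?L) (cells K h k) (cells K (u \<cdot> p) (k \<cdot> q))"
    if "k \<in> hom K Y A" for k
    using lk that unfolding left_kan_def by (auto simp: hom_def)
  show ?thesis unfolding left_kan_def
  proof (intro exI conjI ballI)
    show "f \<in> hom K X Y" "u \<in> hom K X A" "h \<in> hom K Y A" "\<psi> \<in> cells K u (h \<cdot> f)"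
      using u h psi by (auto simp: hom_def)
    fix k assume k: "k \<in> hom K Y A"
    then have [simp]: "k \<in> Mor K" "src K k = Y" "tgt K k = A" by (auto simp: hom_def)
    let ?\<Psi> = "\<lambda>\<beta>. (\<beta> \<star> id2 K f) \<bullet> \<psi>" and ?\<Phi> = "\<lambda>\<beta>. (\<beta> \<star> id2 K q) \<bullet> ?L"
    let ?E = "\<lambda>\<theta>. (id2 K k \<star> l) \<bullet> (\<theta> \<star> id2 K p)"
    have ext: "?E (?\<Psi> \<beta>) = ?\<Phi> \<beta>" if "\<beta> \<in> cells K h k" for \<beta>
    proof -
      have b: "\<beta> \<in> Cell K" "dom2 K \<beta> = h" "cod2 K \<beta> = k" using that by (auto simp: cells_def)
      show ?thesis using b whisker_exchange_assoc[of l "f \<cdot> p" q \<beta> h k "\<psi> \<star> id2 K p"] by (simp add: cells_def)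
    qed
    have res: "?E \<theta> \<star> id2 K i = \<theta>" if "\<theta> \<in> cells K u (k \<cdot> f)" for \<theta>
      using that li by (auto simp: cells_def)
    have dom: "?E \<theta> \<in> cells K (u \<cdot> p) (k \<cdot> q)" if "\<theta> \<in> cells K u (k \<cdot> f)" for \<theta>
      using that by (auto simp: cells_def)
    show "bij_betw ?\<Psi> (cells K h k) (cells K u (k \<cdot> f))"
    proof (rule bij_betwI')
      fix \<beta> \<beta>' assume b: "\<beta> \<in> cells K h k" "\<beta>' \<in> cells K h k"
      show "(?\<Psi> \<beta> = ?\<Psi> \<beta>') = (\<beta> = \<beta>')"
        using ext[OF b(1)] ext[OF b(2)] bij_betw_imp_inj_on[OF bij[OF k]] b by (metis (no_types, lifting) inj_onD)
    next
      fix \<beta> assume "\<beta> \<in> cells K h k" then show "?\<Psi> \<beta> \<in> cells K u (k \<cdot> f)" by (auto simp: cells_def)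
    next
      fix \<theta> assume th: "\<theta> \<in> cells K u (k \<cdot> f)"
      then obtain \<beta> where b: "\<beta> \<in> cells K h k" "?E \<theta> = ?\<Phi> \<beta>"
        using bij_betw_imp_surj_on[OF bij[OF k]] dom[OF th] by (smt (verit) imageE)
      have "?\<Psi> \<beta> \<in> cells K u (k \<cdot> f)" using b(1) by (auto simp: cells_def)
      then have "\<theta> = ?\<Psi> \<beta>" using res[OF th] res[of "?\<Psi> \<beta>"] ext[OF b(1)] b(2) by simp
      then show "\<exists>\<beta>\<in>cells K h k. \<theta> = ?\<Psi> \<beta>" using b by blast
    qed
  qed
qed

end

definition has_commas :: "('o, 'f, 't) two_cat \<Rightarrow> bool" where
  "has_commas K \<longleftrightarrow> (\<forall>f\<in>Mor K. \<forall>k\<in>Mor K. tgt K f = tgt K k \<longrightarrow> (\<exists>p q l. comma_square K f k p q l))"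

text \<open>
  A square \<open>f p = k q\<close> all of whose 2-cells \<open>f x \<Rightarrow> k y\<close> factor through it, by a
  factorization \<open>(\<rho>, \<chi>, \<omega>)\<close> which receives a map from every factorization of the form
  \<open>(\<rho>', 1, \<omega>')\<close>.  Up to the fixed shape of the zigzags this is Guitart exactness.
\<close>

definition factoring_square :: "('o, 'f, 't) two_cat \<Rightarrow> 'f \<Rightarrow> 'f \<Rightarrow> 'f \<Rightarrow> 'f \<Rightarrow> bool" where
  "factoring_square K f k p q \<longleftrightarrow>
     (\<exists>P. p \<in> hom K P (src K f) \<and> q \<in> hom K P (src K k)) \<and> f \<in> Mor K \<and> k \<in> Mor K \<and>
     tgt K f = tgt K k \<and> f \<cdot>\<^bsub>K\<^esub> p = k \<cdot>\<^bsub>K\<^esub> q \<and>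
     (\<forall>W\<in>Ob K. \<forall>x\<in>hom K W (src K f). \<forall>y\<in>hom K W (src K k). \<forall>\<phi>\<in>cells K (f \<cdot>\<^bsub>K\<^esub> x) (k \<cdot>\<^bsub>K\<^esub> y).
        \<exists>\<rho>\<in>hom K W (src K p). \<exists>\<chi>\<in>cells K x (p \<cdot>\<^bsub>K\<^esub> \<rho>). \<exists>\<omega>\<in>cells K (q \<cdot>\<^bsub>K\<^esub> \<rho>) y.
          (id2 K k \<star>\<^bsub>K\<^esub> \<omega>) \<bullet>\<^bsub>K\<^esub> (id2 K f \<star>\<^bsub>K\<^esub> \<chi>) = \<phi> \<and>
          (\<forall>V\<in>Ob K. \<forall>t\<in>hom K V W. \<forall>\<rho>'\<in>hom K V (src K p). \<forall>\<omega>'\<in>cells K (q \<cdot>\<^bsub>K\<^esub> \<rho>') (y \<cdot>\<^bsub>K\<^esub> t).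
             x \<cdot>\<^bsub>K\<^esub> t = p \<cdot>\<^bsub>K\<^esub> \<rho>' \<and> id2 K k \<star>\<^bsub>K\<^esub> \<omega>' = \<phi> \<star>\<^bsub>K\<^esub> id2 K t \<longrightarrow>
             (\<exists>\<kappa>\<in>cells K \<rho>' (\<rho> \<cdot>\<^bsub>K\<^esub> t). id2 K p \<star>\<^bsub>K\<^esub> \<kappa> = \<chi> \<star>\<^bsub>K\<^esub> id2 K t \<and>
                (\<omega> \<star>\<^bsub>K\<^esub> id2 K t) \<bullet>\<^bsub>K\<^esub> (id2 K q \<star>\<^bsub>K\<^esub> \<kappa>) = \<omega>')))"

context twocat begin

text \<open>Let \<open>C\<close> be the comma object of \<open>q\<close> and \<open>m\<close>, and
  \<open>C'\<close> that of \<open>f\<close> and \<open>k m\<close>. Pointwiseness of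
  \<open>h\<close> gives the Kan extension along the projection of \<open>C'\<close>. Factoring the
  universal cell of \<open>C'\<close> through the square produces \<open>r : C' -> C\<close> next to
  the evident \<open>j : C -> C'\<close>, and \<open>left_kan_restrict\<close> carries the extension
  over to \<open>C\<close>.\<close>

theorem pointwise_left_kan_paste:
  assumes hc: "has_commas K" and fs: "factoring_square K f k p q" and pk: "pointwise_left_kan K f u h \<psi>"
  shows "pointwise_left_kan K q (u \<cdot> p) (h \<cdot> k) (\<psi> \<star> id2 K p)"
proof -
  obtain X Y Y' P where fs0: "f \<in> hom K X Y" "k \<in> hom K Y' Y" "p \<in> hom K P X" "q \<in> hom K P Y'"
    and sq: "f \<cdot> p = k \<cdot> q"
    and fac: "\<And>W x y \<phi>. x \<in> hom K W X \<Longrightarrow> y \<in> hom K W Y' \<Longrightarrow> \<phi> \<in> cells K (f \<cdot> x) (k \<cdot> y) \<Longrightarrow>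
        \<exists>\<rho>\<in>hom K W P. \<exists>\<chi>\<in>cells K x (p \<cdot> \<rho>). \<exists>\<omega>\<in>cells K (q \<cdot> \<rho>) y.
          (id2 K k \<star> \<omega>) \<bullet> (id2 K f \<star> \<chi>) = \<phi> \<and>
          (\<forall>V\<in>Ob K. \<forall>t\<in>hom K V W. \<forall>\<rho>'\<in>hom K V P. \<forall>\<omega>'\<in>cells K (q \<cdot> \<rho>') (y \<cdot> t).
             x \<cdot> t = p \<cdot> \<rho>' \<and> id2 K k \<star> \<omega>' = \<phi> \<star> id2 K t \<longrightarrow>
             (\<exists>\<kappa>\<in>cells K \<rho>' (\<rho> \<cdot> t). id2 K p \<star> \<kappa> = \<chi> \<star> id2 K t \<and>
                (\<omega> \<star> id2 K t) \<bullet> (id2 K q \<star> \<kappa>) = \<omega>'))"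
  proof -
    from fs[unfolded factoring_square_def] have 1: "f \<in> hom K (src K f) (tgt K f)" "k \<in> hom K (src K k) (tgt K f)"
      "p \<in> hom K (src K p) (src K f)" "q \<in> hom K (src K p) (src K k)" "f \<cdot> p = k \<cdot> q" by (auto simp: hom_def)
    have 2: "x \<in> hom K W (src K f) \<Longrightarrow> W \<in> Ob K" for x W by (auto simp: hom_def)
    note 3 = fs[unfolded factoring_square_def, THEN conjunct2, THEN conjunct2, THEN conjunct2, THEN conjunct2, THEN conjunct2]
    show thesis
      by (rule that[OF 1], rule 3[THEN bspec, THEN bspec, THEN bspec, THEN bspec, OF 2]) assumption+
  qed
  have lk: "left_kan K f u h \<psi>" and
    pw: "\<And>k p q l. comma_square K f k p q l \<Longrightarrow>
        left_kan K q (u \<cdot> p) (h \<cdot> k) ((id2 K h \<star> l) \<bullet> (\<psi> \<star> id2 K p))"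
    using pk unfolding pointwise_left_kan_def by blast+
  obtain X1 Y1 A where "f \<in> hom K X1 Y1" "u \<in> hom K X1 A" "h \<in> hom K Y1 A" "\<psi> \<in> cells K u (h \<cdot> f)"
    using lk unfolding left_kan_def by blast
  then have A: "u \<in> hom K X A" "h \<in> hom K Y A" "\<psi> \<in> cells K u (h \<cdot> f)"
    using fs0 by (auto simp: hom_def)
  have t [simp]: "f \<in> Mor K" "src K f = X" "tgt K f = Y" "k \<in> Mor K" "src K k = Y'" "tgt K k = Y"
    "p \<in> Mor K" "src K p = P" "tgt K p = X" "q \<in> Mor K" "src K q = P" "tgt K q = Y'"
    "u \<in> Mor K" "src K u = X" "tgt K u = A" "h \<in> Mor K" "src K h = Y" "tgt K h = A"
    "\<psi> \<in> Cell K" "dom2 K \<psi> = u" "cod2 K \<psi> = h \<cdot> f"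
    using fs0 A by (auto simp: hom_def cells_def)
  have sq': "f \<cdot> p \<cdot> w = k \<cdot> q \<cdot> w" if "w \<in> Mor K" "tgt K w = P" for w
    using that cmp_assoc'[of w p f] cmp_assoc'[of w q k] sq by simp
  have main: "left_kan K b ((u \<cdot> p) \<cdot> a) ((h \<cdot> k) \<cdot> m) ((id2 K (h \<cdot> k) \<star> l) \<bullet> ((\<psi> \<star> id2 K p) \<star> id2 K a))"
    if "comma_square K q m a b l" for m a b l
    using that
  proof (rule comma_squareE)
    fix P1 Z Y1 C
    assume t1': "q \<in> Mor K" "src K q = P1" "tgt K q = Y1" "m \<in> Mor K" "src K m = Z" "tgt K m = Y1"
      "a \<in> Mor K" "src K a = C" "tgt K a = P1" "b \<in> Mor K" "src K b = C" "tgt K b = Z"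
      "l \<in> Cell K" "dom2 K l = q \<cdot> a" "cod2 K l = m \<cdot> b" "C \<in> Ob K" "Z \<in> Ob K"
      and up1: "\<And>W u v \<theta>. u \<in> hom K W P1 \<Longrightarrow> v \<in> hom K W Z \<Longrightarrow> \<theta> \<in> cells K (q \<cdot> u) (m \<cdot> v) \<Longrightarrow>
       \<exists>!w. w \<in> hom K W C \<and> a \<cdot> w = u \<and> b \<cdot> w = v \<and> l \<star> id2 K w = \<theta>"
      and up2: "\<And>W w w' \<alpha> \<beta>. w \<in> hom K W C \<Longrightarrow> w' \<in> hom K W C \<Longrightarrow> \<alpha> \<in> cells K (a \<cdot> w) (a \<cdot> w') \<Longrightarrow>
       \<beta> \<in> cells K (b \<cdot> w) (b \<cdot> w') \<Longrightarrow>
       (id2 K m \<star> \<beta>) \<bullet> (l \<star> id2 K w) = (l \<star> id2 K w') \<bullet> (id2 K q \<star> \<alpha>) \<Longrightarrow>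
       \<exists>!\<gamma>. \<gamma> \<in> cells K w w' \<and> id2 K a \<star> \<gamma> = \<alpha> \<and> id2 K b \<star> \<gamma> = \<beta>"
    have [simp]: "P1 = P" "Y1 = Y'" using t1' by auto
    note t1 [simp] = t1'[simplified]
    obtain a' b' l' where com: "comma_square K f (k \<cdot> m) a' b' l'"
      using hc[unfolded has_commas_def, THEN bspec, THEN bspec, THEN mp, of f "k \<cdot> m"] by auto
    show ?thesis using com
    proof (rule comma_squareE)
      fix X1 Z1 Y1 C'
      assume t2': "src K f = X1" "tgt K f = Y1" "src K (k \<cdot> m) = Z1"
        "a' \<in> Mor K" "src K a' = C'" "tgt K a' = X1" "b' \<in> Mor K" "src K b' = C'" "tgt K b' = Z1"
        "l' \<in> Cell K" "dom2 K l' = f \<cdot> a'" "cod2 K l' = (k \<cdot> m) \<cdot> b'" "C' \<in> Ob K"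
        and vp1: "\<And>W u v \<theta>. u \<in> hom K W X1 \<Longrightarrow> v \<in> hom K W Z1 \<Longrightarrow> \<theta> \<in> cells K (f \<cdot> u) ((k \<cdot> m) \<cdot> v) \<Longrightarrow>
       \<exists>!w. w \<in> hom K W C' \<and> a' \<cdot> w = u \<and> b' \<cdot> w = v \<and> l' \<star> id2 K w = \<theta>"
        and vp2: "\<And>W w w' \<alpha> \<beta>. w \<in> hom K W C' \<Longrightarrow> w' \<in> hom K W C' \<Longrightarrow> \<alpha> \<in> cells K (a' \<cdot> w) (a' \<cdot> w') \<Longrightarrow>
       \<beta> \<in> cells K (b' \<cdot> w) (b' \<cdot> w') \<Longrightarrow>
       (id2 K (k \<cdot> m) \<star> \<beta>) \<bullet> (l' \<star> id2 K w) = (l' \<star> id2 K w') \<bullet> (id2 K f \<star> \<alpha>) \<Longrightarrow>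
       \<exists>!\<gamma>. \<gamma> \<in> cells K w w' \<and> id2 K a' \<star> \<gamma> = \<alpha> \<and> id2 K b' \<star> \<gamma> = \<beta>"
      have [simp]: "X1 = X" "Z1 = Z" using t2' by auto
      have t2 [simp]: "a' \<in> Mor K" "src K a' = C'" "tgt K a' = X" "b' \<in> Mor K" "src K b' = C'" "tgt K b' = Z"
        "l' \<in> Cell K" "dom2 K l' = f \<cdot> a'" "cod2 K l' = k \<cdot> m \<cdot> b'" "C' \<in> Ob K" using t2' by auto
      \<comment> \<open>Since \<open>f p = k q\<close>, the cell \<open>k l\<close> has the form
        required for a 1-cell into \<open>C'\<close>.\<close>
      obtain j where j0: "j \<in> hom K C C'" "a' \<cdot> j = p \<cdot> a" "b' \<cdot> j = b" "l' \<star> id2 K j = id2 K k \<star> l"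
        using vp1[of "p \<cdot> a" C b "id2 K k \<star> l"] by (auto simp: hom_def cells_def sq')
      then have j [simp]: "j \<in> Mor K" "src K j = C" "tgt K j = C'" by (auto simp: hom_def)
      note j' [simp] = j0(2,3,4)
      \<comment> \<open>The factorization is applied to the universal cell \<open>l'\<close>
        itself.\<close>
      obtain \<rho> \<chi> \<omega> where rho: "\<rho> \<in> hom K C' P" "\<chi> \<in> cells K a' (p \<cdot> \<rho>)" "\<omega> \<in> cells K (q \<cdot> \<rho>) (m \<cdot> b')"
        and fact: "(id2 K k \<star> \<omega>) \<bullet> (id2 K f \<star> \<chi>) = l'"
        and init: "\<forall>V\<in>Ob K. \<forall>t\<in>hom K V C'. \<forall>\<rho>'\<in>hom K V P. \<forall>\<omega>'\<in>cells K (q \<cdot> \<rho>') ((m \<cdot> b') \<cdot> t).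
             a' \<cdot> t = p \<cdot> \<rho>' \<and> id2 K k \<star> \<omega>' = l' \<star> id2 K t \<longrightarrow>
             (\<exists>\<kappa>\<in>cells K \<rho>' (\<rho> \<cdot> t). id2 K p \<star> \<kappa> = \<chi> \<star> id2 K t \<and>
                (\<omega> \<star> id2 K t) \<bullet> (id2 K q \<star> \<kappa>) = \<omega>')"
      proof -
        have "a' \<in> hom K C' X" "m \<cdot> b' \<in> hom K C' Y'" "l' \<in> cells K (f \<cdot> a') (k \<cdot> m \<cdot> b')" by (auto simp: hom_def cells_def)
        from fac[OF this] show thesis using that by blast
      qed
      have t3 [simp]: "\<rho> \<in> Mor K" "src K \<rho> = C'" "tgt K \<rho> = P" "\<chi> \<in> Cell K" "dom2 K \<chi> = a'" "cod2 K \<chi> = p \<cdot> \<rho>"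
         "\<omega> \<in> Cell K" "dom2 K \<omega> = q \<cdot> \<rho>" "cod2 K \<omega> = m \<cdot> b'" using rho by (auto simp: hom_def cells_def)
      \<comment> \<open>The second half \<omega> of the factorization is a 2-cell from
        \<open>q\<close> \<rho> to \<open>m b'\<close>, hence a 1-cell into
        \<open>C\<close>.\<close>
      obtain r where r0: "r \<in> hom K C' C" "a \<cdot> r = \<rho>" "b \<cdot> r = b'" "l \<star> id2 K r = \<omega>"
        using up1[of \<rho> C' b' \<omega>] by (auto simp: hom_def cells_def)
      then have r [simp]: "r \<in> Mor K" "src K r = C'" "tgt K r = C" by (auto simp: hom_def)
      note r' [simp] = r0(2,3,4)
      have jr1 [simp]: "a' \<cdot> j \<cdot> r = p \<cdot> \<rho>" "b' \<cdot> j \<cdot> r = b'"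
        using cmp_assoc'[of r j a'] cmp_assoc'[of r j b'] by auto
      have ljr: "l' \<star> id2 K (j \<cdot> r) = id2 K k \<star> \<omega>"
        using hcmp_assoc'[of "id2 K r" "id2 K j" l'] hcmp_assoc'[of "id2 K r" l "id2 K k"] by simp
      \<comment> \<open>The factorization equation for \<open>l'\<close> says precisely that \<chi>
        and the identity of \<open>b'\<close> form a 2-cell of \<open>C'\<close> from the identity
        to \<open>j r\<close>.\<close>
      have "(id2 K (k \<cdot> m) \<star> id2 K b') \<bullet> (l' \<star> id2 K (one K C')) = (l' \<star> id2 K (j \<cdot> r)) \<bullet> (id2 K f \<star> \<chi>)"
        using ljr fact by simp
      then obtain \<eta> where eta: "\<eta> \<in> cells K (one K C') (j \<cdot> r)" "id2 K a' \<star> \<eta> = \<chi>" "id2 K b' \<star> \<eta> = id2 K b'"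
        using vp2[of "one K C'" C' "j \<cdot> r" \<chi> "id2 K b'"] by (auto simp: hom_def cells_def)
      \<comment> \<open>\<open>C\<close> with its own cell \<open>l\<close> is a factorization of
        the restricted kind for \<open>l' j\<close>. Initiality of \<rho> compares the two.\<close>
      obtain \<kappa>0 where k0: "\<kappa>0 \<in> cells K a (\<rho> \<cdot> j)" "id2 K p \<star> \<kappa>0 = \<chi> \<star> id2 K j" "(\<omega> \<star> id2 K j) \<bullet> (id2 K q \<star> \<kappa>0) = l"
        using init[THEN bspec, THEN bspec, THEN bspec, THEN bspec, THEN mp, of C j a l] by (auto simp: hom_def cells_def)
      then have [simp]: "\<kappa>0 \<in> Cell K" "dom2 K \<kappa>0 = a" "cod2 K \<kappa>0 = \<rho> \<cdot> j" by (auto simp: cells_def)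
      have rj1 [simp]: "a \<cdot> r \<cdot> j = \<rho> \<cdot> j" "b \<cdot> r \<cdot> j = b"
        using cmp_assoc'[of j r a] cmp_assoc'[of j r b] by auto
      have lrj: "l \<star> id2 K (r \<cdot> j) = \<omega> \<star> id2 K j"
        using hcmp_assoc'[of "id2 K j" "id2 K r" l] by simp
      have "(id2 K m \<star> id2 K b) \<bullet> (l \<star> id2 K (one K C)) = (l \<star> id2 K (r \<cdot> j)) \<bullet> (id2 K q \<star> \<kappa>0)"
        using lrj k0 by simp
      then obtain \<kappa> where kap: "\<kappa> \<in> cells K (one K C) (r \<cdot> j)" "id2 K a \<star> \<kappa> = \<kappa>0" "id2 K b \<star> \<kappa> = id2 K b"
        using up2[of "one K C" C "r \<cdot> j" \<kappa>0 "id2 K b"] by (auto simp: hom_def cells_def)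
      have t4 [simp]: "\<eta> \<in> Cell K" "dom2 K \<eta> = one K C'" "cod2 K \<eta> = j \<cdot> r" "\<kappa> \<in> Cell K" "dom2 K \<kappa> = one K C" "cod2 K \<kappa> = r \<cdot> j"
        using eta kap by (auto simp: cells_def)
      \<comment> \<open>Both sides are 2-cells of \<open>C'\<close> with projections \<chi>
        \<open>j\<close> and the identity of \<open>b\<close>.\<close>
      have jk: "id2 K j \<star> \<kappa> = \<eta> \<star> id2 K j"
      proof -
        have a1: "id2 K a' \<star> (id2 K j \<star> \<kappa>) = \<chi> \<star> id2 K j"
          using whisker_whisker[of a p \<kappa>] kap k0 by simp
        have a2: "id2 K a' \<star> (\<eta> \<star> id2 K j) = \<chi> \<star> id2 K j"
          using hcmp_assoc'[of "id2 K j" \<eta> "id2 K a'"] eta by simp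
        have b1: "id2 K b' \<star> (id2 K j \<star> \<kappa>) = id2 K b" using kap by simp
        have b2: "id2 K b' \<star> (\<eta> \<star> id2 K j) = id2 K b"
          using hcmp_assoc'[of "id2 K j" \<eta> "id2 K b'"] eta by simp
        have e: "(id2 K (k \<cdot> m) \<star> id2 K b) \<bullet> (l' \<star> id2 K j) = (l' \<star> id2 K (j \<cdot> r \<cdot> j)) \<bullet> (id2 K f \<star> (\<chi> \<star> id2 K j))"
        proof -
          have "(l' \<star> id2 K (j \<cdot> r \<cdot> j)) \<bullet> (id2 K f \<star> (\<chi> \<star> id2 K j)) = ((l' \<star> id2 K (j \<cdot> r)) \<bullet> (id2 K f \<star> \<chi>)) \<star> id2 K j"
            by simp
          also have "\<dots> = l' \<star> id2 K j" using ljr fact by simp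
          finally show ?thesis by simp
        qed
        have jrj [simp]: "a' \<cdot> j \<cdot> r \<cdot> j = p \<cdot> \<rho> \<cdot> j" "b' \<cdot> j \<cdot> r \<cdot> j = b"
          using cmp_assoc'[of j "j \<cdot> r" a'] cmp_assoc'[of j "j \<cdot> r" b'] by auto
        have "\<exists>!\<gamma>. \<gamma> \<in> cells K j (j \<cdot> r \<cdot> j) \<and> id2 K a' \<star> \<gamma> = \<chi> \<star> id2 K j \<and> id2 K b' \<star> \<gamma> = id2 K b"
          by (rule vp2[OF _ _ _ _ e]) (auto simp: hom_def cells_def)
        moreover have "id2 K j \<star> \<kappa> \<in> cells K j (j \<cdot> r \<cdot> j)" "\<eta> \<star> id2 K j \<in> cells K j (j \<cdot> r \<cdot> j)"
          by (auto simp: cells_def)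
        ultimately show ?thesis using a1 a2 b1 b2 by blast
      qed
      have "left_kan K b' (u \<cdot> a') (h \<cdot> k \<cdot> m) ((id2 K h \<star> l') \<bullet> (\<psi> \<star> id2 K a'))" by (rule pw[OF com])
      from left_kan_restrict[OF this _ _ _ _ _ jk, of C r]
      have "left_kan K (b' \<cdot> j) ((u \<cdot> a') \<cdot> j) (h \<cdot> k \<cdot> m) (((id2 K h \<star> l') \<bullet> (\<psi> \<star> id2 K a')) \<star> id2 K j)"
        using j0 r0 eta kap by simp
      moreover have "((id2 K h \<star> l') \<bullet> (\<psi> \<star> id2 K a')) \<star> id2 K j = (id2 K (h \<cdot> k) \<star> l) \<bullet> (\<psi> \<star> id2 K (p \<cdot> a))"
        using whisker_whisker[of k h l] by simp
      ultimately show ?thesis by simp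
    qed
  qed
  show ?thesis unfolding pointwise_left_kan_def
  proof (intro conjI allI impI)
    \<comment> \<open>The plain Kan property is the case where \<open>m\<close> is the identity,
      through \<open>left_kan_from_comma_one\<close>.\<close>
    obtain a b l where com: "comma_square K q (one K Y') a b l"
      using hc[unfolded has_commas_def, THEN bspec, THEN bspec, THEN mp, of q "one K Y'"] Mor_facts(2)[of q] by auto
    show "left_kan K q (u \<cdot> p) (h \<cdot> k) (\<psi> \<star> id2 K p)"
    proof (rule left_kan_from_comma_one)
      show "comma_square K q (one K (tgt K q)) a b l" using com by simp
      have "h \<cdot> k \<cdot> one K Y' = h \<cdot> k" by simp
      then show "left_kan K b ((u \<cdot> p) \<cdot> a) (h \<cdot> k) ((id2 K (h \<cdot> k) \<star> l) \<bullet> ((\<psi> \<star> id2 K p) \<star> id2 K a))"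
        using main[OF com] by simp
    qed (auto simp: hom_def cells_def sq)
  qed (rule main)
qed

end

section \<open>Transposition along a 2-adjunction\<close>

context twocat begin

lemma invertible1E:
  assumes "invertible1 K f"
  obtains f' where "f \<in> Mor K" "f' \<in> Mor K" "src K f' = tgt K f" "tgt K f' = src K f"
    "f' \<cdot> f = one K (src K f)" "f \<cdot> f' = one K (tgt K f)"
    "\<And>w. w \<in> Mor K \<Longrightarrow> tgt K w = src K f \<Longrightarrow> f' \<cdot> f \<cdot> w = w"
    "\<And>w. w \<in> Mor K \<Longrightarrow> tgt K w = tgt K f \<Longrightarrow> f \<cdot> f' \<cdot> w = w"
proof -
  from assms obtain f' where *: "f \<in> Mor K" "f' \<in> Mor K" "src K f' = tgt K f" "tgt K f' = src K f"
    "f' \<cdot> f = one K (src K f)" "f \<cdot> f' = one K (tgt K f)"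
    unfolding invertible1_def hom_def by blast
  show thesis
  proof (rule that[OF *])
    fix w assume "w \<in> Mor K" "tgt K w = src K f"
    then show "f' \<cdot> f \<cdot> w = w" using * cmp_assoc'[of w f f'] by simp
  next
    fix w assume "w \<in> Mor K" "tgt K w = tgt K f"
    then show "f \<cdot> f' \<cdot> w = w" using * cmp_assoc'[of w f' f] by simp
  qed
qed

lemma factoring_square_iso:
  assumes f: "f \<in> Mor K" "f' \<in> Mor K" and iso: "invertible1 K a" "invertible1 K b"
    and t: "src K a = src K f'" "tgt K a = src K f" "src K b = tgt K f'" "tgt K b = tgt K f"
    and sq: "f \<cdot> a = b \<cdot> f'"
  shows "factoring_square K f b a f'"
proof -
  obtain a' where a [simp]: "a \<in> Mor K" "a' \<in> Mor K" "src K a' = tgt K a" "tgt K a' = src K a"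
    and aa [simp]: "\<And>w. w \<in> Mor K \<Longrightarrow> tgt K w = src K a \<Longrightarrow> a' \<cdot> a \<cdot> w = w" "\<And>w. w \<in> Mor K \<Longrightarrow> tgt K w = tgt K a \<Longrightarrow> a \<cdot> a' \<cdot> w = w"
    by (rule invertible1E[OF iso(1)], rule that, assumption+)
  obtain b' where b [simp]: "b \<in> Mor K" "b' \<in> Mor K" "src K b' = tgt K b" "tgt K b' = src K b"
    and b1 [simp]: "b' \<cdot> b = one K (src K b)" "b \<cdot> b' = one K (tgt K b)"
    and bb [simp]: "\<And>w. w \<in> Mor K \<Longrightarrow> tgt K w = src K b \<Longrightarrow> b' \<cdot> b \<cdot> w = w" "\<And>w. w \<in> Mor K \<Longrightarrow> tgt K w = tgt K b \<Longrightarrow> b \<cdot> b' \<cdot> w = w"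
    by (rule invertible1E[OF iso(2)], rule that, assumption+)
  note [simp] = f t
  have tt [simp]: "src K f \<in> Ob K" "tgt K f \<in> Ob K" using f by auto
  have fa: "b' \<cdot> f \<cdot> x = f' \<cdot> a' \<cdot> x" if "x \<in> Mor K" "tgt K x = src K f" for x
  proof -
    have "b' \<cdot> f \<cdot> x = b' \<cdot> (f \<cdot> a) \<cdot> a' \<cdot> x" using that by simp
    also have "\<dots> = f' \<cdot> a' \<cdot> x" using that unfolding sq by simp
    finally show ?thesis .
  qed
  show ?thesis unfolding factoring_square_def
  proof (intro conjI ballI)
    show "\<exists>P. a \<in> hom K P (src K f) \<and> f' \<in> hom K P (src K b)" by (auto simp: hom_def)
    fix W x y \<phi> assume W: "W \<in> Ob K" and x: "x \<in> hom K W (src K f)" and y: "y \<in> hom K W (src K b)" and phi: "\<phi> \<in> cells K (f \<cdot> x) (b \<cdot> y)"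
    have [simp]: "x \<in> Mor K" "src K x = W" "tgt K x = src K f" "y \<in> Mor K" "src K y = W" "tgt K y = tgt K f'"
      "\<phi> \<in> Cell K" "dom2 K \<phi> = f \<cdot> x" "cod2 K \<phi> = b \<cdot> y"
      using x y phi by (auto simp: hom_def cells_def)
    show "\<exists>\<rho>\<in>hom K W (src K a). \<exists>\<chi>\<in>cells K x (a \<cdot> \<rho>). \<exists>\<omega>\<in>cells K (f' \<cdot> \<rho>) y.
          (id2 K b \<star> \<omega>) \<bullet> (id2 K f \<star> \<chi>) = \<phi> \<and>
          (\<forall>V\<in>Ob K. \<forall>t\<in>hom K V W. \<forall>\<rho>'\<in>hom K V (src K a). \<forall>\<omega>'\<in>cells K (f' \<cdot> \<rho>') (y \<cdot> t).
             x \<cdot> t = a \<cdot> \<rho>' \<and> id2 K b \<star> \<omega>' = \<phi> \<star> id2 K t \<longrightarrow>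
             (\<exists>\<kappa>\<in>cells K \<rho>' (\<rho> \<cdot> t). id2 K a \<star> \<kappa> = \<chi> \<star> id2 K t \<and>
                (\<omega> \<star> id2 K t) \<bullet> (id2 K f' \<star> \<kappa>) = \<omega>'))"
    proof (intro bexI conjI ballI impI)
      show "a' \<cdot> x \<in> hom K W (src K a)" "id2 K x \<in> cells K x (a \<cdot> a' \<cdot> x)" "id2 K b' \<star> \<phi> \<in> cells K (f' \<cdot> a' \<cdot> x) y"
        by (auto simp: hom_def cells_def fa)
      show "(id2 K b \<star> id2 K b' \<star> \<phi>) \<bullet> (id2 K f \<star> id2 K x) = \<phi>" by simp
      fix V t \<rho>' \<omega>' assume *: "V \<in> Ob K" "t \<in> hom K V W" "\<rho>' \<in> hom K V (src K a)" "\<omega>' \<in> cells K (f' \<cdot> \<rho>') (y \<cdot> t)"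
        "x \<cdot> t = a \<cdot> \<rho>' \<and> id2 K b \<star> \<omega>' = \<phi> \<star> id2 K t"
      have [simp]: "t \<in> Mor K" "src K t = V" "tgt K t = W" "\<rho>' \<in> Mor K" "src K \<rho>' = V" "tgt K \<rho>' = src K f'"
        "\<omega>' \<in> Cell K" "dom2 K \<omega>' = f' \<cdot> \<rho>'" "cod2 K \<omega>' = y \<cdot> t" using * by (auto simp: hom_def cells_def)
      have xt: "x \<cdot> t = a \<cdot> \<rho>'" and w: "id2 K b \<star> \<omega>' = \<phi> \<star> id2 K t" using * by auto
      show "id2 K \<rho>' \<in> cells K \<rho>' ((a' \<cdot> x) \<cdot> t)" using xt by (auto simp: cells_def)
      show "id2 K a \<star> id2 K \<rho>' = id2 K x \<star> id2 K t" using xt by simp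
      have "(id2 K b' \<star> \<phi>) \<star> id2 K t = id2 K b' \<star> id2 K b \<star> \<omega>'" using w by simp
      also have "\<dots> = id2 K (b' \<cdot> b) \<star> \<omega>'" by (rule whisker_whisker) auto
      also have "\<dots> = \<omega>'" by simp
      finally show "((id2 K b' \<star> \<phi>) \<star> id2 K t) \<bullet> (id2 K f' \<star> id2 K \<rho>') = \<omega>'" by simp
    qed
  qed (use sq in auto)
qed

lemma whisker_iso_bij:
  assumes iso: "invertible1 K b" and h: "h \<in> Mor K" "src K h = tgt K b" and m: "m \<in> Mor K" "src K m = tgt K b"
  shows "bij_betw (\<lambda>\<beta>. \<beta> \<star> id2 K b) (cells K h m) (cells K (h \<cdot> b) (m \<cdot> b))"
proof -
  obtain b' where b [simp]: "b \<in> Mor K" "b' \<in> Mor K" "src K b' = tgt K b" "tgt K b' = src K b"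
    and b1 [simp]: "b' \<cdot> b = one K (src K b)" "b \<cdot> b' = one K (tgt K b)"
    by (rule invertible1E[OF iso])
  show ?thesis
    by (rule bij_betw_byWitness[where f' = "\<lambda>\<beta>. \<beta> \<star> id2 K b'"]; intro ballI image_subsetI)
      (use h m in \<open>auto simp: cells_def\<close>)
qed

text \<open>The required map is a composite of three bijections: whiskering with the inverse of
  \<open>b\<close>, pasting with \<psi>, and whiskering with \<open>a\<close>.\<close>

lemma left_kan_iso:
  assumes f': "f' \<in> Mor K" and iso: "invertible1 K a" "invertible1 K b"
    and t: "src K a = src K f'" "tgt K a = src K f" "src K b = tgt K f'" "tgt K b = tgt K f"
    and sq: "f \<cdot> a = b \<cdot> f'" and lk: "left_kan K f u h \<psi>"
  shows "left_kan K f' (u \<cdot> a) (h \<cdot> b) (\<psi> \<star> id2 K a)"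
proof -
  from lk obtain X Y A where t0: "f \<in> hom K X Y" "u \<in> hom K X A" "h \<in> hom K Y A" "\<psi> \<in> cells K u (h \<cdot> f)"
    and bij: "\<And>k. k \<in> hom K Y A \<Longrightarrow> bij_betw (\<lambda>\<beta>. (\<beta> \<star> id2 K f) \<bullet> \<psi>) (cells K h k) (cells K u (k \<cdot> f))"
    unfolding left_kan_def by blast
  have t1 [simp]: "f \<in> Mor K" "src K f = X" "tgt K f = Y" "u \<in> Mor K" "src K u = X" "tgt K u = A"
    "h \<in> Mor K" "src K h = Y" "tgt K h = A" "\<psi> \<in> Cell K" "dom2 K \<psi> = u" "cod2 K \<psi> = h \<cdot> f"
    using t0 by (auto simp: hom_def cells_def)
  obtain b' where b [simp]: "b \<in> Mor K" "b' \<in> Mor K" "src K b' = tgt K b" "tgt K b' = src K b"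
    and b1 [simp]: "b' \<cdot> b = one K (src K b)" "b \<cdot> b' = one K (tgt K b)"
    and bb [simp]: "\<And>w. w \<in> Mor K \<Longrightarrow> tgt K w = src K b \<Longrightarrow> b' \<cdot> b \<cdot> w = w" "\<And>w. w \<in> Mor K \<Longrightarrow> tgt K w = tgt K b \<Longrightarrow> b \<cdot> b' \<cdot> w = w"
    by (rule invertible1E[OF iso(2)], rule that, assumption+)
  have a [simp]: "a \<in> Mor K" using iso by (auto simp: invertible1_def)
  note [simp] = f' t
  show ?thesis unfolding left_kan_def
  proof (intro exI conjI ballI)
    show "f' \<in> hom K (src K f') (tgt K f')" "u \<cdot> a \<in> hom K (src K f') A" "h \<cdot> b \<in> hom K (tgt K f') A"
      "\<psi> \<star> id2 K a \<in> cells K (u \<cdot> a) ((h \<cdot> b) \<cdot> f')"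
      using sq by (auto simp: hom_def cells_def)
    fix k assume k: "k \<in> hom K (tgt K f') A"
    then have [simp]: "k \<in> Mor K" "src K k = tgt K f'" "tgt K k = A" by (auto simp: hom_def)
    have kk: "k \<cdot> b' \<in> hom K Y A" by (auto simp: hom_def)
    have e: "b' \<cdot> f \<cdot> a = f'" using sq by simp
    let ?c = "(\<lambda>\<beta>. \<beta> \<star> id2 K a) \<circ> ((\<lambda>\<beta>. (\<beta> \<star> id2 K f) \<bullet> \<psi>) \<circ> (\<lambda>\<beta>. \<beta> \<star> id2 K b'))"
    have "invertible1 K b'" unfolding invertible1_def by (intro conjI bexI[of _ b]) (simp_all add: hom_def)
    then have "bij_betw (\<lambda>\<beta>. \<beta> \<star> id2 K b') (cells K (h \<cdot> b) k) (cells K ((h \<cdot> b) \<cdot> b') (k \<cdot> b'))"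
      by (rule whisker_iso_bij) auto
    then have 1: "bij_betw (\<lambda>\<beta>. \<beta> \<star> id2 K b') (cells K (h \<cdot> b) k) (cells K h (k \<cdot> b'))" by simp
    have 3: "bij_betw (\<lambda>\<beta>. \<beta> \<star> id2 K a) (cells K u ((k \<cdot> b') \<cdot> f)) (cells K (u \<cdot> a) (((k \<cdot> b') \<cdot> f) \<cdot> a))"
      by (rule whisker_iso_bij[OF iso(1)]) auto
    have "bij_betw ?c (cells K (h \<cdot> b) k) (cells K (u \<cdot> a) (((k \<cdot> b') \<cdot> f) \<cdot> a))"
      by (rule bij_betw_trans[OF bij_betw_trans[OF 1 bij[OF kk]] 3])
    moreover have "bij_betw ?c (cells K (h \<cdot> b) k) B \<longleftrightarrow> bij_betw (\<lambda>\<beta>. (\<beta> \<star> id2 K f') \<bullet> (\<psi> \<star> id2 K a)) (cells K (h \<cdot> b) k) B" for B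
    proof (rule bij_betw_cong)
      fix \<beta> assume "\<beta> \<in> cells K (h \<cdot> b) k"
      then have [simp]: "\<beta> \<in> Cell K" "dom2 K \<beta> = h \<cdot> b" "cod2 K \<beta> = k" by (auto simp: cells_def)
      show "?c \<beta> = (\<beta> \<star> id2 K f') \<bullet> (\<psi> \<star> id2 K a)" by (simp add: e)
    qed
    moreover have "((k \<cdot> b') \<cdot> f) \<cdot> a = k \<cdot> f'" by (simp add: e)
    ultimately show "bij_betw (\<lambda>\<beta>. (\<beta> \<star> id2 K f') \<bullet> (\<psi> \<star> id2 K a)) (cells K (h \<cdot> b) k) (cells K (u \<cdot> a) (k \<cdot> f'))"
      by metis
  qed
qed

end

section \<open>2-functors, 2-natural transformations and transposition across a 2-adjunction\<close>

lemma two_functor_facts: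
  assumes "two_functor K L F"
  shows "X \<in> Ob K \<Longrightarrow> onob F X \<in> Ob L"
    and "f \<in> Mor K \<Longrightarrow> onmor F f \<in> Mor L"
    and "f \<in> Mor K \<Longrightarrow> src L (onmor F f) = onob F (src K f)"
    and "f \<in> Mor K \<Longrightarrow> tgt L (onmor F f) = onob F (tgt K f)"
    and "\<alpha> \<in> Cell K \<Longrightarrow> oncell F \<alpha> \<in> Cell L"
    and "\<alpha> \<in> Cell K \<Longrightarrow> dom2 L (oncell F \<alpha>) = onmor F (dom2 K \<alpha>)"
    and "\<alpha> \<in> Cell K \<Longrightarrow> cod2 L (oncell F \<alpha>) = onmor F (cod2 K \<alpha>)"
    and "X \<in> Ob K \<Longrightarrow> onmor F (one K X) = one L (onob F X)"
    and "f \<in> Mor K \<Longrightarrow> g \<in> Mor K \<Longrightarrow> tgt K f = src K g \<Longrightarrow> onmor F (g \<cdot>\<^bsub>K\<^esub> f) = onmor F g \<cdot>\<^bsub>L\<^esub> onmor F f"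
    and "f \<in> Mor K \<Longrightarrow> oncell F (id2 K f) = id2 L (onmor F f)"
    and "\<alpha> \<in> Cell K \<Longrightarrow> \<beta> \<in> Cell K \<Longrightarrow> cod2 K \<alpha> = dom2 K \<beta> \<Longrightarrow> oncell F (\<beta> \<bullet>\<^bsub>K\<^esub> \<alpha>) = oncell F \<beta> \<bullet>\<^bsub>L\<^esub> oncell F \<alpha>"
    and "\<alpha> \<in> Cell K \<Longrightarrow> \<beta> \<in> Cell K \<Longrightarrow> tgt K (dom2 K \<alpha>) = src K (dom2 K \<beta>) \<Longrightarrow>
      oncell F (\<beta> \<star>\<^bsub>K\<^esub> \<alpha>) = oncell F \<beta> \<star>\<^bsub>L\<^esub> oncell F \<alpha>"
  using assms unfolding two_functor_def by (simp_all add: hom_def cells_def)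

lemma two_natural_facts:
  assumes "two_natural K L F G \<tau>"
  shows "X \<in> Ob K \<Longrightarrow> \<tau> X \<in> Mor L"
    and "X \<in> Ob K \<Longrightarrow> src L (\<tau> X) = onob F X"
    and "X \<in> Ob K \<Longrightarrow> tgt L (\<tau> X) = onob G X"
    and "f \<in> Mor K \<Longrightarrow> src K f = X \<Longrightarrow> tgt K f = Y \<Longrightarrow> \<tau> Y \<cdot>\<^bsub>L\<^esub> onmor F f = onmor G f \<cdot>\<^bsub>L\<^esub> \<tau> X"
    and "\<alpha> \<in> Cell K \<Longrightarrow> src K (dom2 K \<alpha>) = X \<Longrightarrow> tgt K (dom2 K \<alpha>) = Y \<Longrightarrow>
      id2 L (\<tau> Y) \<star>\<^bsub>L\<^esub> oncell F \<alpha> = oncell G \<alpha> \<star>\<^bsub>L\<^esub> id2 L (\<tau> X)"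
  using assms unfolding two_natural_def by (auto simp: hom_def)

lemma comp_fun_simps [simp]:
  "onob (G \<odot> F) X = onob G (onob F X)" "onmor (G \<odot> F) f = onmor G (onmor F f)" "oncell (G \<odot> F) \<alpha> = oncell G (oncell F \<alpha>)"
  by (auto simp: comp_fun_def)

lemma id_fun_simps [simp]: "onob id_fun X = X" "onmor id_fun f = f" "oncell id_fun \<alpha> = \<alpha>"
  by (auto simp: id_fun_def)

text \<open>\<open>r\<close> is the conjugate of \<open>s\<close> by the bijections \<open>f\<close>
  and \<open>g\<close>. In the application \<open>f\<close> and \<open>g\<close> are transpositions
  of 2-cells and \<open>r\<close>, \<open>s\<close> are pastings with a candidate Kan
  extension.\<close>

lemma bij_betw_conj_iff:
  assumes "bij_betw f A B" "bij_betw g C D" "\<And>x. x \<in> A \<Longrightarrow> r (f x) = g (s x)" "s ` A \<subseteq> C"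
  shows "bij_betw s A C \<longleftrightarrow> bij_betw r B D"
proof
  assume "bij_betw s A C"
  then have "bij_betw (g \<circ> s) A D" using assms(2) by (rule bij_betw_trans)
  then have "bij_betw (r \<circ> f) A D" using bij_betw_cong[of A "g \<circ> s" "r \<circ> f" D] assms(3) by auto
  then show "bij_betw r B D" by (rule bij_betw_comp_iff[OF assms(1), THEN iffD2])
next
  assume "bij_betw r B D"
  then have "bij_betw (r \<circ> f) A D" using assms(1) bij_betw_trans by blast
  then have "bij_betw (g \<circ> s) A D" using bij_betw_cong[of A "r \<circ> f" "g \<circ> s" D] assms(3) by auto
  then show "bij_betw s A C" using bij_betw_comp_iff2[OF assms(2,4)] by blast
qed

locale twoadj = L: twocat L + K: twocat K
  for L :: "('o, 'f, 't) two_cat" and K :: "('p, 'g, 'u) two_cat" +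
  fixes F :: "('o, 'f, 't, 'p, 'g, 'u, 'z) two_adj_scheme"
  assumes adj: "two_adjunction L K F"
begin

abbreviation "FO \<equiv> onob (ladj F)"
abbreviation "F1 \<equiv> onmor (ladj F)"
abbreviation "F2 \<equiv> oncell (ladj F)"
abbreviation "GO \<equiv> onob (radj F)"
abbreviation "G1 \<equiv> onmor (radj F)"
abbreviation "G2 \<equiv> oncell (radj F)"
abbreviation "un \<equiv> adj_unit F"
abbreviation "co \<equiv> adj_counit F"

lemma lfun: "two_functor L K (ladj F)" and rfun: "two_functor K L (radj F)"
  and unat: "two_natural L L id_fun (radj F \<odot> ladj F) un"
  and conat: "two_natural K K (ladj F \<odot> radj F) id_fun co"
  using adj unfolding two_adjunction_def by auto

lemmas lfun_facts [simp] = two_functor_facts[OF lfun]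
lemmas rfun_facts [simp] = two_functor_facts[OF rfun]
lemmas un_facts [simp] = two_natural_facts(1-3)[OF unat, simplified]
lemmas co_facts [simp] = two_natural_facts(1-3)[OF conat, simplified]
lemmas un_nat = two_natural_facts(4,5)[OF unat, simplified]
lemmas co_nat = two_natural_facts(4,5)[OF conat, simplified]

lemma triangle:
  "X \<in> Ob L \<Longrightarrow> co (FO X) \<cdot>\<^bsub>K\<^esub> F1 (un X) = one K (FO X)"
  "Y \<in> Ob K \<Longrightarrow> G1 (co Y) \<cdot>\<^bsub>L\<^esub> un (GO Y) = one L (GO Y)"
  using adj unfolding two_adjunction_def by auto

lemma transpose_untranspose:
  assumes "u \<in> Mor L" "src L u = X" "tgt L u = GO A" "A \<in> Ob K"
  shows "G1 (co A \<cdot>\<^bsub>K\<^esub> F1 u) \<cdot>\<^bsub>L\<^esub> un X = u"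
proof -
  have X: "X \<in> Ob L" "GO A \<in> Ob L" using assms by auto
  have "G1 (co A \<cdot>\<^bsub>K\<^esub> F1 u) \<cdot>\<^bsub>L\<^esub> un X = G1 (co A) \<cdot>\<^bsub>L\<^esub> G1 (F1 u) \<cdot>\<^bsub>L\<^esub> un X"
    using assms X by simp
  also have "\<dots> = G1 (co A) \<cdot>\<^bsub>L\<^esub> un (GO A) \<cdot>\<^bsub>L\<^esub> u"
    using assms X un_nat(1)[of u X "GO A"] by simp
  also have "\<dots> = u" using assms X triangle(2)[of A] L.cmp_assoc'[of u "un (GO A)" "G1 (co A)"] by simp
  finally show ?thesis .
qed

lemma untranspose_transpose:
  assumes "v \<in> Mor K" "src K v = FO X" "tgt K v = A" "X \<in> Ob L"
  shows "co A \<cdot>\<^bsub>K\<^esub> F1 (G1 v \<cdot>\<^bsub>L\<^esub> un X) = v"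
proof -
  have X: "A \<in> Ob K" using assms by auto
  have "co A \<cdot>\<^bsub>K\<^esub> F1 (G1 v \<cdot>\<^bsub>L\<^esub> un X) = (co A \<cdot>\<^bsub>K\<^esub> F1 (G1 v)) \<cdot>\<^bsub>K\<^esub> F1 (un X)"
    using assms X by simp
  also have "\<dots> = v \<cdot>\<^bsub>K\<^esub> co (FO X) \<cdot>\<^bsub>K\<^esub> F1 (un X)"
    using assms X co_nat(1)[of v "FO X" A] by simp
  also have "\<dots> = v" using assms X triangle(1)[of X] by simp
  finally show ?thesis .
qed

text \<open>The 2-dimensional half of the adjunction: the inverse applies the right adjoint to a
  2-cell and whiskers with the unit, and the two triangle identities give the round trips.\<close>

lemma transpose_cells_bij:
  assumes u: "u \<in> hom L X (GO A)" and v: "v \<in> hom L X (GO A)" and A [simp]: "A \<in> Ob K"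
  shows "bij_betw (\<lambda>\<alpha>. id2 K (co A) \<star>\<^bsub>K\<^esub> F2 \<alpha>) (cells L u v) (cells K (co A \<cdot>\<^bsub>K\<^esub> F1 u) (co A \<cdot>\<^bsub>K\<^esub> F1 v))"
proof -
  have t [simp]: "u \<in> Mor L" "src L u = X" "tgt L u = GO A" "v \<in> Mor L" "src L v = X" "tgt L v = GO A" using u v by (auto simp: hom_def)
  have [simp]: "X \<in> Ob L" using L.Mor_facts[of u] by simp
  show ?thesis
  proof (rule bij_betw_byWitness[where f' = "\<lambda>\<gamma>. G2 \<gamma> \<star>\<^bsub>L\<^esub> id2 L (un X)"]; intro ballI image_subsetI)
    fix \<alpha> assume "\<alpha> \<in> cells L u v"
    then have a [simp]: "\<alpha> \<in> Cell L" "dom2 L \<alpha> = u" "cod2 L \<alpha> = v" by (auto simp: cells_def)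
    show "id2 K (co A) \<star>\<^bsub>K\<^esub> F2 \<alpha> \<in> cells K (co A \<cdot>\<^bsub>K\<^esub> F1 u) (co A \<cdot>\<^bsub>K\<^esub> F1 v)" by (auto simp: cells_def)
    have "G2 (id2 K (co A) \<star>\<^bsub>K\<^esub> F2 \<alpha>) \<star>\<^bsub>L\<^esub> id2 L (un X) = id2 L (G1 (co A)) \<star>\<^bsub>L\<^esub> G2 (F2 \<alpha>) \<star>\<^bsub>L\<^esub> id2 L (un X)" by simp
    also have "\<dots> = id2 L (G1 (co A)) \<star>\<^bsub>L\<^esub> id2 L (un (GO A)) \<star>\<^bsub>L\<^esub> \<alpha>" using un_nat(2)[of \<alpha> X "GO A"] by simp
    also have "\<dots> = \<alpha>" using triangle(2)[of A] by (simp del: L.hcmp_id2' )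
    finally show "G2 (id2 K (co A) \<star>\<^bsub>K\<^esub> F2 \<alpha>) \<star>\<^bsub>L\<^esub> id2 L (un X) = \<alpha>" .
  next
    fix \<gamma> assume "\<gamma> \<in> cells K (co A \<cdot>\<^bsub>K\<^esub> F1 u) (co A \<cdot>\<^bsub>K\<^esub> F1 v)"
    then have a [simp]: "\<gamma> \<in> Cell K" "dom2 K \<gamma> = co A \<cdot>\<^bsub>K\<^esub> F1 u" "cod2 K \<gamma> = co A \<cdot>\<^bsub>K\<^esub> F1 v" by (auto simp: cells_def)
    have "dom2 L (G2 \<gamma> \<star>\<^bsub>L\<^esub> id2 L (un X)) = u" "cod2 L (G2 \<gamma> \<star>\<^bsub>L\<^esub> id2 L (un X)) = v"
      using transpose_untranspose[of u X A] transpose_untranspose[of v X A] by (simp_all del: lfun_facts(9) rfun_facts(9))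
    then show "G2 \<gamma> \<star>\<^bsub>L\<^esub> id2 L (un X) \<in> cells L u v" by (simp add: cells_def)
    have "id2 K (co A) \<star>\<^bsub>K\<^esub> F2 (G2 \<gamma> \<star>\<^bsub>L\<^esub> id2 L (un X)) = (id2 K (co A) \<star>\<^bsub>K\<^esub> F2 (G2 \<gamma>)) \<star>\<^bsub>K\<^esub> id2 K (F1 (un X))" by simp
    also have "\<dots> = (\<gamma> \<star>\<^bsub>K\<^esub> id2 K (co (FO X))) \<star>\<^bsub>K\<^esub> id2 K (F1 (un X))" using co_nat(2)[of \<gamma> "FO X" A] by simp
    also have "\<dots> = \<gamma> \<star>\<^bsub>K\<^esub> id2 K (co (FO X) \<cdot>\<^bsub>K\<^esub> F1 (un X))" by simp
    also have "\<dots> = \<gamma>" using triangle(1)[of X] by simp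
    finally show "id2 K (co A) \<star>\<^bsub>K\<^esub> F2 (G2 \<gamma> \<star>\<^bsub>L\<^esub> id2 L (un X)) = \<gamma>" .
  qed
qed

text \<open>Transposition commutes with pasting, so for each \<open>k\<close> the two Kan conditions
  are conjugate. Every 1-cell \<open>F Y -> A\<close> is the transpose of some \<open>k\<close>, so
  testing all \<open>k\<close> on one side tests all of them on the other.\<close>

theorem left_kan_transpose:
  assumes g: "g \<in> hom L X Y" and u: "u \<in> hom L X (GO A)" and h: "h \<in> hom L Y (GO A)"
    and psi: "\<psi> \<in> cells L u (h \<cdot>\<^bsub>L\<^esub> g)" and A [simp]: "A \<in> Ob K"
  shows "left_kan L g u h \<psi> \<longleftrightarrow>
    left_kan K (F1 g) (co A \<cdot>\<^bsub>K\<^esub> F1 u) (co A \<cdot>\<^bsub>K\<^esub> F1 h) (id2 K (co A) \<star>\<^bsub>K\<^esub> F2 \<psi>)"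
proof -
  have t [simp]: "g \<in> Mor L" "src L g = X" "tgt L g = Y" "u \<in> Mor L" "src L u = X" "tgt L u = GO A"
    "h \<in> Mor L" "src L h = Y" "tgt L h = GO A" "\<psi> \<in> Cell L" "dom2 L \<psi> = u" "cod2 L \<psi> = h \<cdot>\<^bsub>L\<^esub> g"
    using g u h psi by (auto simp: hom_def cells_def)
  have [simp]: "X \<in> Ob L" "Y \<in> Ob L" using L.Mor_facts[of g] by auto
  let ?P = "\<lambda>\<beta>. (\<beta> \<star>\<^bsub>L\<^esub> id2 L g) \<bullet>\<^bsub>L\<^esub> \<psi>"
  let ?Q = "\<lambda>\<beta>. (\<beta> \<star>\<^bsub>K\<^esub> id2 K (F1 g)) \<bullet>\<^bsub>K\<^esub> (id2 K (co A) \<star>\<^bsub>K\<^esub> F2 \<psi>)"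
  have iff: "bij_betw ?P (cells L h k) (cells L u (k \<cdot>\<^bsub>L\<^esub> g)) \<longleftrightarrow>
    bij_betw ?Q (cells K (co A \<cdot>\<^bsub>K\<^esub> F1 h) (co A \<cdot>\<^bsub>K\<^esub> F1 k)) (cells K (co A \<cdot>\<^bsub>K\<^esub> F1 u) ((co A \<cdot>\<^bsub>K\<^esub> F1 k) \<cdot>\<^bsub>K\<^esub> F1 g))"
    if k: "k \<in> hom L Y (GO A)" for k
  proof (rule bij_betw_conj_iff)
    have [simp]: "k \<in> Mor L" "src L k = Y" "tgt L k = GO A" using k by (auto simp: hom_def)
    show "bij_betw (\<lambda>\<alpha>. id2 K (co A) \<star>\<^bsub>K\<^esub> F2 \<alpha>) (cells L h k) (cells K (co A \<cdot>\<^bsub>K\<^esub> F1 h) (co A \<cdot>\<^bsub>K\<^esub> F1 k))"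
      by (rule transpose_cells_bij[OF h k A])
    show "bij_betw (\<lambda>\<alpha>. id2 K (co A) \<star>\<^bsub>K\<^esub> F2 \<alpha>) (cells L u (k \<cdot>\<^bsub>L\<^esub> g)) (cells K (co A \<cdot>\<^bsub>K\<^esub> F1 u) ((co A \<cdot>\<^bsub>K\<^esub> F1 k) \<cdot>\<^bsub>K\<^esub> F1 g))"
      using transpose_cells_bij[OF u _ A, of "k \<cdot>\<^bsub>L\<^esub> g"] by (simp add: hom_def)
    show "?P ` cells L h k \<subseteq> cells L u (k \<cdot>\<^bsub>L\<^esub> g)"
      by (rule image_subsetI) (simp add: cells_def)
    fix \<beta> assume "\<beta> \<in> cells L h k"
    then have [simp]: "\<beta> \<in> Cell L" "dom2 L \<beta> = h" "cod2 L \<beta> = k" by (auto simp: cells_def)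
    show "?Q (id2 K (co A) \<star>\<^bsub>K\<^esub> F2 \<beta>) = id2 K (co A) \<star>\<^bsub>K\<^esub> F2 (?P \<beta>)" by simp
  qed
  have P: "left_kan L g u h \<psi> \<longleftrightarrow> (\<forall>k\<in>hom L Y (GO A). bij_betw ?P (cells L h k) (cells L u (k \<cdot>\<^bsub>L\<^esub> g)))"
    unfolding left_kan_def using g u h psi by (auto simp: hom_def)
  have Q: "left_kan K (F1 g) (co A \<cdot>\<^bsub>K\<^esub> F1 u) (co A \<cdot>\<^bsub>K\<^esub> F1 h) (id2 K (co A) \<star>\<^bsub>K\<^esub> F2 \<psi>) \<longleftrightarrow>
    (\<forall>k\<in>hom K (FO Y) A. bij_betw ?Q (cells K (co A \<cdot>\<^bsub>K\<^esub> F1 h) k) (cells K (co A \<cdot>\<^bsub>K\<^esub> F1 u) (k \<cdot>\<^bsub>K\<^esub> F1 g)))"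
    unfolding left_kan_def by (auto simp: hom_def cells_def)
  show ?thesis unfolding P Q
  proof (intro iffI ballI)
    fix k assume a: "\<forall>k\<in>hom L Y (GO A). bij_betw ?P (cells L h k) (cells L u (k \<cdot>\<^bsub>L\<^esub> g))" and k: "k \<in> hom K (FO Y) A"
    let ?k = "G1 k \<cdot>\<^bsub>L\<^esub> un Y"
    have "?k \<in> hom L Y (GO A)" using k by (auto simp: hom_def)
    moreover have "co A \<cdot>\<^bsub>K\<^esub> F1 ?k = k" using k by (intro untranspose_transpose) (auto simp: hom_def)
    ultimately show "bij_betw ?Q (cells K (co A \<cdot>\<^bsub>K\<^esub> F1 h) k) (cells K (co A \<cdot>\<^bsub>K\<^esub> F1 u) (k \<cdot>\<^bsub>K\<^esub> F1 g))"
      using iff[of ?k] a by metis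
  next
    fix k assume a: "\<forall>k\<in>hom K (FO Y) A. bij_betw ?Q (cells K (co A \<cdot>\<^bsub>K\<^esub> F1 h) k) (cells K (co A \<cdot>\<^bsub>K\<^esub> F1 u) (k \<cdot>\<^bsub>K\<^esub> F1 g))"
      and k: "k \<in> hom L Y (GO A)"
    have "co A \<cdot>\<^bsub>K\<^esub> F1 k \<in> hom K (FO Y) A" using k by (auto simp: hom_def)
    then show "bij_betw ?P (cells L h k) (cells L u (k \<cdot>\<^bsub>L\<^esub> g))" using iff[OF k] a by blast
  qed
qed

end

text \<open>A choice of inverse as a function of the 1-cell, so that the inverses of the components
  of a transformation form a family again.\<close>

definition inv1 :: "('o, 'f, 't) two_cat \<Rightarrow> 'f \<Rightarrow> 'f" where
  "inv1 K f = (SOME f'. f' \<in> hom K (tgt K f) (src K f) \<and>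
     f' \<cdot>\<^bsub>K\<^esub> f = one K (src K f) \<and> f \<cdot>\<^bsub>K\<^esub> f' = one K (tgt K f))"

context twocat begin

lemma inv1_facts [simp]:
  assumes "invertible1 K f"
  shows "f \<in> Mor K" "inv1 K f \<in> Mor K" "src K (inv1 K f) = tgt K f" "tgt K (inv1 K f) = src K f"
    "inv1 K f \<cdot> f = one K (src K f)" "f \<cdot> inv1 K f = one K (tgt K f)"
    "w \<in> Mor K \<Longrightarrow> tgt K w = src K f \<Longrightarrow> inv1 K f \<cdot> f \<cdot> w = w"
    "w \<in> Mor K \<Longrightarrow> tgt K w = tgt K f \<Longrightarrow> f \<cdot> inv1 K f \<cdot> w = w"
proof -
  have "\<exists>f'. f' \<in> hom K (tgt K f) (src K f) \<and> f' \<cdot> f = one K (src K f) \<and> f \<cdot> f' = one K (tgt K f)"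
    using assms unfolding invertible1_def by blast
  from someI_ex[OF this, folded inv1_def]
  have *: "inv1 K f \<in> Mor K" "src K (inv1 K f) = tgt K f" "tgt K (inv1 K f) = src K f"
    "inv1 K f \<cdot> f = one K (src K f)" "f \<cdot> inv1 K f = one K (tgt K f)" by (auto simp: hom_def)
  show f: "f \<in> Mor K" using assms by (simp add: invertible1_def)
  show "inv1 K f \<in> Mor K" "src K (inv1 K f) = tgt K f" "tgt K (inv1 K f) = src K f"
    "inv1 K f \<cdot> f = one K (src K f)" "f \<cdot> inv1 K f = one K (tgt K f)" by fact+
  show "w \<in> Mor K \<Longrightarrow> tgt K w = src K f \<Longrightarrow> inv1 K f \<cdot> f \<cdot> w = w" using * f cmp_assoc'[of w f "inv1 K f"] by simp
  show "w \<in> Mor K \<Longrightarrow> tgt K w = tgt K f \<Longrightarrow> f \<cdot> inv1 K f \<cdot> w = w" using * f cmp_assoc'[of w "inv1 K f" f] by simp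
qed

lemma invertible1_inv1: "invertible1 K f \<Longrightarrow> invertible1 K (inv1 K f)"
  unfolding invertible1_def[of K "inv1 K f"] by (intro conjI bexI[of _ f]) (simp_all add: hom_def)

end

text \<open>Each naturality equation for the inverse is the one for \<tau>, composed with inverse
  components at both ends.\<close>

lemma two_natural_inv1:
  assumes L: "twocat L" and K: "twocat K" and F: "two_functor L K F" and G: "two_functor L K G"
    and nat: "two_natural L K F G \<tau>" and iso: "\<And>X. X \<in> Ob L \<Longrightarrow> invertible1 K (\<tau> X)"
  shows "two_natural L K G F (\<lambda>X. inv1 K (\<tau> X))"
proof -
  interpret L: twocat L by fact
  interpret K: twocat K by fact
  note [simp] = two_functor_facts[OF F] two_functor_facts[OF G] two_natural_facts(1-3)[OF nat] iso
  show ?thesis unfolding two_natural_def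
  proof (intro conjI ballI)
    fix X assume "X \<in> Ob L" then show "inv1 K (\<tau> X) \<in> hom K (onob G X) (onob F X)" by (simp add: hom_def)
  next
    fix f assume f [simp]: "f \<in> Mor L"
    let ?X = "src L f" and ?Y = "tgt L f"
    have n: "\<tau> ?Y \<cdot>\<^bsub>K\<^esub> onmor F f = onmor G f \<cdot>\<^bsub>K\<^esub> \<tau> ?X" by (rule two_natural_facts(4)[OF nat f]) auto
    have "inv1 K (\<tau> ?Y) \<cdot>\<^bsub>K\<^esub> onmor G f = inv1 K (\<tau> ?Y) \<cdot>\<^bsub>K\<^esub> (onmor G f \<cdot>\<^bsub>K\<^esub> \<tau> ?X) \<cdot>\<^bsub>K\<^esub> inv1 K (\<tau> ?X)" by simp
    also have "\<dots> = onmor F f \<cdot>\<^bsub>K\<^esub> inv1 K (\<tau> ?X)" unfolding n[symmetric] by simp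
    finally show "inv1 K (\<tau> ?Y) \<cdot>\<^bsub>K\<^esub> onmor G f = onmor F f \<cdot>\<^bsub>K\<^esub> inv1 K (\<tau> ?X)" .
  next
    fix \<alpha> assume a [simp]: "\<alpha> \<in> Cell L"
    let ?X = "src L (dom2 L \<alpha>)" and ?Y = "tgt L (dom2 L \<alpha>)"
    have n: "id2 K (\<tau> ?Y) \<star>\<^bsub>K\<^esub> oncell F \<alpha> = oncell G \<alpha> \<star>\<^bsub>K\<^esub> id2 K (\<tau> ?X)" by (rule two_natural_facts(5)[OF nat a]) auto
    have "id2 K (inv1 K (\<tau> ?Y)) \<star>\<^bsub>K\<^esub> oncell G \<alpha> =
       id2 K (inv1 K (\<tau> ?Y)) \<star>\<^bsub>K\<^esub> (oncell G \<alpha> \<star>\<^bsub>K\<^esub> id2 K (\<tau> ?X)) \<star>\<^bsub>K\<^esub> id2 K (inv1 K (\<tau> ?X))" by simp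
    also have "\<dots> = oncell F \<alpha> \<star>\<^bsub>K\<^esub> id2 K (inv1 K (\<tau> ?X))" unfolding n[symmetric] by simp
    finally show "id2 K (inv1 K (\<tau> ?Y)) \<star>\<^bsub>K\<^esub> oncell G \<alpha> = oncell F \<alpha> \<star>\<^bsub>K\<^esub> id2 K (inv1 K (\<tau> ?X))" .
  qed
qed

context twocat begin

lemma pointwise_left_kan_iso:
  assumes hc: "has_commas K" and f': "f' \<in> Mor K" and iso: "invertible1 K a" "invertible1 K b"
    and t: "src K a = src K f'" "tgt K a = src K f" "src K b = tgt K f'" "tgt K b = tgt K f"
    and sq: "f \<cdot> a = b \<cdot> f'" and lk: "pointwise_left_kan K f u h \<psi>"
  shows "pointwise_left_kan K f' (u \<cdot> a) (h \<cdot> b) (\<psi> \<star> id2 K a)"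
proof -
  have f: "f \<in> Mor K" using lk unfolding pointwise_left_kan_def left_kan_def by (auto simp: hom_def)
  show ?thesis
    by (rule pointwise_left_kan_paste[OF hc factoring_square_iso[OF f f' iso t sq] lk])
qed

end

section \<open>Pointwise Kan extensions across an adjunction\<close>

context twoadj begin

text \<open>\<open>com\<close> and \<open>com'\<close> are stated for a 2-functor \<open>H\<close>
  isomorphic to the left adjoint and not for the left adjoint itself: for \<open>H\<close> a
  \<Sigma>, comma squares over \<open>H g\<close> are images of comma squares over \<open>g\<close>
  on the nose. The isomorphism \<phi> moves Kan extensions between the two by
  \<open>left_kan_iso\<close> and \<open>pointwise_left_kan_iso\<close>.\<close>

lemma pointwise_left_kan_transpose:
  assumes hc: "has_commas K" and H: "two_functor L K H" and nat: "two_natural L K (ladj F) H \<phi>"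
    and iso: "\<And>X. X \<in> Ob L \<Longrightarrow> invertible1 K (\<phi> X)"
    and com: "\<And>g k p q l. comma_square L g k p q l \<Longrightarrow>
      comma_square K (onmor H g) (onmor H k) (onmor H p) (onmor H q) (oncell H l)"
    and com': "\<And>g m a b l'. g \<in> Mor L \<Longrightarrow> comma_square K (onmor H g) m a b l' \<Longrightarrow>
      \<exists>k p q l. comma_square L g k p q l \<and> m = onmor H k \<and> a = onmor H p \<and> b = onmor H q \<and> l' = oncell H l"
    and g: "g \<in> hom L X Y" and u: "u \<in> hom L X (GO A)" and h: "h \<in> hom L Y (GO A)"
    and psi: "\<psi> \<in> cells L u (h \<cdot>\<^bsub>L\<^esub> g)" and A [simp]: "A \<in> Ob K"
  shows "pointwise_left_kan L g u h \<psi> \<longleftrightarrow>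
    pointwise_left_kan K (F1 g) (co A \<cdot>\<^bsub>K\<^esub> F1 u) (co A \<cdot>\<^bsub>K\<^esub> F1 h) (id2 K (co A) \<star>\<^bsub>K\<^esub> F2 \<psi>)"
proof -
  note [simp] = two_functor_facts[OF H] two_natural_facts(1-3)[OF nat] iso
  let ?i = "\<lambda>X. inv1 K (\<phi> X)"
  have inat: "two_natural L K H (ladj F) ?i"
    by (rule two_natural_inv1[OF L.twocat_axioms K.twocat_axioms lfun H nat iso])
  note N = two_natural_facts(4,5)[OF nat]
  note I = two_natural_facts(4,5)[OF inat]
  have t [simp]: "g \<in> Mor L" "src L g = X" "tgt L g = Y" "u \<in> Mor L" "src L u = X" "tgt L u = GO A"
    "h \<in> Mor L" "src L h = Y" "tgt L h = GO A" "\<psi> \<in> Cell L" "dom2 L \<psi> = u" "cod2 L \<psi> = h \<cdot>\<^bsub>L\<^esub> g"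
    using g u h psi by (auto simp: hom_def cells_def)
  have X [simp]: "X \<in> Ob L" "Y \<in> Ob L" using L.Mor_facts[of g] by auto
  let ?u = "co A \<cdot>\<^bsub>K\<^esub> F1 u" and ?h = "co A \<cdot>\<^bsub>K\<^esub> F1 h" and ?\<psi> = "id2 K (co A) \<star>\<^bsub>K\<^esub> F2 \<psi>"
  let ?k = "\<lambda>k p l. (id2 L h \<star>\<^bsub>L\<^esub> l) \<bullet>\<^bsub>L\<^esub> (\<psi> \<star>\<^bsub>L\<^esub> id2 L p)"
  \<comment> \<open>The cell that tests pointwiseness after the transposed extension has been moved
    along the inverse components \<open>?i\<close>.\<close>
  let ?K = "\<lambda>k p l. (id2 K (?h \<cdot>\<^bsub>K\<^esub> ?i Y) \<star>\<^bsub>K\<^esub> oncell H l) \<bullet>\<^bsub>K\<^esub> ((?\<psi> \<star>\<^bsub>K\<^esub> id2 K (?i X)) \<star>\<^bsub>K\<^esub> id2 K (onmor H p))"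
  have tr: "left_kan L q (u \<cdot>\<^bsub>L\<^esub> p) (h \<cdot>\<^bsub>L\<^esub> k) (?k k p l) \<longleftrightarrow>
      left_kan K (onmor H q) ((?u \<cdot>\<^bsub>K\<^esub> ?i X) \<cdot>\<^bsub>K\<^esub> onmor H p) ((?h \<cdot>\<^bsub>K\<^esub> ?i Y) \<cdot>\<^bsub>K\<^esub> onmor H k) (?K k p l)"
    if "comma_square L g k p q l" for k p q l
    using that
  proof (rule L.comma_squareE)
    fix X1 Y1 Z P
    assume t0: "src L g = X1" "tgt L g = Z" "k \<in> Mor L" "src L k = Y1" "tgt L k = Z"
      "p \<in> Mor L" "src L p = P" "tgt L p = X1" "q \<in> Mor L" "src L q = P" "tgt L q = Y1"
      "l \<in> Cell L" "dom2 L l = g \<cdot>\<^bsub>L\<^esub> p" "cod2 L l = k \<cdot>\<^bsub>L\<^esub> q" "P \<in> Ob L" "Y1 \<in> Ob L"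
    then have [simp]: "X1 = X" "Z = Y" by auto
    note t1 [simp] = t0[simplified]
    have 1: "left_kan L q (u \<cdot>\<^bsub>L\<^esub> p) (h \<cdot>\<^bsub>L\<^esub> k) (?k k p l) \<longleftrightarrow>
      left_kan K (F1 q) (co A \<cdot>\<^bsub>K\<^esub> F1 (u \<cdot>\<^bsub>L\<^esub> p)) (co A \<cdot>\<^bsub>K\<^esub> F1 (h \<cdot>\<^bsub>L\<^esub> k)) (id2 K (co A) \<star>\<^bsub>K\<^esub> F2 (?k k p l))"
      by (rule left_kan_transpose[of q P Y1]) (auto simp: hom_def cells_def)
    have Np: "\<phi> X \<cdot>\<^bsub>K\<^esub> F1 p = onmor H p \<cdot>\<^bsub>K\<^esub> \<phi> P" "\<phi> Y \<cdot>\<^bsub>K\<^esub> F1 k = onmor H k \<cdot>\<^bsub>K\<^esub> \<phi> Y1"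
      "\<phi> Y1 \<cdot>\<^bsub>K\<^esub> F1 q = onmor H q \<cdot>\<^bsub>K\<^esub> \<phi> P"
      by (rule N; simp)+
    have Nl: "id2 K (\<phi> Y) \<star>\<^bsub>K\<^esub> F2 l = oncell H l \<star>\<^bsub>K\<^esub> id2 K (\<phi> P)" by (rule N; simp)
    have Ip: "?i X \<cdot>\<^bsub>K\<^esub> onmor H p = F1 p \<cdot>\<^bsub>K\<^esub> ?i P" "?i Y \<cdot>\<^bsub>K\<^esub> onmor H k = F1 k \<cdot>\<^bsub>K\<^esub> ?i Y1"
      "?i Y1 \<cdot>\<^bsub>K\<^esub> onmor H q = F1 q \<cdot>\<^bsub>K\<^esub> ?i P"
      by (rule I; simp)+
    have Il: "id2 K (?i Y) \<star>\<^bsub>K\<^esub> oncell H l = F2 l \<star>\<^bsub>K\<^esub> id2 K (?i P)" by (rule I; simp)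
    have e1: "((?u \<cdot>\<^bsub>K\<^esub> ?i X) \<cdot>\<^bsub>K\<^esub> onmor H p) \<cdot>\<^bsub>K\<^esub> \<phi> P = co A \<cdot>\<^bsub>K\<^esub> F1 (u \<cdot>\<^bsub>L\<^esub> p)"
      "((?h \<cdot>\<^bsub>K\<^esub> ?i Y) \<cdot>\<^bsub>K\<^esub> onmor H k) \<cdot>\<^bsub>K\<^esub> \<phi> Y1 = co A \<cdot>\<^bsub>K\<^esub> F1 (h \<cdot>\<^bsub>L\<^esub> k)"
      using Np by (simp_all add: Np[symmetric])
    have "?K k p l = (id2 K ?h \<star>\<^bsub>K\<^esub> (id2 K (?i Y) \<star>\<^bsub>K\<^esub> oncell H l)) \<bullet>\<^bsub>K\<^esub> (?\<psi> \<star>\<^bsub>K\<^esub> id2 K (?i X \<cdot>\<^bsub>K\<^esub> onmor H p))"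
      by (simp add: Ip)
    then have e0: "?K k p l = (id2 K ?h \<star>\<^bsub>K\<^esub> (F2 l \<star>\<^bsub>K\<^esub> id2 K (?i P))) \<bullet>\<^bsub>K\<^esub> (?\<psi> \<star>\<^bsub>K\<^esub> id2 K (F1 p \<cdot>\<^bsub>K\<^esub> ?i P))"
      unfolding Il Ip(1) .
    have e2: "?K k p l \<star>\<^bsub>K\<^esub> id2 K (\<phi> P) = id2 K (co A) \<star>\<^bsub>K\<^esub> F2 (?k k p l)"
      unfolding e0 by simp
    have e3: "(co A \<cdot>\<^bsub>K\<^esub> F1 (u \<cdot>\<^bsub>L\<^esub> p)) \<cdot>\<^bsub>K\<^esub> ?i P = (?u \<cdot>\<^bsub>K\<^esub> ?i X) \<cdot>\<^bsub>K\<^esub> onmor H p"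
      "(co A \<cdot>\<^bsub>K\<^esub> F1 (h \<cdot>\<^bsub>L\<^esub> k)) \<cdot>\<^bsub>K\<^esub> ?i Y1 = (?h \<cdot>\<^bsub>K\<^esub> ?i Y) \<cdot>\<^bsub>K\<^esub> onmor H k"
      by (simp_all add: Ip)
    have e4: "(id2 K (co A) \<star>\<^bsub>K\<^esub> F2 (?k k p l)) \<star>\<^bsub>K\<^esub> id2 K (?i P) = ?K k p l"
      unfolding e0 by simp
    have 2: "left_kan K (F1 q) (co A \<cdot>\<^bsub>K\<^esub> F1 (u \<cdot>\<^bsub>L\<^esub> p)) (co A \<cdot>\<^bsub>K\<^esub> F1 (h \<cdot>\<^bsub>L\<^esub> k)) (id2 K (co A) \<star>\<^bsub>K\<^esub> F2 (?k k p l)) \<Longrightarrow>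
      left_kan K (onmor H q) ((?u \<cdot>\<^bsub>K\<^esub> ?i X) \<cdot>\<^bsub>K\<^esub> onmor H p) ((?h \<cdot>\<^bsub>K\<^esub> ?i Y) \<cdot>\<^bsub>K\<^esub> onmor H k) (?K k p l)"
      unfolding e3[symmetric] e4[symmetric]
      by (rule K.left_kan_iso) (simp_all add: Ip K.invertible1_inv1)
    have 3: "left_kan K (onmor H q) ((?u \<cdot>\<^bsub>K\<^esub> ?i X) \<cdot>\<^bsub>K\<^esub> onmor H p) ((?h \<cdot>\<^bsub>K\<^esub> ?i Y) \<cdot>\<^bsub>K\<^esub> onmor H k) (?K k p l) \<Longrightarrow>
      left_kan K (F1 q) (co A \<cdot>\<^bsub>K\<^esub> F1 (u \<cdot>\<^bsub>L\<^esub> p)) (co A \<cdot>\<^bsub>K\<^esub> F1 (h \<cdot>\<^bsub>L\<^esub> k)) (id2 K (co A) \<star>\<^bsub>K\<^esub> F2 (?k k p l))"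
      unfolding e1[symmetric] e2[symmetric]
      by (rule K.left_kan_iso) (simp_all add: Np)
    show ?thesis using 1 2 3 by blast
  qed
  have Ng: "\<phi> Y \<cdot>\<^bsub>K\<^esub> F1 g = onmor H g \<cdot>\<^bsub>K\<^esub> \<phi> X" by (rule N; simp)
  have Ig: "?i Y \<cdot>\<^bsub>K\<^esub> onmor H g = F1 g \<cdot>\<^bsub>K\<^esub> ?i X" by (rule I; simp)
  have M: "left_kan L g u h \<psi> \<longleftrightarrow> left_kan K (F1 g) ?u ?h ?\<psi>"
    by (rule left_kan_transpose[OF g u h psi A])
  show ?thesis
  proof
    assume pl: "pointwise_left_kan L g u h \<psi>"
    have "pointwise_left_kan K (onmor H g) (?u \<cdot>\<^bsub>K\<^esub> ?i X) (?h \<cdot>\<^bsub>K\<^esub> ?i Y) (?\<psi> \<star>\<^bsub>K\<^esub> id2 K (?i X))"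
      unfolding pointwise_left_kan_def
    proof (intro conjI allI impI)
      show "left_kan K (onmor H g) (?u \<cdot>\<^bsub>K\<^esub> ?i X) (?h \<cdot>\<^bsub>K\<^esub> ?i Y) (?\<psi> \<star>\<^bsub>K\<^esub> id2 K (?i X))"
        by (rule K.left_kan_iso[of _ _ _ "F1 g"]) (use pl M in \<open>auto simp: Ig K.invertible1_inv1 pointwise_left_kan_def\<close>)
      \<comment> \<open>By \<open>com'\<close> no test squares exist over \<open>H g\<close> beyond
        the images of those over \<open>g\<close>.\<close>
      fix m a b l' assume "comma_square K (onmor H g) m a b l'"
      then obtain k p q l where c: "comma_square L g k p q l" and e: "m = onmor H k" "a = onmor H p" "b = onmor H q" "l' = oncell H l"
        using com' by (meson t(1))
      show "left_kan K b ((?u \<cdot>\<^bsub>K\<^esub> ?i X) \<cdot>\<^bsub>K\<^esub> a) ((?h \<cdot>\<^bsub>K\<^esub> ?i Y) \<cdot>\<^bsub>K\<^esub> m)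
        ((id2 K (?h \<cdot>\<^bsub>K\<^esub> ?i Y) \<star>\<^bsub>K\<^esub> l') \<bullet>\<^bsub>K\<^esub> ((?\<psi> \<star>\<^bsub>K\<^esub> id2 K (?i X)) \<star>\<^bsub>K\<^esub> id2 K a))"
        unfolding e using tr[OF c] pl c unfolding pointwise_left_kan_def by blast
    qed
    from K.pointwise_left_kan_iso[OF hc _ _ _ _ _ _ _ _ this, of "F1 g" "\<phi> X" "\<phi> Y"]
    show "pointwise_left_kan K (F1 g) ?u ?h ?\<psi>" by (simp add: Ng)
  next
    assume pk: "pointwise_left_kan K (F1 g) ?u ?h ?\<psi>"
    have pw: "pointwise_left_kan K (onmor H g) (?u \<cdot>\<^bsub>K\<^esub> ?i X) (?h \<cdot>\<^bsub>K\<^esub> ?i Y) (?\<psi> \<star>\<^bsub>K\<^esub> id2 K (?i X))"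
      by (rule K.pointwise_left_kan_iso[OF hc _ _ _ _ _ _ _ _ pk]) (simp_all add: Ig K.invertible1_inv1)
    show "pointwise_left_kan L g u h \<psi>"
      unfolding pointwise_left_kan_def
    proof (intro conjI allI impI)
      show "left_kan L g u h \<psi>" using M pk unfolding pointwise_left_kan_def by blast
      fix k p q l assume c: "comma_square L g k p q l"
      show "left_kan L q (u \<cdot>\<^bsub>L\<^esub> p) (h \<cdot>\<^bsub>L\<^esub> k) (?k k p l)"
        using tr[OF c] pw com[OF c] unfolding pointwise_left_kan_def by blast
    qed
  qed
qed

end

section \<open>Slices over a discrete object\<close>

lemma slice_simps [simp]:
  "f \<in> Ob (slice K I) \<longleftrightarrow> f \<in> Mor K \<and> tgt K f = I"
  "(f, y) \<in> Mor (slice K I) \<longleftrightarrow> f \<in> Mor K \<and> y \<in> Mor K \<and> tgt K y = I \<and> tgt K f = src K y"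
  "(\<alpha>, y) \<in> Cell (slice K I) \<longleftrightarrow> \<alpha> \<in> Cell K \<and> y \<in> Mor K \<and> tgt K y = I \<and> tgt K (dom2 K \<alpha>) = src K y \<and>
     id2 K y \<star>\<^bsub>K\<^esub> \<alpha> = id2 K (y \<cdot>\<^bsub>K\<^esub> dom2 K \<alpha>)"
  "src (slice K I) (f, y) = y \<cdot>\<^bsub>K\<^esub> f" "tgt (slice K I) (f, y) = y" "one (slice K I) y = (one K (src K y), y)"
  "(g, z) \<cdot>\<^bsub>slice K I\<^esub> (f, y) = (g \<cdot>\<^bsub>K\<^esub> f, z)"
  "dom2 (slice K I) (\<alpha>, y) = (dom2 K \<alpha>, y)" "cod2 (slice K I) (\<alpha>, y) = (cod2 K \<alpha>, y)"
  "id2 (slice K I) (f, y) = (id2 K f, y)"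
  "(\<beta>, z) \<bullet>\<^bsub>slice K I\<^esub> (\<alpha>, y) = (\<beta> \<bullet>\<^bsub>K\<^esub> \<alpha>, z)" "(\<beta>, z) \<star>\<^bsub>slice K I\<^esub> (\<alpha>, y) = (\<beta> \<star>\<^bsub>K\<^esub> \<alpha>, z)"
  by (simp_all add: slice_def)

lemma slice_hom [simp]: "(f, y) \<in> hom (slice K I) x z \<longleftrightarrow>
    f \<in> Mor K \<and> y \<in> Mor K \<and> tgt K y = I \<and> tgt K f = src K y \<and> y \<cdot>\<^bsub>K\<^esub> f = x \<and> y = z"
  by (auto simp: hom_def)

lemma slice_cells [simp]: "(\<alpha>, y) \<in> cells (slice K I) (f, z) (g, w) \<longleftrightarrow>
    (\<alpha>, y) \<in> Cell (slice K I) \<and> dom2 K \<alpha> = f \<and> cod2 K \<alpha> = g \<and> y = z \<and> y = w"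
  by (auto simp: cells_def)

lemma Sigma_fun_simps [simp]:
  "onob (Sigma_fun K f) x = f \<cdot>\<^bsub>K\<^esub> x" "onmor (Sigma_fun K f) (u, y) = (u, f \<cdot>\<^bsub>K\<^esub> y)"
  "oncell (Sigma_fun K f) (\<alpha>, y) = (\<alpha>, f \<cdot>\<^bsub>K\<^esub> y)"
  by (simp_all add: Sigma_fun_def)

text \<open>Over such an object every 2-cell of the underlying 2-category lies in the slice.\<close>

definition discrete_ob :: "('o, 'f, 't) two_cat \<Rightarrow> 'o \<Rightarrow> bool" where
  "discrete_ob K I \<longleftrightarrow> (\<forall>\<alpha>\<in>Cell K. tgt K (dom2 K \<alpha>) = I \<longrightarrow> \<alpha> = id2 K (dom2 K \<alpha>))"

context twocat begin

lemma twocat_slice: "twocat (slice K I)"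
  using two_category_slice[OF two_category_axioms] by (simp add: twocat_def)

text \<open>A whiskered 2-cell that lands in \<open>I\<close> is an identity, hence its domain and
  codomain coincide. So a 1-cell over \<open>I\<close> may be replaced by one connected to it by a
  2-cell without changing the structure map.\<close>

lemma discrete_whisker:
  assumes "discrete_ob K I" "y \<in> Mor K" "tgt K y = I" "\<alpha> \<in> Cell K" "tgt K (dom2 K \<alpha>) = src K y"
  shows "id2 K y \<star> \<alpha> = id2 K (y \<cdot> dom2 K \<alpha>)" "y \<cdot> cod2 K \<alpha> = y \<cdot> dom2 K \<alpha>"
proof -
  show 1: "id2 K y \<star> \<alpha> = id2 K (y \<cdot> dom2 K \<alpha>)"
    using assms(1)[unfolded discrete_ob_def, THEN bspec, of "id2 K y \<star> \<alpha>"] assms by simp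
  have "cod2 K (id2 K y \<star> \<alpha>) = y \<cdot> cod2 K \<alpha>" using assms by simp
  then show "y \<cdot> cod2 K \<alpha> = y \<cdot> dom2 K \<alpha>" unfolding 1 using assms by simp
qed

lemma slice_cells_discrete:
  assumes dI: "discrete_ob K I" and y: "y \<in> Mor K" "tgt K y = I" and f: "f \<in> Mor K" "tgt K f = src K y"
  shows "(\<gamma>, z) \<in> cells (slice K I) (f, y) (g, y) \<longleftrightarrow> z = y \<and> \<gamma> \<in> cells K f g"
proof
  assume "(\<gamma>, z) \<in> cells (slice K I) (f, y) (g, y)" then show "z = y \<and> \<gamma> \<in> cells K f g" by (simp add: cells_def)
next
  assume "z = y \<and> \<gamma> \<in> cells K f g"
  then have g: "z = y" "\<gamma> \<in> Cell K" "dom2 K \<gamma> = f" "cod2 K \<gamma> = g" by (simp_all add: cells_def)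
  then have "id2 K y \<star> \<gamma> = id2 K (y \<cdot> f)" using discrete_whisker(1)[OF dI y, of \<gamma>] f by simp
  then show "(\<gamma>, z) \<in> cells (slice K I) (f, y) (g, y)" using g y f by simp
qed

text \<open>\<open>y l\<close> is a 2-cell into \<open>I\<close>, hence an identity, so
  \<open>y g p = y k q\<close>. The comma object thus has one unambiguous structure map, and both
  projections and all 2-cells between test data lie over \<open>I\<close>.\<close>

lemma comma_square_slice:
  assumes dI: "discrete_ob K I" and y: "y \<in> Mor K" "tgt K y = I" "src K y = tgt K g"
    and com: "comma_square K g k p q l"
  shows "comma_square (slice K I) (g, y) (k, y) (p, y \<cdot> g) (q, y \<cdot> k) (l, y)"
  using com
proof (rule comma_squareE)
  fix X Y Z P
  assume t: "g \<in> Mor K" "src K g = X" "tgt K g = Z" "k \<in> Mor K" "src K k = Y" "tgt K k = Z"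
    "p \<in> Mor K" "src K p = P" "tgt K p = X" "q \<in> Mor K" "src K q = P" "tgt K q = Y"
    "l \<in> Cell K" "dom2 K l = g \<cdot> p" "cod2 K l = k \<cdot> q" "P \<in> Ob K" "X \<in> Ob K" "Y \<in> Ob K" "Z \<in> Ob K"
  and up1: "\<And>W u v \<theta>. u \<in> hom K W X \<Longrightarrow> v \<in> hom K W Y \<Longrightarrow> \<theta> \<in> cells K (g \<cdot> u) (k \<cdot> v) \<Longrightarrow>
       \<exists>!w. w \<in> hom K W P \<and> p \<cdot> w = u \<and> q \<cdot> w = v \<and> l \<star> id2 K w = \<theta>"
  and up2: "\<And>W w w' \<alpha> \<beta>. w \<in> hom K W P \<Longrightarrow> w' \<in> hom K W P \<Longrightarrow> \<alpha> \<in> cells K (p \<cdot> w) (p \<cdot> w') \<Longrightarrow>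
       \<beta> \<in> cells K (q \<cdot> w) (q \<cdot> w') \<Longrightarrow>
       (id2 K k \<star> \<beta>) \<bullet> (l \<star> id2 K w) = (l \<star> id2 K w') \<bullet> (id2 K g \<star> \<alpha>) \<Longrightarrow>
       \<exists>!\<gamma>. \<gamma> \<in> cells K w w' \<and> id2 K p \<star> \<gamma> = \<alpha> \<and> id2 K q \<star> \<gamma> = \<beta>"
  note [simp] = t
  have y' [simp]: "y \<in> Mor K" "tgt K y = I" "src K y = Z" using y by auto
  have l: "y \<cdot> k \<cdot> q = y \<cdot> g \<cdot> p" "id2 K y \<star> l = id2 K (y \<cdot> g \<cdot> p)" using discrete_whisker[OF dI, of y l] by auto
  let ?S = "slice K I"
  show ?thesis unfolding comma_square_def
  proof (intro conjI exI ballI impI)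
    show "(p, y \<cdot> g) \<in> hom ?S (y \<cdot> g \<cdot> p) (src ?S (g, y))" "(q, y \<cdot> k) \<in> hom ?S (y \<cdot> g \<cdot> p) (src ?S (k, y))"
      "(l, y) \<in> cells ?S ((g, y) \<cdot>\<^bsub>?S\<^esub> (p, y \<cdot> g)) ((k, y) \<cdot>\<^bsub>?S\<^esub> (q, y \<cdot> k))" using l by auto
  next
    fix W u v \<theta> assume W: "W \<in> Ob ?S" and u: "u \<in> hom ?S W (src ?S (g, y))" and v: "v \<in> hom ?S W (src ?S (k, y))"
      and th: "\<theta> \<in> cells ?S ((g, y) \<cdot>\<^bsub>?S\<^esub> u) ((k, y) \<cdot>\<^bsub>?S\<^esub> v)"
    obtain u0 where e1: "u = (u0, y \<cdot> g)" using u by (cases u) simp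
    obtain v0 where e2: "v = (v0, y \<cdot> k)" using v by (cases v) simp
    obtain \<theta>0 where e3: "\<theta> = (\<theta>0, y)" using th unfolding e1 e2 by (cases \<theta>) simp
    note e = e1 e2 e3
    have tu [simp]: "u0 \<in> Mor K" "tgt K u0 = X" and We: "y \<cdot> g \<cdot> u0 = W" using u unfolding e by auto
    have tv [simp]: "v0 \<in> Mor K" "tgt K v0 = Y" and We2: "y \<cdot> k \<cdot> v0 = W" using v unfolding e by auto
    have tth [simp]: "\<theta>0 \<in> Cell K" "dom2 K \<theta>0 = g \<cdot> u0" "cod2 K \<theta>0 = k \<cdot> v0" using th unfolding e by simp_all
    \<comment> \<open>A 1-cell of the slice is a pair that does not name the source of its
      underlying 1-cell; the sources are compared through the common structure map
      \<open>W\<close>.\<close>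
    have [simp]: "src K v0 = src K u0" using arg_cong[OF trans[OF We2 We[symmetric]], of "src K"] by simp
    have ex: "\<exists>!w. w \<in> hom K (src K u0) P \<and> p \<cdot> w = u0 \<and> q \<cdot> w = v0 \<and> l \<star> id2 K w = \<theta>0"
      by (rule up1) (auto simp: hom_def cells_def)
    have iff: "(w, z) \<in> hom ?S W (y \<cdot> g \<cdot> p) \<and> (p, y \<cdot> g) \<cdot>\<^bsub>?S\<^esub> (w, z) = u \<and> (q, y \<cdot> k) \<cdot>\<^bsub>?S\<^esub> (w, z) = v \<and> (l, y) \<star>\<^bsub>?S\<^esub> id2 ?S (w, z) = \<theta> \<longleftrightarrow>
      z = y \<cdot> g \<cdot> p \<and> w \<in> hom K (src K u0) P \<and> p \<cdot> w = u0 \<and> q \<cdot> w = v0 \<and> l \<star> id2 K w = \<theta>0" for w z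
      unfolding e We[symmetric] using We We2 by (auto simp: hom_def)
    show "\<exists>!w. w \<in> hom ?S W (y \<cdot> g \<cdot> p) \<and> (p, y \<cdot> g) \<cdot>\<^bsub>?S\<^esub> w = u \<and> (q, y \<cdot> k) \<cdot>\<^bsub>?S\<^esub> w = v \<and> (l, y) \<star>\<^bsub>?S\<^esub> id2 ?S w = \<theta>"
      unfolding Ex1_def split_paired_Ex split_paired_All iff using ex by (auto simp: Ex1_def)
  next
    fix W w w' \<alpha> \<beta> assume W: "W \<in> Ob ?S" and w: "w \<in> hom ?S W (y \<cdot> g \<cdot> p)" and w': "w' \<in> hom ?S W (y \<cdot> g \<cdot> p)"
      and a: "\<alpha> \<in> cells ?S ((p, y \<cdot> g) \<cdot>\<^bsub>?S\<^esub> w) ((p, y \<cdot> g) \<cdot>\<^bsub>?S\<^esub> w')"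
      and b: "\<beta> \<in> cells ?S ((q, y \<cdot> k) \<cdot>\<^bsub>?S\<^esub> w) ((q, y \<cdot> k) \<cdot>\<^bsub>?S\<^esub> w')"
      and eq: "(id2 ?S (k, y) \<star>\<^bsub>?S\<^esub> \<beta>) \<bullet>\<^bsub>?S\<^esub> ((l, y) \<star>\<^bsub>?S\<^esub> id2 ?S w) = ((l, y) \<star>\<^bsub>?S\<^esub> id2 ?S w') \<bullet>\<^bsub>?S\<^esub> (id2 ?S (g, y) \<star>\<^bsub>?S\<^esub> \<alpha>)"
    obtain w0 where e1: "w = (w0, y \<cdot> g \<cdot> p)" using w by (cases w) simp
    obtain w0' where e2: "w' = (w0', y \<cdot> g \<cdot> p)" using w' by (cases w') simp
    obtain a0 where e3: "\<alpha> = (a0, y \<cdot> g)" using a unfolding e1 e2 by (cases \<alpha>) simp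
    obtain b0 where e4: "\<beta> = (b0, y \<cdot> k)" using b unfolding e1 e2 by (cases \<beta>) simp
    note e = e1 e2 e3 e4
    have tw [simp]: "w0 \<in> Mor K" "tgt K w0 = P" and We: "y \<cdot> g \<cdot> p \<cdot> w0 = W" using w unfolding e by auto
    have tw' [simp]: "w0' \<in> Mor K" "tgt K w0' = P" and We2: "y \<cdot> g \<cdot> p \<cdot> w0' = W" using w' unfolding e by auto
    have ta [simp]: "a0 \<in> Cell K" "dom2 K a0 = p \<cdot> w0" "cod2 K a0 = p \<cdot> w0'" using a unfolding e by simp_all
    have tb [simp]: "b0 \<in> Cell K" "dom2 K b0 = q \<cdot> w0" "cod2 K b0 = q \<cdot> w0'" using b unfolding e by simp_all
    have [simp]: "src K w0' = src K w0" using arg_cong[OF trans[OF We2 We[symmetric]], of "src K"] by simp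
    have "\<exists>!\<gamma>. \<gamma> \<in> cells K w0 w0' \<and> id2 K p \<star> \<gamma> = a0 \<and> id2 K q \<star> \<gamma> = b0"
      by (rule up2[of _ "src K w0"]) (use eq in \<open>auto simp: hom_def cells_def e\<close>)
    moreover have iff: "(\<gamma>, z) \<in> cells ?S w w' \<and> id2 ?S (p, y \<cdot> g) \<star>\<^bsub>?S\<^esub> (\<gamma>, z) = \<alpha> \<and> id2 ?S (q, y \<cdot> k) \<star>\<^bsub>?S\<^esub> (\<gamma>, z) = \<beta> \<longleftrightarrow>
      z = y \<cdot> g \<cdot> p \<and> \<gamma> \<in> cells K w0 w0' \<and> id2 K p \<star> \<gamma> = a0 \<and> id2 K q \<star> \<gamma> = b0" for \<gamma> z
      unfolding e by (simp add: slice_cells_discrete[OF dI] del: slice_cells)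
    ultimately show "\<exists>!\<gamma>. \<gamma> \<in> cells ?S w w' \<and> id2 ?S (p, y \<cdot> g) \<star>\<^bsub>?S\<^esub> \<gamma> = \<alpha> \<and> id2 ?S (q, y \<cdot> k) \<star>\<^bsub>?S\<^esub> \<gamma> = \<beta>"
      unfolding Ex1_def split_paired_Ex split_paired_All iff by (auto simp: Ex1_def)
  qed auto
qed

text \<open>For the converse, a test object of the underlying 2-category receives a structure map by
  composing into \<open>I\<close>. Discreteness makes the structure maps obtained from the two legs
  equal, so the universal property of the slice applies to all test data.\<close>

lemma comma_square_unslice:
  assumes dI: "discrete_ob K I" and com: "comma_square (slice K I) G M P Q L"
  shows "\<exists>y g k p q l. y \<in> Mor K \<and> tgt K y = I \<and> src K y = tgt K g \<and> comma_square K g k p q l \<and>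
     G = (g, y) \<and> M = (k, y) \<and> P = (p, y \<cdot> g) \<and> Q = (q, y \<cdot> k) \<and> L = (l, y)"
proof -
  let ?S = "slice K I"
  interpret S: twocat ?S by (rule twocat_slice)
  obtain C X0 Y0 where c0: "G \<in> Mor ?S" "M \<in> Mor ?S" "tgt ?S M = tgt ?S G" "src ?S G = X0" "src ?S M = Y0"
    "P \<in> Mor ?S" "src ?S P = C" "tgt ?S P = X0" "Q \<in> Mor ?S" "src ?S Q = C" "tgt ?S Q = Y0"
    "L \<in> Cell ?S" "dom2 ?S L = G \<cdot>\<^bsub>?S\<^esub> P" "cod2 ?S L = M \<cdot>\<^bsub>?S\<^esub> Q"
    and up1: "\<And>W u v \<theta>. u \<in> hom ?S W X0 \<Longrightarrow> v \<in> hom ?S W Y0 \<Longrightarrow> \<theta> \<in> cells ?S (G \<cdot>\<^bsub>?S\<^esub> u) (M \<cdot>\<^bsub>?S\<^esub> v) \<Longrightarrow>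
       \<exists>!w. w \<in> hom ?S W C \<and> P \<cdot>\<^bsub>?S\<^esub> w = u \<and> Q \<cdot>\<^bsub>?S\<^esub> w = v \<and> L \<star>\<^bsub>?S\<^esub> id2 ?S w = \<theta>"
    and up2: "\<And>W w w' \<alpha> \<beta>. w \<in> hom ?S W C \<Longrightarrow> w' \<in> hom ?S W C \<Longrightarrow> \<alpha> \<in> cells ?S (P \<cdot>\<^bsub>?S\<^esub> w) (P \<cdot>\<^bsub>?S\<^esub> w') \<Longrightarrow>
       \<beta> \<in> cells ?S (Q \<cdot>\<^bsub>?S\<^esub> w) (Q \<cdot>\<^bsub>?S\<^esub> w') \<Longrightarrow>
       (id2 ?S M \<star>\<^bsub>?S\<^esub> \<beta>) \<bullet>\<^bsub>?S\<^esub> (L \<star>\<^bsub>?S\<^esub> id2 ?S w) = (L \<star>\<^bsub>?S\<^esub> id2 ?S w') \<bullet>\<^bsub>?S\<^esub> (id2 ?S G \<star>\<^bsub>?S\<^esub> \<alpha>) \<Longrightarrow>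
       \<exists>!\<gamma>. \<gamma> \<in> cells ?S w w' \<and> id2 ?S P \<star>\<^bsub>?S\<^esub> \<gamma> = \<alpha> \<and> id2 ?S Q \<star>\<^bsub>?S\<^esub> \<gamma> = \<beta>"
    by (rule S.comma_squareE[OF com], rule that, assumption+, simp, assumption+)
  obtain g y where e1: "G = (g, y)" by (cases G)
  obtain k where e2: "M = (k, y)" using c0(3) unfolding e1 by (cases M) simp
  obtain p where e3: "P = (p, y \<cdot> g)" using c0(8) c0(4)[symmetric] unfolding e1 by (cases P) simp
  obtain q where e4: "Q = (q, y \<cdot> k)" using c0(11) c0(5)[symmetric] unfolding e2 by (cases Q) simp
  obtain l where e5: "L = (l, y)" using c0(13) unfolding e1 e3 by (cases L) simp
  note e = e1 e2 e3 e4 e5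
  define X Y Z D where d: "X = src K g" "Y = src K k" "Z = tgt K g" "D = src K p"
  have y [simp]: "y \<in> Mor K" "tgt K y = I" "src K y = Z" and g [simp]: "g \<in> Mor K" "src K g = X" "tgt K g = Z"
    and k [simp]: "k \<in> Mor K" "src K k = Y" "tgt K k = Z" using c0(1,2) unfolding e d by simp_all
  have p [simp]: "p \<in> Mor K" "src K p = D" "tgt K p = X" "q \<in> Mor K" "tgt K q = Y" and C: "C = y \<cdot> g \<cdot> p" "C = y \<cdot> k \<cdot> q"
    using c0(6,9) c0(7,10)[symmetric] unfolding e by (simp_all add: d(4))
  have q [simp]: "src K q = D" using arg_cong[OF trans[OF C(1)[symmetric] C(2)], of "src K"] by simp
  have l [simp]: "l \<in> Cell K" "dom2 K l = g \<cdot> p" "cod2 K l = k \<cdot> q" using c0(12-14) unfolding e by simp_all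
  have X0: "X0 = y \<cdot> g" "Y0 = y \<cdot> k" using c0(4,5) unfolding e by simp_all
  have Cob [simp]: "C \<in> Mor K" "src K C = D" "tgt K C = I" unfolding C(1) by auto
  have "comma_square K g k p q l" unfolding comma_square_def
  proof (intro conjI exI ballI impI)
    show "p \<in> hom K D (src K g)" "q \<in> hom K D (src K k)" "l \<in> cells K (g \<cdot> p) (k \<cdot> q)" by (auto simp: hom_def cells_def)
  next
    fix W u v \<theta> assume W: "W \<in> Ob K" and u: "u \<in> hom K W (src K g)" and v: "v \<in> hom K W (src K k)" and th: "\<theta> \<in> cells K (g \<cdot> u) (k \<cdot> v)"
    have t [simp]: "u \<in> Mor K" "src K u = W" "tgt K u = X" "v \<in> Mor K" "src K v = W" "tgt K v = Y"
      "\<theta> \<in> Cell K" "dom2 K \<theta> = g \<cdot> u" "cod2 K \<theta> = k \<cdot> v" using u v th by (auto simp: hom_def cells_def)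
    have th': "y \<cdot> k \<cdot> v = y \<cdot> g \<cdot> u" "id2 K y \<star> \<theta> = id2 K (y \<cdot> g \<cdot> u)" using discrete_whisker[OF dI, of y \<theta>] by auto
    \<comment> \<open>The structure map given to the bare test object; \<open>y k v\<close> equals
      it by \<open>th'\<close>.\<close>
    let ?W = "y \<cdot> g \<cdot> u"
    have "\<exists>!w. w \<in> hom ?S ?W C \<and> P \<cdot>\<^bsub>?S\<^esub> w = (u, y \<cdot> g) \<and> Q \<cdot>\<^bsub>?S\<^esub> w = (v, y \<cdot> k) \<and> L \<star>\<^bsub>?S\<^esub> id2 ?S w = (\<theta>, y)"
      by (rule up1) (use th' in \<open>auto simp: e X0\<close>)
    moreover have sw: "src K w = W" if "w \<in> Mor K" "tgt K w = D" "p \<cdot> w = u" for w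
    proof -
      have "src K (p \<cdot> w) = src K w" using that(1,2) by simp
      then show ?thesis unfolding that(3) by simp
    qed
    moreover have iff: "(w, z) \<in> hom ?S ?W C \<and> P \<cdot>\<^bsub>?S\<^esub> (w, z) = (u, y \<cdot> g) \<and> Q \<cdot>\<^bsub>?S\<^esub> (w, z) = (v, y \<cdot> k) \<and> L \<star>\<^bsub>?S\<^esub> id2 ?S (w, z) = (\<theta>, y) \<longleftrightarrow>
      z = C \<and> w \<in> hom K W D \<and> p \<cdot> w = u \<and> q \<cdot> w = v \<and> l \<star> id2 K w = \<theta>" for w z
    proof
      assume *: "(w, z) \<in> hom ?S ?W C \<and> P \<cdot>\<^bsub>?S\<^esub> (w, z) = (u, y \<cdot> g) \<and> Q \<cdot>\<^bsub>?S\<^esub> (w, z) = (v, y \<cdot> k) \<and> L \<star>\<^bsub>?S\<^esub> id2 ?S (w, z) = (\<theta>, y)"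
      have 1: "w \<in> Mor K" "z = C" using *[THEN conjunct1] by simp_all
      moreover have "tgt K w = D" using *[THEN conjunct1] by simp
      moreover have "p \<cdot> w = u" "q \<cdot> w = v" "l \<star> id2 K w = \<theta>" using *[THEN conjunct2] unfolding e by simp_all
      ultimately show "z = C \<and> w \<in> hom K W D \<and> p \<cdot> w = u \<and> q \<cdot> w = v \<and> l \<star> id2 K w = \<theta>" using sw by (simp add: hom_def)
    next
      assume *: "z = C \<and> w \<in> hom K W D \<and> p \<cdot> w = u \<and> q \<cdot> w = v \<and> l \<star> id2 K w = \<theta>"
      then have [simp]: "w \<in> Mor K" "tgt K w = D" by (simp_all add: hom_def)
      have "C \<cdot> w = y \<cdot> g \<cdot> (p \<cdot> w)" unfolding C(1) by simp
      then have "C \<cdot> w = y \<cdot> g \<cdot> u" using * by simp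
      then show "(w, z) \<in> hom ?S ?W C \<and> P \<cdot>\<^bsub>?S\<^esub> (w, z) = (u, y \<cdot> g) \<and> Q \<cdot>\<^bsub>?S\<^esub> (w, z) = (v, y \<cdot> k) \<and> L \<star>\<^bsub>?S\<^esub> id2 ?S (w, z) = (\<theta>, y)"
        using * unfolding e by simp
    qed
    ultimately show "\<exists>!w. w \<in> hom K W D \<and> p \<cdot> w = u \<and> q \<cdot> w = v \<and> l \<star> id2 K w = \<theta>"
      unfolding Ex1_def split_paired_Ex split_paired_All iff by (auto simp: Ex1_def)
  next
    fix W w w' \<alpha> \<beta> assume W: "W \<in> Ob K" and w: "w \<in> hom K W D" and w': "w' \<in> hom K W D"
      and a: "\<alpha> \<in> cells K (p \<cdot> w) (p \<cdot> w')" and b: "\<beta> \<in> cells K (q \<cdot> w) (q \<cdot> w')"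
      and eq: "(id2 K k \<star> \<beta>) \<bullet> (l \<star> id2 K w) = (l \<star> id2 K w') \<bullet> (id2 K g \<star> \<alpha>)"
    have t [simp]: "w \<in> Mor K" "src K w = W" "tgt K w = D" "w' \<in> Mor K" "src K w' = W" "tgt K w' = D"
      "\<alpha> \<in> Cell K" "dom2 K \<alpha> = p \<cdot> w" "cod2 K \<alpha> = p \<cdot> w'" "\<beta> \<in> Cell K" "dom2 K \<beta> = q \<cdot> w" "cod2 K \<beta> = q \<cdot> w'"
      using w w' a b by (auto simp: hom_def cells_def)
    have a': "y \<cdot> g \<cdot> p \<cdot> w' = y \<cdot> g \<cdot> p \<cdot> w" "id2 K (y \<cdot> g) \<star> \<alpha> = id2 K (y \<cdot> g \<cdot> p \<cdot> w)"
      "y \<cdot> k \<cdot> q \<cdot> w' = y \<cdot> k \<cdot> q \<cdot> w" "id2 K (y \<cdot> k) \<star> \<beta> = id2 K (y \<cdot> k \<cdot> q \<cdot> w)"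
      using discrete_whisker[OF dI, of "y \<cdot> g" \<alpha>] discrete_whisker[OF dI, of "y \<cdot> k" \<beta>] by auto
    let ?W = "y \<cdot> g \<cdot> p \<cdot> w"
    have "\<exists>!\<gamma>. \<gamma> \<in> cells ?S (w, C) (w', C) \<and> id2 ?S P \<star>\<^bsub>?S\<^esub> \<gamma> = (\<alpha>, y \<cdot> g) \<and> id2 ?S Q \<star>\<^bsub>?S\<^esub> \<gamma> = (\<beta>, y \<cdot> k)"
      by (rule up2[of _ ?W]) (use a' eq C in \<open>auto simp: e\<close>)
    moreover have iff: "(\<gamma>, z) \<in> cells ?S (w, C) (w', C) \<and> id2 ?S P \<star>\<^bsub>?S\<^esub> (\<gamma>, z) = (\<alpha>, y \<cdot> g) \<and> id2 ?S Q \<star>\<^bsub>?S\<^esub> (\<gamma>, z) = (\<beta>, y \<cdot> k) \<longleftrightarrow>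
      z = C \<and> \<gamma> \<in> cells K w w' \<and> id2 K p \<star> \<gamma> = \<alpha> \<and> id2 K q \<star> \<gamma> = \<beta>" for \<gamma> z
      unfolding e by (simp add: slice_cells_discrete[OF dI] del: slice_cells)
    ultimately show "\<exists>!\<gamma>. \<gamma> \<in> cells K w w' \<and> id2 K p \<star> \<gamma> = \<alpha> \<and> id2 K q \<star> \<gamma> = \<beta>"
      unfolding Ex1_def split_paired_Ex split_paired_All iff by (auto simp: Ex1_def)
  qed auto
  then show ?thesis using e y(1,2) by (intro exI[of _ y] exI[of _ g] exI[of _ k] exI[of _ p] exI[of _ q] exI[of _ l]) simp
qed

lemma has_commas_slice:
  assumes "has_commas K" "discrete_ob K I"
  shows "has_commas (slice K I)"
  unfolding has_commas_def
proof (intro ballI impI)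
  fix F G assume *: "F \<in> Mor (slice K I)" "G \<in> Mor (slice K I)" "tgt (slice K I) F = tgt (slice K I) G"
  obtain f g y where e: "F = (f, y)" "G = (g, y)" using * by (cases F; cases G; auto)
  then obtain p q l where "comma_square K f g p q l" using assms(1)[unfolded has_commas_def, THEN bspec, THEN bspec, THEN mp, of f g] * by auto
  then have "comma_square (slice K I) F G (p, y \<cdot> f) (q, y \<cdot> g) (l, y)" using comma_square_slice[OF assms(2), of y f g p q l] * unfolding e by auto
  then show "\<exists>p q l. comma_square (slice K I) F G p q l" by blast
qed

text \<open>The factorization found in the underlying 2-category lies over \<open>I\<close>
  automatically: \<chi>, \<omega> and \<kappa> are 2-cells and so cannot change a structure
  map.\<close>

lemma factoring_square_slice:
  assumes dI: "discrete_ob K I" and y: "y \<in> Mor K" "tgt K y = I" "src K y = tgt K f" and fs: "factoring_square K f k p q"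
  shows "factoring_square (slice K I) (f, y) (k, y) (p, y \<cdot> f) (q, y \<cdot> k)"
proof -
  let ?S = "slice K I"
  obtain X Y Y' P where t0: "f \<in> Mor K" "src K f = X" "tgt K f = Y" "k \<in> Mor K" "src K k = Y'" "tgt K k = Y"
    "p \<in> Mor K" "src K p = P" "tgt K p = X" "q \<in> Mor K" "src K q = P" "tgt K q = Y'" and sq: "f \<cdot> p = k \<cdot> q"
    using fs[unfolded factoring_square_def, THEN conjunct1] fs[unfolded factoring_square_def, THEN conjunct2, THEN conjunct1]
      fs[unfolded factoring_square_def, THEN conjunct2, THEN conjunct2, THEN conjunct1]
      fs[unfolded factoring_square_def, THEN conjunct2, THEN conjunct2, THEN conjunct2, THEN conjunct1]
      fs[unfolded factoring_square_def, THEN conjunct2, THEN conjunct2, THEN conjunct2, THEN conjunct2, THEN conjunct1]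
    by (auto simp: hom_def)
  note fac = fs[unfolded factoring_square_def, THEN conjunct2, THEN conjunct2, THEN conjunct2, THEN conjunct2, THEN conjunct2]
  note [simp] = t0
  have y' [simp]: "y \<in> Mor K" "tgt K y = I" "src K y = Y" using y by auto
  show ?thesis unfolding factoring_square_def
  proof (intro conjI ballI)
    show "\<exists>C. (p, y \<cdot> f) \<in> hom ?S C (src ?S (f, y)) \<and> (q, y \<cdot> k) \<in> hom ?S C (src ?S (k, y))" using sq by auto
    fix W0 x0 v0 \<phi>0 assume W: "W0 \<in> Ob ?S" and x: "x0 \<in> hom ?S W0 (src ?S (f, y))" and v: "v0 \<in> hom ?S W0 (src ?S (k, y))"
      and phi: "\<phi>0 \<in> cells ?S ((f, y) \<cdot>\<^bsub>?S\<^esub> x0) ((k, y) \<cdot>\<^bsub>?S\<^esub> v0)"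
    obtain x' where e1: "x0 = (x', y \<cdot> f)" using x by (cases x0) simp
    obtain v' where e2: "v0 = (v', y \<cdot> k)" using v by (cases v0) simp
    obtain \<phi>' where e3: "\<phi>0 = (\<phi>', y)" using phi unfolding e1 e2 by (cases \<phi>0) simp
    obtain x v \<phi> where e: "x0 = (x, y \<cdot> f)" "v0 = (v, y \<cdot> k)" "\<phi>0 = (\<phi>, y)" using e1 e2 e3 by blast
    define W where "W = src K x"
    have tx [simp]: "x \<in> Mor K" "src K x = W" "tgt K x = X" and We: "W0 = y \<cdot> f \<cdot> x" using x unfolding e by (auto simp: W_def)
    have tv [simp]: "v \<in> Mor K" "tgt K v = Y'" and We': "W0 = y \<cdot> k \<cdot> v" using v unfolding e by auto
    have tphi [simp]: "\<phi> \<in> Cell K" "dom2 K \<phi> = f \<cdot> x" "cod2 K \<phi> = k \<cdot> v" using phi unfolding e by simp_all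
    have [simp]: "src K v = W" using arg_cong[OF trans[OF We'[symmetric] We], of "src K"] by simp
    have "W \<in> Ob K" "x \<in> hom K W (src K f)" "v \<in> hom K W (src K k)" "\<phi> \<in> cells K (f \<cdot> x) (k \<cdot> v)"
      using Mor_facts[of x] by (auto simp: hom_def cells_def)
    from fac[THEN bspec, THEN bspec, THEN bspec, THEN bspec, OF this]
    obtain \<rho> \<chi> \<omega> where r0: "\<rho>\<in>hom K W P" "\<chi>\<in>cells K x (p \<cdot> \<rho>)" "\<omega>\<in>cells K (q \<cdot> \<rho>) v" and f1: "(id2 K k \<star> \<omega>) \<bullet> (id2 K f \<star> \<chi>) = \<phi>"
      and f2: "\<forall>V\<in>Ob K. \<forall>t\<in>hom K V W. \<forall>\<rho>'\<in>hom K V P. \<forall>\<omega>'\<in>cells K (q \<cdot> \<rho>') (v \<cdot> t).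
             x \<cdot> t = p \<cdot> \<rho>' \<and> id2 K k \<star> \<omega>' = \<phi> \<star> id2 K t \<longrightarrow>
             (\<exists>\<kappa>\<in>cells K \<rho>' (\<rho> \<cdot> t). id2 K p \<star> \<kappa> = \<chi> \<star> id2 K t \<and>
                (\<omega> \<star> id2 K t) \<bullet> (id2 K q \<star> \<kappa>) = \<omega>')" unfolding t0 by blast
    have [simp]: "\<rho> \<in> Mor K" "src K \<rho> = W" "tgt K \<rho> = P" "\<chi> \<in> Cell K" "dom2 K \<chi> = x" "cod2 K \<chi> = p \<cdot> \<rho>"
      "\<omega> \<in> Cell K" "dom2 K \<omega> = q \<cdot> \<rho>" "cod2 K \<omega> = v" using r0 by (auto simp: hom_def cells_def)
    have st: "y \<cdot> f \<cdot> p \<cdot> \<rho> = y \<cdot> f \<cdot> x" "id2 K (y \<cdot> f) \<star> \<chi> = id2 K (y \<cdot> f \<cdot> x)" "id2 K (y \<cdot> k) \<star> \<omega> = id2 K (y \<cdot> k \<cdot> q \<cdot> \<rho>)"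
      using discrete_whisker[OF dI, of "y \<cdot> f" \<chi>] discrete_whisker[OF dI, of "y \<cdot> k" \<omega>] by auto
    show "\<exists>\<rho>\<in>hom ?S W0 (src ?S (p, y \<cdot> f)). \<exists>\<chi>\<in>cells ?S x0 ((p, y \<cdot> f) \<cdot>\<^bsub>?S\<^esub> \<rho>). \<exists>\<omega>\<in>cells ?S ((q, y \<cdot> k) \<cdot>\<^bsub>?S\<^esub> \<rho>) v0.
       (id2 ?S (k, y) \<star>\<^bsub>?S\<^esub> \<omega>) \<bullet>\<^bsub>?S\<^esub> (id2 ?S (f, y) \<star>\<^bsub>?S\<^esub> \<chi>) = \<phi>0 \<and>
       (\<forall>V\<in>Ob ?S. \<forall>t\<in>hom ?S V W0. \<forall>\<rho>'\<in>hom ?S V (src ?S (p, y \<cdot> f)). \<forall>\<omega>'\<in>cells ?S ((q, y \<cdot> k) \<cdot>\<^bsub>?S\<^esub> \<rho>') (v0 \<cdot>\<^bsub>?S\<^esub> t).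
             x0 \<cdot>\<^bsub>?S\<^esub> t = (p, y \<cdot> f) \<cdot>\<^bsub>?S\<^esub> \<rho>' \<and> id2 ?S (k, y) \<star>\<^bsub>?S\<^esub> \<omega>' = \<phi>0 \<star>\<^bsub>?S\<^esub> id2 ?S t \<longrightarrow>
             (\<exists>\<kappa>\<in>cells ?S \<rho>' (\<rho> \<cdot>\<^bsub>?S\<^esub> t). id2 ?S (p, y \<cdot> f) \<star>\<^bsub>?S\<^esub> \<kappa> = \<chi> \<star>\<^bsub>?S\<^esub> id2 ?S t \<and>
                (\<omega> \<star>\<^bsub>?S\<^esub> id2 ?S t) \<bullet>\<^bsub>?S\<^esub> (id2 ?S (q, y \<cdot> k) \<star>\<^bsub>?S\<^esub> \<kappa>) = \<omega>'))"
    proof (rule bexI[of _ "(\<rho>, y \<cdot> f \<cdot> p)"], rule bexI[of _ "(\<chi>, y \<cdot> f)"], rule bexI[of _ "(\<omega>, y \<cdot> k)"],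
        intro conjI ballI impI)
      let ?z = "y \<cdot> f \<cdot> p"
      have zk: "?z = y \<cdot> k \<cdot> q" using sq by simp
      show "(\<rho>, ?z) \<in> hom ?S W0 (src ?S (p, y \<cdot> f))" using st We by simp
      show "(\<chi>, y \<cdot> f) \<in> cells ?S x0 ((p, y \<cdot> f) \<cdot>\<^bsub>?S\<^esub> (\<rho>, ?z))" using st unfolding e by simp
      show "(\<omega>, y \<cdot> k) \<in> cells ?S ((q, y \<cdot> k) \<cdot>\<^bsub>?S\<^esub> (\<rho>, ?z)) v0" using st unfolding e by simp
      show "(id2 ?S (k, y) \<star>\<^bsub>?S\<^esub> (\<omega>, y \<cdot> k)) \<bullet>\<^bsub>?S\<^esub> (id2 ?S (f, y) \<star>\<^bsub>?S\<^esub> (\<chi>, y \<cdot> f)) = \<phi>0" using f1 unfolding e by simp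
      fix V0 t0 \<rho>0' \<omega>0' assume a: "V0 \<in> Ob ?S" "t0 \<in> hom ?S V0 W0" "\<rho>0' \<in> hom ?S V0 (src ?S (p, y \<cdot> f))"
        "\<omega>0' \<in> cells ?S ((q, y \<cdot> k) \<cdot>\<^bsub>?S\<^esub> \<rho>0') (v0 \<cdot>\<^bsub>?S\<^esub> t0)"
        "x0 \<cdot>\<^bsub>?S\<^esub> t0 = (p, y \<cdot> f) \<cdot>\<^bsub>?S\<^esub> \<rho>0' \<and> id2 ?S (k, y) \<star>\<^bsub>?S\<^esub> \<omega>0' = \<phi>0 \<star>\<^bsub>?S\<^esub> id2 ?S t0"
      obtain t where e3: "t0 = (t, W0)" using a(2) by (cases t0) simp
      obtain \<rho>' where e4: "\<rho>0' = (\<rho>', ?z)" using a(3) by (cases \<rho>0') simp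
      obtain \<omega>' where e5: "\<omega>0' = (\<omega>', y \<cdot> k)" using a(4) unfolding e e3 e4 by (cases \<omega>0') simp
      note e2 = e3 e4 e5
      define V where "V = src K t"
      have t3 [simp]: "t \<in> Mor K" "src K t = V" "tgt K t = W" and Ve1: "V0 = y \<cdot> f \<cdot> x \<cdot> t" using a(2) unfolding We e2 V_def by auto
      have t3' [simp]: "\<rho>' \<in> Mor K" "tgt K \<rho>' = P" and Ve2: "V0 = y \<cdot> f \<cdot> p \<cdot> \<rho>'" using a(3) unfolding e2 by auto
      note Ve = Ve1 Ve2
      have t4: "src K \<rho>' = V" using arg_cong[OF trans[OF Ve(1)[symmetric] Ve(2)], of "src K"] t3 by simp
      note [simp] = t4
      have t5 [simp]: "\<omega>' \<in> Cell K" "dom2 K \<omega>' = q \<cdot> \<rho>'" "cod2 K \<omega>' = v \<cdot> t"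
        using a(4) unfolding e2 e by simp_all
      have eq: "x \<cdot> t = p \<cdot> \<rho>'" "id2 K k \<star> \<omega>' = \<phi> \<star> id2 K t" using a(5) unfolding e2 e by simp_all
      have "V \<in> Ob K" "t \<in> hom K V W" "\<rho>' \<in> hom K V P" "\<omega>' \<in> cells K (q \<cdot> \<rho>') (v \<cdot> t)" using Mor_facts[of t] by (auto simp: hom_def cells_def)
      from f2[THEN bspec, THEN bspec, THEN bspec, THEN bspec, OF this, THEN mp, OF conjI, OF eq]
      obtain \<kappa> where k: "\<kappa>\<in>cells K \<rho>' (\<rho> \<cdot> t)" "id2 K p \<star> \<kappa> = \<chi> \<star> id2 K t" "(\<omega> \<star> id2 K t) \<bullet> (id2 K q \<star> \<kappa>) = \<omega>'" by blast
      have [simp]: "\<kappa> \<in> Cell K" "dom2 K \<kappa> = \<rho>'" "cod2 K \<kappa> = \<rho> \<cdot> t" using k by (auto simp: cells_def)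
      have "id2 K ?z \<star> \<kappa> = id2 K (?z \<cdot> \<rho>')" using discrete_whisker[OF dI, of ?z \<kappa>] by simp
      then have "(\<kappa>, ?z) \<in> cells ?S \<rho>0' ((\<rho>, ?z) \<cdot>\<^bsub>?S\<^esub> t0)" unfolding e2 by simp
      then show "\<exists>\<kappa>\<in>cells ?S \<rho>0' ((\<rho>, ?z) \<cdot>\<^bsub>?S\<^esub> t0). id2 ?S (p, y \<cdot> f) \<star>\<^bsub>?S\<^esub> \<kappa> = (\<chi>, y \<cdot> f) \<star>\<^bsub>?S\<^esub> id2 ?S t0 \<and>
                ((\<omega>, y \<cdot> k) \<star>\<^bsub>?S\<^esub> id2 ?S t0) \<bullet>\<^bsub>?S\<^esub> (id2 ?S (q, y \<cdot> k) \<star>\<^bsub>?S\<^esub> \<kappa>) = \<omega>0'"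
        by (rule rev_bexI) (use k in \<open>simp add: e2\<close>)
    qed
  qed (use sq in auto)
qed

lemma two_functor_Sigma:
  assumes [simp]: "f \<in> Mor K" "src K f = I" "tgt K f = J"
  shows "two_functor (slice K I) (slice K J) (Sigma_fun K f)"
  unfolding two_functor_def by (auto simp del: whisker_whisker simp: whisker_whisker[symmetric])

end

section \<open>Push-forward structures\<close>

text \<open>
  The data of a normalised opfibration: an action \<open>z\<close> of the comma object of \<open>\<pi>\<close> and \<open>1\<close>.
  An opcartesian lift of \<open>\<beta> : \<pi> x \<Rightarrow> c\<close> is obtained by whiskering \<open>z\<close> with a 2-cell of the comma object.
\<close>

locale pushing = twocat K for K :: "('o, 'f, 't) two_cat" (structure) +
  fixes \<pi> d c :: 'f and \<beta>0 :: 't and z :: 'f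
  assumes com: "comma_square K \<pi> (one K (tgt K \<pi>)) d c \<beta>0"
    and z0: "z \<in> hom K (src K d) (src K \<pi>)" and \<pi>z: "\<pi> \<cdot> z = c"
    and normal: "\<And>i. i \<in> hom K (src K \<pi>) (src K d) \<Longrightarrow> d \<cdot> i = one K (src K \<pi>) \<Longrightarrow> c \<cdot> i = \<pi> \<Longrightarrow>
      \<beta>0 \<star> id2 K i = id2 K \<pi> \<Longrightarrow> z \<cdot> i = one K (src K \<pi>)"
begin

abbreviation "Z \<equiv> src K \<pi>"
abbreviation "B \<equiv> tgt K \<pi>"
abbreviation "W0 \<equiv> src K d"

lemma com_facts [simp]: "\<pi> \<in> Mor K" "d \<in> Mor K" "tgt K d = Z" "c \<in> Mor K" "src K c = W0" "tgt K c = B"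
  "\<beta>0 \<in> Cell K" "dom2 K \<beta>0 = \<pi> \<cdot> d" "cod2 K \<beta>0 = c" "z \<in> Mor K" "src K z = W0" "tgt K z = Z" "W0 \<in> Ob K" "Z \<in> Ob K" "B \<in> Ob K"
proof -
  show \<pi> [simp]: "\<pi> \<in> Mor K" using com by (rule comma_squareE)
  have *: "d \<in> Mor K" "tgt K d = Z" "c \<in> Mor K" "src K c = W0" "tgt K c = B" "\<beta>0 \<in> Cell K" "dom2 K \<beta>0 = \<pi> \<cdot> d" "cod2 K \<beta>0 = one K B \<cdot> c"
    "W0 \<in> Ob K" "Z \<in> Ob K" "B \<in> Ob K"
    by (rule comma_squareE[OF com], simp)+
  show "d \<in> Mor K" "tgt K d = Z" "c \<in> Mor K" "src K c = W0" "tgt K c = B" "\<beta>0 \<in> Cell K" "dom2 K \<beta>0 = \<pi> \<cdot> d" "cod2 K \<beta>0 = c"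
    "W0 \<in> Ob K" "Z \<in> Ob K" "B \<in> Ob K" using * by simp_all
  show "z \<in> Mor K" "src K z = W0" "tgt K z = Z" using z0 by (auto simp: hom_def)
qed

lemma com1:
  assumes "u \<in> Mor K" "tgt K u = Z" "\<theta> \<in> Cell K" "dom2 K \<theta> = \<pi> \<cdot> u"
  shows "\<exists>!w. w \<in> hom K (src K u) W0 \<and> d \<cdot> w = u \<and> c \<cdot> w = cod2 K \<theta> \<and> \<beta>0 \<star> id2 K w = \<theta>"
  using com
proof (rule comma_squareE)
  fix X Y Z' P
  assume a: "src K \<pi> = X" "src K (one K B) = Y" "src K d = P" "tgt K \<pi> = Z'"
    and up: "\<And>W u v \<theta>. u \<in> hom K W X \<Longrightarrow> v \<in> hom K W Y \<Longrightarrow> \<theta> \<in> cells K (\<pi> \<cdot> u) (one K B \<cdot> v) \<Longrightarrow>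
       \<exists>!w. w \<in> hom K W P \<and> d \<cdot> w = u \<and> c \<cdot> w = v \<and> \<beta>0 \<star> id2 K w = \<theta>"
  have s: "src K (cod2 K \<theta>) = src K u" "tgt K (cod2 K \<theta>) = B" using assms Cell_facts(3,4)[of \<theta>] by auto
  show ?thesis unfolding a(3)
    by (rule up) (use assms s a in \<open>auto simp: hom_def cells_def\<close>)
qed

lemma com2:
  assumes "w \<in> Mor K" "tgt K w = W0" "w' \<in> Mor K" "tgt K w' = W0"
    "\<alpha> \<in> cells K (d \<cdot> w) (d \<cdot> w')" "\<gamma> \<in> cells K (c \<cdot> w) (c \<cdot> w')"
    and eq: "\<gamma> \<bullet> (\<beta>0 \<star> id2 K w) = (\<beta>0 \<star> id2 K w') \<bullet> (id2 K \<pi> \<star> \<alpha>)"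
  shows "\<exists>!\<delta>. \<delta> \<in> cells K w w' \<and> id2 K d \<star> \<delta> = \<alpha> \<and> id2 K c \<star> \<delta> = \<gamma>"
  using com
proof (rule comma_squareE)
  fix X Y Z' P
  assume a: "src K d = P"
    and up: "\<And>W w w' \<alpha> \<beta>. w \<in> hom K W P \<Longrightarrow> w' \<in> hom K W P \<Longrightarrow> \<alpha> \<in> cells K (d \<cdot> w) (d \<cdot> w') \<Longrightarrow>
       \<beta> \<in> cells K (c \<cdot> w) (c \<cdot> w') \<Longrightarrow>
       (id2 K (one K B) \<star> \<beta>) \<bullet> (\<beta>0 \<star> id2 K w) = (\<beta>0 \<star> id2 K w') \<bullet> (id2 K \<pi> \<star> \<alpha>) \<Longrightarrow>
       \<exists>!\<gamma>. \<gamma> \<in> cells K w w' \<and> id2 K d \<star> \<gamma> = \<alpha> \<and> id2 K c \<star> \<gamma> = \<beta>"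
  have A: "\<alpha> \<in> Cell K" "dom2 K \<alpha> = d \<cdot> w" "cod2 K \<alpha> = d \<cdot> w'" "\<gamma> \<in> Cell K" "dom2 K \<gamma> = c \<cdot> w" "cod2 K \<gamma> = c \<cdot> w'"
    using assms by (auto simp: cells_def)
  have s: "src K w = src K w'" using Cell_facts(3)[OF A(1)] assms(1-4) unfolding A by simp
  show ?thesis
    by (rule up[of _ "src K w"]) (use assms s a A in \<open>auto simp: hom_def\<close>)
qed

text \<open>An element of the comma object is a pair of an element \<open>x\<close> and a 2-cell
  \<beta> out of its image in the base. The action \<open>z\<close> sends such a pair to
  \<open>pu x \<beta>\<close>, the push-forward of \<open>x\<close> along \<beta>.\<close>

definition tup :: "'f \<Rightarrow> 't \<Rightarrow> 'f" where
  "tup x \<beta> = (THE w. w \<in> hom K (src K x) W0 \<and> d \<cdot> w = x \<and> c \<cdot> w = cod2 K \<beta> \<and> \<beta>0 \<star> id2 K w = \<beta>)"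

definition pu :: "'f \<Rightarrow> 't \<Rightarrow> 'f" where "pu x \<beta> = z \<cdot> tup x \<beta>"

lemma tup [simp]:
  assumes "x \<in> Mor K" "tgt K x = Z" "\<beta> \<in> Cell K" "dom2 K \<beta> = \<pi> \<cdot> x"
  shows "tup x \<beta> \<in> Mor K" "src K (tup x \<beta>) = src K x" "tgt K (tup x \<beta>) = W0"
    "d \<cdot> tup x \<beta> = x" "c \<cdot> tup x \<beta> = cod2 K \<beta>" "\<beta>0 \<star> id2 K (tup x \<beta>) = \<beta>"
  using theI'[OF com1[OF assms], folded tup_def] by (auto simp: hom_def)

lemma tup_unique:
  assumes "x \<in> Mor K" "tgt K x = Z" "\<beta> \<in> Cell K" "dom2 K \<beta> = \<pi> \<cdot> x"
    "w \<in> Mor K" "tgt K w = W0" "d \<cdot> w = x" "c \<cdot> w = cod2 K \<beta>" "\<beta>0 \<star> id2 K w = \<beta>"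
  shows "w = tup x \<beta>"
proof -
  have "src K (d \<cdot> w) = src K w" using assms(5,6) by simp
  then have "src K w = src K x" using assms by simp
  then show ?thesis using com1[OF assms(1-4)] tup[OF assms(1-4)] assms(5-9) unfolding hom_def by blast
qed

lemma pu [simp]:
  assumes "x \<in> Mor K" "tgt K x = Z" "\<beta> \<in> Cell K" "dom2 K \<beta> = \<pi> \<cdot> x"
  shows "pu x \<beta> \<in> Mor K" "src K (pu x \<beta>) = src K x" "tgt K (pu x \<beta>) = Z" "\<pi> \<cdot> pu x \<beta> = cod2 K \<beta>"
proof -
  show "pu x \<beta> \<in> Mor K" "src K (pu x \<beta>) = src K x" "tgt K (pu x \<beta>) = Z" unfolding pu_def using assms by simp_all
  have "\<pi> \<cdot> pu x \<beta> = (\<pi> \<cdot> z) \<cdot> tup x \<beta>" unfolding pu_def using assms by simp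
  then show "\<pi> \<cdot> pu x \<beta> = cod2 K \<beta>" unfolding \<pi>z using assms by simp
qed

text \<open>All operations of this locale are shown to commute with restriction along
  \<open>t\<close>. The initiality clause of \<open>factoring_square\<close> compares factorizations
  after such restrictions.\<close>

lemma tup_precomp:
  assumes "x \<in> Mor K" "tgt K x = Z" "\<beta> \<in> Cell K" "dom2 K \<beta> = \<pi> \<cdot> x" "t \<in> Mor K" "tgt K t = src K x"
  shows "tup (x \<cdot> t) (\<beta> \<star> id2 K t) = tup x \<beta> \<cdot> t"
proof -
  have s [simp]: "src K (cod2 K \<beta>) = src K x" using Cell_facts(3)[OF assms(3)] assms by simp
  have 1: "d \<cdot> tup x \<beta> \<cdot> t = x \<cdot> t" "c \<cdot> tup x \<beta> \<cdot> t = cod2 K \<beta> \<cdot> t"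
    using assms cmp_assoc'[of t "tup x \<beta>" d] cmp_assoc'[of t "tup x \<beta>" c] by simp_all
  have 2: "\<beta>0 \<star> id2 K (tup x \<beta> \<cdot> t) = \<beta> \<star> id2 K t"
    using assms hcmp_assoc'[of "id2 K t" "id2 K (tup x \<beta>)" \<beta>0] by simp
  show ?thesis by (rule tup_unique[symmetric]) (use assms 1 2 in auto)
qed

lemma pu_precomp:
  assumes "x \<in> Mor K" "tgt K x = Z" "\<beta> \<in> Cell K" "dom2 K \<beta> = \<pi> \<cdot> x" "t \<in> Mor K" "tgt K t = src K x"
  shows "pu (x \<cdot> t) (\<beta> \<star> id2 K t) = pu x \<beta> \<cdot> t"
  unfolding pu_def tup_precomp[OF assms] using assms by simp

text \<open>The unit section, sending \<open>x\<close> to the pair of \<open>x\<close> and the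
  identity of its image. By \<open>normal\<close> the action is trivial on it, which is why the
  2-cells constructed below start or end at \<open>x\<close> itself.\<close>

definition ii :: 'f where "ii = tup (one K Z) (id2 K \<pi>)"

lemma ii [simp]: "ii \<in> Mor K" "src K ii = Z" "tgt K ii = W0" "d \<cdot> ii = one K Z" "c \<cdot> ii = \<pi>" "\<beta>0 \<star> id2 K ii = id2 K \<pi>" "z \<cdot> ii = one K Z"
proof -
  show 1: "ii \<in> Mor K" "src K ii = Z" "tgt K ii = W0" "d \<cdot> ii = one K Z" "c \<cdot> ii = \<pi>" "\<beta>0 \<star> id2 K ii = id2 K \<pi>"
    unfolding ii_def by simp_all
  show "z \<cdot> ii = one K Z" by (rule normal) (use 1 in \<open>auto simp: hom_def\<close>)
qed

lemma tup_id: "x \<in> Mor K \<Longrightarrow> tgt K x = Z \<Longrightarrow> tup x (id2 K (\<pi> \<cdot> x)) = ii \<cdot> x"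
  using tup_precomp[of "one K Z" "id2 K \<pi>" x] unfolding ii_def[symmetric] by simp

lemma z_ii: "x \<in> Mor K \<Longrightarrow> tgt K x = Z \<Longrightarrow> z \<cdot> ii \<cdot> x = x"
  using cmp_assoc'[of x ii z] by simp

text \<open>The 2-cell of the comma object from (\<open>x\<close>, identity) to (\<open>x\<close>,
  \<beta>) with components the identity of \<open>x\<close> and \<beta>. The action turns it into
  the opcartesian lift of \<beta> at \<open>x\<close>.\<close>

definition iota_cell :: "'f \<Rightarrow> 't \<Rightarrow> 't" where
  "iota_cell x \<beta> = (THE \<delta>. \<delta> \<in> cells K (ii \<cdot> x) (tup x \<beta>) \<and> id2 K d \<star> \<delta> = id2 K x \<and> id2 K c \<star> \<delta> = \<beta>)"

definition iota :: "'f \<Rightarrow> 't \<Rightarrow> 't" where "iota x \<beta> = id2 K z \<star> iota_cell x \<beta>"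

lemma d_ii: "x \<in> Mor K \<Longrightarrow> tgt K x = Z \<Longrightarrow> d \<cdot> ii \<cdot> x = x"
  and c_ii: "x \<in> Mor K \<Longrightarrow> tgt K x = Z \<Longrightarrow> c \<cdot> ii \<cdot> x = \<pi> \<cdot> x"
  and \<beta>_ii: "x \<in> Mor K \<Longrightarrow> tgt K x = Z \<Longrightarrow> \<beta>0 \<star> id2 K (ii \<cdot> x) = id2 K (\<pi> \<cdot> x)"
  using cmp_assoc'[of x ii d] cmp_assoc'[of x ii c] hcmp_assoc'[of "id2 K x" "id2 K ii" \<beta>0] by simp_all

lemma iota_cell_ex:
  assumes "x \<in> Mor K" "tgt K x = Z" "\<beta> \<in> Cell K" "dom2 K \<beta> = \<pi> \<cdot> x"
  shows "\<exists>!\<delta>. \<delta> \<in> cells K (ii \<cdot> x) (tup x \<beta>) \<and> id2 K d \<star> \<delta> = id2 K x \<and> id2 K c \<star> \<delta> = \<beta>"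
  by (rule com2) (use assms in \<open>auto simp: cells_def d_ii c_ii \<beta>_ii\<close>)

lemma iota_cell:
  assumes "x \<in> Mor K" "tgt K x = Z" "\<beta> \<in> Cell K" "dom2 K \<beta> = \<pi> \<cdot> x"
  shows "iota_cell x \<beta> \<in> Cell K" "dom2 K (iota_cell x \<beta>) = ii \<cdot> x" "cod2 K (iota_cell x \<beta>) = tup x \<beta>"
   "id2 K d \<star> iota_cell x \<beta> = id2 K x" "id2 K c \<star> iota_cell x \<beta> = \<beta>"
  using theI'[OF iota_cell_ex[OF assms], folded iota_cell_def] by (auto simp: cells_def)

lemma iota [simp]:
  assumes a: "x \<in> Mor K" "tgt K x = Z" "\<beta> \<in> Cell K" "dom2 K \<beta> = \<pi> \<cdot> x"
  shows "iota x \<beta> \<in> Cell K" "dom2 K (iota x \<beta>) = x" "cod2 K (iota x \<beta>) = pu x \<beta>" "id2 K \<pi> \<star> iota x \<beta> = \<beta>"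
proof -
  note [simp] = a iota_cell[OF a]
  show "iota x \<beta> \<in> Cell K" "dom2 K (iota x \<beta>) = x" "cod2 K (iota x \<beta>) = pu x \<beta>" by (simp_all add: iota_def pu_def z_ii)
  show "id2 K \<pi> \<star> iota x \<beta> = \<beta>" by (simp add: iota_def \<pi>z)
qed

lemma iota_cell_precomp:
  assumes a: "x \<in> Mor K" "tgt K x = Z" "\<beta> \<in> Cell K" "dom2 K \<beta> = \<pi> \<cdot> x" and t: "t \<in> Mor K" "tgt K t = src K x"
  shows "iota_cell (x \<cdot> t) (\<beta> \<star> id2 K t) = iota_cell x \<beta> \<star> id2 K t"
proof -
  note [simp] = a iota_cell[OF a] t
  have ex: "\<exists>!\<delta>. \<delta> \<in> cells K (ii \<cdot> x \<cdot> t) (tup (x \<cdot> t) (\<beta> \<star> id2 K t)) \<and> id2 K d \<star> \<delta> = id2 K (x \<cdot> t) \<and> id2 K c \<star> \<delta> = \<beta> \<star> id2 K t"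
    by (rule iota_cell_ex) simp_all
  show ?thesis
  proof (rule ex[THEN ex1E], goal_cases)
    case (1 \<delta>)
    have "iota_cell (x \<cdot> t) (\<beta> \<star> id2 K t) = \<delta>" unfolding iota_cell_def by (rule the_equality) (use 1 in blast)+
    moreover have "iota_cell x \<beta> \<star> id2 K t = \<delta>"
      by (rule 1(2)[rule_format], intro conjI)
        (auto simp: cells_def tup_precomp hcmp_assoc'[of "id2 K t" "iota_cell x \<beta>" "id2 K d", symmetric]
         hcmp_assoc'[of "id2 K t" "iota_cell x \<beta>" "id2 K c", symmetric] simp del: hcmp_assoc')
    ultimately show ?case by simp
  qed
qed

lemma iota_precomp:
  assumes a: "x \<in> Mor K" "tgt K x = Z" "\<beta> \<in> Cell K" "dom2 K \<beta> = \<pi> \<cdot> x" and t: "t \<in> Mor K" "tgt K t = src K x"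
  shows "iota (x \<cdot> t) (\<beta> \<star> id2 K t) = iota x \<beta> \<star> id2 K t"
  unfolding iota_def iota_cell_precomp[OF assms] using a t iota_cell[OF a] by simp

text \<open>For \<phi> from \<open>x\<close> to \<open>y\<close>, the 2-cell of the comma object
  from (\<open>x\<close>, \<pi> \<phi>) to (\<open>y\<close>, identity) with components \<phi> and
  an identity. The action turns it into the vertical part of \<phi>, which starts at the
  push-forward of \<open>x\<close>.\<close>

definition bar_cell :: "'t \<Rightarrow> 't" where
  "bar_cell \<phi> = (THE \<delta>. \<delta> \<in> cells K (tup (dom2 K \<phi>) (id2 K \<pi> \<star> \<phi>)) (ii \<cdot> cod2 K \<phi>) \<and>
     id2 K d \<star> \<delta> = \<phi> \<and> id2 K c \<star> \<delta> = id2 K (\<pi> \<cdot> cod2 K \<phi>))"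

definition bar :: "'t \<Rightarrow> 't" where "bar \<phi> = id2 K z \<star> bar_cell \<phi>"

lemma bar_cell_ex:
  assumes "\<phi> \<in> Cell K" "tgt K (dom2 K \<phi>) = Z"
  shows "\<exists>!\<delta>. \<delta> \<in> cells K (tup (dom2 K \<phi>) (id2 K \<pi> \<star> \<phi>)) (ii \<cdot> cod2 K \<phi>) \<and>
     id2 K d \<star> \<delta> = \<phi> \<and> id2 K c \<star> \<delta> = id2 K (\<pi> \<cdot> cod2 K \<phi>)"
  by (rule com2) (use assms in \<open>auto simp: cells_def d_ii c_ii \<beta>_ii\<close>)

lemma bar_cell:
  assumes "\<phi> \<in> Cell K" "tgt K (dom2 K \<phi>) = Z"
  shows "bar_cell \<phi> \<in> Cell K" "dom2 K (bar_cell \<phi>) = tup (dom2 K \<phi>) (id2 K \<pi> \<star> \<phi>)" "cod2 K (bar_cell \<phi>) = ii \<cdot> cod2 K \<phi>"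
    "id2 K d \<star> bar_cell \<phi> = \<phi>" "id2 K c \<star> bar_cell \<phi> = id2 K (\<pi> \<cdot> cod2 K \<phi>)"
  using theI'[OF bar_cell_ex[OF assms], folded bar_cell_def] by (auto simp: cells_def)

lemma bar [simp]:
  assumes a: "\<phi> \<in> Cell K" "tgt K (dom2 K \<phi>) = Z"
  shows "bar \<phi> \<in> Cell K" "dom2 K (bar \<phi>) = pu (dom2 K \<phi>) (id2 K \<pi> \<star> \<phi>)" "cod2 K (bar \<phi>) = cod2 K \<phi>"
    "id2 K \<pi> \<star> bar \<phi> = id2 K (\<pi> \<cdot> cod2 K \<phi>)"
proof -
  note [simp] = a bar_cell[OF a]
  show "bar \<phi> \<in> Cell K" "dom2 K (bar \<phi>) = pu (dom2 K \<phi>) (id2 K \<pi> \<star> \<phi>)" "cod2 K (bar \<phi>) = cod2 K \<phi>"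
    by (simp_all add: bar_def pu_def z_ii)
  show "id2 K \<pi> \<star> bar \<phi> = id2 K (\<pi> \<cdot> cod2 K \<phi>)" by (simp add: bar_def \<pi>z)
qed

lemma bar_cell_precomp:
  assumes a: "\<phi> \<in> Cell K" "tgt K (dom2 K \<phi>) = Z" and t: "t \<in> Mor K" "tgt K t = src K (dom2 K \<phi>)"
  shows "bar_cell (\<phi> \<star> id2 K t) = bar_cell \<phi> \<star> id2 K t"
proof -
  note [simp] = a bar_cell[OF a] t
  have T: "tup (dom2 K \<phi> \<cdot> t) (id2 K \<pi> \<star> \<phi> \<star> id2 K t) = tup (dom2 K \<phi>) (id2 K \<pi> \<star> \<phi>) \<cdot> t"
    using tup_precomp[of "dom2 K \<phi>" "id2 K \<pi> \<star> \<phi>" t] by simp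
  show ?thesis
  proof (rule bar_cell_ex[of "\<phi> \<star> id2 K t", THEN ex1E], goal_cases)
    case (3 \<delta>)
    have "bar_cell (\<phi> \<star> id2 K t) = \<delta>" unfolding bar_cell_def by (rule the_equality) (use 3 in blast)+
    moreover have "bar_cell \<phi> \<star> id2 K t = \<delta>"
      by (rule 3(2)[rule_format], intro conjI)
        (auto simp: cells_def T hcmp_assoc'[of "id2 K t" "bar_cell \<phi>" "id2 K d", symmetric]
         hcmp_assoc'[of "id2 K t" "bar_cell \<phi>" "id2 K c", symmetric] simp del: hcmp_assoc')
    ultimately show ?case by simp
  qed simp_all
qed

lemma bar_precomp:
  assumes a: "\<phi> \<in> Cell K" "tgt K (dom2 K \<phi>) = Z" and t: "t \<in> Mor K" "tgt K t = src K (dom2 K \<phi>)"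
  shows "bar (\<phi> \<star> id2 K t) = bar \<phi> \<star> id2 K t"
  unfolding bar_def bar_cell_precomp[OF assms] using a t bar_cell[OF a] by simp

text \<open>Before \<open>z\<close> is applied, the composite and the image of \<phi> under the unit
  section are 2-cells of the comma object with the same projections \<phi> and \<pi> \<phi>. Hence
  they agree, and \<open>z\<close> cancels the unit section.\<close>

lemma bar_iota:
  assumes a: "\<phi> \<in> Cell K" "tgt K (dom2 K \<phi>) = Z"
  shows "bar \<phi> \<bullet> iota (dom2 K \<phi>) (id2 K \<pi> \<star> \<phi>) = \<phi>"
proof -
  let ?x = "dom2 K \<phi>" and ?y = "cod2 K \<phi>" and ?b = "id2 K \<pi> \<star> \<phi>"
  have x: "?x \<in> Mor K" "tgt K ?x = Z" "?b \<in> Cell K" "dom2 K ?b = \<pi> \<cdot> ?x" using a by auto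
  note [simp] = a bar_cell[OF a] iota_cell[OF x]
  have ex: "\<exists>!\<delta>. \<delta> \<in> cells K (ii \<cdot> ?x) (ii \<cdot> ?y) \<and> id2 K d \<star> \<delta> = \<phi> \<and> id2 K c \<star> \<delta> = ?b"
    by (rule com2) (auto simp: cells_def d_ii c_ii \<beta>_ii)
  have A: "id2 K d \<star> id2 K ii \<star> \<phi> = \<phi>" "id2 K c \<star> id2 K ii \<star> \<phi> = ?b" "id2 K z \<star> id2 K ii \<star> \<phi> = \<phi>"
    by (simp_all)
  have "bar_cell \<phi> \<bullet> iota_cell ?x ?b \<in> cells K (ii \<cdot> ?x) (ii \<cdot> ?y)"
    "id2 K d \<star> (bar_cell \<phi> \<bullet> iota_cell ?x ?b) = \<phi>" "id2 K c \<star> (bar_cell \<phi> \<bullet> iota_cell ?x ?b) = ?b"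
    "id2 K ii \<star> \<phi> \<in> cells K (ii \<cdot> ?x) (ii \<cdot> ?y)"
    by (simp_all add: cells_def)
  with ex A(1,2) have "bar_cell \<phi> \<bullet> iota_cell ?x ?b = id2 K ii \<star> \<phi>" by blast
  then have "id2 K z \<star> (bar_cell \<phi> \<bullet> iota_cell ?x ?b) = \<phi>" using A(3) by simp
  then show ?thesis unfolding bar_def iota_def by simp
qed

end

text \<open>\<open>compat\<close> demands that \<open>m\<close> commute strictly with the actions,
  where the induced map on comma objects pairs \<open>m d\<close> with \<open>g\<close>
  \<beta>\<open>0\<close>. Consequently \<open>m\<close> preserves push-forwards, opcartesian lifts
  and vertical parts as equalities, and no coherence cells arise later.\<close>

locale push_map = D: pushing K \<pi> d c \<beta>0 z + D': pushing K \<pi>' d' c' \<beta>0' z'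
  for K :: "('o, 'f, 't) two_cat" (structure) and \<pi> d c \<beta>0 z \<pi>' d' c' \<beta>0' z' +
  fixes m g :: 'f
  assumes m0: "m \<in> hom K (src K \<pi>) (src K \<pi>')" and g0: "g \<in> hom K (tgt K \<pi>) (tgt K \<pi>')"
    and \<pi>m: "\<pi>' \<cdot> m = g \<cdot> \<pi>" and compat: "m \<cdot> z = z' \<cdot> D'.tup (m \<cdot> d) (id2 K g \<star> \<beta>0)"
begin

lemma m_facts [simp]: "m \<in> Mor K" "src K m = src K \<pi>" "tgt K m = src K \<pi>'"
  "g \<in> Mor K" "src K g = tgt K \<pi>" "tgt K g = tgt K \<pi>'"
  using m0 g0 by (auto simp: hom_def)

lemma \<pi>m': "x \<in> Mor K \<Longrightarrow> tgt K x = src K \<pi> \<Longrightarrow> \<pi>' \<cdot> m \<cdot> x = g \<cdot> \<pi> \<cdot> x"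
  using D.cmp_assoc'[of x m \<pi>'] D.cmp_assoc'[of x \<pi> g] \<pi>m by simp

lemma \<pi>m_cell: "\<alpha> \<in> Cell K \<Longrightarrow> tgt K (dom2 K \<alpha>) = src K \<pi> \<Longrightarrow> id2 K \<pi>' \<star> id2 K m \<star> \<alpha> = id2 K g \<star> id2 K \<pi> \<star> \<alpha>"
  using \<pi>m by simp

definition n where "n = D'.tup (m \<cdot> d) (id2 K g \<star> \<beta>0)"

lemma n [simp]: "n \<in> Mor K" "src K n = src K d" "tgt K n = src K d'"
  "d' \<cdot> n = m \<cdot> d" "c' \<cdot> n = g \<cdot> c" "\<beta>0' \<star> id2 K n = id2 K g \<star> \<beta>0" "z' \<cdot> n = m \<cdot> z"
  unfolding n_def using compat by (simp_all add: \<pi>m')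

lemma n' : assumes "x \<in> Mor K" "tgt K x = src K d"
  shows "d' \<cdot> n \<cdot> x = m \<cdot> d \<cdot> x" "c' \<cdot> n \<cdot> x = g \<cdot> c \<cdot> x" "\<beta>0' \<star> id2 K (n \<cdot> x) = id2 K g \<star> \<beta>0 \<star> id2 K x" "z' \<cdot> n \<cdot> x = m \<cdot> z \<cdot> x"
  using assms D.cmp_assoc'[of x n d'] D.cmp_assoc'[of x n c'] D.cmp_assoc'[of x n z']
    D.hcmp_assoc'[of "id2 K x" "id2 K n" \<beta>0'] by simp_all

lemma n_tup:
  assumes "x \<in> Mor K" "tgt K x = src K \<pi>" "\<beta> \<in> Cell K" "dom2 K \<beta> = \<pi> \<cdot> x"
  shows "n \<cdot> D.tup x \<beta> = D'.tup (m \<cdot> x) (id2 K g \<star> \<beta>)"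
proof -
  have [simp]: "tgt K (cod2 K \<beta>) = tgt K \<pi>" "src K (cod2 K \<beta>) = src K x"
    using D.Cell_facts(3,4)[OF assms(3)] assms by simp_all
  show ?thesis by (rule D'.tup_unique) (use assms in \<open>simp_all add: n' \<pi>m'\<close>)
qed

lemma m_pu:
  assumes "x \<in> Mor K" "tgt K x = src K \<pi>" "\<beta> \<in> Cell K" "dom2 K \<beta> = \<pi> \<cdot> x"
  shows "m \<cdot> D.pu x \<beta> = D'.pu (m \<cdot> x) (id2 K g \<star> \<beta>)"
  unfolding D'.pu_def n_tup[OF assms, symmetric] D.pu_def using assms by (simp add: n')

lemma n_ii: "n \<cdot> D.ii = D'.ii \<cdot> m"
  using n_tup[of "one K (src K \<pi>)" "id2 K \<pi>"] D'.tup_id[of m] by (simp add: D.ii_def[symmetric] \<pi>m)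

lemma n_ii': "x \<in> Mor K \<Longrightarrow> tgt K x = src K \<pi> \<Longrightarrow> n \<cdot> D.ii \<cdot> x = D'.ii \<cdot> m \<cdot> x"
  using D.cmp_assoc'[of x D.ii n] D.cmp_assoc'[of x m D'.ii] n_ii by simp

lemma n_cell: assumes "\<delta> \<in> Cell K" "tgt K (dom2 K \<delta>) = src K d"
  shows "id2 K d' \<star> id2 K n \<star> \<delta> = id2 K m \<star> id2 K d \<star> \<delta>" "id2 K c' \<star> id2 K n \<star> \<delta> = id2 K g \<star> id2 K c \<star> \<delta>"
    "id2 K z' \<star> id2 K n \<star> \<delta> = id2 K m \<star> id2 K z \<star> \<delta>"
  using assms by simp_all

text \<open>The map \<open>n\<close> on comma objects sends the defining cell of one lift to a cell
  with the projections that define the other; uniqueness identifies them. The same argument gives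
  \<open>m_bar\<close>.\<close>

lemma m_iota:
  assumes a: "x \<in> Mor K" "tgt K x = src K \<pi>" "\<beta> \<in> Cell K" "dom2 K \<beta> = \<pi> \<cdot> x"
  shows "id2 K m \<star> D.iota x \<beta> = D'.iota (m \<cdot> x) (id2 K g \<star> \<beta>)"
proof -
  note [simp] = a D.iota_cell[OF a]
  have a': "m \<cdot> x \<in> Mor K" "tgt K (m \<cdot> x) = src K \<pi>'" "id2 K g \<star> \<beta> \<in> Cell K" "dom2 K (id2 K g \<star> \<beta>) = \<pi>' \<cdot> m \<cdot> x"
    by (simp_all add: \<pi>m')
  have "id2 K n \<star> D.iota_cell x \<beta> \<in> cells K (D'.ii \<cdot> m \<cdot> x) (D'.tup (m \<cdot> x) (id2 K g \<star> \<beta>))"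
     by (simp add: cells_def n_ii' n_tup)
  moreover have "id2 K d' \<star> id2 K n \<star> D.iota_cell x \<beta> = id2 K (m \<cdot> x)" by (subst n_cell) simp_all
  moreover have "id2 K c' \<star> id2 K n \<star> D.iota_cell x \<beta> = id2 K g \<star> \<beta>" by (subst n_cell) simp_all
  ultimately have "id2 K n \<star> D.iota_cell x \<beta> = D'.iota_cell (m \<cdot> x) (id2 K g \<star> \<beta>)"
    using D'.iota_cell_ex[OF a'] D'.iota_cell[OF a'] unfolding cells_def by blast
  then have "id2 K z' \<star> id2 K n \<star> D.iota_cell x \<beta> = D'.iota (m \<cdot> x) (id2 K g \<star> \<beta>)" unfolding D'.iota_def by simp
  then show ?thesis unfolding D.iota_def by (subst (asm) n_cell) simp_all
qed

lemma m_bar: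
  assumes a: "\<phi> \<in> Cell K" "tgt K (dom2 K \<phi>) = src K \<pi>"
  shows "id2 K m \<star> D.bar \<phi> = D'.bar (id2 K m \<star> \<phi>)"
proof -
  note [simp] = a D.bar_cell[OF a]
  have a': "id2 K m \<star> \<phi> \<in> Cell K" "tgt K (dom2 K (id2 K m \<star> \<phi>)) = src K \<pi>'" by simp_all
  have "id2 K n \<star> D.bar_cell \<phi> \<in> cells K (D'.tup (dom2 K (id2 K m \<star> \<phi>)) (id2 K \<pi>' \<star> id2 K m \<star> \<phi>)) (D'.ii \<cdot> cod2 K (id2 K m \<star> \<phi>))"
    unfolding \<pi>m_cell[OF a] by (simp add: cells_def n_ii' n_tup)
  moreover have "id2 K d' \<star> id2 K n \<star> D.bar_cell \<phi> = id2 K m \<star> \<phi>" by (subst n_cell) simp_all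
  moreover have "id2 K c' \<star> id2 K n \<star> D.bar_cell \<phi> = id2 K (\<pi>' \<cdot> cod2 K (id2 K m \<star> \<phi>))"
    by (subst n_cell) (simp_all add: \<pi>m')
  ultimately have "id2 K n \<star> D.bar_cell \<phi> = D'.bar_cell (id2 K m \<star> \<phi>)"
    using D'.bar_cell_ex[OF a'] D'.bar_cell[OF a'] unfolding cells_def by blast
  then have "id2 K z' \<star> id2 K n \<star> D.bar_cell \<phi> = D'.bar (id2 K m \<star> \<phi>)" unfolding D'.bar_def by simp
  then show ?thesis unfolding D.bar_def by (subst (asm) n_cell) simp_all
qed

end

text \<open>
  \<open>S \<rightarrow> T\<close> is a transformation over \<open>g\<close> with components \<open>kX\<close>, \<open>kY\<close>, and \<open>Sf\<close>, \<open>Tf\<close> are the values at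
  \<open>X \<rightarrow> Y\<close>.  A 2-cell \<open>\<phi> : Tf x \<Rightarrow> kY y\<close> is factored by pushing \<open>x\<close> forward along the image of
  \<open>\<phi>\<close> in the base and lifting the result through \<open>kX\<close>.
\<close>

theorem factoring_square_pushing:
  fixes K :: "('o, 'f, 't) two_cat" (structure)
  assumes Tf: "push_map K \<pi>x dx cx bx zx \<pi>y dy cy by zy Tf (one K (tgt K \<pi>x))"
    and Sf: "push_map K \<pi>x' dx' cx' bx' zx' \<pi>y' dy' cy' by' zy' Sf (one K (tgt K \<pi>x'))"
    and kX: "push_map K \<pi>x' dx' cx' bx' zx' \<pi>x dx cx bx zx kX g"
    and kY: "push_map K \<pi>y' dy' cy' by' zy' \<pi>y dy cy by zy kY g"
    and sq: "Tf \<cdot> kX = kY \<cdot> Sf"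
    and lift: "\<And>v b y \<omega>. v \<in> Mor K \<Longrightarrow> tgt K v = src K \<pi>x \<Longrightarrow> b \<in> Mor K \<Longrightarrow> tgt K b = tgt K \<pi>x' \<Longrightarrow> src K b = src K v \<Longrightarrow>
       \<pi>x \<cdot> v = g \<cdot> b \<Longrightarrow> y \<in> Mor K \<Longrightarrow> src K y = src K v \<Longrightarrow> tgt K y = src K \<pi>y' \<Longrightarrow> \<pi>y' \<cdot> y = b \<Longrightarrow>
       \<omega> \<in> cells K (Tf \<cdot> v) (kY \<cdot> y) \<Longrightarrow> id2 K \<pi>y \<star> \<omega> = id2 K (g \<cdot> b) \<Longrightarrow>
       \<exists>\<rho>. \<rho> \<in> Mor K \<and> src K \<rho> = src K v \<and> tgt K \<rho> = src K \<pi>x' \<and> kX \<cdot> \<rho> = v \<and> \<pi>x' \<cdot> \<rho> = b"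
    and unique: "\<And>\<rho> \<rho>'. \<rho> \<in> Mor K \<Longrightarrow> \<rho>' \<in> Mor K \<Longrightarrow> src K \<rho> = src K \<rho>' \<Longrightarrow> tgt K \<rho> = src K \<pi>x' \<Longrightarrow> tgt K \<rho>' = src K \<pi>x' \<Longrightarrow>
       kX \<cdot> \<rho> = kX \<cdot> \<rho>' \<Longrightarrow> \<pi>x' \<cdot> \<rho> = \<pi>x' \<cdot> \<rho>' \<Longrightarrow> \<rho> = \<rho>'"
    and vert: "\<And>y y' \<omega>. y \<in> Mor K \<Longrightarrow> y' \<in> Mor K \<Longrightarrow> src K y = src K y' \<Longrightarrow> tgt K y = src K \<pi>y' \<Longrightarrow> tgt K y' = src K \<pi>y' \<Longrightarrow>
       \<pi>y' \<cdot> y = \<pi>y' \<cdot> y' \<Longrightarrow> \<omega> \<in> cells K (kY \<cdot> y) (kY \<cdot> y') \<Longrightarrow> id2 K \<pi>y \<star> \<omega> = id2 K (\<pi>y \<cdot> kY \<cdot> y') \<Longrightarrow>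
       \<exists>!\<omega>'. \<omega>' \<in> cells K y y' \<and> id2 K \<pi>y' \<star> \<omega>' = id2 K (\<pi>y' \<cdot> y') \<and> id2 K kY \<star> \<omega>' = \<omega>"
  shows "factoring_square K Tf kY kX Sf"
proof -
  interpret Tf: push_map K \<pi>x dx cx bx zx \<pi>y dy cy "by" zy Tf "one K (tgt K \<pi>x)" by (rule Tf)
  interpret Sf: push_map K \<pi>x' dx' cx' bx' zx' \<pi>y' dy' cy' by' zy' Sf "one K (tgt K \<pi>x')" by (rule Sf)
  interpret kX: push_map K \<pi>x' dx' cx' bx' zx' \<pi>x dx cx bx zx kX g by (rule kX)
  interpret kY: push_map K \<pi>y' dy' cy' by' zy' \<pi>y dy cy "by" zy kY g by (rule kY)
  have B [simp]: "tgt K \<pi>y = tgt K \<pi>x" "tgt K \<pi>y' = tgt K \<pi>x'"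
    using Tf.m_facts(6) Tf.D.one_facts(3)[OF Tf.D.com_facts(15)] Sf.m_facts(6) Tf.D.one_facts(3)[OF Sf.D.com_facts(15)] by metis+
  have sq': "Tf \<cdot> kX \<cdot> w = kY \<cdot> Sf \<cdot> w" if "w \<in> Mor K" "tgt K w = src K \<pi>x'" for w
    using that Tf.D.cmp_assoc'[of w kX Tf] Tf.D.cmp_assoc'[of w Sf kY] sq by simp
  have sqc: "id2 K Tf \<star> id2 K kX \<star> w = id2 K kY \<star> id2 K Sf \<star> w" if "w \<in> Cell K" "tgt K (dom2 K w) = src K \<pi>x'" for w
    using that sq by simp
  show ?thesis unfolding factoring_square_def
  proof (intro conjI ballI)
    show "\<exists>P. kX \<in> hom K P (src K Tf) \<and> Sf \<in> hom K P (src K kY)" by (auto simp: hom_def)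
    fix W x y \<phi> assume W: "W \<in> Ob K" and x: "x \<in> hom K W (src K Tf)" and y: "y \<in> hom K W (src K kY)" and phi: "\<phi> \<in> cells K (Tf \<cdot> x) (kY \<cdot> y)"
    have tx [simp]: "x \<in> Mor K" "src K x = W" "tgt K x = src K \<pi>x" using x by (simp_all add: hom_def)
    have ty [simp]: "y \<in> Mor K" "src K y = W" "tgt K y = src K \<pi>y'" using y by (simp_all add: hom_def)
    have tphi [simp]: "\<phi> \<in> Cell K" "dom2 K \<phi> = Tf \<cdot> x" "cod2 K \<phi> = kY \<cdot> y" using phi by (simp_all add: cells_def)
    have \<pi>T [simp]: "\<pi>y \<cdot> Tf \<cdot> w = \<pi>x \<cdot> w" if "w \<in> Mor K" "tgt K w = src K \<pi>x" for w using Tf.\<pi>m'[OF that] that by simp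
    have \<pi>S [simp]: "\<pi>y' \<cdot> Sf \<cdot> w = \<pi>x' \<cdot> w" if "w \<in> Mor K" "tgt K w = src K \<pi>x'" for w using Sf.\<pi>m'[OF that] that by simp
    define \<beta> where "\<beta> = id2 K \<pi>y \<star> \<phi>"
    have \<beta> [simp]: "\<beta> \<in> Cell K" "dom2 K \<beta> = \<pi>x \<cdot> x" "cod2 K \<beta> = g \<cdot> \<pi>y' \<cdot> y" unfolding \<beta>_def by (simp_all add: kY.\<pi>m')
    \<comment> \<open>The push-forward moves \<open>x\<close> into the part of \<open>Tf\<close>'s
      source lying over \<open>g b\<close>, where \<open>b\<close> is the base of \<open>y\<close>;
      only there can it come from \<open>kX\<close>.\<close>
    define v where "v = Tf.D.pu x \<beta>"
    have v [simp]: "v \<in> Mor K" "src K v = W" "tgt K v = src K \<pi>x" "\<pi>x \<cdot> v = g \<cdot> \<pi>y' \<cdot> y" unfolding v_def by simp_all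
    have Tv: "Tf \<cdot> v = Tf.D'.pu (Tf \<cdot> x) \<beta>" unfolding v_def by (subst Tf.m_pu) simp_all
    define \<chi> where "\<chi> = Tf.D.iota x \<beta>"
    have \<chi> [simp]: "\<chi> \<in> Cell K" "dom2 K \<chi> = x" "cod2 K \<chi> = v" unfolding \<chi>_def v_def by simp_all
    have T\<chi>: "id2 K Tf \<star> \<chi> = Tf.D'.iota (Tf \<cdot> x) \<beta>" unfolding \<chi>_def by (subst Tf.m_iota) simp_all
    define \<omega>T where "\<omega>T = Tf.D'.bar \<phi>"
    have \<omega>T [simp]: "\<omega>T \<in> Cell K" "dom2 K \<omega>T = Tf \<cdot> v" "cod2 K \<omega>T = kY \<cdot> y" "id2 K \<pi>y \<star> \<omega>T = id2 K (g \<cdot> \<pi>y' \<cdot> y)"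
      unfolding \<omega>T_def by (simp_all add: Tv \<beta>_def kY.\<pi>m')
    have fac: "\<omega>T \<bullet> (id2 K Tf \<star> \<chi>) = \<phi>" using Tf.D'.bar_iota[of \<phi>] unfolding T\<chi> \<omega>T_def \<beta>_def by simp
    \<comment> \<open>The vertical part of \<phi> connects the image of \<open>v\<close> with
      \<open>kY y\<close>, and this connection is what \<open>lift\<close> asks for.\<close>
    obtain \<rho> where rho [simp]: "\<rho> \<in> Mor K" "src K \<rho> = W" "tgt K \<rho> = src K \<pi>x'" "kX \<cdot> \<rho> = v" "\<pi>x' \<cdot> \<rho> = \<pi>y' \<cdot> y"
      using lift[of v "\<pi>y' \<cdot> y" y \<omega>T] by (auto simp: cells_def)
    have kS: "kY \<cdot> Sf \<cdot> \<rho> = Tf \<cdot> v" using sq'[of \<rho>] by simp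
    \<comment> \<open>The vertical part of \<phi> has both ends in the image of \<open>kY\<close>,
      so \<open>vert\<close> lifts it.\<close>
    obtain \<omega> where om0: "\<omega> \<in> cells K (Sf \<cdot> \<rho>) y" and om [simp]: "id2 K \<pi>y' \<star> \<omega> = id2 K (\<pi>y' \<cdot> y)" "id2 K kY \<star> \<omega> = \<omega>T"
    proof -
      have "\<exists>!\<omega>'. \<omega>' \<in> cells K (Sf \<cdot> \<rho>) y \<and> id2 K \<pi>y' \<star> \<omega>' = id2 K (\<pi>y' \<cdot> y) \<and> id2 K kY \<star> \<omega>' = \<omega>T"
        by (rule vert) (simp_all add: cells_def kS kY.\<pi>m')
      then show thesis using that by blast
    qed
    have om' [simp]: "\<omega> \<in> Cell K" "dom2 K \<omega> = Sf \<cdot> \<rho>" "cod2 K \<omega> = y" using om0 by (simp_all add: cells_def)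
    show "\<exists>\<rho>\<in>hom K W (src K kX). \<exists>\<chi>\<in>cells K x (kX \<cdot> \<rho>). \<exists>\<omega>\<in>cells K (Sf \<cdot> \<rho>) y.
          (id2 K kY \<star> \<omega>) \<bullet> (id2 K Tf \<star> \<chi>) = \<phi> \<and>
          (\<forall>V\<in>Ob K. \<forall>t\<in>hom K V W. \<forall>\<rho>'\<in>hom K V (src K kX). \<forall>\<omega>'\<in>cells K (Sf \<cdot> \<rho>') (y \<cdot> t).
             x \<cdot> t = kX \<cdot> \<rho>' \<and> id2 K kY \<star> \<omega>' = \<phi> \<star> id2 K t \<longrightarrow>
             (\<exists>\<kappa>\<in>cells K \<rho>' (\<rho> \<cdot> t). id2 K kX \<star> \<kappa> = \<chi> \<star> id2 K t \<and>
                (\<omega> \<star> id2 K t) \<bullet> (id2 K Sf \<star> \<kappa>) = \<omega>'))"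
    proof (rule bexI[of _ \<rho>], rule bexI[of _ \<chi>], rule bexI[of _ \<omega>], intro conjI ballI impI)
      show "(id2 K kY \<star> \<omega>) \<bullet> (id2 K Tf \<star> \<chi>) = \<phi>" using fac by simp
      show "\<rho> \<in> hom K W (src K kX)" "\<chi> \<in> cells K x (kX \<cdot> \<rho>)" "\<omega> \<in> cells K (Sf \<cdot> \<rho>) y" by (simp_all add: hom_def cells_def)
      fix V t \<rho>' \<omega>' assume a: "V \<in> Ob K" "t \<in> hom K V W" "\<rho>' \<in> hom K V (src K kX)" "\<omega>' \<in> cells K (Sf \<cdot> \<rho>') (y \<cdot> t)"
        "x \<cdot> t = kX \<cdot> \<rho>' \<and> id2 K kY \<star> \<omega>' = \<phi> \<star> id2 K t"
      have t [simp]: "t \<in> Mor K" "src K t = V" "tgt K t = W" using a(2) by (simp_all add: hom_def)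
      have r' [simp]: "\<rho>' \<in> Mor K" "src K \<rho>' = V" "tgt K \<rho>' = src K \<pi>x'" using a(3) by (simp_all add: hom_def)
      have o' [simp]: "\<omega>' \<in> Cell K" "dom2 K \<omega>' = Sf \<cdot> \<rho>'" "cod2 K \<omega>' = y \<cdot> t" using a(4) by (simp_all add: cells_def)
      have xt: "kX \<cdot> \<rho>' = x \<cdot> t" and ko: "id2 K kY \<star> \<omega>' = \<phi> \<star> id2 K t" using a(5) by simp_all
      define \<beta>1 where "\<beta>1 = id2 K \<pi>y' \<star> \<omega>'"
      have b1 [simp]: "\<beta>1 \<in> Cell K" "dom2 K \<beta>1 = \<pi>x' \<cdot> \<rho>'" "cod2 K \<beta>1 = \<pi>y' \<cdot> y \<cdot> t" unfolding \<beta>1_def by simp_all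
      \<comment> \<open>The base part of a competing \<omega>' is a lift through \<open>g\<close> of
        the restricted base part of \<phi>. Pushing \<rho>' along it therefore corresponds under
        \<open>kX\<close> to pushing \<open>x t\<close>.\<close>
      have gb: "id2 K g \<star> \<beta>1 = \<beta> \<star> id2 K t"
      proof -
        have "id2 K g \<star> \<beta>1 = id2 K \<pi>y \<star> id2 K kY \<star> \<omega>'" unfolding \<beta>1_def by (rule kY.\<pi>m_cell[symmetric]) simp_all
        then show ?thesis unfolding ko \<beta>_def by simp
      qed
      have vt: "Tf.D.pu (x \<cdot> t) (\<beta> \<star> id2 K t) = v \<cdot> t" unfolding v_def by (rule Tf.D.pu_precomp) simp_all
      have 1: "kX \<cdot> Sf.D.pu \<rho>' \<beta>1 = v \<cdot> t"
        by (subst kX.m_pu) (simp_all add: xt gb vt)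
      have krt: "kX \<cdot> \<rho> \<cdot> t = v \<cdot> t" "\<pi>x' \<cdot> \<rho> \<cdot> t = \<pi>y' \<cdot> y \<cdot> t"
        using Tf.D.cmp_assoc'[of t \<rho> kX] Tf.D.cmp_assoc'[of t \<rho> \<pi>x'] by simp_all
      \<comment> \<open>Both 1-cells have image \<open>v t\<close> under \<open>kX\<close> and the
        same base. Hence the opcartesian lift of \<beta>\<open>1\<close> at \<rho>' ends at \<rho>
        \<open>t\<close> and can serve as \<kappa>.\<close>
      have pu [simp]: "Sf.D.pu \<rho>' \<beta>1 = \<rho> \<cdot> t"
        by (rule unique) (simp_all add: 1 krt)
      define \<kappa> where "\<kappa> = Sf.D.iota \<rho>' \<beta>1"
      have k [simp]: "\<kappa> \<in> Cell K" "dom2 K \<kappa> = \<rho>'" "cod2 K \<kappa> = \<rho> \<cdot> t" unfolding \<kappa>_def by simp_all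
      have kk: "id2 K kX \<star> \<kappa> = \<chi> \<star> id2 K t"
        unfolding \<kappa>_def \<chi>_def by (subst kX.m_iota, simp_all add: xt gb) (rule Tf.D.iota_precomp, simp_all)
      have Sk: "id2 K Sf \<star> \<kappa> = Sf.D'.iota (Sf \<cdot> \<rho>') \<beta>1" unfolding \<kappa>_def by (subst Sf.m_iota) simp_all
      have Spu: "Sf.D'.pu (Sf \<cdot> \<rho>') \<beta>1 = Sf \<cdot> \<rho> \<cdot> t"
        using Sf.m_pu[of \<rho>' \<beta>1] by simp
      \<comment> \<open>The vertical part of \<omega>' and the restriction of \<omega> have the same
        image under \<open>kY\<close>, since \<open>kY\<close> preserves vertical parts;
        \<open>vert\<close> gives equality.\<close>
      have bar: "Sf.D'.bar \<omega>' = \<omega> \<star> id2 K t"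
      proof -
        have b: "\<phi> \<star> id2 K t \<in> Cell K" by simp
        have kb: "id2 K kY \<star> Sf.D'.bar \<omega>' = \<omega>T \<star> id2 K t"
          by (subst kY.m_bar, simp_all add: ko) (unfold \<omega>T_def, rule Tf.D'.bar_precomp, simp_all)
        have ex: "\<exists>!\<omega>''. \<omega>'' \<in> cells K (Sf \<cdot> \<rho> \<cdot> t) (y \<cdot> t) \<and> id2 K \<pi>y' \<star> \<omega>'' = id2 K (\<pi>y' \<cdot> y \<cdot> t) \<and> id2 K kY \<star> \<omega>'' = \<omega>T \<star> id2 K t"
        proof (rule vert)
          show "\<pi>y' \<cdot> Sf \<cdot> \<rho> \<cdot> t = \<pi>y' \<cdot> y \<cdot> t" using Tf.D.cmp_assoc'[of t \<rho> \<pi>x'] by simp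
          have "kY \<cdot> Sf \<cdot> \<rho> \<cdot> t = Tf \<cdot> v \<cdot> t" using Tf.D.cmp_assoc'[of t "Sf \<cdot> \<rho>" kY] kS by simp
          then show "\<omega>T \<star> id2 K t \<in> cells K (kY \<cdot> Sf \<cdot> \<rho> \<cdot> t) (kY \<cdot> y \<cdot> t)" by (simp add: cells_def)
          show "id2 K \<pi>y \<star> \<omega>T \<star> id2 K t = id2 K (\<pi>y \<cdot> kY \<cdot> y \<cdot> t)"
            using Tf.D.hcmp_assoc'[of "id2 K t" \<omega>T "id2 K \<pi>y"] by (simp add: kY.\<pi>m')
        qed simp_all
        have "id2 K \<pi>y' \<star> \<omega> \<star> id2 K t = id2 K (\<pi>y' \<cdot> y \<cdot> t)" "id2 K kY \<star> \<omega> \<star> id2 K t = \<omega>T \<star> id2 K t"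
          using Tf.D.hcmp_assoc'[of "id2 K t" \<omega> "id2 K \<pi>y'"] Tf.D.hcmp_assoc'[of "id2 K t" \<omega> "id2 K kY"] by simp_all
        moreover have "\<omega> \<star> id2 K t \<in> cells K (Sf \<cdot> \<rho> \<cdot> t) (y \<cdot> t)" by (simp add: cells_def)
        moreover have "Sf.D'.bar \<omega>' \<in> cells K (Sf \<cdot> \<rho> \<cdot> t) (y \<cdot> t)" using Spu unfolding \<beta>1_def by (simp add: cells_def)
        moreover have "id2 K \<pi>y' \<star> Sf.D'.bar \<omega>' = id2 K (\<pi>y' \<cdot> y \<cdot> t)" by simp
        ultimately show ?thesis using ex kb by blast
      qed
      have "(\<omega> \<star> id2 K t) \<bullet> (id2 K Sf \<star> \<kappa>) = \<omega>'"
        using Sf.D'.bar_iota[of \<omega>'] unfolding bar Sk \<beta>1_def by simp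
      then show "\<exists>\<kappa>\<in>cells K \<rho>' (\<rho> \<cdot> t). id2 K kX \<star> \<kappa> = \<chi> \<star> id2 K t \<and> (\<omega> \<star> id2 K t) \<bullet> (id2 K Sf \<star> \<kappa>) = \<omega>'"
        using kk by (intro bexI[of _ \<kappa>]) (simp_all add: cells_def)
    qed
  qed (simp_all add: sq)
qed

section \<open>Elements of polynomials\<close>

definition has_pullbacks :: "('o, 'f, 't) two_cat \<Rightarrow> bool" where
  "has_pullbacks K \<longleftrightarrow> (\<forall>f\<in>Mor K. \<forall>g\<in>Mor K. tgt K f = tgt K g \<longrightarrow> (\<exists>p q. pullback K f g p q))"

context twocat begin

lemma pullback_facts:
  assumes "pullback K f g p q"
  shows "f \<in> Mor K" "g \<in> Mor K" "tgt K g = tgt K f" "p \<in> Mor K" "tgt K p = src K f" "q \<in> Mor K" "src K q = src K p" "tgt K q = src K g"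
    "f \<cdot> p = g \<cdot> q"
proof -
  obtain P where P: "p \<in> hom K P (src K f)" "q \<in> hom K P (src K g)" "f \<cdot> p = g \<cdot> q" "f \<in> Mor K" "g \<in> Mor K" "tgt K f = tgt K g"
    using assms unfolding pullback_def by blast
  then show "f \<in> Mor K" "g \<in> Mor K" "tgt K g = tgt K f" "p \<in> Mor K" "tgt K p = src K f" "q \<in> Mor K" "src K q = src K p" "tgt K q = src K g"
    "f \<cdot> p = g \<cdot> q" by (simp_all add: hom_def)
qed

lemma pullback_sq:
  assumes "pullback K f g p q" "w \<in> Mor K" "tgt K w = src K p"
  shows "f \<cdot> p \<cdot> w = g \<cdot> q \<cdot> w"
  using pullback_facts[OF assms(1)] assms cmp_assoc'[of w p f] cmp_assoc'[of w q g] by simp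

lemma pullback_ex1:
  assumes pb: "pullback K f g p q" and u: "u \<in> Mor K" "tgt K u = src K f" and v: "v \<in> Mor K" "tgt K v = src K g" "src K v = src K u"
    and eq: "f \<cdot> u = g \<cdot> v"
  shows "\<exists>!w. w \<in> hom K (src K u) (src K p) \<and> p \<cdot> w = u \<and> q \<cdot> w = v"
proof -
  obtain P where P: "p \<in> hom K P (src K f)" and
   up: "\<forall>W\<in>Ob K. \<forall>u\<in>hom K W (src K f). \<forall>v\<in>hom K W (src K g). f \<cdot> u = g \<cdot> v \<longrightarrow>
          (\<exists>!w. w \<in> hom K W P \<and> p \<cdot> w = u \<and> q \<cdot> w = v)"
    using pb unfolding pullback_def by blast
  have "P = src K p" using P by (simp add: hom_def)
  then show ?thesis
    using up[THEN bspec, THEN bspec, THEN bspec, THEN mp, of "src K u" u v] u v eq Mor_facts[of u] by (simp add: hom_def)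
qed

lemma pullback_cell_ex1:
  assumes pb: "pullback K f g p q" and w: "w \<in> Mor K" "tgt K w = src K p" and w': "w' \<in> Mor K" "tgt K w' = src K p"
    and a: "\<alpha> \<in> cells K (p \<cdot> w) (p \<cdot> w')" and b: "\<beta> \<in> cells K (q \<cdot> w) (q \<cdot> w')" and eq: "id2 K f \<star> \<alpha> = id2 K g \<star> \<beta>"
  shows "\<exists>!\<gamma>. \<gamma> \<in> cells K w w' \<and> id2 K p \<star> \<gamma> = \<alpha> \<and> id2 K q \<star> \<gamma> = \<beta>"
proof -
  obtain P where P: "p \<in> hom K P (src K f)" and
   up: "\<forall>W\<in>Ob K. \<forall>w\<in>hom K W P. \<forall>w'\<in>hom K W P.
          \<forall>\<alpha>\<in>cells K (p \<cdot> w) (p \<cdot> w'). \<forall>\<beta>\<in>cells K (q \<cdot> w) (q \<cdot> w').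
          id2 K f \<star> \<alpha> = id2 K g \<star> \<beta> \<longrightarrow>
          (\<exists>!\<gamma>. \<gamma> \<in> cells K w w' \<and> id2 K p \<star> \<gamma> = \<alpha> \<and> id2 K q \<star> \<gamma> = \<beta>)"
    using pb unfolding pullback_def by blast
  have [simp]: "p \<in> Mor K" using P by (simp add: hom_def)
  have P': "P = src K p" using P by (simp add: hom_def)
  have A: "\<alpha> \<in> Cell K" "dom2 K \<alpha> = p \<cdot> w" "cod2 K \<alpha> = p \<cdot> w'" using a by (simp_all add: cells_def)
  have s: "src K w' = src K w" using Cell_facts(3)[OF A(1)] w w' unfolding A by simp
  have W: "src K w \<in> Ob K" "w \<in> hom K (src K w) P" "w' \<in> hom K (src K w) P" using w w' s P' by (simp_all add: hom_def)
  show ?thesis by (rule up[THEN bspec, THEN bspec, THEN bspec, THEN bspec, THEN bspec, THEN mp, OF W a b eq])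
qed

lemma pullback_cell_eq:
  assumes pb: "pullback K f g p q" and g: "\<gamma> \<in> Cell K" "\<gamma>' \<in> Cell K" "dom2 K \<gamma> = dom2 K \<gamma>'" "cod2 K \<gamma> = cod2 K \<gamma>'" "tgt K (dom2 K \<gamma>') = src K p"
    and eq: "id2 K p \<star> \<gamma> = id2 K p \<star> \<gamma>'" "id2 K q \<star> \<gamma> = id2 K q \<star> \<gamma>'"
  shows "\<gamma> = \<gamma>'"
proof -
  note [simp] = pullback_facts[OF pb] g
  have sq: "id2 K f \<star> id2 K p \<star> \<gamma>' = id2 K g \<star> id2 K q \<star> \<gamma>'" by simp
  have t: "tgt K (cod2 K \<gamma>') = src K p" using Cell_facts(4)[OF g(2)] by simp
  have "\<exists>!\<delta>. \<delta> \<in> cells K (dom2 K \<gamma>') (cod2 K \<gamma>') \<and> id2 K p \<star> \<delta> = id2 K p \<star> \<gamma>' \<and> id2 K q \<star> \<delta> = id2 K q \<star> \<gamma>'"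
    by (rule pullback_cell_ex1[OF pb _ _ _ _ _ _ sq]) (simp_all add: cells_def t)
  then show ?thesis using eq g unfolding cells_def by blast
qed

lemma pullback_eq:
  assumes pb: "pullback K f g p q" and w: "w \<in> Mor K" "tgt K w = src K p" and w': "w' \<in> Mor K" "tgt K w' = src K p" "src K w = src K w'"
    and eq: "p \<cdot> w = p \<cdot> w'" "q \<cdot> w = q \<cdot> w'"
  shows "w = w'"
proof -
  note [simp] = pullback_facts[OF pb] w w'
  have "\<exists>!v. v \<in> hom K (src K (p \<cdot> w')) (src K p) \<and> p \<cdot> v = p \<cdot> w' \<and> q \<cdot> v = q \<cdot> w'"
    by (rule pullback_ex1[OF pb]) (simp_all add: pullback_sq[OF pb])
  moreover have "w \<in> hom K (src K (p \<cdot> w')) (src K p)" "w' \<in> hom K (src K (p \<cdot> w')) (src K p)" by (simp_all add: hom_def)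
  ultimately show ?thesis using eq by blast
qed

end

locale pullbacks = twocat K for K :: "('o, 'f, 't) two_cat" (structure) +
  assumes hp: "has_pullbacks K"
begin

lemma pb_pullback:
  assumes "f \<in> Mor K" "g \<in> Mor K" "tgt K g = tgt K f"
  shows "pullback K f g (pb1 K f g) (pb2 K f g)"
proof -
  obtain a b where "pullback K f g a b"
    using hp[unfolded has_pullbacks_def, THEN bspec, THEN bspec, THEN mp, OF assms(1,2) assms(3)[symmetric]] by blast
  then have "\<exists>pq. pullback K f g (fst pq) (snd pq)" by (intro exI[of _ "(a, b)"]) simp
  then show ?thesis unfolding pb_def by (rule someI_ex)
qed

lemma pb_facts [simp]:
  assumes "f \<in> Mor K" "g \<in> Mor K" "tgt K g = tgt K f"
  shows "pb1 K f g \<in> Mor K" "tgt K (pb1 K f g) = src K f" "pb2 K f g \<in> Mor K" "src K (pb2 K f g) = src K (pb1 K f g)"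
    "tgt K (pb2 K f g) = src K g"
  using pullback_facts[OF pb_pullback[OF assms]] by simp_all

lemma pb_sq:
  assumes "f \<in> Mor K" "g \<in> Mor K" "tgt K g = tgt K f"
  shows "g \<cdot> pb2 K f g = f \<cdot> pb1 K f g"
  using pullback_facts[OF pb_pullback[OF assms]] by simp

lemma pb_sq':
  assumes "f \<in> Mor K" "g \<in> Mor K" "tgt K g = tgt K f" "w \<in> Mor K" "tgt K w = src K (pb1 K f g)"
  shows "g \<cdot> pb2 K f g \<cdot> w = f \<cdot> pb1 K f g \<cdot> w"
  using pullback_sq[OF pb_pullback[OF assms(1-3)] assms(4,5)] by simp

lemma pb_pair [simp]:
  assumes "f \<in> Mor K" "g \<in> Mor K" "tgt K g = tgt K f" "u \<in> Mor K" "tgt K u = src K f" "v \<in> Mor K" "tgt K v = src K g" "src K v = src K u"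
    "f \<cdot> u = g \<cdot> v"
  shows "pb_pair K f g u v \<in> Mor K" "src K (pb_pair K f g u v) = src K u" "tgt K (pb_pair K f g u v) = src K (pb1 K f g)"
    "pb1 K f g \<cdot> pb_pair K f g u v = u" "pb2 K f g \<cdot> pb_pair K f g u v = v"
  using theI'[OF pullback_ex1[OF pb_pullback[OF assms(1-3)] assms(4-9)], folded pb_pair_def] by (simp_all add: hom_def)

lemma pb_pair_unique:
  assumes "f \<in> Mor K" "g \<in> Mor K" "tgt K g = tgt K f" "w \<in> Mor K" "tgt K w = src K (pb1 K f g)"
    "pb1 K f g \<cdot> w = u" "pb2 K f g \<cdot> w = v"
  shows "pb_pair K f g u v = w"
proof -
  have "pb_pair K f g (pb1 K f g \<cdot> w) (pb2 K f g \<cdot> w) = w"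
    by (rule pullback_eq[OF pb_pullback[OF assms(1-3)]]) (use assms(1-5) in \<open>simp_all add: pb_sq'\<close>)
  then show ?thesis using assms(6,7) by simp
qed

lemma pb_pair_precomp:
  assumes "f \<in> Mor K" "g \<in> Mor K" "tgt K g = tgt K f" "u \<in> Mor K" "tgt K u = src K f" "v \<in> Mor K" "tgt K v = src K g" "src K v = src K u"
    "f \<cdot> u = g \<cdot> v" "t \<in> Mor K" "tgt K t = src K u"
  shows "pb_pair K f g u v \<cdot> t = pb_pair K f g (u \<cdot> t) (v \<cdot> t)"
  by (rule pb_pair_unique[symmetric]) (use assms in \<open>simp_all add: cmp_assoc'[symmetric] del: cmp_assoc'\<close>)

end

locale polyn = pullbacks K for K :: "('o, 'f, 't) two_cat" (structure) +
  fixes P :: "'f poly" and I J :: 'o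
  assumes polynomial: "polynomial K I J P"
begin

abbreviation "p \<equiv> pp P"
abbreviation "s \<equiv> ps P"
abbreviation "E \<equiv> src K p"
abbreviation "B \<equiv> tgt K p"
abbreviation "R \<equiv> Pi_adj K p"
abbreviation "pr x \<equiv> poly_proj K P x"
abbreviation "ev x \<equiv> poly_ev K P x"
abbreviation "app x e z \<equiv> poly_app K P x e z"
abbreviation "dl x \<equiv> pb1 K s x"

lemma P_facts [simp]: "p \<in> Mor K" "s \<in> Mor K" "src K s = E" "tgt K s = I" "pt P \<in> Mor K" "src K (pt P) = B" "tgt K (pt P) = J"
  using polynomial unfolding polynomial_def exponentiable_def by (simp_all add: hom_def)

lemma Pi: "is_Pi_adj K p R"
  using polynomial someI_ex[of "is_Pi_adj K p"] unfolding polynomial_def exponentiable_def Pi_adj_def by blast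

text \<open>\<Pi> being a choice, \<open>pr\<close>, \<open>ev\<close> and \<open>app\<close> are
  controlled only through this adjunction between pullback along \<open>p\<close> and its right
  adjoint.\<close>

sublocale A: twoadj "slice K B" "slice K E" R
  by (rule twoadj.intro[OF twocat_slice twocat_slice twoadj_axioms.intro]) (use Pi in \<open>simp add: is_Pi_adj_def\<close>)

lemma ladj_R [simp]: "ladj R = Delta_fun K p" using Pi by (simp add: is_Pi_adj_def)

lemma Delta_simps [simp]: "onob (Delta_fun K f) y = pb1 K f y" "onmor (Delta_fun K f) (u, y) = (Delta_mor K f u y, pb1 K f y)"
  "oncell (Delta_fun K f) (\<alpha>, y) = (Delta_cell K f \<alpha> y, pb1 K f y)"
  by (simp_all add: Delta_fun_def)

lemma pr_def: "pr x = onob (radj R) (dl x)" by (simp add: poly_proj_def Pi_fun_def)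

context
  fixes x assumes x [simp]: "x \<in> Mor K" "tgt K x = I"
begin

lemma dl_Ob: "dl x \<in> Ob (slice K E)" by simp

lemma pr_facts [simp]: "pr x \<in> Mor K" "tgt K (pr x) = B"
  using A.rfun_facts(1)[OF dl_Ob] unfolding pr_def by simp_all

text \<open>The counit is a 1-cell of a slice and so a pair. Its first component goes from the
  pullback of \<open>E\<close> and the total object \<open>Z\<close> over \<open>B\<close> to the
  pullback of \<open>E\<close> and \<open>X\<close> over \<open>I\<close>, sending
  (\<open>e\<close>, \<open>z\<close>) to (\<open>e\<close>, \<open>z e\<close>).\<close>

definition cc where "cc = fst (adj_counit R (dl x))"

lemma co_eq: "adj_counit R (dl x) = (cc, dl x)"
  using A.co_facts(3)[OF dl_Ob] by (cases "adj_counit R (dl x)") (simp add: cc_def)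

lemma cc [simp]: "cc \<in> Mor K" "tgt K cc = src K (dl x)" "dl x \<cdot> cc = pb1 K p (pr x)" "src K cc = src K (pb1 K p (pr x))"
proof -
  show 1: "cc \<in> Mor K" "tgt K cc = src K (dl x)" "dl x \<cdot> cc = pb1 K p (pr x)"
    using A.co_facts[OF dl_Ob] unfolding co_eq by (simp_all add: pr_def)
  have "src K (dl x \<cdot> cc) = src K cc" using 1(1,2) by simp
  then show "src K cc = src K (pb1 K p (pr x))" using 1(3) by simp
qed

lemma ev_eq: "ev x = pb2 K s x \<cdot> cc" unfolding poly_ev_def by (simp add: co_eq)

lemma ev_facts [simp]: "ev x \<in> Mor K" "src K (ev x) = src K (pb1 K p (pr x))" "tgt K (ev x) = src K x" "x \<cdot> ev x = s \<cdot> pb1 K p (pr x)"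
  by (simp_all add: ev_eq pb_sq')

lemma app_facts [simp]:
  assumes "e \<in> Mor K" "tgt K e = E" "z \<in> Mor K" "tgt K z = src K (pr x)" "src K z = src K e" "p \<cdot> e = pr x \<cdot> z"
  shows "app x e z \<in> Mor K" "src K (app x e z) = src K e" "tgt K (app x e z) = src K x" "x \<cdot> app x e z = s \<cdot> e"
proof -
  show 1: "app x e z \<in> Mor K" "src K (app x e z) = src K e" "tgt K (app x e z) = src K x"
    using assms by (simp_all add: poly_app_def)
  have "x \<cdot> app x e z = (x \<cdot> ev x) \<cdot> pb_pair K p (pr x) e z" using assms by (simp add: poly_app_def del: ev_facts(4))
  also have "\<dots> = s \<cdot> e" using assms by simp
  finally show "x \<cdot> app x e z = s \<cdot> e" .
qed

lemma app_precomp: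
  assumes "e \<in> Mor K" "tgt K e = E" "z \<in> Mor K" "tgt K z = src K (pr x)" "src K z = src K e" "p \<cdot> e = pr x \<cdot> z" "t \<in> Mor K" "tgt K t = src K e"
  shows "app x e z \<cdot> t = app x (e \<cdot> t) (z \<cdot> t)"
  using assms pb_pair_precomp[of p "pr x" e z t] by (simp add: poly_app_def)

lemma Delta_z:
  assumes "z \<in> Mor K" "tgt K z = src K (pr x)"
  shows "A.F1 (z, pr x) = (pb_pair K p (pr x) (pb1 K p (pr x \<cdot> z)) (z \<cdot> pb2 K p (pr x \<cdot> z)), pb1 K p (pr x))"
  by (simp add: Delta_mor_def)

lemma pb_z: assumes "z \<in> Mor K" "tgt K z = src K (pr x)" "pr x \<cdot> z = w"
  shows "p \<cdot> pb1 K p w = pr x \<cdot> z \<cdot> pb2 K p w" "src K (z \<cdot> pb2 K p w) = src K (pb1 K p w)" "tgt K (z \<cdot> pb2 K p w) = src K (pr x)" "z \<cdot> pb2 K p w \<in> Mor K"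
    "w \<in> Mor K" "tgt K w = B" "src K w = src K z"
proof -
  show [simp]: "w \<in> Mor K" "tgt K w = B" "src K w = src K z" unfolding assms(3)[symmetric] using assms(1,2) by simp_all
  show "src K (z \<cdot> pb2 K p w) = src K (pb1 K p w)" "tgt K (z \<cdot> pb2 K p w) = src K (pr x)" "z \<cdot> pb2 K p w \<in> Mor K" using assms(1,2) by simp_all
  have "pr x \<cdot> z \<cdot> pb2 K p w = (pr x \<cdot> z) \<cdot> pb2 K p w" using assms(1,2) by simp
  also have "\<dots> = p \<cdot> pb1 K p w" unfolding assms(3) by (rule pb_sq) simp_all
  finally show "p \<cdot> pb1 K p w = pr x \<cdot> z \<cdot> pb2 K p w" by simp
qed

text \<open>A 1-cell into the total object over \<open>w\<close> is a 1-cell on the pullback of \<open>w\<close> along \<open>p\<close>.\<close>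

lemma curry:
  assumes w: "w \<in> Mor K" "tgt K w = B" and phi: "\<phi> \<in> Mor K" "src K \<phi> = src K (pb1 K p w)" "tgt K \<phi> = src K x" "x \<cdot> \<phi> = s \<cdot> pb1 K p w"
  obtains z where "z \<in> Mor K" "src K z = src K w" "tgt K z = src K (pr x)" "pr x \<cdot> z = w" "app x (pb1 K p w) (z \<cdot> pb2 K p w) = \<phi>"
proof -
  note [simp] = w phi
  \<comment> \<open>The graph of \<phi>: paired with the projection to \<open>E\<close>, it becomes
    a 1-cell over \<open>E\<close> out of the pullback of \<open>w\<close>, and \<open>z\<close> is
    read off from its transpose.\<close>
  let ?\<phi> = "pb_pair K s x (pb1 K p w) \<phi>"
  let ?v = "A.G1 (?\<phi>, dl x) \<cdot>\<^bsub>slice K B\<^esub> adj_unit R w"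
  have hom: "(?\<phi>, dl x) \<in> Mor (slice K E)" "src (slice K E) (?\<phi>, dl x) = A.FO w" "tgt (slice K E) (?\<phi>, dl x) = dl x"
    by simp_all
  have wOb: "w \<in> Ob (slice K B)" by simp
  have v: "?v \<in> Mor (slice K B)" "src (slice K B) ?v = w" "tgt (slice K B) ?v = pr x"
    using hom wOb A.rfun_facts(2-4)[OF hom(1)] A.un_facts[OF wOb] by (simp_all add: pr_def)
  then obtain z where vz: "?v = (z, pr x)" by (cases ?v) simp
  have z [simp]: "z \<in> Mor K" "tgt K z = src K (pr x)" "pr x \<cdot> z = w" using v unfolding vz by simp_all
  note pbz = pb_z[OF z]
  have "adj_counit R (dl x) \<cdot>\<^bsub>slice K E\<^esub> A.F1 ?v = (?\<phi>, dl x)" by (rule A.untranspose_transpose[OF hom wOb])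
  then have c: "cc \<cdot> pb_pair K p (pr x) (pb1 K p w) (z \<cdot> pb2 K p w) = ?\<phi>"
    unfolding vz co_eq Delta_z[OF z(1,2)] z(3) by simp
  have "app x (pb1 K p w) (z \<cdot> pb2 K p w) = pb2 K s x \<cdot> cc \<cdot> pb_pair K p (pr x) (pb1 K p w) (z \<cdot> pb2 K p w)"
    unfolding poly_app_def ev_eq using pbz by simp
  then have "app x (pb1 K p w) (z \<cdot> pb2 K p w) = \<phi>" unfolding c by simp
  then show thesis using that[of z] z pbz(7) by simp
qed

text \<open>Equal evaluations give equal composites with \<open>cc\<close>, because the other
  projection, to \<open>E\<close>, is fixed in advance. The round trip of transposition then returns
  \<open>z\<close> and \<open>z'\<close>.\<close>

lemma curry_unique:
  assumes z: "z \<in> Mor K" "tgt K z = src K (pr x)" and z': "z' \<in> Mor K" "tgt K z' = src K (pr x)" and w: "pr x \<cdot> z = w" "pr x \<cdot> z' = w"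
    and eq: "app x (pb1 K p w) (z \<cdot> pb2 K p w) = app x (pb1 K p w) (z' \<cdot> pb2 K p w)"
  shows "z = z'"
proof -
  note pbz = pb_z[OF z w(1)] and pbz' = pb_z[OF z' w(2)]
  let ?y = "pb_pair K p (pr x) (pb1 K p w) (z \<cdot> pb2 K p w)" and ?y' = "pb_pair K p (pr x) (pb1 K p w) (z' \<cdot> pb2 K p w)"
  have y [simp]: "?y \<in> Mor K" "src K ?y = src K (pb1 K p w)" "tgt K ?y = src K (pb1 K p (pr x))" "pb1 K p (pr x) \<cdot> ?y = pb1 K p w"
    using pbz pb_facts[of p w] by simp_all
  have y' [simp]: "?y' \<in> Mor K" "src K ?y' = src K (pb1 K p w)" "tgt K ?y' = src K (pb1 K p (pr x))" "pb1 K p (pr x) \<cdot> ?y' = pb1 K p w"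
    using pbz' pb_facts[of p w] by simp_all
  have "cc \<cdot> ?y = cc \<cdot> ?y'"
  proof (rule pullback_eq[OF pb_pullback[of s x]])
    show "dl x \<cdot> cc \<cdot> ?y = dl x \<cdot> cc \<cdot> ?y'" using cmp_assoc'[of ?y cc "dl x"] cmp_assoc'[of ?y' cc "dl x"] by simp
    show "pb2 K s x \<cdot> cc \<cdot> ?y = pb2 K s x \<cdot> cc \<cdot> ?y'" using eq unfolding poly_app_def ev_eq by simp
  qed simp_all
  then have "adj_counit R (dl x) \<cdot>\<^bsub>slice K E\<^esub> A.F1 (z, pr x) = adj_counit R (dl x) \<cdot>\<^bsub>slice K E\<^esub> A.F1 (z', pr x)"
    unfolding co_eq Delta_z[OF z] Delta_z[OF z'] w by simp
  moreover have "A.G1 (adj_counit R (dl x) \<cdot>\<^bsub>slice K E\<^esub> A.F1 (z, pr x)) \<cdot>\<^bsub>slice K B\<^esub> adj_unit R w = (z, pr x)"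
    by (rule A.transpose_untranspose) (use z w dl_Ob in \<open>simp_all add: pr_def[symmetric]\<close>)
  moreover have "A.G1 (adj_counit R (dl x) \<cdot>\<^bsub>slice K E\<^esub> A.F1 (z', pr x)) \<cdot>\<^bsub>slice K B\<^esub> adj_unit R w = (z', pr x)"
    by (rule A.transpose_untranspose) (use z' w dl_Ob in \<open>simp_all add: pr_def[symmetric]\<close>)
  ultimately show ?thesis by simp
qed

text \<open>Extensionality: elements over the same base are equal when all their values are. The
  hypothesis is needed at the generic element of the fibre, the pair of projections of the pullback
  along \<open>p\<close>, which \<open>curry_unique\<close> handles.\<close>

lemma curry_ext:
  assumes z: "z \<in> Mor K" "tgt K z = src K (pr x)" and z': "z' \<in> Mor K" "tgt K z' = src K (pr x)" and w: "pr x \<cdot> z = pr x \<cdot> z'"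
    and eq: "\<And>e t. e \<in> Mor K \<Longrightarrow> tgt K e = E \<Longrightarrow> t \<in> Mor K \<Longrightarrow> tgt K t = src K z \<Longrightarrow> src K t = src K e \<Longrightarrow>
      p \<cdot> e = pr x \<cdot> z \<cdot> t \<Longrightarrow> app x e (z \<cdot> t) = app x e (z' \<cdot> t)"
  shows "z = z'"
proof (rule curry_unique[OF z z' refl w[symmetric]], rule eq)
  note pbz = pb_z[OF z refl]
  show "p \<cdot> pb1 K p (pr x \<cdot> z) = pr x \<cdot> z \<cdot> pb2 K p (pr x \<cdot> z)" by (rule pbz)
qed (use z in simp_all)

end

end

section \<open>Vertical 2-cells between elements of a polynomial functor\<close>

context polyn begin

context
  fixes x assumes x [simp]: "x \<in> Mor K" "tgt K x = I"
begin

text \<open>For \<zeta> vertical over \<open>p e\<close>, the pair of the identity of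
  \<open>e\<close> and \<zeta> is a 2-cell into the evaluation domain. Evaluating it yields
  \<open>appc e \<zeta>\<close>, the component of \<zeta> at \<open>e\<close>.\<close>

definition vcell where
  "vcell e \<zeta> = (THE \<gamma>. \<gamma> \<in> cells K (pb_pair K p (pr x) e (dom2 K \<zeta>)) (pb_pair K p (pr x) e (cod2 K \<zeta>)) \<and>
     id2 K (pb1 K p (pr x)) \<star> \<gamma> = id2 K e \<and> id2 K (pb2 K p (pr x)) \<star> \<gamma> = \<zeta>)"

definition appc where "appc e \<zeta> = id2 K (ev x) \<star> vcell e \<zeta>"

lemma vertical:
  assumes "\<zeta> \<in> Cell K" "tgt K (dom2 K \<zeta>) = src K (pr x)" "w \<in> Mor K" "id2 K (pr x) \<star> \<zeta> = id2 K w"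
  shows "pr x \<cdot> dom2 K \<zeta> = w" "pr x \<cdot> cod2 K \<zeta> = w"
proof -
  have "dom2 K (id2 K (pr x) \<star> \<zeta>) = pr x \<cdot> dom2 K \<zeta>" "cod2 K (id2 K (pr x) \<star> \<zeta>) = pr x \<cdot> cod2 K \<zeta>" using assms(1,2) by simp_all
  then show "pr x \<cdot> dom2 K \<zeta> = w" "pr x \<cdot> cod2 K \<zeta> = w" unfolding assms(4) using assms(3) by simp_all
qed

context
  fixes e \<zeta> assumes e [simp]: "e \<in> Mor K" "tgt K e = E"
   and z [simp]: "\<zeta> \<in> Cell K" "tgt K (dom2 K \<zeta>) = src K (pr x)" "src K (dom2 K \<zeta>) = src K e" and v [simp]: "id2 K (pr x) \<star> \<zeta> = id2 K (p \<cdot> e)"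
begin

lemma vd [simp]: "pr x \<cdot> dom2 K \<zeta> = p \<cdot> e" "pr x \<cdot> cod2 K \<zeta> = p \<cdot> e"
  using vertical[OF z(1,2) _ v] by simp_all

lemma vcell_ex: "\<exists>!\<gamma>. \<gamma> \<in> cells K (pb_pair K p (pr x) e (dom2 K \<zeta>)) (pb_pair K p (pr x) e (cod2 K \<zeta>)) \<and>
     id2 K (pb1 K p (pr x)) \<star> \<gamma> = id2 K e \<and> id2 K (pb2 K p (pr x)) \<star> \<gamma> = \<zeta>"
  by (rule pullback_cell_ex1[OF pb_pullback]) (simp_all add: cells_def)

lemma vcell [simp]: "vcell e \<zeta> \<in> Cell K" "dom2 K (vcell e \<zeta>) = pb_pair K p (pr x) e (dom2 K \<zeta>)" "cod2 K (vcell e \<zeta>) = pb_pair K p (pr x) e (cod2 K \<zeta>)"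
  "id2 K (pb1 K p (pr x)) \<star> vcell e \<zeta> = id2 K e" "id2 K (pb2 K p (pr x)) \<star> vcell e \<zeta> = \<zeta>"
  using theI'[OF vcell_ex, folded vcell_def] by (simp_all add: cells_def)

lemma vcell_unique:
  assumes "\<gamma> \<in> Cell K" "dom2 K \<gamma> = pb_pair K p (pr x) e (dom2 K \<zeta>)" "cod2 K \<gamma> = pb_pair K p (pr x) e (cod2 K \<zeta>)"
    "id2 K (pb1 K p (pr x)) \<star> \<gamma> = id2 K e" "id2 K (pb2 K p (pr x)) \<star> \<gamma> = \<zeta>"
  shows "\<gamma> = vcell e \<zeta>"
  by (rule pullback_cell_eq[OF pb_pullback[of p "pr x"]]) (use assms in simp_all)

lemma appc [simp]: "appc e \<zeta> \<in> Cell K" "dom2 K (appc e \<zeta>) = app x e (dom2 K \<zeta>)" "cod2 K (appc e \<zeta>) = app x e (cod2 K \<zeta>)"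
  unfolding appc_def poly_app_def by simp_all

end

lemma appc_precomp:
  assumes e: "e \<in> Mor K" "tgt K e = E"
   and z: "\<zeta> \<in> Cell K" "tgt K (dom2 K \<zeta>) = src K (pr x)" "src K (dom2 K \<zeta>) = src K e" and v: "id2 K (pr x) \<star> \<zeta> = id2 K (p \<cdot> e)"
   and t: "t \<in> Mor K" "tgt K t = src K e"
  shows "appc e \<zeta> \<star> id2 K t = appc (e \<cdot> t) (\<zeta> \<star> id2 K t)"
proof -
  have v': "id2 K (pr x) \<star> \<zeta> \<star> id2 K t = id2 K (p \<cdot> e \<cdot> t)"
    using hcmp_assoc'[of "id2 K t" \<zeta> "id2 K (pr x)"] e z v t by simp
  have c: "e \<cdot> t \<in> Mor K" "tgt K (e \<cdot> t) = E" "\<zeta> \<star> id2 K t \<in> Cell K" "tgt K (dom2 K (\<zeta> \<star> id2 K t)) = src K (pr x)"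
     "src K (dom2 K (\<zeta> \<star> id2 K t)) = src K (e \<cdot> t)" "id2 K (pr x) \<star> \<zeta> \<star> id2 K t = id2 K (p \<cdot> (e \<cdot> t))"
    using e z t v' by simp_all
  note V = vcell[OF e z v] and V' = vcell[OF c] and vd = vd[OF e z v]
  have s: "src K (cod2 K \<zeta>) = src K e" "tgt K (cod2 K \<zeta>) = src K (pr x)" using Cell_facts(3,4)[OF z(1)] z by simp_all
  have "vcell e \<zeta> \<star> id2 K t = vcell (e \<cdot> t) (\<zeta> \<star> id2 K t)"
  proof (rule vcell_unique[OF c])
    show "vcell e \<zeta> \<star> id2 K t \<in> Cell K" using V e z t vd by simp
    show "dom2 K (vcell e \<zeta> \<star> id2 K t) = pb_pair K p (pr x) (e \<cdot> t) (dom2 K (\<zeta> \<star> id2 K t))"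
      "cod2 K (vcell e \<zeta> \<star> id2 K t) = pb_pair K p (pr x) (e \<cdot> t) (cod2 K (\<zeta> \<star> id2 K t))"
      using V e z t vd s by (simp_all add: pb_pair_precomp)
    have "id2 K (pb1 K p (pr x)) \<star> vcell e \<zeta> \<star> id2 K t = (id2 K (pb1 K p (pr x)) \<star> vcell e \<zeta>) \<star> id2 K t"
      "id2 K (pb2 K p (pr x)) \<star> vcell e \<zeta> \<star> id2 K t = (id2 K (pb2 K p (pr x)) \<star> vcell e \<zeta>) \<star> id2 K t"
      using V(1-3) e z t vd by simp_all
    then show "id2 K (pb1 K p (pr x)) \<star> vcell e \<zeta> \<star> id2 K t = id2 K (e \<cdot> t)" "id2 K (pb2 K p (pr x)) \<star> vcell e \<zeta> \<star> id2 K t = \<zeta> \<star> id2 K t"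
      unfolding V using e t by simp_all
  qed
  moreover have "appc e \<zeta> \<star> id2 K t = id2 K (ev x) \<star> (vcell e \<zeta> \<star> id2 K t)" unfolding appc_def using V(1-3) e z t vd by simp
  ultimately show ?thesis unfolding appc_def by simp
qed

text \<open>At the generic element, \<open>vcell\<close> and the action of \<Delta> on 2-cells are
  characterized by the same projections. This places components of vertical 2-cells within reach of
  the adjunction.\<close>

lemma Delta_cell_eq:
  assumes z: "\<zeta> \<in> Cell K" "tgt K (dom2 K \<zeta>) = src K (pr x)" and w: "w \<in> Mor K" and v: "id2 K (pr x) \<star> \<zeta> = id2 K w"
  shows "A.F2 (\<zeta>, pr x) = (vcell (pb1 K p w) (\<zeta> \<star> id2 K (pb2 K p w)), pb1 K p (pr x))"
proof -
  note vd = vertical[OF z w v]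
  have w' [simp]: "w \<in> Mor K" "tgt K w = B" "src K w = src K (dom2 K \<zeta>)" unfolding vd(1)[symmetric] using z by simp_all
  show ?thesis using z by (simp add: Delta_cell_def Delta_mor_def vcell_def vd)
qed

lemma curry_cell_facts:
  assumes z: "\<zeta> \<in> Cell K" "tgt K (dom2 K \<zeta>) = src K (pr x)" and w: "w \<in> Mor K" and v: "id2 K (pr x) \<star> \<zeta> = id2 K w"
  shows "\<zeta> \<star> id2 K (pb2 K p w) \<in> Cell K" "tgt K (dom2 K (\<zeta> \<star> id2 K (pb2 K p w))) = src K (pr x)"
    "src K (dom2 K (\<zeta> \<star> id2 K (pb2 K p w))) = src K (pb1 K p w)" "id2 K (pr x) \<star> \<zeta> \<star> id2 K (pb2 K p w) = id2 K (p \<cdot> pb1 K p w)"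
    "pb1 K p w \<in> Mor K" "tgt K (pb1 K p w) = E"
proof -
  note vd = vertical[OF z w v]
  have w' [simp]: "w \<in> Mor K" "tgt K w = B" "src K w = src K (dom2 K \<zeta>)" unfolding vd(1)[symmetric] using z by simp_all
  have "id2 K (pr x) \<star> \<zeta> \<star> id2 K (pb2 K p w) = (id2 K (pr x) \<star> \<zeta>) \<star> id2 K (pb2 K p w)" using z by simp
  also have "\<dots> = id2 K (w \<cdot> pb2 K p w)" unfolding v by simp
  finally show "id2 K (pr x) \<star> \<zeta> \<star> id2 K (pb2 K p w) = id2 K (p \<cdot> pb1 K p w)" by (simp add: pb_sq)
qed (use z w vertical[OF z w v] in \<open>simp_all add: pb_z(6)[OF x _ _ vertical(1)[OF z w v]] pb_z(7)[OF x _ _ vertical(1)[OF z w v]]\<close>)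

text \<open>Two-dimensional currying: a family \<theta> of components over \<open>I\<close> comes
  from a vertical 2-cell, because transposition is surjective on 2-cells.\<close>

lemma curry_cell:
  assumes z: "z \<in> Mor K" "tgt K z = src K (pr x)" and z': "z' \<in> Mor K" "tgt K z' = src K (pr x)" and w: "pr x \<cdot> z = w" "pr x \<cdot> z' = w"
    and th: "\<theta> \<in> cells K (app x (pb1 K p w) (z \<cdot> pb2 K p w)) (app x (pb1 K p w) (z' \<cdot> pb2 K p w))" and xt: "id2 K x \<star> \<theta> = id2 K (s \<cdot> pb1 K p w)"
  shows "\<exists>\<zeta>\<in>cells K z z'. id2 K (pr x) \<star> \<zeta> = id2 K w \<and> appc (pb1 K p w) (\<zeta> \<star> id2 K (pb2 K p w)) = \<theta>"
proof -
  note pbz = pb_z[OF x z w(1)] and pbz' = pb_z[OF x z' w(2)]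
  let ?y = "pb_pair K p (pr x) (pb1 K p w) (z \<cdot> pb2 K p w)" and ?y' = "pb_pair K p (pr x) (pb1 K p w) (z' \<cdot> pb2 K p w)"
  have y [simp]: "?y \<in> Mor K" "src K ?y = src K (pb1 K p w)" "tgt K ?y = src K (pb1 K p (pr x))" "pb1 K p (pr x) \<cdot> ?y = pb1 K p w"
    using pbz pb_facts[of p w] by simp_all
  have y' [simp]: "?y' \<in> Mor K" "src K ?y' = src K (pb1 K p w)" "tgt K ?y' = src K (pb1 K p (pr x))" "pb1 K p (pr x) \<cdot> ?y' = pb1 K p w"
    using pbz' pb_facts[of p w] by simp_all
  have [simp]: "w \<in> Mor K" "tgt K w = B" using pbz by simp_all
  have dc: "dl x \<cdot> cc x \<cdot> ?y = pb1 K p w" "dl x \<cdot> cc x \<cdot> ?y' = pb1 K p w" using cmp_assoc'[of ?y "cc x" "dl x"] cmp_assoc'[of ?y' "cc x" "dl x"] by simp_all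
  have ev: "pb2 K s x \<cdot> cc x \<cdot> ?y = app x (pb1 K p w) (z \<cdot> pb2 K p w)" "pb2 K s x \<cdot> cc x \<cdot> ?y' = app x (pb1 K p w) (z' \<cdot> pb2 K p w)"
    by (simp_all add: poly_app_def ev_eq)
  \<comment> \<open>\<theta> together with the identity on the \<open>E\<close> component is a
    2-cell into the pullback of \<open>s\<close> and \<open>x\<close>; \<open>xt\<close> is the
    compatibility over \<open>I\<close>.\<close>
  have "\<exists>!\<gamma>. \<gamma> \<in> cells K (cc x \<cdot> ?y) (cc x \<cdot> ?y') \<and> id2 K (dl x) \<star> \<gamma> = id2 K (pb1 K p w) \<and> id2 K (pb2 K s x) \<star> \<gamma> = \<theta>"
    by (rule pullback_cell_ex1[OF pb_pullback[of s x]]) (use th xt in \<open>simp_all add: dc ev cells_def\<close>)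
  then obtain \<theta>' where t': "\<theta>' \<in> cells K (cc x \<cdot> ?y) (cc x \<cdot> ?y')" "id2 K (dl x) \<star> \<theta>' = id2 K (pb1 K p w)" "id2 K (pb2 K s x) \<star> \<theta>' = \<theta>" by blast
  have t1: "(\<theta>', dl x) \<in> cells (slice K E) (adj_counit R (dl x) \<cdot>\<^bsub>slice K E\<^esub> A.F1 (z, pr x)) (adj_counit R (dl x) \<cdot>\<^bsub>slice K E\<^esub> A.F1 (z', pr x))"
    using t'(1,2) unfolding co_eq[OF x] Delta_z[OF x z] Delta_z[OF x z'] w by (simp add: cells_def dc)
  have h: "(z, pr x) \<in> hom (slice K B) w (A.GO (dl x))" "(z', pr x) \<in> hom (slice K B) w (A.GO (dl x))"
    using z z' w by (simp_all add: pr_def[symmetric])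
  obtain \<alpha> where al: "\<alpha> \<in> cells (slice K B) (z, pr x) (z', pr x)" "id2 (slice K E) (adj_counit R (dl x)) \<star>\<^bsub>slice K E\<^esub> A.F2 \<alpha> = (\<theta>', dl x)"
    using bij_betw_imp_surj_on[OF A.transpose_cells_bij[OF h dl_Ob[OF x]]] t1 by (metis (no_types, lifting) image_iff)
  obtain \<zeta> where a: "\<alpha> = (\<zeta>, pr x)" using al(1) by (cases \<alpha>) simp
  have z1: "\<zeta> \<in> Cell K" "dom2 K \<zeta> = z" "cod2 K \<zeta> = z'" and zv: "id2 K (pr x) \<star> \<zeta> = id2 K w" using al(1) w unfolding a by simp_all
  have zt: "tgt K (dom2 K \<zeta>) = src K (pr x)" using z1 z by simp
  note cf = curry_cell_facts[OF z1(1) zt pbz(5) zv]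
  note vc = vcell[OF cf(5,6,1,2,3,4)]
  have "id2 K (cc x) \<star> vcell (pb1 K p w) (\<zeta> \<star> id2 K (pb2 K p w)) = \<theta>'"
    using al(2) unfolding a co_eq[OF x] Delta_cell_eq[OF z1(1) zt pbz(5) zv] by simp
  moreover have "appc (pb1 K p w) (\<zeta> \<star> id2 K (pb2 K p w)) = id2 K (pb2 K s x) \<star> id2 K (cc x) \<star> vcell (pb1 K p w) (\<zeta> \<star> id2 K (pb2 K p w))"
  proof -
    have "dom2 K (vcell (pb1 K p w) (\<zeta> \<star> id2 K (pb2 K p w))) = ?y" unfolding vc(2) using z1 z w pbz by simp
    then show ?thesis unfolding appc_def ev_eq[OF x] using vc(1) by (intro whisker_whisker[symmetric]) simp_all
  qed
  ultimately show ?thesis using t'(3) zv z1 by (intro bexI[of _ \<zeta>]) (simp_all add: cells_def)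
qed

text \<open>After whiskering with \<open>cc\<close>, the projections to \<open>E\<close> are
  identities and those to \<open>X\<close> agree by \<open>eq\<close>. Injectivity of transposition
  on 2-cells gives the rest.\<close>

lemma curry_cell_unique:
  assumes z: "\<zeta> \<in> Cell K" "tgt K (dom2 K \<zeta>) = src K (pr x)" and z': "\<zeta>' \<in> Cell K" "dom2 K \<zeta>' = dom2 K \<zeta>" "cod2 K \<zeta>' = cod2 K \<zeta>" and w: "w \<in> Mor K"
    and v: "id2 K (pr x) \<star> \<zeta> = id2 K w" "id2 K (pr x) \<star> \<zeta>' = id2 K w"
    and eq: "appc (pb1 K p w) (\<zeta> \<star> id2 K (pb2 K p w)) = appc (pb1 K p w) (\<zeta>' \<star> id2 K (pb2 K p w))"
  shows "\<zeta> = \<zeta>'"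
proof -
  have zt': "tgt K (dom2 K \<zeta>') = src K (pr x)" using z z' by simp
  note cf = curry_cell_facts[OF z w v(1)] and cf' = curry_cell_facts[OF z'(1) zt' w v(2)]
  let ?v = "vcell (pb1 K p w) (\<zeta> \<star> id2 K (pb2 K p w))" and ?v' = "vcell (pb1 K p w) (\<zeta>' \<star> id2 K (pb2 K p w))"
  note vc = vcell[OF cf(5,6,1,2,3,4)] and vc' = vcell[OF cf'(5,6,1,2,3,4)]
  have vd: "pr x \<cdot> dom2 K \<zeta> = w" "pr x \<cdot> cod2 K \<zeta> = w" by (rule vertical[OF z w v(1)])+
  have w' [simp]: "w \<in> Mor K" "tgt K w = B" "src K w = src K (dom2 K \<zeta>)" unfolding vd(1)[symmetric] using z by simp_all
  have v1 [simp]: "?v \<in> Cell K" "?v' \<in> Cell K" "dom2 K ?v' = dom2 K ?v" "cod2 K ?v' = cod2 K ?v"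
    using vc(1) vc'(1) unfolding vc(2,3) vc'(2,3) using z z' by simp_all
  have v2: "tgt K (dom2 K ?v) = src K (pb1 K p (pr x))"
    unfolding vc(2) using z pb_z[OF x _ _ vd(1)] by simp
  then have v2': "tgt K (dom2 K ?v') = src K (pb1 K p (pr x))" by simp
  have "id2 K (cc x) \<star> ?v = id2 K (cc x) \<star> ?v'"
  proof (rule pullback_cell_eq[OF pb_pullback[of s x]])
    have D: "id2 K (dl x) \<star> id2 K (cc x) \<star> u = id2 K (pb1 K p (pr x)) \<star> u" if "u \<in> Cell K" "tgt K (dom2 K u) = src K (pb1 K p (pr x))" for u
      using that by simp
    show "id2 K (dl x) \<star> id2 K (cc x) \<star> ?v = id2 K (dl x) \<star> id2 K (cc x) \<star> ?v'"
      unfolding D[OF v1(1) v2] D[OF v1(2) v2'] vc(4) vc'(4) ..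
    have D': "id2 K (pb2 K s x) \<star> id2 K (cc x) \<star> u = id2 K (ev x) \<star> u" if "u \<in> Cell K" "tgt K (dom2 K u) = src K (pb1 K p (pr x))" for u
      using that by (simp add: ev_eq)
    show "id2 K (pb2 K s x) \<star> id2 K (cc x) \<star> ?v = id2 K (pb2 K s x) \<star> id2 K (cc x) \<star> ?v'"
      unfolding D'[OF v1(1) v2] D'[OF v1(2) v2'] by (rule eq[unfolded appc_def])
  qed (simp_all add: v2)
  then have e: "id2 (slice K E) (adj_counit R (dl x)) \<star>\<^bsub>slice K E\<^esub> A.F2 (\<zeta>, pr x) = id2 (slice K E) (adj_counit R (dl x)) \<star>\<^bsub>slice K E\<^esub> A.F2 (\<zeta>', pr x)"
    unfolding co_eq[OF x] Delta_cell_eq[OF z w v(1)] Delta_cell_eq[OF z'(1) zt' w v(2)] by simp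
  have h: "(dom2 K \<zeta>, pr x) \<in> hom (slice K B) w (A.GO (dl x))" "(cod2 K \<zeta>, pr x) \<in> hom (slice K B) w (A.GO (dl x))"
    using z vd by (simp_all add: pr_def[symmetric])
  have c: "(\<zeta>, pr x) \<in> cells (slice K B) (dom2 K \<zeta>, pr x) (cod2 K \<zeta>, pr x)" "(\<zeta>', pr x) \<in> cells (slice K B) (dom2 K \<zeta>, pr x) (cod2 K \<zeta>, pr x)"
    using z z' v vd by simp_all
  have "(\<zeta>, pr x) = (\<zeta>', pr x)"
    by (rule inj_onD[OF bij_betw_imp_inj_on[OF A.transpose_cells_bij[OF h dl_Ob[OF x]]] e c])
  then show ?thesis by simp
qed

end

section \<open>The associated 2-functor on 1-cells\<close>

definition act where "act g y = fst (onmor (Pi_fun K p) (onmor (Delta_fun K s) (g, y)))"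

text \<open>The last clause says that the functor acts on a function on a fibre by composing it with
  \<open>g\<close>; it is naturality of the counit, evaluated at \<open>e\<close>. Together with the
  preceding clause it determines \<open>act g y\<close>.\<close>

lemma act:
  assumes g [simp]: "g \<in> Mor K" "tgt K g = src K y" and y [simp]: "y \<in> Mor K" "tgt K y = I"
  shows "onmor (poly_fun K P) (g, y) = (act g y, pt P \<cdot> pr y)" "act g y \<in> Mor K" "src K (act g y) = src K (pr (y \<cdot> g))" "tgt K (act g y) = src K (pr y)"
    "pr y \<cdot> act g y = pr (y \<cdot> g)"
    "e \<in> Mor K \<Longrightarrow> tgt K e = E \<Longrightarrow> z \<in> Mor K \<Longrightarrow> tgt K z = src K (pr (y \<cdot> g)) \<Longrightarrow> src K z = src K e \<Longrightarrow> p \<cdot> e = pr (y \<cdot> g) \<cdot> z \<Longrightarrow>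
      app y e (act g y \<cdot> z) = g \<cdot> app (y \<cdot> g) e z"
proof -
  let ?x = "y \<cdot> g"
  have x [simp]: "?x \<in> Mor K" "tgt K ?x = I" by simp_all
  let ?\<delta> = "Delta_mor K s g y"
  have sq: "s \<cdot> pb1 K s ?x = y \<cdot> g \<cdot> pb2 K s ?x" using pb_sq[of s ?x] by simp
  have \<delta> [simp]: "?\<delta> \<in> Mor K" "src K ?\<delta> = src K (dl ?x)" "tgt K ?\<delta> = src K (dl y)" "dl y \<cdot> ?\<delta> = dl ?x" "pb2 K s y \<cdot> ?\<delta> = g \<cdot> pb2 K s ?x"
    using sq unfolding Delta_mor_def by simp_all
  have D: "onmor (Delta_fun K s) (g, y) = (?\<delta>, dl y)" by simp
  have hD: "(?\<delta>, dl y) \<in> Mor (slice K E)" by simp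
  have G: "A.G1 (?\<delta>, dl y) = (act g y, pr y)"
  proof (cases "A.G1 (?\<delta>, dl y)")
    case (Pair a b)
    have "tgt (slice K B) (A.G1 (?\<delta>, dl y)) = A.GO (dl y)" using A.rfun_facts(4)[OF hD] by simp
    then show ?thesis using Pair unfolding act_def D Pi_fun_def pr_def by simp
  qed
  show "onmor (poly_fun K P) (g, y) = (act g y, pt P \<cdot> pr y)" using G by (simp add: poly_fun_def Pi_fun_def)
  show a [simp]: "act g y \<in> Mor K" "src K (act g y) = src K (pr ?x)" "tgt K (act g y) = src K (pr y)" and pa: "pr y \<cdot> act g y = pr ?x"
  proof -
    show 1: "act g y \<in> Mor K" "tgt K (act g y) = src K (pr y)" using A.rfun_facts(2)[OF hD] unfolding G by simp_all
    show pa: "pr y \<cdot> act g y = pr ?x" using A.rfun_facts(3)[OF hD] unfolding G by (simp add: pr_def)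
    have "src K (pr y \<cdot> act g y) = src K (act g y)" using 1 by simp
    then show "src K (act g y) = src K (pr ?x)" unfolding pa by simp
  qed
  \<comment> \<open>Naturality of the counit at the 1-cell which \<Delta> along \<open>s\<close>
    makes out of \<open>g\<close>.\<close>
  have "adj_counit R (dl y) \<cdot>\<^bsub>slice K E\<^esub> A.F1 (A.G1 (?\<delta>, dl y)) = (?\<delta>, dl y) \<cdot>\<^bsub>slice K E\<^esub> adj_counit R (dl ?x)"
    by (rule A.co_nat(1)[OF hD]) simp_all
  then have c: "cc y \<cdot> pb_pair K p (pr y) (pb1 K p (pr ?x)) (act g y \<cdot> pb2 K p (pr ?x)) = ?\<delta> \<cdot> cc ?x"
    unfolding co_eq[OF y] co_eq[OF x] G Delta_z[OF y a(1,3)] by (simp add: pa)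
  assume e [simp]: "e \<in> Mor K" "tgt K e = E" "z \<in> Mor K" "tgt K z = src K (pr ?x)" "src K z = src K e" "p \<cdot> e = pr ?x \<cdot> z"
  let ?Y = "pb_pair K p (pr y) (pb1 K p (pr ?x)) (act g y \<cdot> pb2 K p (pr ?x))"
  note pbz = pb_z(1-4)[OF y a(1,3) pa]
  have Y [simp]: "?Y \<in> Mor K" "src K ?Y = src K (pb1 K p (pr ?x))" "tgt K ?Y = src K (pb1 K p (pr y))"
    using pbz pb_facts[of p "pr ?x"] by simp_all
  have pe: "pr y \<cdot> act g y \<cdot> z = pr ?x \<cdot> z" using cmp_assoc'[of z "act g y" "pr y"] pa by simp
  have "?Y \<cdot> pb_pair K p (pr ?x) e z = pb_pair K p (pr y) e (act g y \<cdot> z)"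
    using pbz pb_facts[of p "pr ?x"] by (subst pb_pair_precomp) simp_all
  then have "app y e (act g y \<cdot> z) = pb2 K s y \<cdot> (cc y \<cdot> ?Y) \<cdot> pb_pair K p (pr ?x) e z"
    using pe unfolding poly_app_def ev_eq[OF y] by simp
  also have "\<dots> = (pb2 K s y \<cdot> ?\<delta>) \<cdot> cc ?x \<cdot> pb_pair K p (pr ?x) e z" unfolding c by (simp del: \<delta>(5))
  also have "\<dots> = g \<cdot> app ?x e z" unfolding poly_app_def ev_eq[OF x] by simp
  finally show "app y e (act g y \<cdot> z) = g \<cdot> app ?x e z" .
qed

end

section \<open>Maps between polynomials\<close>

text \<open>The chosen lift of \<beta> at \<open>e\<close> is represented by its domain
  \<open>st e \<beta>\<close>, on which push-forwards act; the lifting 2-cell itself is only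
  asserted to exist. Compatibility with \<open>t\<close> lets \<open>st\<close> be used on
  generalised elements, and the first clause is normality.\<close>

definition normal_cleavage :: "('o, 'f, 't) two_cat \<Rightarrow> 'f \<Rightarrow> ('f \<Rightarrow> 't \<Rightarrow> 'f) \<Rightarrow> bool" where
  "normal_cleavage K p st \<longleftrightarrow>
     (\<forall>e\<in>Mor K. tgt K e = src K p \<longrightarrow> st e (id2 K (p \<cdot>\<^bsub>K\<^esub> e)) = e \<and>
       (\<forall>\<beta>\<in>Cell K. cod2 K \<beta> = p \<cdot>\<^bsub>K\<^esub> e \<longrightarrow>
          st e \<beta> \<in> Mor K \<and> src K (st e \<beta>) = src K e \<and> tgt K (st e \<beta>) = src K p \<and> p \<cdot>\<^bsub>K\<^esub> st e \<beta> = dom2 K \<beta> \<and>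
          (\<exists>l\<in>cells K (st e \<beta>) e. id2 K p \<star>\<^bsub>K\<^esub> l = \<beta>) \<and>
          (\<forall>t\<in>Mor K. tgt K t = src K e \<longrightarrow> st (e \<cdot>\<^bsub>K\<^esub> t) (\<beta> \<star>\<^bsub>K\<^esub> id2 K t) = st e \<beta> \<cdot>\<^bsub>K\<^esub> t)))"

lemma normal_cleavageD:
  assumes "normal_cleavage K p st" "e \<in> Mor K" "tgt K e = src K p"
  shows "st e (id2 K (p \<cdot>\<^bsub>K\<^esub> e)) = e"
    "\<beta> \<in> Cell K \<Longrightarrow> cod2 K \<beta> = p \<cdot>\<^bsub>K\<^esub> e \<Longrightarrow> st e \<beta> \<in> Mor K"
    "\<beta> \<in> Cell K \<Longrightarrow> cod2 K \<beta> = p \<cdot>\<^bsub>K\<^esub> e \<Longrightarrow> src K (st e \<beta>) = src K e"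
    "\<beta> \<in> Cell K \<Longrightarrow> cod2 K \<beta> = p \<cdot>\<^bsub>K\<^esub> e \<Longrightarrow> tgt K (st e \<beta>) = src K p"
    "\<beta> \<in> Cell K \<Longrightarrow> cod2 K \<beta> = p \<cdot>\<^bsub>K\<^esub> e \<Longrightarrow> p \<cdot>\<^bsub>K\<^esub> st e \<beta> = dom2 K \<beta>"
    "\<beta> \<in> Cell K \<Longrightarrow> cod2 K \<beta> = p \<cdot>\<^bsub>K\<^esub> e \<Longrightarrow> \<exists>l\<in>cells K (st e \<beta>) e. id2 K p \<star>\<^bsub>K\<^esub> l = \<beta>"
    "\<beta> \<in> Cell K \<Longrightarrow> cod2 K \<beta> = p \<cdot>\<^bsub>K\<^esub> e \<Longrightarrow> t \<in> Mor K \<Longrightarrow> tgt K t = src K e \<Longrightarrow> st (e \<cdot>\<^bsub>K\<^esub> t) (\<beta> \<star>\<^bsub>K\<^esub> id2 K t) = st e \<beta> \<cdot>\<^bsub>K\<^esub> t"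
  using assms unfolding normal_cleavage_def by blast+

text \<open>The action of push-forwards along \<open>\<beta>\<close> is given by precomposition with the cartesian lifts along \<open>p\<close>.\<close>

lemma (in polyn) pushing_exists:
  assumes x [simp]: "x \<in> Mor K" "tgt K x = I" and st: "normal_cleavage K p st" and dI: "discrete_ob K I"
    and com: "comma_square K (pr x) (one K B) d c \<beta>0"
  obtains z where "pushing K (pr x) d c \<beta>0 z"
    "\<And>e w. e \<in> Mor K \<Longrightarrow> tgt K e = E \<Longrightarrow> w \<in> Mor K \<Longrightarrow> tgt K w = src K d \<Longrightarrow> src K w = src K e \<Longrightarrow> p \<cdot> e = c \<cdot> w \<Longrightarrow>
       app x e (z \<cdot> w) = app x (st e (\<beta>0 \<star> id2 K w)) (d \<cdot> w)"
proof -
  have c0: "d \<in> Mor K" "tgt K d = src K (pr x)" "c \<in> Mor K" "src K c = src K d" "tgt K c = B" "\<beta>0 \<in> Cell K" "dom2 K \<beta>0 = pr x \<cdot> d" "cod2 K \<beta>0 = one K B \<cdot> c"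
    by (rule comma_squareE[OF com], simp)+
  have c1 [simp]: "d \<in> Mor K" "tgt K d = src K (pr x)" "c \<in> Mor K" "src K c = src K d" "tgt K c = B" "\<beta>0 \<in> Cell K" "dom2 K \<beta>0 = pr x \<cdot> d" "cod2 K \<beta>0 = c"
    using c0 by simp_all
  note nc = normal_cleavageD[OF st]
  \<comment> \<open>A lifting 2-cell becomes an identity in the discrete \<open>I\<close>, so moving
    \<open>e\<close> along it keeps the place over \<open>I\<close> where a value must lie.\<close>
  have ssrc: "s \<cdot> st e \<beta> = s \<cdot> e" if "e \<in> Mor K" "tgt K e = E" "\<beta> \<in> Cell K" "cod2 K \<beta> = p \<cdot> e" for e \<beta>
  proof -
    note h = that
    obtain l where "l \<in> cells K (st e \<beta>) e" using nc(6)[OF h] by blast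
    then have l: "l \<in> Cell K" "dom2 K l = st e \<beta>" "cod2 K l = e" by (simp_all add: cells_def)
    have "tgt K (st e \<beta>) = E" by (rule nc(4)[OF h])
    then show ?thesis using discrete_whisker(2)[OF dI, of s l] l by simp
  qed
  let ?e = "pb1 K p c" and ?t = "pb2 K p c"
  have ct: "c \<cdot> ?t = p \<cdot> ?e" by (rule pb_sq) simp_all
  have b: "\<beta>0 \<star> id2 K ?t \<in> Cell K" "cod2 K (\<beta>0 \<star> id2 K ?t) = p \<cdot> ?e" "dom2 K (\<beta>0 \<star> id2 K ?t) = pr x \<cdot> d \<cdot> ?t" by (simp_all add: ct)
  have e: "?e \<in> Mor K" "tgt K ?e = E" by simp_all
  note S = nc(2-5)[OF e b(1,2)]
  \<comment> \<open>The push-forward is defined at the generic element: its value at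
    \<open>e\<close> is the old value at the lifted \<open>e\<close>. Currying then gives
    \<open>z\<close>.\<close>
  let ?\<phi> = "app x (st ?e (\<beta>0 \<star> id2 K ?t)) (d \<cdot> ?t)"
  have phi: "?\<phi> \<in> Mor K" "src K ?\<phi> = src K ?e" "tgt K ?\<phi> = src K x" "x \<cdot> ?\<phi> = s \<cdot> ?e"
    using app_facts[OF x S(1) S(3), of "d \<cdot> ?t"] S b(3) ssrc[OF e b(1,2)] by simp_all
  obtain z where z [simp]: "z \<in> Mor K" "src K z = src K d" "tgt K z = src K (pr x)" "pr x \<cdot> z = c" and az: "app x ?e (z \<cdot> ?t) = ?\<phi>"
    using curry[OF x c1(3,5) phi] unfolding c1(4) by blast
  have prz: "pr x \<cdot> z \<cdot> w = c \<cdot> w" if "w \<in> Mor K" "tgt K w = src K d" for w using cmp_assoc'[of w z "pr x"] that by simp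
  have main: "app x e (z \<cdot> w) = app x (st e (\<beta>0 \<star> id2 K w)) (d \<cdot> w)"
    if e': "e \<in> Mor K" "tgt K e = E" "w \<in> Mor K" "tgt K w = src K d" "src K w = src K e" "p \<cdot> e = c \<cdot> w" for e w
  proof -
    let ?u = "pb_pair K p c e w"
    have u [simp]: "?u \<in> Mor K" "src K ?u = src K e" "tgt K ?u = src K ?e" "?e \<cdot> ?u = e" "?t \<cdot> ?u = w" using e' by simp_all
    have "app x e (z \<cdot> w) = app x ?e (z \<cdot> ?t) \<cdot> ?u" using e' by (subst app_precomp) (simp_all add: prz ct)
    also have "\<dots> = app x (st ?e (\<beta>0 \<star> id2 K ?t) \<cdot> ?u) ((d \<cdot> ?t) \<cdot> ?u)"
      unfolding az by (rule app_precomp[OF x]) (use S b(3) in simp_all)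
    also have "st ?e (\<beta>0 \<star> id2 K ?t) \<cdot> ?u = st (?e \<cdot> ?u) ((\<beta>0 \<star> id2 K ?t) \<star> id2 K ?u)"
      by (rule nc(7)[OF e b(1,2), symmetric]) simp_all
    finally show ?thesis by simp
  qed
  have push: "pushing K (pr x) d c \<beta>0 z"
  proof (unfold_locales)
    show "comma_square K (pr x) (one K (tgt K (pr x))) d c \<beta>0" using com by simp
    show "z \<in> hom K (src K d) (src K (pr x))" "pr x \<cdot> z = c" by (simp_all add: hom_def)
    fix i assume "i \<in> hom K (src K (pr x)) (src K d)" and i2 [simp]: "d \<cdot> i = one K (src K (pr x))" "c \<cdot> i = pr x" "\<beta>0 \<star> id2 K i = id2 K (pr x)"
    then have i [simp]: "i \<in> Mor K" "src K i = src K (pr x)" "tgt K i = src K d" by (simp_all add: hom_def)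
    \<comment> \<open>On the unit section the 2-cell is an identity, and normality says that
      \<open>st\<close> then leaves \<open>e\<close> unchanged; so the values do not change.\<close>
    show "z \<cdot> i = one K (src K (pr x))"
    proof (rule curry_ext[OF x])
      show "pr x \<cdot> z \<cdot> i = pr x \<cdot> one K (src K (pr x))" by (simp add: prz)
      fix e t assume et: "e \<in> Mor K" "tgt K e = E" "t \<in> Mor K" "tgt K t = src K (z \<cdot> i)" "src K t = src K e" "p \<cdot> e = pr x \<cdot> (z \<cdot> i) \<cdot> t"
      then have et': "e \<in> Mor K" "tgt K e = E" "t \<in> Mor K" "tgt K t = src K (pr x)" "src K t = src K e" by simp_all
      have ci: "c \<cdot> i \<cdot> t = pr x \<cdot> t" "d \<cdot> i \<cdot> t = t" using et' cmp_assoc'[of t i c] cmp_assoc'[of t i d] by simp_all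
      have pe: "p \<cdot> e = pr x \<cdot> t" using et(6) et' by (simp add: prz ci)
      have bi: "\<beta>0 \<star> id2 K (i \<cdot> t) = id2 K (p \<cdot> e)" using et' hcmp_assoc'[of "id2 K t" "id2 K i" \<beta>0] by (simp add: pe)
      have "app x e (z \<cdot> i \<cdot> t) = app x (st e (\<beta>0 \<star> id2 K (i \<cdot> t))) (d \<cdot> i \<cdot> t)"
        by (rule main) (use et' pe ci in simp_all)
      then show "app x e ((z \<cdot> i) \<cdot> t) = app x e (one K (src K (pr x)) \<cdot> t)"
        unfolding bi nc(1)[OF et'(1,2)] ci using et' by simp
    qed simp_all
  qed
  show thesis by (rule that[OF push main])
qed

section \<open>Maps of polynomials given by a pullback square of middle arrows\<close>

locale two_poly = P: polyn K P I J + Q: polyn K Q I' J' for K :: "('o, 'f, 't) two_cat" (structure) and P I J Q I' J' +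
  fixes f g1 g2
  assumes f [simp]: "f \<in> Mor K" "src K f = I" "tgt K f = I'"
    and g1 [simp]: "g1 \<in> Mor K" "src K g1 = tgt K (pp P)" "tgt K g1 = tgt K (pp Q)"
    and fs: "f \<cdot> ps P = ps Q \<cdot> g2" and pb: "pullback K (pp Q) g1 g2 (pp P)"
begin

lemma g2 [simp]: "g2 \<in> Mor K" "src K g2 = src K (pp P)" "tgt K g2 = src K (pp Q)" and pg: "pp Q \<cdot> g2 = g1 \<cdot> pp P"
  using P.pullback_facts[OF pb] by simp_all

lemma pg': "e \<in> Mor K \<Longrightarrow> tgt K e = src K (pp P) \<Longrightarrow> pp Q \<cdot> g2 \<cdot> e = g1 \<cdot> pp P \<cdot> e"
  using P.pullback_sq[OF pb] by simp

lemma fs': "e \<in> Mor K \<Longrightarrow> tgt K e = src K (pp P) \<Longrightarrow> ps Q \<cdot> g2 \<cdot> e = f \<cdot> ps P \<cdot> e"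
  using P.cmp_assoc'[of e g2 "ps Q"] P.cmp_assoc'[of e "ps P" f] fs by simp

text \<open>The pullback square identifies the fibre over \<open>b\<close> with the fibre over
  \<open>g1 b\<close>; \<open>e0\<close> is the element corresponding to \<open>e\<close>.\<close>

lemma factor:
  assumes "e \<in> Mor K" "tgt K e = src K (pp Q)" "b \<in> Mor K" "tgt K b = tgt K (pp P)" "src K b = src K e" "pp Q \<cdot> e = g1 \<cdot> b"
  obtains e0 where "e0 \<in> Mor K" "src K e0 = src K e" "tgt K e0 = src K (pp P)" "g2 \<cdot> e0 = e" "pp P \<cdot> e0 = b"
  using P.pullback_ex1[OF pb, of e b] assms by (auto simp: hom_def)

text \<open>Lifts pull back along the square: lift in the total object of \<open>Q\<close> and pair
  the result with the domain of \<beta>. The resulting \<open>star st\<close> is a cleavage which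
  \<open>g2\<close> preserves strictly, so the push-forwards for \<open>P\<close> and
  \<open>Q\<close> match.\<close>

lemma star_ex:
  assumes st: "normal_cleavage K (pp Q) st" and e: "e \<in> Mor K" "tgt K e = src K (pp P)" and b: "\<beta> \<in> Cell K" "cod2 K \<beta> = pp P \<cdot> e"
  shows "\<exists>!w. w \<in> hom K (src K (st (g2 \<cdot> e) (id2 K g1 \<star> \<beta>))) (src K g2) \<and> g2 \<cdot> w = st (g2 \<cdot> e) (id2 K g1 \<star> \<beta>) \<and> pp P \<cdot> w = dom2 K \<beta>"
proof -
  have s: "src K (dom2 K \<beta>) = src K e" "tgt K (dom2 K \<beta>) = tgt K (pp P)" using P.Cell_facts(3,4)[OF b(1)] b e by simp_all
  have E: "g2 \<cdot> e \<in> Mor K" "tgt K (g2 \<cdot> e) = src K (pp Q)" "id2 K g1 \<star> \<beta> \<in> Cell K" "cod2 K (id2 K g1 \<star> \<beta>) = pp Q \<cdot> g2 \<cdot> e"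
    using e b s by (simp_all add: pg')
  note S = normal_cleavageD(2-5)[OF st E]
  show ?thesis by (rule P.pullback_ex1[OF pb]) (use S s b e in simp_all)
qed

definition star where "star st e \<beta> = (THE w. w \<in> hom K (src K (st (g2 \<cdot> e) (id2 K g1 \<star> \<beta>))) (src K g2) \<and>
   g2 \<cdot> w = st (g2 \<cdot> e) (id2 K g1 \<star> \<beta>) \<and> pp P \<cdot> w = dom2 K \<beta>)"

lemma star:
  assumes st: "normal_cleavage K (pp Q) st" and e: "e \<in> Mor K" "tgt K e = src K (pp P)" and b: "\<beta> \<in> Cell K" "cod2 K \<beta> = pp P \<cdot> e"
  shows "star st e \<beta> \<in> Mor K" "src K (star st e \<beta>) = src K e" "tgt K (star st e \<beta>) = src K (pp P)" "g2 \<cdot> star st e \<beta> = st (g2 \<cdot> e) (id2 K g1 \<star> \<beta>)"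
    "pp P \<cdot> star st e \<beta> = dom2 K \<beta>"
proof -
  have s: "src K (dom2 K \<beta>) = src K e" "tgt K (dom2 K \<beta>) = tgt K (pp P)" using P.Cell_facts(3,4)[OF b(1)] b e by simp_all
  have E: "g2 \<cdot> e \<in> Mor K" "tgt K (g2 \<cdot> e) = src K (pp Q)" "id2 K g1 \<star> \<beta> \<in> Cell K" "cod2 K (id2 K g1 \<star> \<beta>) = pp Q \<cdot> g2 \<cdot> e"
    using e b s by (simp_all add: pg')
  note S = normal_cleavageD(2-5)[OF st E]
  show "star st e \<beta> \<in> Mor K" "src K (star st e \<beta>) = src K e" "tgt K (star st e \<beta>) = src K (pp P)" "g2 \<cdot> star st e \<beta> = st (g2 \<cdot> e) (id2 K g1 \<star> \<beta>)"
    "pp P \<cdot> star st e \<beta> = dom2 K \<beta>"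
    using theI'[OF star_ex[OF assms], folded star_def] S e by (simp_all add: hom_def)
qed

lemma star_cleavage:
  assumes st: "normal_cleavage K (pp Q) st"
  shows "normal_cleavage K (pp P) (star st)"
  unfolding normal_cleavage_def
proof (intro ballI impI conjI)
  fix e assume e: "e \<in> Mor K" "tgt K e = src K (pp P)"
  have g2e: "g2 \<cdot> e \<in> Mor K" "tgt K (g2 \<cdot> e) = src K (pp Q)" using e by simp_all
  show "star st e (id2 K (pp P \<cdot> e)) = e"
  proof (rule P.pullback_eq[OF pb])
    have b: "id2 K (pp P \<cdot> e) \<in> Cell K" "cod2 K (id2 K (pp P \<cdot> e)) = pp P \<cdot> e" using e by simp_all
    note S = star[OF st e b]
    show "star st e (id2 K (pp P \<cdot> e)) \<in> Mor K" "tgt K (star st e (id2 K (pp P \<cdot> e))) = src K g2" "src K (star st e (id2 K (pp P \<cdot> e))) = src K e"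
      "pp P \<cdot> star st e (id2 K (pp P \<cdot> e)) = pp P \<cdot> e" using S e by simp_all
    have "id2 K g1 \<star> id2 K (pp P \<cdot> e) = id2 K (pp Q \<cdot> g2 \<cdot> e)" using e by (simp add: pg')
    then show "g2 \<cdot> star st e (id2 K (pp P \<cdot> e)) = g2 \<cdot> e" using S(4) normal_cleavageD(1)[OF st g2e] by simp
  qed (use e in simp_all)
  fix \<beta> assume b: "\<beta> \<in> Cell K" "cod2 K \<beta> = pp P \<cdot> e"
  note S = star[OF st e b]
  show "star st e \<beta> \<in> Mor K" "src K (star st e \<beta>) = src K e" "tgt K (star st e \<beta>) = src K (pp P)" "pp P \<cdot> star st e \<beta> = dom2 K \<beta>"
    by (rule S)+
  have s: "src K (dom2 K \<beta>) = src K e" "tgt K (dom2 K \<beta>) = tgt K (pp P)" using P.Cell_facts(3,4)[OF b(1)] b e by simp_all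
  have E: "id2 K g1 \<star> \<beta> \<in> Cell K" "cod2 K (id2 K g1 \<star> \<beta>) = pp Q \<cdot> g2 \<cdot> e"
    using e b s by (simp_all add: pg')
  obtain l where l: "l \<in> cells K (st (g2 \<cdot> e) (id2 K g1 \<star> \<beta>)) (g2 \<cdot> e)" "id2 K (pp Q) \<star> l = id2 K g1 \<star> \<beta>"
    using normal_cleavageD(6)[OF st g2e E] by blast
  \<comment> \<open>The lifting 2-cell for \<open>P\<close> is the one with components the lifting
    2-cell for \<open>Q\<close> and \<beta>.\<close>
  have "\<exists>!\<gamma>. \<gamma> \<in> cells K (star st e \<beta>) e \<and> id2 K g2 \<star> \<gamma> = l \<and> id2 K (pp P) \<star> \<gamma> = \<beta>"
    by (rule P.pullback_cell_ex1[OF pb _ _ _ _ _ _ l(2)]) (use S e b l in \<open>simp_all add: cells_def\<close>)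
  then show "\<exists>l\<in>cells K (star st e \<beta>) e. id2 K (pp P) \<star> l = \<beta>" by blast
  fix t assume t: "t \<in> Mor K" "tgt K t = src K e"
  have et: "e \<cdot> t \<in> Mor K" "tgt K (e \<cdot> t) = src K (pp P)" "\<beta> \<star> id2 K t \<in> Cell K" "cod2 K (\<beta> \<star> id2 K t) = pp P \<cdot> e \<cdot> t" using e b t s by simp_all
  note S' = star[OF st et]
  show "star st (e \<cdot> t) (\<beta> \<star> id2 K t) = star st e \<beta> \<cdot> t"
  proof (rule P.pullback_eq[OF pb])
    have "g2 \<cdot> star st e \<beta> \<cdot> t = (g2 \<cdot> star st e \<beta>) \<cdot> t" using S(1-3) t by simp
    also have "\<dots> = st ((g2 \<cdot> e) \<cdot> t) ((id2 K g1 \<star> \<beta>) \<star> id2 K t)"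
      unfolding S(4) by (rule normal_cleavageD(7)[OF st g2e E, symmetric]) (use e t in simp_all)
    also have "\<dots> = g2 \<cdot> star st (e \<cdot> t) (\<beta> \<star> id2 K t)" unfolding S'(4) using e t b s by simp
    finally show "g2 \<cdot> star st (e \<cdot> t) (\<beta> \<star> id2 K t) = g2 \<cdot> star st e \<beta> \<cdot> t" by simp
    have "pp P \<cdot> star st e \<beta> \<cdot> t = (pp P \<cdot> star st e \<beta>) \<cdot> t" using S(1-3) t by simp
    then show "pp P \<cdot> star st (e \<cdot> t) (\<beta> \<star> id2 K t) = pp P \<cdot> star st e \<beta> \<cdot> t" unfolding S(5) S'(5) using t b s by simp
  qed (use S S' t e in simp_all)
qed

text \<open>The property singled out by the definite description in \<open>poly_act\<close>, made
  into a predicate so that it can be checked for composites and for the functor action as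
  well.\<close>

definition poly_map where
  "poly_map x y v m \<longleftrightarrow> m \<in> Mor K \<and> src K m = src K (P.pr x) \<and> tgt K m = src K (Q.pr y) \<and> Q.pr y \<cdot> m = g1 \<cdot> P.pr x \<and>
    (\<forall>e z. e \<in> Mor K \<longrightarrow> tgt K e = src K (pp P) \<longrightarrow> z \<in> Mor K \<longrightarrow> tgt K z = src K (P.pr x) \<longrightarrow> src K z = src K e \<longrightarrow> pp P \<cdot> e = P.pr x \<cdot> z \<longrightarrow>
       Q.app y (g2 \<cdot> e) (m \<cdot> z) = v \<cdot> P.app x e z)"

lemma poly_map_facts:
  assumes "poly_map x y v m"
  shows "m \<in> Mor K" "src K m = src K (P.pr x)" "tgt K m = src K (Q.pr y)" "Q.pr y \<cdot> m = g1 \<cdot> P.pr x"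
    "e \<in> Mor K \<Longrightarrow> tgt K e = src K (pp P) \<Longrightarrow> z \<in> Mor K \<Longrightarrow> tgt K z = src K (P.pr x) \<Longrightarrow> src K z = src K e \<Longrightarrow> pp P \<cdot> e = P.pr x \<cdot> z \<Longrightarrow>
       Q.app y (g2 \<cdot> e) (m \<cdot> z) = v \<cdot> P.app x e z"
  using assms unfolding poly_map_def by blast+

context
  fixes x y v assumes x [simp]: "x \<in> Mor K" "tgt K x = I" and y [simp]: "y \<in> Mor K" "tgt K y = I'" and v [simp]: "v \<in> Mor K" "src K v = src K x" "tgt K v = src K y"
    and yv: "y \<cdot> v = f \<cdot> x"
begin

lemma pr_poly_map:
  assumes m: "poly_map x y v m" and z: "z \<in> Mor K" "tgt K z = src K (P.pr x)"
  shows "Q.pr y \<cdot> m \<cdot> z = g1 \<cdot> P.pr x \<cdot> z"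
  using poly_map_facts[OF m] z P.cmp_assoc'[of z m "Q.pr y"] P.cmp_assoc'[of z "P.pr x" g1] by simp

text \<open>Curry the assignment that sends an element \<open>e\<close> over \<open>g1 b\<close> to
  \<open>v (z e0)\<close>, where \<open>e0\<close> is the element over \<open>b\<close>
  corresponding to \<open>e\<close>. Naturality in the generic element then gives the formula
  everywhere.\<close>

lemma poly_map_ex: "\<exists>m. poly_map x y v m"
proof -
  let ?w = "g1 \<cdot> P.pr x"
  have w [simp]: "?w \<in> Mor K" "tgt K ?w = Q.B" by simp_all
  let ?e = "pb1 K (pp Q) ?w" and ?t = "pb2 K (pp Q) ?w"
  have sq: "pp Q \<cdot> ?e = g1 \<cdot> P.pr x \<cdot> ?t" using P.pb_sq[of "pp Q" ?w] by simp
  obtain e0 where e0 [simp]: "e0 \<in> Mor K" "src K e0 = src K ?e" "tgt K e0 = src K (pp P)" "g2 \<cdot> e0 = ?e" and pe0: "pp P \<cdot> e0 = P.pr x \<cdot> ?t"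
    by (rule factor[of ?e "P.pr x \<cdot> ?t"]) (simp_all add: sq)
  let ?a = "P.app x e0 ?t"
  have a [simp]: "?a \<in> Mor K" "src K ?a = src K ?e" "tgt K ?a = src K x" "x \<cdot> ?a = ps P \<cdot> e0"
    using P.app_facts[OF x, of e0 ?t] pe0 by simp_all
  have "y \<cdot> v \<cdot> ?a = (y \<cdot> v) \<cdot> ?a" by simp
  also have "\<dots> = ps Q \<cdot> ?e" unfolding yv using fs'[of e0] by simp
  finally have phi: "v \<cdot> ?a \<in> Mor K" "src K (v \<cdot> ?a) = src K ?e" "tgt K (v \<cdot> ?a) = src K y" "y \<cdot> v \<cdot> ?a = ps Q \<cdot> ?e" by simp_all
  obtain m where m [simp]: "m \<in> Mor K" "src K m = src K (P.pr x)" "tgt K m = src K (Q.pr y)" "Q.pr y \<cdot> m = ?w" and am: "Q.app y ?e (m \<cdot> ?t) = v \<cdot> ?a"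
    by (rule Q.curry[OF y w phi]) simp
  have "poly_map x y v m" unfolding poly_map_def
  proof (intro conjI allI impI)
    fix e z assume e [simp]: "e \<in> Mor K" "tgt K e = src K (pp P)" and z [simp]: "z \<in> Mor K" "tgt K z = src K (P.pr x)" "src K z = src K e" and pe: "pp P \<cdot> e = P.pr x \<cdot> z"
    let ?u = "pb_pair K (pp Q) ?w (g2 \<cdot> e) z"
    have u [simp]: "?u \<in> Mor K" "src K ?u = src K e" "tgt K ?u = src K ?e" "?e \<cdot> ?u = g2 \<cdot> e" "?t \<cdot> ?u = z"
      by (simp_all add: pg' pe)
    have eu: "e0 \<cdot> ?u = e"
      by (rule P.pullback_eq[OF pb])
        (simp_all add: P.cmp_assoc'[of ?u e0 g2, symmetric] P.cmp_assoc'[of ?u e0 "pp P", symmetric] pe0 pe del: P.cmp_assoc', simp)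
    have "Q.app y (g2 \<cdot> e) (m \<cdot> z) = Q.app y ?e (m \<cdot> ?t) \<cdot> ?u"
      by (subst Q.app_precomp[OF y]) (simp_all add: sq P.cmp_assoc'[of ?t m "Q.pr y", symmetric] del: P.cmp_assoc', simp_all)
    also have "\<dots> = v \<cdot> ?a \<cdot> ?u" unfolding am by simp
    also have "?a \<cdot> ?u = P.app x (e0 \<cdot> ?u) (?t \<cdot> ?u)" by (rule P.app_precomp[OF x]) (simp_all add: pe0)
    finally show "Q.app y (g2 \<cdot> e) (m \<cdot> z) = v \<cdot> P.app x e z" unfolding eu by simp
  qed simp_all
  then show ?thesis by blast
qed

text \<open>By extensionality it is enough to know values at elements \<open>e\<close> over points
  \<open>g1 b\<close>, and each such \<open>e\<close> has the form \<open>g2 e0\<close>, where the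
  predicate prescribes the value.\<close>

lemma poly_map_unique:
  assumes m: "poly_map x y v m" and m': "poly_map x y v m'"
  shows "m = m'"
proof (rule Q.curry_ext[OF y])
  note M = poly_map_facts[OF m] and M' = poly_map_facts[OF m']
  note [simp] = M(1-3) M'(1-3)
  show "m \<in> Mor K" "tgt K m = src K (Q.pr y)" "m' \<in> Mor K" "tgt K m' = src K (Q.pr y)" by simp_all
  show "Q.pr y \<cdot> m = Q.pr y \<cdot> m'" unfolding M(4) M'(4) ..
  fix e t assume e: "e \<in> Mor K" "tgt K e = src K (pp Q)" "t \<in> Mor K" "tgt K t = src K m" "src K t = src K e" "pp Q \<cdot> e = Q.pr y \<cdot> m \<cdot> t"
  obtain e0 where e0: "e0 \<in> Mor K" "src K e0 = src K e" "tgt K e0 = src K (pp P)" "g2 \<cdot> e0 = e" and pe0: "pp P \<cdot> e0 = P.pr x \<cdot> t"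
    by (rule factor[of e "P.pr x \<cdot> t"]) (use e pr_poly_map[OF m, of t] in simp_all)
  show "Q.app y e (m \<cdot> t) = Q.app y e (m' \<cdot> t)"
    using M(5)[of e0 t] M'(5)[of e0 t] e e0 pe0 by simp
qed

end

lemma poly_act_eq:
  assumes x: "x \<in> Mor K" "tgt K x = I" and y: "y \<in> Mor K" "tgt K y = I'" and v: "v \<in> Mor K" "src K v = src K x" "tgt K v = src K y"
    and yv: "y \<cdot> v = f \<cdot> x"
  shows "poly_map x y v (poly_act K P Q (g1, g2) x y v)"
proof -
  have iff: "poly_map x y v m \<longleftrightarrow> m \<in> hom K (src K (P.pr x)) (src K (Q.pr y)) \<and> Q.pr y \<cdot> m = fst (g1, g2) \<cdot> P.pr x \<and>
     (\<forall>W\<in>Ob K. \<forall>e\<in>hom K W (src K (pp P)). \<forall>z\<in>hom K W (src K (P.pr x)).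
           pp P \<cdot> e = P.pr x \<cdot> z \<longrightarrow> Q.app y (snd (g1, g2) \<cdot> e) (m \<cdot> z) = v \<cdot> P.app x e z)"
    (is "_ \<longleftrightarrow> ?L \<and> ?C \<and> ?R") for m
  proof
    assume "poly_map x y v m" then show "?L \<and> ?C \<and> ?R" unfolding poly_map_def hom_def by auto
  next
    assume *: "?L \<and> ?C \<and> ?R"
    show "poly_map x y v m" unfolding poly_map_def
    proof (intro conjI allI impI)
      fix e z assume e: "e \<in> Mor K" "tgt K e = src K (pp P)" "z \<in> Mor K" "tgt K z = src K (P.pr x)" "src K z = src K e" "pp P \<cdot> e = P.pr x \<cdot> z"
      then have "src K e \<in> Ob K" "e \<in> hom K (src K e) (src K (pp P))" "z \<in> hom K (src K e) (src K (P.pr x))" by (simp_all add: hom_def)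
      from *[THEN conjunct2, THEN conjunct2, THEN bspec, THEN bspec, THEN bspec, THEN mp, OF this e(6)]
      show "Q.app y (g2 \<cdot> e) (m \<cdot> z) = v \<cdot> P.app x e z" by simp
    qed (use * in \<open>simp_all add: hom_def\<close>)
  qed
  have "\<exists>!m. poly_map x y v m" using poly_map_ex[OF assms] poly_map_unique[OF assms] by blast
  from theI'[OF this] show ?thesis unfolding poly_act_def iff[symmetric] .
qed

end

text \<open>The formula provided by \<open>pushing_exists\<close>, named so that push-forwards
  belonging to two polynomials can be compared.\<close>

definition (in polyn) action_law where
  "action_law st x d c \<beta>0 z \<longleftrightarrow> (\<forall>e w. e \<in> Mor K \<longrightarrow> tgt K e = E \<longrightarrow> w \<in> Mor K \<longrightarrow> tgt K w = src K d \<longrightarrow> src K w = src K e \<longrightarrow>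
     p \<cdot> e = c \<cdot> w \<longrightarrow> app x e (z \<cdot> w) = app x (st e (\<beta>0 \<star> id2 K w)) (d \<cdot> w))"

context two_poly begin

text \<open>Evaluate at an element \<open>g2 e0\<close>. Pushing first and mapping afterwards gives
  \<open>v\<close> of the value at the lift of \<open>e0\<close>; the other order gives the value of
  the mapped element at the lift of \<open>g2 e0\<close>. By \<open>stst\<close> these two lifts
  correspond under \<open>g2\<close>.\<close>

lemma push_map_poly_map:
  assumes x [simp]: "x \<in> Mor K" "tgt K x = I" and y [simp]: "y \<in> Mor K" "tgt K y = I'" and v [simp]: "v \<in> Mor K" "src K v = src K x" "tgt K v = src K y"
    and m: "poly_map x y v m"
    and D: "pushing K (P.pr x) d c \<beta>0 z" and law: "P.action_law st' x d c \<beta>0 z"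
    and D': "pushing K (Q.pr y) d' c' \<beta>0' z'" and law': "Q.action_law st y d' c' \<beta>0' z'"
    and nc: "normal_cleavage K (pp P) st'"
    and stst: "\<And>e \<beta>. e \<in> Mor K \<Longrightarrow> tgt K e = src K (pp P) \<Longrightarrow> \<beta> \<in> Cell K \<Longrightarrow> cod2 K \<beta> = pp P \<cdot> e \<Longrightarrow> g2 \<cdot> st' e \<beta> = st (g2 \<cdot> e) (id2 K g1 \<star> \<beta>)"
  shows "push_map K (P.pr x) d c \<beta>0 z (Q.pr y) d' c' \<beta>0' z' m g1"
proof -
  interpret D: pushing K "P.pr x" d c \<beta>0 z by (rule D)
  interpret D': pushing K "Q.pr y" d' c' \<beta>0' z' by (rule D')
  note M = poly_map_facts[OF m]
  note [simp] = M(1-3)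
  have prm: "Q.pr y \<cdot> m \<cdot> w = g1 \<cdot> P.pr x \<cdot> w" if "w \<in> Mor K" "tgt K w = src K (P.pr x)" for w
    using M P.cmp_assoc'[of w m "Q.pr y"] P.cmp_assoc'[of w "P.pr x" g1] that by simp
  have prx [simp]: "P.pr x \<in> Mor K" "tgt K (P.pr x) = tgt K (pp P)" "Q.pr y \<in> Mor K" "tgt K (Q.pr y) = tgt K (pp Q)" by simp_all
  have t [simp]: "m \<cdot> d \<in> Mor K" "tgt K (m \<cdot> d) = src K (Q.pr y)" "src K (m \<cdot> d) = src K d" "id2 K g1 \<star> \<beta>0 \<in> Cell K" "dom2 K (id2 K g1 \<star> \<beta>0) = Q.pr y \<cdot> m \<cdot> d"
    "cod2 K (id2 K g1 \<star> \<beta>0) = g1 \<cdot> c"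
    by (simp_all add: prm)
  let ?n = "D'.tup (m \<cdot> d) (id2 K g1 \<star> \<beta>0)"
  note n [simp] = D'.tup[OF t(1,2,4,5)]
  have nw: "d' \<cdot> ?n \<cdot> w = m \<cdot> d \<cdot> w" "c' \<cdot> ?n \<cdot> w = g1 \<cdot> c \<cdot> w" "\<beta>0' \<star> id2 K (?n \<cdot> w) = id2 K g1 \<star> \<beta>0 \<star> id2 K w"
    if "w \<in> Mor K" "tgt K w = src K d" for w
    using that P.cmp_assoc'[of w ?n d'] P.cmp_assoc'[of w ?n c'] P.hcmp_assoc'[of "id2 K w" "id2 K ?n" \<beta>0'] by simp_all
  have prz: "P.pr x \<cdot> z \<cdot> w = c \<cdot> w" if "w \<in> Mor K" "tgt K w = src K d" for w using P.cmp_assoc'[of w z "P.pr x"] D.\<pi>z that by simp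
  have prz': "Q.pr y \<cdot> z' \<cdot> w = c' \<cdot> w" if "w \<in> Mor K" "tgt K w = src K d'" for w using P.cmp_assoc'[of w z' "Q.pr y"] D'.\<pi>z that by simp
  have compat: "m \<cdot> z = z' \<cdot> ?n"
  proof (rule Q.curry_ext[OF y])
    show "m \<cdot> z \<in> Mor K" "tgt K (m \<cdot> z) = src K (Q.pr y)" "z' \<cdot> ?n \<in> Mor K" "tgt K (z' \<cdot> ?n) = src K (Q.pr y)" by simp_all
    show "Q.pr y \<cdot> m \<cdot> z = Q.pr y \<cdot> z' \<cdot> ?n" using D.\<pi>z by (simp add: prm prz')
    fix e w assume e: "e \<in> Mor K" "tgt K e = src K (pp Q)" "w \<in> Mor K" "tgt K w = src K (m \<cdot> z)" "src K w = src K e" and pe: "pp Q \<cdot> e = Q.pr y \<cdot> (m \<cdot> z) \<cdot> w"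
    have w [simp]: "w \<in> Mor K" "tgt K w = src K d" "src K w = src K e" using e by simp_all
    have pe': "pp Q \<cdot> e = g1 \<cdot> c \<cdot> w" using pe by (simp add: prm prz)
    obtain e0 where e0: "e0 \<in> Mor K" "src K e0 = src K e" "tgt K e0 = src K (pp P)" "g2 \<cdot> e0 = e" and pe0: "pp P \<cdot> e0 = c \<cdot> w"
      by (rule factor[of e "c \<cdot> w"]) (use e pe' in simp_all)
    note [simp] = e0(1-3)
    have b: "\<beta>0 \<star> id2 K w \<in> Cell K" "cod2 K (\<beta>0 \<star> id2 K w) = pp P \<cdot> e0" "dom2 K (\<beta>0 \<star> id2 K w) = P.pr x \<cdot> d \<cdot> w" using pe0 by simp_all
    note S = normal_cleavageD(2-5)[OF nc e0(1,3) b(1,2)]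
    have "Q.app y e ((m \<cdot> z) \<cdot> w) = v \<cdot> P.app x e0 (z \<cdot> w)" using M(5)[of e0 "z \<cdot> w"] e0(4) by (simp add: pe0 prz)
    also have "P.app x e0 (z \<cdot> w) = P.app x (st' e0 (\<beta>0 \<star> id2 K w)) (d \<cdot> w)"
      using law[unfolded P.action_law_def, rule_format, of e0 w] pe0 by simp
    also have "v \<cdot> \<dots> = Q.app y (g2 \<cdot> st' e0 (\<beta>0 \<star> id2 K w)) (m \<cdot> d \<cdot> w)"
      using M(5)[of "st' e0 (\<beta>0 \<star> id2 K w)" "d \<cdot> w"] S b(3) by simp
    also have "\<dots> = Q.app y (st e (\<beta>0' \<star> id2 K (?n \<cdot> w))) (d' \<cdot> ?n \<cdot> w)"
      unfolding stst[OF e0(1,3) b(1,2)] e0(4) by (simp add: nw)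
    also have "\<dots> = Q.app y e (z' \<cdot> ?n \<cdot> w)"
      using law'[unfolded Q.action_law_def, rule_format, of e "?n \<cdot> w"] e pe' by (simp add: nw)
    finally show "Q.app y e ((m \<cdot> z) \<cdot> w) = Q.app y e ((z' \<cdot> ?n) \<cdot> w)" by simp
  qed
  show ?thesis
    by unfold_locales (use M(4) compat in \<open>simp_all add: hom_def\<close>)
qed

section \<open>Components of the colax structure on elements and vertical 2-cells\<close>

context
  fixes x m assumes x [simp]: "x \<in> Mor K" "tgt K x = I" and m: "poly_map x (f \<cdot> x) (one K (src K x)) m"
begin

lemma x' [simp]: "f \<cdot> x \<in> Mor K" "tgt K (f \<cdot> x) = I'" "src K (f \<cdot> x) = src K x" "src K x \<in> Ob K" by simp_all

lemma m_facts [simp]: "m \<in> Mor K" "src K m = src K (P.pr x)" "tgt K m = src K (Q.pr (f \<cdot> x))"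
  using poly_map_facts[OF m] by simp_all

lemma prm: "w \<in> Mor K \<Longrightarrow> tgt K w = src K (P.pr x) \<Longrightarrow> Q.pr (f \<cdot> x) \<cdot> m \<cdot> w = g1 \<cdot> P.pr x \<cdot> w"
  using poly_map_facts(4)[OF m] P.cmp_assoc'[of w m "Q.pr (f \<cdot> x)"] P.cmp_assoc'[of w "P.pr x" g1] by simp

lemma app_m:
  assumes "e \<in> Mor K" "tgt K e = src K (pp P)" "z \<in> Mor K" "tgt K z = src K (P.pr x)" "src K z = src K e" "pp P \<cdot> e = P.pr x \<cdot> z"
  shows "Q.app (f \<cdot> x) (g2 \<cdot> e) (m \<cdot> z) = P.app x e z"
  using poly_map_facts(5)[OF m assms] assms by simp

text \<open>No value is lost: the value of \<rho> at \<open>e\<close> is the value of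
  \<open>m\<close> \<rho> at \<open>g2 e\<close>.\<close>

lemma poly_map_inj:
  assumes r: "\<rho> \<in> Mor K" "\<rho>' \<in> Mor K" "src K \<rho> = src K \<rho>'" "tgt K \<rho> = src K (P.pr x)" "tgt K \<rho>' = src K (P.pr x)"
    and eq: "m \<cdot> \<rho> = m \<cdot> \<rho>'" "P.pr x \<cdot> \<rho> = P.pr x \<cdot> \<rho>'"
  shows "\<rho> = \<rho>'"
proof (rule P.curry_ext[OF x r(1,4,2,5) eq(2)])
  fix e t assume e: "e \<in> Mor K" "tgt K e = src K (pp P)" "t \<in> Mor K" "tgt K t = src K \<rho>" "src K t = src K e" "pp P \<cdot> e = P.pr x \<cdot> \<rho> \<cdot> t"
  have t: "tgt K t = src K \<rho>'" using e r by simp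
  have "P.pr x \<cdot> \<rho> \<cdot> t = P.pr x \<cdot> \<rho>' \<cdot> t" "m \<cdot> \<rho> \<cdot> t = m \<cdot> \<rho>' \<cdot> t"
    using e r t eq P.cmp_assoc'[of t \<rho> "P.pr x"] P.cmp_assoc'[of t \<rho>' "P.pr x"] P.cmp_assoc'[of t \<rho> m] P.cmp_assoc'[of t \<rho>' m] by simp_all
  then show "P.app x e (\<rho> \<cdot> t) = P.app x e (\<rho>' \<cdot> t)"
    using app_m[of e "\<rho> \<cdot> t"] app_m[of e "\<rho>' \<cdot> t"] e r t by simp
qed

text \<open>The first equation is \<open>app_m\<close> one dimension up. The 1-cell
  \<open>?M\<close> between the evaluation domains, induced by \<open>g2\<close> and
  \<open>m\<close>, satisfies \<open>ev ?M = ev\<close> and carries the 2-cell evaluated on the side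
  of \<open>P\<close> to the one on the side of \<open>Q\<close>.\<close>

lemma appc_m:
  assumes e [simp]: "e \<in> Mor K" "tgt K e = src K (pp P)"
   and z [simp]: "\<zeta> \<in> Cell K" "tgt K (dom2 K \<zeta>) = src K (P.pr x)" "src K (dom2 K \<zeta>) = src K e" and v: "id2 K (P.pr x) \<star> \<zeta> = id2 K (pp P \<cdot> e)"
  shows "Q.appc (f \<cdot> x) (g2 \<cdot> e) (id2 K m \<star> \<zeta>) = P.appc x e \<zeta>"
    and "id2 K (Q.pr (f \<cdot> x)) \<star> id2 K m \<star> \<zeta> = id2 K (pp Q \<cdot> g2 \<cdot> e)"
proof -
  let ?p1 = "pb1 K (pp P) (P.pr x)" and ?p2 = "pb2 K (pp P) (P.pr x)"
  let ?M = "pb_pair K (pp Q) (Q.pr (f \<cdot> x)) (g2 \<cdot> ?p1) (m \<cdot> ?p2)"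
  have s [simp]: "src K (cod2 K \<zeta>) = src K e" "tgt K (cod2 K \<zeta>) = src K (P.pr x)" using P.Cell_facts(3,4)[OF z(1)] by simp_all
  have sq: "pp P \<cdot> ?p1 = P.pr x \<cdot> ?p2" by (rule P.pb_sq[symmetric]) simp_all
  have M [simp]: "?M \<in> Mor K" "src K ?M = src K ?p1" "tgt K ?M = src K (pb1 K (pp Q) (Q.pr (f \<cdot> x)))"
     "pb1 K (pp Q) (Q.pr (f \<cdot> x)) \<cdot> ?M = g2 \<cdot> ?p1" "pb2 K (pp Q) (Q.pr (f \<cdot> x)) \<cdot> ?M = m \<cdot> ?p2"
    by (simp_all add: pg' prm sq)
  note V = P.vcell[OF x e z v] and vd = P.vd[OF x e z v]
  show v2: "id2 K (Q.pr (f \<cdot> x)) \<star> id2 K m \<star> \<zeta> = id2 K (pp Q \<cdot> g2 \<cdot> e)"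
  proof -
    have "id2 K (Q.pr (f \<cdot> x)) \<star> id2 K m \<star> \<zeta> = id2 K (Q.pr (f \<cdot> x) \<cdot> m) \<star> \<zeta>" by simp
    also have "\<dots> = id2 K g1 \<star> id2 K (P.pr x) \<star> \<zeta>" unfolding poly_map_facts(4)[OF m] by simp
    also have "\<dots> = id2 K (pp Q \<cdot> g2 \<cdot> e)" unfolding v by (simp add: pg')
    finally show ?thesis .
  qed
  have one: "pb_pair K (pp P) (P.pr x) ?p1 ?p2 = one K (src K ?p1)"
    by (rule P.pb_pair_unique) simp_all
  \<comment> \<open>\<open>app_m\<close> at the generic element compares the two evaluation maps
    directly.\<close>
  have "Q.ev (f \<cdot> x) \<cdot> ?M = P.ev x \<cdot> one K (src K ?p1)"
    using app_m[of ?p1 ?p2] sq unfolding poly_app_def one by simp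
  then have ev: "Q.ev (f \<cdot> x) \<cdot> ?M = P.ev x" by simp
  have c: "g2 \<cdot> e \<in> Mor K" "tgt K (g2 \<cdot> e) = src K (pp Q)" "id2 K m \<star> \<zeta> \<in> Cell K" "tgt K (dom2 K (id2 K m \<star> \<zeta>)) = src K (Q.pr (f \<cdot> x))"
    "src K (dom2 K (id2 K m \<star> \<zeta>)) = src K (g2 \<cdot> e)" by simp_all
  have vdom: "dom2 K (P.vcell x e \<zeta>) \<in> Mor K" "src K (dom2 K (P.vcell x e \<zeta>)) = src K e" "tgt K (dom2 K (P.vcell x e \<zeta>)) = src K ?p1"
    unfolding V(2) using vd by simp_all
  note [simp] = V(1) vdom
  have "id2 K ?M \<star> P.vcell x e \<zeta> = Q.vcell (f \<cdot> x) (g2 \<cdot> e) (id2 K m \<star> \<zeta>)"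
  proof (rule Q.vcell_unique[OF x'(1,2) c v2])
    show "id2 K ?M \<star> P.vcell x e \<zeta> \<in> Cell K" by simp
    show "dom2 K (id2 K ?M \<star> P.vcell x e \<zeta>) = pb_pair K (pp Q) (Q.pr (f \<cdot> x)) (g2 \<cdot> e) (dom2 K (id2 K m \<star> \<zeta>))"
      "cod2 K (id2 K ?M \<star> P.vcell x e \<zeta>) = pb_pair K (pp Q) (Q.pr (f \<cdot> x)) (g2 \<cdot> e) (cod2 K (id2 K m \<star> \<zeta>))"
      using V(2,3) vd by (simp_all add: P.pb_pair_precomp pg' prm sq)
    have "id2 K (pb1 K (pp Q) (Q.pr (f \<cdot> x))) \<star> id2 K ?M \<star> P.vcell x e \<zeta> = id2 K g2 \<star> (id2 K ?p1 \<star> P.vcell x e \<zeta>)" by simp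
    then show "id2 K (pb1 K (pp Q) (Q.pr (f \<cdot> x))) \<star> id2 K ?M \<star> P.vcell x e \<zeta> = id2 K (g2 \<cdot> e)" unfolding V(4) by simp
    have "id2 K (pb2 K (pp Q) (Q.pr (f \<cdot> x))) \<star> id2 K ?M \<star> P.vcell x e \<zeta> = id2 K m \<star> (id2 K ?p2 \<star> P.vcell x e \<zeta>)" by simp
    then show "id2 K (pb2 K (pp Q) (Q.pr (f \<cdot> x))) \<star> id2 K ?M \<star> P.vcell x e \<zeta> = id2 K m \<star> \<zeta>" unfolding V(5) .
  qed
  then have "Q.appc (f \<cdot> x) (g2 \<cdot> e) (id2 K m \<star> \<zeta>) = id2 K (Q.ev (f \<cdot> x)) \<star> id2 K ?M \<star> P.vcell x e \<zeta>"
    unfolding Q.appc_def[OF x'(1,2)] by simp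
  also have "\<dots> = id2 K (Q.ev (f \<cdot> x) \<cdot> ?M) \<star> P.vcell x e \<zeta>" by simp
  also have "\<dots> = P.appc x e \<zeta>" unfolding ev P.appc_def[OF x] ..
  finally show "Q.appc (f \<cdot> x) (g2 \<cdot> e) (id2 K m \<star> \<zeta>) = P.appc x e \<zeta>" .
qed

text \<open>\<open>m\<close> is fully faithful on vertical 2-cells because it reindexes along
  isomorphisms of fibres: the component of \<omega>' at \<open>e\<close> has to be that of \<omega>
  at \<open>g2 e\<close>.\<close>

lemma poly_map_vertical:
  assumes dI: "discrete_ob K I"
    and y [simp]: "y \<in> Mor K" "y' \<in> Mor K" "src K y = src K y'" "tgt K y = src K (P.pr x)" "tgt K y' = src K (P.pr x)"
    and yy: "P.pr x \<cdot> y = P.pr x \<cdot> y'" and om: "\<omega> \<in> cells K (m \<cdot> y) (m \<cdot> y')" and vert: "id2 K (Q.pr (f \<cdot> x)) \<star> \<omega> = id2 K (Q.pr (f \<cdot> x) \<cdot> m \<cdot> y')"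
  shows "\<exists>!\<omega>'. \<omega>' \<in> cells K y y' \<and> id2 K (P.pr x) \<star> \<omega>' = id2 K (P.pr x \<cdot> y') \<and> id2 K m \<star> \<omega>' = \<omega>"
proof -
  define w where "w = P.pr x \<cdot> y'"
  have w [simp]: "w \<in> Mor K" "src K w = src K y'" "tgt K w = tgt K (pp P)" and yw: "P.pr x \<cdot> y = w" "P.pr x \<cdot> y' = w" unfolding w_def using yy by simp_all
  have o [simp]: "\<omega> \<in> Cell K" "dom2 K \<omega> = m \<cdot> y" "cod2 K \<omega> = m \<cdot> y'" using om by (simp_all add: cells_def)
  have vert': "id2 K (Q.pr (f \<cdot> x)) \<star> \<omega> = id2 K (g1 \<cdot> w)" using vert prm[of y'] by (simp add: w_def)
  let ?e = "pb1 K (pp P) w" and ?t = "pb2 K (pp P) w"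
  have sq: "pp P \<cdot> ?e = w \<cdot> ?t" by (rule P.pb_sq[symmetric]) simp_all
  have yt: "P.pr x \<cdot> y \<cdot> t = w \<cdot> t" "P.pr x \<cdot> y' \<cdot> t = w \<cdot> t" if "t \<in> Mor K" "tgt K t = src K y'" for t
    using that yw P.cmp_assoc'[of t y "P.pr x"] P.cmp_assoc'[of t y' "P.pr x"] by simp_all
  have wt: "id2 K (Q.pr (f \<cdot> x)) \<star> \<omega> \<star> id2 K t = id2 K (g1 \<cdot> w \<cdot> t)" if "t \<in> Mor K" "tgt K t = src K y'" for t
    using that vert' P.hcmp_assoc'[of "id2 K t" \<omega> "id2 K (Q.pr (f \<cdot> x))"] by simp
  have oc: "g2 \<cdot> ?e \<in> Mor K" "tgt K (g2 \<cdot> ?e) = src K (pp Q)" "\<omega> \<star> id2 K ?t \<in> Cell K" "tgt K (dom2 K (\<omega> \<star> id2 K ?t)) = src K (Q.pr (f \<cdot> x))"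
     "src K (dom2 K (\<omega> \<star> id2 K ?t)) = src K (g2 \<cdot> ?e)" "id2 K (Q.pr (f \<cdot> x)) \<star> \<omega> \<star> id2 K ?t = id2 K (pp Q \<cdot> g2 \<cdot> ?e)"
    by (simp_all add: wt pg' sq)
  let ?\<theta> = "Q.appc (f \<cdot> x) (g2 \<cdot> ?e) (\<omega> \<star> id2 K ?t)"
  note T = Q.appc[OF x'(1,2) oc]
  have th: "?\<theta> \<in> cells K (P.app x ?e (y \<cdot> ?t)) (P.app x ?e (y' \<cdot> ?t))"
    using T app_m[of ?e "y \<cdot> ?t"] app_m[of ?e "y' \<cdot> ?t"] by (simp add: cells_def yt sq)
  have dth: "dom2 K ?\<theta> = P.app x ?e (y \<cdot> ?t)" using th by (simp add: cells_def)
  have A: "P.app x ?e (y \<cdot> ?t) \<in> Mor K" "tgt K (P.app x ?e (y \<cdot> ?t)) = src K x" "x \<cdot> P.app x ?e (y \<cdot> ?t) = ps P \<cdot> ?e"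
    using P.app_facts[OF x, of ?e "y \<cdot> ?t"] by (simp_all add: yt sq)
  \<comment> \<open>Components of \<omega> are given over \<open>I'\<close> only. Since
    \<open>I\<close> is discrete they lie over \<open>I\<close> as well, which currying
    requires.\<close>
  have "id2 K x \<star> ?\<theta> = id2 K (x \<cdot> dom2 K ?\<theta>)" by (rule P.discrete_whisker[OF dI x T(1)]) (simp add: dth A)
  then have xth: "id2 K x \<star> ?\<theta> = id2 K (ps P \<cdot> ?e)" unfolding dth A(3) .
  obtain \<zeta> where z: "\<zeta> \<in> cells K y y'" "id2 K (P.pr x) \<star> \<zeta> = id2 K w" "P.appc x ?e (\<zeta> \<star> id2 K ?t) = ?\<theta>"
    using P.curry_cell[OF x y(1,4,2,5) yw th xth] by blast
  have z' [simp]: "\<zeta> \<in> Cell K" "dom2 K \<zeta> = y" "cod2 K \<zeta> = y'" using z(1) by (simp_all add: cells_def)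
  have mz: "id2 K m \<star> \<zeta> = \<omega>"
  proof (rule Q.curry_cell_unique[OF x'(1,2)])
    show "id2 K (Q.pr (f \<cdot> x)) \<star> \<omega> = id2 K (g1 \<cdot> w)" by (rule vert')
    have "id2 K (Q.pr (f \<cdot> x)) \<star> id2 K m \<star> \<zeta> = id2 K (Q.pr (f \<cdot> x) \<cdot> m) \<star> \<zeta>" by simp
    also have "\<dots> = id2 K g1 \<star> id2 K (P.pr x) \<star> \<zeta>" unfolding poly_map_facts(4)[OF m] by simp
    also have "\<dots> = id2 K (g1 \<cdot> w)" unfolding z by simp
    finally show "id2 K (Q.pr (f \<cdot> x)) \<star> id2 K m \<star> \<zeta> = id2 K (g1 \<cdot> w)" .
    let ?e1 = "pb1 K (pp Q) (g1 \<cdot> w)" and ?t1 = "pb2 K (pp Q) (g1 \<cdot> w)"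
    have t1 [simp]: "?e1 \<in> Mor K" "?t1 \<in> Mor K" "tgt K ?e1 = src K (pp Q)" "src K ?t1 = src K ?e1" "tgt K ?t1 = src K y'" by simp_all
    have sq1: "pp Q \<cdot> ?e1 = g1 \<cdot> w \<cdot> ?t1" using P.pb_sq[of "pp Q" "g1 \<cdot> w"] by simp
    \<comment> \<open>The generic element over \<open>g1 w\<close> corresponds to an element over
      \<open>w\<close>; there \<open>appc_m\<close> computes components.\<close>
    obtain e0 where e0 [simp]: "e0 \<in> Mor K" "src K e0 = src K ?e1" "tgt K e0 = src K (pp P)" "g2 \<cdot> e0 = ?e1" and pe0: "pp P \<cdot> e0 = w \<cdot> ?t1"
      by (rule factor[of ?e1 "w \<cdot> ?t1"]) (simp_all add: sq1)
    let ?n = "pb_pair K (pp P) w e0 ?t1"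
    have n [simp]: "?n \<in> Mor K" "src K ?n = src K ?e1" "tgt K ?n = src K ?e" "?e \<cdot> ?n = e0" "?t \<cdot> ?n = ?t1" using pe0 by simp_all
    have zc: "?e \<in> Mor K" "tgt K ?e = src K (pp P)" "\<zeta> \<star> id2 K ?t \<in> Cell K" "tgt K (dom2 K (\<zeta> \<star> id2 K ?t)) = src K (P.pr x)"
      "src K (dom2 K (\<zeta> \<star> id2 K ?t)) = src K ?e" "id2 K (P.pr x) \<star> \<zeta> \<star> id2 K ?t = id2 K (pp P \<cdot> ?e)"
      using z(2) P.hcmp_assoc'[of "id2 K ?t" \<zeta> "id2 K (P.pr x)"] sq by simp_all
    have z0: "id2 K (P.pr x) \<star> \<zeta> \<star> id2 K ?t1 = id2 K (pp P \<cdot> e0)"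
      using z(2) P.hcmp_assoc'[of "id2 K ?t1" \<zeta> "id2 K (P.pr x)"] pe0 by simp
    have "Q.appc (f \<cdot> x) (g2 \<cdot> e0) (id2 K m \<star> \<zeta> \<star> id2 K ?t1) = P.appc x e0 (\<zeta> \<star> id2 K ?t1)"
      by (rule appc_m(1)) (simp_all add: z0)
    also have "\<dots> = P.appc x ?e (\<zeta> \<star> id2 K ?t) \<star> id2 K ?n"
      by (subst P.appc_precomp[OF x zc]) simp_all
    also have "\<dots> = Q.appc (f \<cdot> x) ((g2 \<cdot> ?e) \<cdot> ?n) ((\<omega> \<star> id2 K ?t) \<star> id2 K ?n)"
      unfolding z(3) by (rule Q.appc_precomp[OF x'(1,2) oc]) simp_all
    finally show "Q.appc (f \<cdot> x) ?e1 ((id2 K m \<star> \<zeta>) \<star> id2 K ?t1) = Q.appc (f \<cdot> x) ?e1 (\<omega> \<star> id2 K ?t1)" by simp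
  qed simp_all
  show ?thesis
  proof (rule ex1I[of _ \<zeta>], intro conjI)
    show "\<zeta> \<in> cells K y y'" "id2 K (P.pr x) \<star> \<zeta> = id2 K (P.pr x \<cdot> y')" "id2 K m \<star> \<zeta> = \<omega>" using z mz yw by simp_all
    fix \<xi> assume xi: "\<xi> \<in> cells K y y' \<and> id2 K (P.pr x) \<star> \<xi> = id2 K (P.pr x \<cdot> y') \<and> id2 K m \<star> \<xi> = \<omega>"
    then have x1 [simp]: "\<xi> \<in> Cell K" "dom2 K \<xi> = y" "cod2 K \<xi> = y'" and x2: "id2 K (P.pr x) \<star> \<xi> = id2 K w" "id2 K m \<star> \<xi> = \<omega>"
      using yw by (simp_all add: cells_def)
    have gen: "P.appc x ?e (u \<star> id2 K ?t) = ?\<theta>" if u: "u \<in> Cell K" "dom2 K u = y" "cod2 K u = y'" "id2 K (P.pr x) \<star> u = id2 K w" "id2 K m \<star> u = \<omega>" for u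
    proof -
      have v: "id2 K (P.pr x) \<star> u \<star> id2 K ?t = id2 K (pp P \<cdot> ?e)"
        using u P.hcmp_assoc'[of "id2 K ?t" u "id2 K (P.pr x)"] sq by simp
      have "Q.appc (f \<cdot> x) (g2 \<cdot> ?e) (id2 K m \<star> (u \<star> id2 K ?t)) = P.appc x ?e (u \<star> id2 K ?t)"
        by (rule appc_m(1)) (use u v in simp_all)
      moreover have "id2 K m \<star> (u \<star> id2 K ?t) = \<omega> \<star> id2 K ?t" using u P.hcmp_assoc'[of "id2 K ?t" u "id2 K m"] by simp
      ultimately show ?thesis by simp
    qed
    show "\<xi> = \<zeta>"
      by (rule P.curry_cell_unique[OF x _ _ _ _ _ w(1)]) (use x2 z(2) mz gen[of \<xi>] gen[of \<zeta>] in simp_all)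
  qed
qed

end

declare m_facts [simp del]

end

section \<open>The naturality square of the colax structure\<close>

lemma (in twocat) pullback_one:
  assumes p [simp]: "p \<in> Mor K"
  shows "pullback K p (one K (tgt K p)) (one K (src K p)) p"
  unfolding pullback_def
proof (intro conjI exI[of _ "src K p"] ballI impI)
  fix W u v assume "W \<in> Ob K" "u \<in> hom K W (src K p)" "v \<in> hom K W (src K (one K (tgt K p)))" "p \<cdot> u = one K (tgt K p) \<cdot> v"
  then have "u \<in> Mor K" "src K u = W" "tgt K u = src K p" "v = p \<cdot> u" by (simp_all add: hom_def)
  then have u: "u \<in> Mor K" "src K u = W" "tgt K u = src K p" and v: "v = p \<cdot> u" by blast+
  show "\<exists>!w. w \<in> hom K W (src K p) \<and> one K (src K p) \<cdot> w = u \<and> p \<cdot> w = v"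
  proof (rule ex1I[of _ u])
    show "u \<in> hom K W (src K p) \<and> one K (src K p) \<cdot> u = u \<and> p \<cdot> u = v" using u v by (simp add: hom_def)
    fix w assume w: "w \<in> hom K W (src K p) \<and> one K (src K p) \<cdot> w = u \<and> p \<cdot> w = v"
    then have "w \<in> Mor K" "tgt K w = src K p" by (simp_all add: hom_def)
    then have "one K (src K p) \<cdot> w = w" by simp
    then show "w = u" using w by simp
  qed
next
  fix W w w' \<alpha> \<beta> assume a: "w \<in> hom K W (src K p)" "w' \<in> hom K W (src K p)" "\<alpha> \<in> cells K (one K (src K p) \<cdot> w) (one K (src K p) \<cdot> w')"
    "\<beta> \<in> cells K (p \<cdot> w) (p \<cdot> w')" "id2 K p \<star> \<alpha> = id2 K (one K (tgt K p)) \<star> \<beta>"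
  have w: "w \<in> Mor K" "tgt K w = src K p" "w' \<in> Mor K" "tgt K w' = src K p" using a(1,2) by (simp_all add: hom_def)
  then have al: "\<alpha> \<in> Cell K" "dom2 K \<alpha> = w" "cod2 K \<alpha> = w'" using a(3) by (simp_all add: cells_def)
  have be: "\<beta> \<in> Cell K" "dom2 K \<beta> = p \<cdot> w" using a(4) by (simp_all add: cells_def)
  have b: "id2 K p \<star> \<alpha> = \<beta>" using a(5) be w by simp
  show "\<exists>!\<gamma>. \<gamma> \<in> cells K w w' \<and> id2 K (one K (src K p)) \<star> \<gamma> = \<alpha> \<and> id2 K p \<star> \<gamma> = \<beta>"
  proof (rule ex1I[of _ \<alpha>], intro conjI)
    show "\<alpha> \<in> cells K w w'" "id2 K (one K (src K p)) \<star> \<alpha> = \<alpha>" "id2 K p \<star> \<alpha> = \<beta>" using al w b by (simp_all add: cells_def)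
    fix \<gamma> assume g: "\<gamma> \<in> cells K w w' \<and> id2 K (one K (src K p)) \<star> \<gamma> = \<alpha> \<and> id2 K p \<star> \<gamma> = \<beta>"
    then have "\<gamma> \<in> Cell K" "dom2 K \<gamma> = w" by (simp_all add: cells_def)
    then have "id2 K (one K (src K p)) \<star> \<gamma> = \<gamma>" using w by simp
    then show "\<gamma> = \<alpha>" using g by simp
  qed
qed (simp_all add: hom_def)

text \<open>The identity square makes the action of the functor on a 1-cell an instance of
  \<open>poly_map\<close>. Then \<open>push_map_poly_map\<close> covers all four sides of the
  naturality square.\<close>

lemma (in polyn) two_poly_self: "two_poly K P I J P I J (one K I) (one K B) (one K E)"
proof (rule two_poly.intro[OF polyn_axioms polyn_axioms], rule two_poly_axioms.intro)
  have "I \<in> Ob K" using Mor_facts(2)[of s] by simp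
  then show "one K I \<in> Mor K" "src K (one K I) = I" "tgt K (one K I) = I" "one K I \<cdot> s = s \<cdot> one K E"
    by simp_all
  show "one K B \<in> Mor K" "src K (one K B) = B" "tgt K (one K B) = B" by simp_all
  show "pullback K p (one K B) (one K E) p" by (rule pullback_one) simp
qed

lemma (in polyn) act_poly_map:
  assumes h [simp]: "h \<in> Mor K" "tgt K h = src K y" and y [simp]: "y \<in> Mor K" "tgt K y = I"
  shows "two_poly.poly_map K P P (one K B) (one K E) (y \<cdot> h) y h (act h y)"
proof -
  interpret S: two_poly K P I J P I J "one K I" "one K B" "one K E" by (rule two_poly_self)
  note A = act[OF h y]
  show ?thesis unfolding S.poly_map_def
  proof (intro conjI allI impI)
    show "pr y \<cdot> act h y = one K B \<cdot> pr (y \<cdot> h)" using A(5) by simp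
    fix e z assume "e \<in> Mor K" "tgt K e = E" "z \<in> Mor K" "tgt K z = src K (pr (y \<cdot> h))" "src K z = src K e" "p \<cdot> e = pr (y \<cdot> h) \<cdot> z"
    then show "app y (one K E \<cdot> e) (act h y \<cdot> z) = h \<cdot> app (y \<cdot> h) e z" using A(6)[of e z] by simp
  qed (rule A)+
qed

context two_poly begin

context
  fixes h y assumes h [simp]: "h \<in> Mor K" "tgt K h = src K y" and y [simp]: "y \<in> Mor K" "tgt K y = I"
begin

abbreviation "kX \<equiv> poly_act K P Q (g1, g2) (y \<cdot> h) (f \<cdot> y \<cdot> h) (one K (src K h))"
abbreviation "kY \<equiv> poly_act K P Q (g1, g2) y (f \<cdot> y) (one K (src K y))"
abbreviation "Tf \<equiv> Q.act h (f \<cdot> y)"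
abbreviation "Sf \<equiv> P.act h y"

lemma kX: "poly_map (y \<cdot> h) (f \<cdot> y \<cdot> h) (one K (src K (y \<cdot> h))) kX"
  using poly_act_eq[of "y \<cdot> h" "f \<cdot> y \<cdot> h" "one K (src K h)"] by simp

lemma kY: "poly_map y (f \<cdot> y) (one K (src K y)) kY"
  using poly_act_eq[of y "f \<cdot> y" "one K (src K y)"] by simp

lemma Tf: "Tf \<in> Mor K" "src K Tf = src K (Q.pr (f \<cdot> y \<cdot> h))" "tgt K Tf = src K (Q.pr (f \<cdot> y))" "Q.pr (f \<cdot> y) \<cdot> Tf = Q.pr (f \<cdot> y \<cdot> h)"
   "e \<in> Mor K \<Longrightarrow> tgt K e = src K (pp Q) \<Longrightarrow> z \<in> Mor K \<Longrightarrow> tgt K z = src K (Q.pr (f \<cdot> y \<cdot> h)) \<Longrightarrow> src K z = src K e \<Longrightarrow> pp Q \<cdot> e = Q.pr (f \<cdot> y \<cdot> h) \<cdot> z \<Longrightarrow>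
      Q.app (f \<cdot> y) e (Tf \<cdot> z) = h \<cdot> Q.app (f \<cdot> y \<cdot> h) e z"
proof -
  have a: "tgt K h = src K (f \<cdot> y)" "f \<cdot> y \<in> Mor K" "tgt K (f \<cdot> y) = I'" "(f \<cdot> y) \<cdot> h = f \<cdot> y \<cdot> h" by simp_all
  note A = Q.act(2-6)[OF h(1) a(1-3), unfolded a(4)]
  show "Tf \<in> Mor K" "src K Tf = src K (Q.pr (f \<cdot> y \<cdot> h))" "tgt K Tf = src K (Q.pr (f \<cdot> y))" "Q.pr (f \<cdot> y) \<cdot> Tf = Q.pr (f \<cdot> y \<cdot> h)" by (rule A)+
  show "e \<in> Mor K \<Longrightarrow> tgt K e = src K (pp Q) \<Longrightarrow> z \<in> Mor K \<Longrightarrow> tgt K z = src K (Q.pr (f \<cdot> y \<cdot> h)) \<Longrightarrow> src K z = src K e \<Longrightarrow> pp Q \<cdot> e = Q.pr (f \<cdot> y \<cdot> h) \<cdot> z \<Longrightarrow>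
      Q.app (f \<cdot> y) e (Tf \<cdot> z) = h \<cdot> Q.app (f \<cdot> y \<cdot> h) e z" by (rule A)
qed

lemma Tf_pr: "w \<in> Mor K \<Longrightarrow> tgt K w = src K (Q.pr (f \<cdot> y \<cdot> h)) \<Longrightarrow> Q.pr (f \<cdot> y) \<cdot> Tf \<cdot> w = Q.pr (f \<cdot> y \<cdot> h) \<cdot> w"
  using Tf(1-4) P.cmp_assoc'[of w Tf "Q.pr (f \<cdot> y)"] by simp

lemmas Sf = P.act(2-6)[OF h y]

lemma Sf_pr: "w \<in> Mor K \<Longrightarrow> tgt K w = src K (P.pr (y \<cdot> h)) \<Longrightarrow> P.pr y \<cdot> Sf \<cdot> w = P.pr (y \<cdot> h) \<cdot> w"
  using Sf(1-4) P.cmp_assoc'[of w Sf "P.pr y"] by simp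

lemma yh: "y \<cdot> h \<in> Mor K" "tgt K (y \<cdot> h) = I" by simp_all

text \<open>Both composites satisfy the \<open>poly_map\<close> predicate over \<open>h\<close>, so
  \<open>poly_map_unique\<close> identifies them.\<close>

lemma square: "Tf \<cdot> kX = kY \<cdot> Sf"
proof (rule poly_map_unique[of "y \<cdot> h" "f \<cdot> y" h])
  note X = m_facts[OF yh kX] prm[OF yh kX] app_m[OF yh kX] and Y = m_facts[OF y kY] prm[OF y kY] app_m[OF y kY]
  note [simp] = X(1-3) Y(1-3) Tf(1-3) Sf(1-3)
  show "poly_map (y \<cdot> h) (f \<cdot> y) h (Tf \<cdot> kX)" unfolding poly_map_def
  proof (intro conjI allI impI)
    show "Q.pr (f \<cdot> y) \<cdot> Tf \<cdot> kX = g1 \<cdot> P.pr (y \<cdot> h)" using poly_map_facts(4)[OF kX] by (simp add: Tf_pr)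
    fix e z assume e: "e \<in> Mor K" "tgt K e = P.E" "z \<in> Mor K" "tgt K z = src K (P.pr (y \<cdot> h))" "src K z = src K e" "pp P \<cdot> e = P.pr (y \<cdot> h) \<cdot> z"
    have "Q.app (f \<cdot> y) (g2 \<cdot> e) (Tf \<cdot> kX \<cdot> z) = h \<cdot> Q.app (f \<cdot> y \<cdot> h) (g2 \<cdot> e) (kX \<cdot> z)"
      by (rule Tf(5)) (use e X(4)[of z] in \<open>simp_all add: pg'\<close>)
    then show "Q.app (f \<cdot> y) (g2 \<cdot> e) ((Tf \<cdot> kX) \<cdot> z) = h \<cdot> P.app (y \<cdot> h) e z" using X(5)[OF e] e by simp
  qed simp_all
  show "poly_map (y \<cdot> h) (f \<cdot> y) h (kY \<cdot> Sf)" unfolding poly_map_def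
  proof (intro conjI allI impI)
    show "Q.pr (f \<cdot> y) \<cdot> kY \<cdot> Sf = g1 \<cdot> P.pr (y \<cdot> h)" using Y(4)[of Sf] Sf(4) by simp
    fix e z assume e: "e \<in> Mor K" "tgt K e = P.E" "z \<in> Mor K" "tgt K z = src K (P.pr (y \<cdot> h))" "src K z = src K e" "pp P \<cdot> e = P.pr (y \<cdot> h) \<cdot> z"
    have "Q.app (f \<cdot> y) (g2 \<cdot> e) (kY \<cdot> Sf \<cdot> z) = P.app y e (Sf \<cdot> z)"
      by (rule Y(5)) (use e Sf_pr[of z] in simp_all)
    then show "Q.app (f \<cdot> y) (g2 \<cdot> e) ((kY \<cdot> Sf) \<cdot> z) = h \<cdot> P.app (y \<cdot> h) e z" using Sf(5)[OF e] e by simp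
  qed simp_all
qed simp_all

text \<open>An element \<open>v\<close> over \<open>g1 b\<close> assigns to each \<open>e\<close>
  over \<open>b\<close> a value in \<open>X\<close>, placed correctly over \<open>I'\<close> only.
  The component of \<omega> at \<open>g2 e\<close> joins \<open>h\<close> of this value to
  \<open>u e\<close>, and the latter lies over \<open>s e\<close>. As \<open>I\<close> is discrete,
  the value itself then lies over \<open>s e\<close>, so \<open>v\<close> is the image of a function
  on the fibre over \<open>b\<close>.\<close>

lemma lift:
  assumes dI: "discrete_ob K I"
    and v: "v \<in> Mor K" "tgt K v = src K (Q.pr (f \<cdot> y \<cdot> h))" and b: "b \<in> Mor K" "tgt K b = P.B" "src K b = src K v" and vb: "Q.pr (f \<cdot> y \<cdot> h) \<cdot> v = g1 \<cdot> b"
    and u: "u \<in> Mor K" "src K u = src K v" "tgt K u = src K (P.pr y)" and ub: "P.pr y \<cdot> u = b"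
    and om: "\<omega> \<in> cells K (Tf \<cdot> v) (kY \<cdot> u)" and vert: "id2 K (Q.pr (f \<cdot> y)) \<star> \<omega> = id2 K (g1 \<cdot> b)"
  shows "\<exists>\<rho>. \<rho> \<in> Mor K \<and> src K \<rho> = src K v \<and> tgt K \<rho> = src K (P.pr (y \<cdot> h)) \<and> kX \<cdot> \<rho> = v \<and> P.pr (y \<cdot> h) \<cdot> \<rho> = b"
proof -
  note X = m_facts[OF yh kX] prm[OF yh kX] app_m[OF yh kX] and Y = m_facts[OF y kY] prm[OF y kY] app_m[OF y kY]
  note [simp] = X(1-3) Y(1-3) Tf(1-3) Sf(1-3) v b u
  have o [simp]: "\<omega> \<in> Cell K" "dom2 K \<omega> = Tf \<cdot> v" "cod2 K \<omega> = kY \<cdot> u" using om by (simp_all add: cells_def)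
  let ?e = "pb1 K (pp P) b" and ?t = "pb2 K (pp P) b"
  have sq: "pp P \<cdot> ?e = b \<cdot> ?t" by (rule P.pb_sq[symmetric]) simp_all
  have vt: "Q.pr (f \<cdot> y \<cdot> h) \<cdot> v \<cdot> t = g1 \<cdot> b \<cdot> t" if "t \<in> Mor K" "tgt K t = src K v" for t
    using that vb P.cmp_assoc'[of t v "Q.pr (f \<cdot> y \<cdot> h)"] by simp
  have ut: "P.pr y \<cdot> u \<cdot> t = b \<cdot> t" if "t \<in> Mor K" "tgt K t = src K v" for t
    using that ub P.cmp_assoc'[of t u "P.pr y"] by simp
  let ?\<phi> = "Q.app (f \<cdot> y \<cdot> h) (g2 \<cdot> ?e) (v \<cdot> ?t)"
  have f1 [simp]: "f \<cdot> y \<cdot> h \<in> Mor K" "tgt K (f \<cdot> y \<cdot> h) = I'" "f \<cdot> y \<in> Mor K" "tgt K (f \<cdot> y) = I'" by simp_all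
  have phi [simp]: "?\<phi> \<in> Mor K" "src K ?\<phi> = src K ?e" "tgt K ?\<phi> = src K (y \<cdot> h)"
    using Q.app_facts[OF f1(1,2), of "g2 \<cdot> ?e" "v \<cdot> ?t"] by (simp_all add: vt pg' sq)
  have oc: "g2 \<cdot> ?e \<in> Mor K" "tgt K (g2 \<cdot> ?e) = src K (pp Q)" "\<omega> \<star> id2 K ?t \<in> Cell K" "tgt K (dom2 K (\<omega> \<star> id2 K ?t)) = src K (Q.pr (f \<cdot> y))"
     "src K (dom2 K (\<omega> \<star> id2 K ?t)) = src K (g2 \<cdot> ?e)" "id2 K (Q.pr (f \<cdot> y)) \<star> \<omega> \<star> id2 K ?t = id2 K (pp Q \<cdot> g2 \<cdot> ?e)"
    using vert P.hcmp_assoc'[of "id2 K ?t" \<omega> "id2 K (Q.pr (f \<cdot> y))"] by (simp_all add: pg' sq)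
  let ?\<theta> = "Q.appc (f \<cdot> y) (g2 \<cdot> ?e) (\<omega> \<star> id2 K ?t)"
  note T = Q.appc[OF f1(3,4) oc]
  have d: "dom2 K ?\<theta> = h \<cdot> ?\<phi>"
    unfolding T(2) using Tf(5)[of "g2 \<cdot> ?e" "v \<cdot> ?t"] by (simp add: vt pg' sq)
  have c: "cod2 K ?\<theta> = P.app y ?e (u \<cdot> ?t)"
    unfolding T(3) using Y(5)[of ?e "u \<cdot> ?t"] by (simp add: ut sq)
  \<comment> \<open>The two ends of a 2-cell have the same image in a discrete object; the codomain
    is a value of \<open>u\<close>, whose place is known.\<close>
  have "y \<cdot> cod2 K ?\<theta> = y \<cdot> dom2 K ?\<theta>" by (rule P.discrete_whisker(2)[OF dI y T(1)]) (simp add: d)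
  then have phi4: "(y \<cdot> h) \<cdot> ?\<phi> = ps P \<cdot> ?e"
    unfolding d c using P.app_facts(4)[OF y, of ?e "u \<cdot> ?t"] by (simp add: ut sq)
  obtain \<rho> where r: "\<rho> \<in> Mor K" "src K \<rho> = src K b" "tgt K \<rho> = src K (P.pr (y \<cdot> h))" "P.pr (y \<cdot> h) \<cdot> \<rho> = b" and ar: "P.app (y \<cdot> h) ?e (\<rho> \<cdot> ?t) = ?\<phi>"
    by (rule P.curry[OF yh b(1,2) phi phi4])
  note [simp] = r(1-3)
  have rt: "P.pr (y \<cdot> h) \<cdot> \<rho> \<cdot> t = b \<cdot> t" if "t \<in> Mor K" "tgt K t = src K v" for t
    using that r(4) P.cmp_assoc'[of t \<rho> "P.pr (y \<cdot> h)"] by simp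
  have "kX \<cdot> \<rho> = v"
  proof (rule Q.curry_ext[OF f1(1,2)])
    show "Q.pr (f \<cdot> y \<cdot> h) \<cdot> kX \<cdot> \<rho> = Q.pr (f \<cdot> y \<cdot> h) \<cdot> v" using X(4)[of \<rho>] r(4) vb by simp
    fix e t assume e: "e \<in> Mor K" "tgt K e = Q.E" "t \<in> Mor K" "tgt K t = src K (kX \<cdot> \<rho>)" "src K t = src K e" "pp Q \<cdot> e = Q.pr (f \<cdot> y \<cdot> h) \<cdot> (kX \<cdot> \<rho>) \<cdot> t"
    have t [simp]: "t \<in> Mor K" "tgt K t = src K v" "src K t = src K e" using e by simp_all
    have pe: "pp Q \<cdot> e = g1 \<cdot> b \<cdot> t" using e(6) X(4)[of "\<rho> \<cdot> t"] by (simp add: rt)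
    obtain e0 where e0: "e0 \<in> Mor K" "src K e0 = src K e" "tgt K e0 = src K (pp P)" "g2 \<cdot> e0 = e" and pe0: "pp P \<cdot> e0 = b \<cdot> t"
      by (rule factor[of e "b \<cdot> t"]) (use e pe in simp_all)
    note [simp] = e0(1-3)
    let ?n = "pb_pair K (pp P) b e0 t"
    have n [simp]: "?n \<in> Mor K" "src K ?n = src K e" "tgt K ?n = src K ?e" "?e \<cdot> ?n = e0" "?t \<cdot> ?n = t" using pe0 by simp_all
    have "Q.app (f \<cdot> y \<cdot> h) (g2 \<cdot> e0) (kX \<cdot> (\<rho> \<cdot> t)) = P.app (y \<cdot> h) e0 (\<rho> \<cdot> t)"
      by (rule X(5)) (simp_all add: rt pe0)
    also have "\<dots> = P.app (y \<cdot> h) ?e (\<rho> \<cdot> ?t) \<cdot> ?n"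
      by (subst P.app_precomp[OF yh]) (simp_all add: rt sq)
    also have "\<dots> = Q.app (f \<cdot> y \<cdot> h) ((g2 \<cdot> ?e) \<cdot> ?n) ((v \<cdot> ?t) \<cdot> ?n)"
      unfolding ar by (rule Q.app_precomp[OF f1(1,2)]) (simp_all add: vt pg' sq)
    finally show "Q.app (f \<cdot> y \<cdot> h) e ((kX \<cdot> \<rho>) \<cdot> t) = Q.app (f \<cdot> y \<cdot> h) e (v \<cdot> t)" using e0(4) by simp
  qed simp_all
  then show ?thesis using r by (intro exI[of _ \<rho>]) simp
qed

text \<open>The cleavage for \<open>Q\<close> is pulled back to \<open>P\<close>, so that the values
  of both functors at \<open>y h\<close> and at \<open>y\<close> carry push-forwards. All four sides
  preserve them, and \<open>lift\<close>, \<open>poly_map_inj\<close> and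
  \<open>poly_map_vertical\<close> supply the remaining hypotheses of the abstract
  criterion.\<close>

theorem factoring_square_colax:
  assumes dI: "discrete_ob K I" and dI': "discrete_ob K I'" and hc: "has_commas K" and st: "normal_cleavage K (pp Q) st"
  shows "factoring_square K Tf kY kX Sf"
proof -
  have com: "\<exists>d c \<beta>0. comma_square K q (one K (tgt K q)) d c \<beta>0" if "q \<in> Mor K" for q
    using hc[unfolded has_commas_def, THEN bspec, THEN bspec, THEN mp, of q "one K (tgt K q)"] that P.Mor_facts(2)[OF that] P.one_facts by simp
  have f1: "f \<cdot> y \<cdot> h \<in> Mor K" "tgt K (f \<cdot> y \<cdot> h) = I'" and f2: "f \<cdot> y \<in> Mor K" "tgt K (f \<cdot> y) = I'" by simp_all
  let ?st = "star st"
  note stP = star_cleavage[OF st]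
  have PE: "\<exists>d c \<beta>0 z. pushing K (P.pr x) d c \<beta>0 z \<and> P.action_law ?st x d c \<beta>0 z" if x: "x \<in> Mor K" "tgt K x = I" for x
  proof -
    obtain d c \<beta>0 where cs: "comma_square K (P.pr x) (one K P.B) d c \<beta>0" using com[of "P.pr x"] x by auto
    show ?thesis
    proof (rule P.pushing_exists[OF x stP dI cs])
      fix z assume 1: "pushing K (P.pr x) d c \<beta>0 z" and 2: "\<And>e w. e \<in> Mor K \<Longrightarrow> tgt K e = P.E \<Longrightarrow> w \<in> Mor K \<Longrightarrow> tgt K w = src K d \<Longrightarrow>
        src K w = src K e \<Longrightarrow> pp P \<cdot> e = c \<cdot> w \<Longrightarrow> P.app x e (z \<cdot> w) = P.app x (?st e (\<beta>0 \<star> id2 K w)) (d \<cdot> w)"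
      have "P.action_law ?st x d c \<beta>0 z" unfolding P.action_law_def by (intro allI impI) (rule 2)
      then show ?thesis using 1 by blast
    qed
  qed
  have QE: "\<exists>d c \<beta>0 z. pushing K (Q.pr x) d c \<beta>0 z \<and> Q.action_law st x d c \<beta>0 z" if x: "x \<in> Mor K" "tgt K x = I'" for x
  proof -
    obtain d c \<beta>0 where cs: "comma_square K (Q.pr x) (one K Q.B) d c \<beta>0" using com[of "Q.pr x"] x by auto
    show ?thesis
    proof (rule Q.pushing_exists[OF x st dI' cs])
      fix z assume 1: "pushing K (Q.pr x) d c \<beta>0 z" and 2: "\<And>e w. e \<in> Mor K \<Longrightarrow> tgt K e = Q.E \<Longrightarrow> w \<in> Mor K \<Longrightarrow> tgt K w = src K d \<Longrightarrow>
        src K w = src K e \<Longrightarrow> pp Q \<cdot> e = c \<cdot> w \<Longrightarrow> Q.app x e (z \<cdot> w) = Q.app x (st e (\<beta>0 \<star> id2 K w)) (d \<cdot> w)"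
      have "Q.action_law st x d c \<beta>0 z" unfolding Q.action_law_def by (intro allI impI) (rule 2)
      then show ?thesis using 1 by blast
    qed
  qed
  obtain d1 c1 b1 z1 where SX: "pushing K (P.pr (y \<cdot> h)) d1 c1 b1 z1" "P.action_law ?st (y \<cdot> h) d1 c1 b1 z1" using PE[OF yh] by blast
  obtain d2 c2 b2 z2 where SY: "pushing K (P.pr y) d2 c2 b2 z2" "P.action_law ?st y d2 c2 b2 z2" using PE[OF y] by blast
  obtain d3 c3 b3 z3 where TX: "pushing K (Q.pr (f \<cdot> y \<cdot> h)) d3 c3 b3 z3" "Q.action_law st (f \<cdot> y \<cdot> h) d3 c3 b3 z3" using QE[OF f1] by blast
  obtain d4 c4 b4 z4 where TY: "pushing K (Q.pr (f \<cdot> y)) d4 c4 b4 z4" "Q.action_law st (f \<cdot> y) d4 c4 b4 z4" using QE[OF f2] by blast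
  interpret PP: two_poly K P I J P I J "one K I" "one K P.B" "one K P.E" by (rule P.two_poly_self)
  interpret QQ: two_poly K Q I' J' Q I' J' "one K I'" "one K Q.B" "one K Q.E" by (rule Q.two_poly_self)
  \<comment> \<open>For an identity square the required agreement of lifts is trivial; it lets
    \<open>push_map_poly_map\<close> treat the horizontal sides.\<close>
  have sP: "one K P.E \<cdot> ?st e \<beta> = ?st (one K P.E \<cdot> e) (id2 K (one K P.B) \<star> \<beta>)"
    if "e \<in> Mor K" "tgt K e = P.E" "\<beta> \<in> Cell K" "cod2 K \<beta> = pp P \<cdot> e" for e \<beta>
  proof -
    have "tgt K (dom2 K \<beta>) = P.B" using P.Cell_facts(4)[OF that(3)] that by simp
    then show ?thesis using that normal_cleavageD(2-4)[OF stP that] by simp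
  qed
  have sQ: "one K Q.E \<cdot> st e \<beta> = st (one K Q.E \<cdot> e) (id2 K (one K Q.B) \<star> \<beta>)"
    if "e \<in> Mor K" "tgt K e = Q.E" "\<beta> \<in> Cell K" "cod2 K \<beta> = pp Q \<cdot> e" for e \<beta>
  proof -
    have "tgt K (dom2 K \<beta>) = Q.B" using P.Cell_facts(4)[OF that(3)] that by simp
    then show ?thesis using that normal_cleavageD(2-4)[OF st that] by simp
  qed
  have mS: "push_map K (P.pr (y \<cdot> h)) d1 c1 b1 z1 (P.pr y) d2 c2 b2 z2 Sf (one K (tgt K (P.pr (y \<cdot> h))))"
    unfolding P.pr_facts(2)[OF yh]
    by (rule PP.push_map_poly_map[OF yh y h(1) _ h(2) P.act_poly_map[OF h y] SX SY stP sP]) simp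
  have hf: "tgt K h = src K (f \<cdot> y)" "(f \<cdot> y) \<cdot> h = f \<cdot> y \<cdot> h" by simp_all
  have aT: "QQ.poly_map (f \<cdot> y \<cdot> h) (f \<cdot> y) h Tf" using Q.act_poly_map[OF h(1) hf(1) f2] unfolding hf(2) .
  have mT: "push_map K (Q.pr (f \<cdot> y \<cdot> h)) d3 c3 b3 z3 (Q.pr (f \<cdot> y)) d4 c4 b4 z4 Tf (one K (tgt K (Q.pr (f \<cdot> y \<cdot> h))))"
    unfolding Q.pr_facts(2)[OF f1]
    by (rule QQ.push_map_poly_map[OF f1 f2 h(1) _ hf(1) aT TX TY st sQ]) simp
  have star_eq: "g2 \<cdot> ?st e \<beta> = st (g2 \<cdot> e) (id2 K g1 \<star> \<beta>)"
    if "e \<in> Mor K" "tgt K e = P.E" "\<beta> \<in> Cell K" "cod2 K \<beta> = pp P \<cdot> e" for e \<beta>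
    by (rule star(4)[OF st that])
  have mX: "push_map K (P.pr (y \<cdot> h)) d1 c1 b1 z1 (Q.pr (f \<cdot> y \<cdot> h)) d3 c3 b3 z3 kX g1"
    by (rule push_map_poly_map[OF yh f1 _ _ _ kX SX TX stP star_eq]) simp_all
  have mY: "push_map K (P.pr y) d2 c2 b2 z2 (Q.pr (f \<cdot> y)) d4 c4 b4 z4 kY g1"
    by (rule push_map_poly_map[OF y f2 _ _ _ kY SY TY stP star_eq]) simp_all
  show ?thesis
  proof (rule factoring_square_pushing[OF mT mS mX mY square])
    show "\<exists>\<rho>. \<rho> \<in> Mor K \<and> src K \<rho> = src K v \<and> tgt K \<rho> = src K (P.pr (y \<cdot> h)) \<and> kX \<cdot> \<rho> = v \<and> P.pr (y \<cdot> h) \<cdot> \<rho> = b"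
      if "v \<in> Mor K" "tgt K v = src K (Q.pr (f \<cdot> y \<cdot> h))" "b \<in> Mor K" "tgt K b = tgt K (P.pr (y \<cdot> h))" "src K b = src K v" "Q.pr (f \<cdot> y \<cdot> h) \<cdot> v = g1 \<cdot> b"
        "u \<in> Mor K" "src K u = src K v" "tgt K u = src K (P.pr y)" "P.pr y \<cdot> u = b" "\<omega> \<in> cells K (Tf \<cdot> v) (kY \<cdot> u)"
        "id2 K (Q.pr (f \<cdot> y)) \<star> \<omega> = id2 K (g1 \<cdot> b)" for v b u \<omega>
      using lift[OF dI that(1-3) _ that(5-12)] that(4) by simp
    show "\<rho> = \<rho>'" if "\<rho> \<in> Mor K" "\<rho>' \<in> Mor K" "src K \<rho> = src K \<rho>'" "tgt K \<rho> = src K (P.pr (y \<cdot> h))" "tgt K \<rho>' = src K (P.pr (y \<cdot> h))"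
      "kX \<cdot> \<rho> = kX \<cdot> \<rho>'" "P.pr (y \<cdot> h) \<cdot> \<rho> = P.pr (y \<cdot> h) \<cdot> \<rho>'" for \<rho> \<rho>'
      by (rule poly_map_inj[OF yh kX that])
    show "\<exists>!\<omega>'. \<omega>' \<in> cells K u u' \<and> id2 K (P.pr y) \<star> \<omega>' = id2 K (P.pr y \<cdot> u') \<and> id2 K kY \<star> \<omega>' = \<omega>"
      if "u \<in> Mor K" "u' \<in> Mor K" "src K u = src K u'" "tgt K u = src K (P.pr y)" "tgt K u' = src K (P.pr y)" "P.pr y \<cdot> u = P.pr y \<cdot> u'"
        "\<omega> \<in> cells K (kY \<cdot> u) (kY \<cdot> u')" "id2 K (Q.pr (f \<cdot> y)) \<star> \<omega> = id2 K (Q.pr (f \<cdot> y) \<cdot> kY \<cdot> u')" for u u' \<omega>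
      by (rule poly_map_vertical[OF y kY dI that])
  qed
qed

end

end

section \<open>The 2-category of small categories\<close>

lemma lesspoll_iff_ordLess:
  includes cardinal_syntax
  shows "A \<prec> B \<longleftrightarrow> |A| <o |B|"
  unfolding lesspoll_def eqpoll_iff_card_of_ordIso lepoll_def card_of_ordLeq
  using ordLeq_iff_ordLess_or_ordIso[of "|A|" "|B|"] not_ordLess_ordIso[of "|A|" "|B|"] by argo

text \<open>If one factor is infinite and neither is empty, the product has the cardinality of the
  larger factor; otherwise it is finite.\<close>

lemma lesspoll_Times:
  includes cardinal_syntax
  assumes inf: "infinite (UNIV :: 'u set)" and A: "A \<prec> (UNIV :: 'u set)" and B: "B \<prec> (UNIV :: 'u set)"
  shows "A \<times> B \<prec> (UNIV :: 'u set)"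
proof (cases "finite A \<and> finite B")
  case True
  then have "finite (A \<times> B)" by simp
  then show ?thesis using inf by (simp add: finite_lesspoll_infinite)
next
  case False
  show ?thesis
  proof (cases "A = {} \<or> B = {}")
    case True
    then have "finite (A \<times> B)" by auto
    then show ?thesis using inf by (simp add: finite_lesspoll_infinite)
  next
    case ne: False
    consider "|A| \<le>o |B|" | "|B| \<le>o |A|" using ordLeq_total[OF card_of_Well_order card_of_Well_order, of A B] by argo
    then have "|A \<times> B| =o |A| \<or> |A \<times> B| =o |B|"
    proof cases
      case 1
      then have "infinite B" using False card_of_ordLeq_finite[OF 1] by argo
      then show ?thesis using card_of_Times_infinite[of B A] 1 ne by argo
    next
      case 2
      then have "infinite A" using False card_of_ordLeq_finite[OF 2] by argo
      then show ?thesis using card_of_Times_infinite[of A B] 2 ne by argo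
    qed
    then show ?thesis using A B unfolding lesspoll_iff_ordLess
      using ordIso_ordLess_trans[of "|A \<times> B|" "|A|" "|UNIV :: 'u set|"] ordIso_ordLess_trans[of "|A \<times> B|" "|B|" "|UNIV :: 'u set|"] by argo
  qed
qed

text \<open>Objects and arrows of a category must be elements of \<open>'u\<close>. Tuples from
  small sets are encoded by such an injection, and every set of codes is small again.\<close>

lemma lesspoll_embedding:
  assumes "A \<prec> (UNIV :: 'u set)"
  obtains f :: "'a \<Rightarrow> 'u" where "inj_on f A" "\<And>S. S \<subseteq> A \<Longrightarrow> f ` S \<prec> (UNIV :: 'u set)"
proof -
  obtain f :: "'a \<Rightarrow> 'u" where f: "inj_on f A" using assms unfolding lesspoll_def lepoll_def by blast
  moreover have "f ` S \<prec> (UNIV :: 'u set)" if "S \<subseteq> A" for S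
  proof -
    have "f ` S \<approx> S" using f that by (metis bij_betw_def eqpoll_def eqpoll_sym inj_on_subset)
    moreover have "S \<lesssim> A" using that by (rule subset_imp_lepoll)
    ultimately show ?thesis using assms by (meson eqpoll_imp_lepoll lepoll_trans lesspoll_trans1)
  qed
  ultimately show thesis using that by blast
qed

lemma small_lesspoll:
  "small_category C \<Longrightarrow> Objs C \<prec> (UNIV :: 'u set)" "small_category (C :: 'u cat) \<Longrightarrow> Arrs C \<prec> (UNIV :: 'u set)"
  by (auto simp: small_category_def)

lemma ncomp_simps:
  "ncomp (vcmp Cat b a) = (\<lambda>x\<in>Objs (fsrc (ndom a)). Comp (ftgt (ndom a)) (ncomp b x) (ncomp a x))"
  "ncomp (hcmp Cat b a) = (\<lambda>x\<in>Objs (fsrc (ndom a)). Comp (ftgt (ndom b)) (ncomp b (fobj (ncod a) x)) (farr (ndom b) (ncomp a x)))"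
  "ncomp (id2 Cat F) = (\<lambda>x\<in>Objs (fsrc F). Id (ftgt F) (fobj F x))"
  by (simp_all add: Cat_def)

lemma Cat_simps: "F \<in> Mor Cat \<longleftrightarrow> is_func F" "src Cat = fsrc" "tgt Cat = ftgt" "X \<in> Ob Cat \<longleftrightarrow> small_category X" "dom2 Cat = ndom" "cod2 Cat = ncod"
  by (simp_all add: Cat_def)

lemma cells_Cat_betw: "func_betw F C D \<Longrightarrow> a \<in> cells Cat F G \<longleftrightarrow> ntrans_betw a F G C D"
  by (auto simp: cellsCat func_betw_def)

lemma func_comp_apply:
  "func_betw F C D \<Longrightarrow> x \<in> Objs C \<Longrightarrow> fobj (func_comp G F) x = fobj G (fobj F x)"
  "func_betw F C D \<Longrightarrow> x \<in> Arrs C \<Longrightarrow> farr (func_comp G F) x = farr G (farr F x)"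
  by (auto simp: func_comp_def func_betw_def)

lemma whisker_apply:
  assumes "ntrans_betw a F F' C D"
  shows "func_betw G D E \<Longrightarrow> x \<in> Objs C \<Longrightarrow> ncomp (hcmp Cat (id2 Cat G) a) x = farr G (ncomp a x)"
    and "func_betw H B C \<Longrightarrow> x \<in> Objs B \<Longrightarrow> ncomp (hcmp Cat a (id2 Cat H)) x = ncomp a (fobj H x)"
proof -
  note n = ntrans_betw_facts[OF assms]
  note f = func_betw_facts[OF n(4)] and f' = func_betw_facts[OF n(5)]
  assume x: "x \<in> Objs C" and G: "func_betw G D E"
  note g = func_betw_facts[OF G]
  show "ncomp (hcmp Cat (id2 Cat G) a) x = farr G (ncomp a x)"
    using x n(1-3)[OF x] g n f f' by (simp add: ncomp_simps category_facts(10) Cat_def)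
next
  note n = ntrans_betw_facts[OF assms]
  note f = func_betw_facts[OF n(4)] and f' = func_betw_facts[OF n(5)]
  assume x: "x \<in> Objs B" and H: "func_betw H B C"
  note h = func_betw_facts[OF H]
  show "ncomp (hcmp Cat a (id2 Cat H)) x = ncomp a (fobj H x)"
    using x h n(1-3)[OF h(1)[OF x]] n f f' by (simp add: ncomp_simps category_facts Cat_def)
qed

lemma vcmp_apply:
  assumes "ntrans_betw a F G C D" "x \<in> Objs C"
  shows "ncomp (vcmp Cat b a) x = Comp D (ncomp b x) (ncomp a x)"
  using assms ntrans_betw_facts[OF assms(1)] func_betw_facts[OF ntrans_betw_facts(4)[OF assms(1)]] by (simp add: ncomp_simps)

text \<open>The components of a transformation into \<open>I\<close> are identities, so its two
  functors agree on objects. They also agree on arrows, since an arrow of \<open>I\<close> is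
  determined by its domain.\<close>

lemma discrete_ob_Cat:
  fixes I :: "'u::universe cat"
  assumes "discrete I"
  shows "discrete_ob Cat I"
  unfolding discrete_ob_def
proof (intro ballI impI)
  fix a :: "'u ntrans" assume a: "a \<in> Cell Cat" "tgt Cat (dom2 Cat a) = I"
  let ?C = "fsrc (ndom a)"
  have n: "ntrans_betw a (ndom a) (ncod a) ?C I" using a by (auto simp: Cat_def ntrans_betw_def func_betw_def ntransformation_def Let_def)
  note N = ntrans_betw_facts[OF n] and F = func_betw_facts[OF ntrans_betw_facts(4)[OF n]] and G = func_betw_facts[OF ntrans_betw_facts(5)[OF n]]
  have d: "g = Id I (Dom I g)" "Cod I g = Dom I g" if "g \<in> Arrs I" for g
  proof -
    show 1: "g = Id I (Dom I g)" using assms that unfolding discrete_def by blast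
    have "Cod I (Id I (Dom I g)) = Dom I g" using category_facts(1)[OF F(8) that] category_facts(5)[OF F(8)] by blast
    then show "Cod I g = Dom I g" using 1 by simp
  qed
  have o: "fobj (ncod a) x = fobj (ndom a) x" if "x \<in> Objs ?C" for x using d(2)[OF N(1)[OF that]] N(2,3)[OF that] by simp
  have e: "ncod a = ndom a"
  proof (rule func_eqI[OF N(5) N(4) o])
    fix x assume x: "x \<in> Arrs ?C"
    show "farr (ncod a) x = farr (ndom a) x"
      using d(1)[OF F(2)[OF x]] d(1)[OF G(2)[OF x]] F(3)[OF x] G(3)[OF x] o[OF category_facts(1)[OF F(7) x]] by simp
  qed
  have "a = id2 Cat (ndom a)"
  proof (rule ntrans_eqI)
    show "ntrans_betw a (ndom a) (ndom a) ?C I" using n e by simp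
    show "ntrans_betw (id2 Cat (ndom a)) (ndom a) (ndom a) ?C I" by (rule id2_betw[OF N(4)])
    fix x assume x: "x \<in> Objs ?C"
    show "ncomp a x = ncomp (id2 Cat (ndom a)) x" using d(1)[OF N(1)[OF x]] N(2)[OF x] x F by (simp add: ncomp_simps)
  qed
  then show "a = id2 Cat (dom2 Cat a)" by (simp add: Cat_def)
qed

section \<open>Comma categories and pullbacks of small categories\<close>

lemma func_betwI:
  assumes "small_category C" "small_category D" "fsrc F = C" "ftgt F = D" "fobj F \<in> extensional (Objs C)" "farr F \<in> extensional (Arrs C)"
    "\<And>x. x \<in> Objs C \<Longrightarrow> fobj F x \<in> Objs D \<and> farr F (Id C x) = Id D (fobj F x)"
    "\<And>g. g \<in> Arrs C \<Longrightarrow> farr F g \<in> Arrs D \<and> Dom D (farr F g) = fobj F (Dom C g) \<and> Cod D (farr F g) = fobj F (Cod C g)"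
    "\<And>g h. g \<in> Arrs C \<Longrightarrow> h \<in> Arrs C \<Longrightarrow> Cod C g = Dom C h \<Longrightarrow> farr F (Comp C h g) = Comp D (farr F h) (farr F g)"
  shows "func_betw F C D"
  using assms unfolding func_betw_def is_func_def functorial_def Let_def PiE_def by auto

text \<open>
  The full subcategory of the comma category of \<open>f\<close> and \<open>k\<close> on the arrows in \<open>\<Phi>\<close>, transported to
  \<open>'u\<close> along injections \<open>eo\<close>, \<open>ea\<close>.  It is the comma category for \<open>\<Phi>\<close> the set of all arrows, and
  the pullback for \<open>\<Phi>\<close> the set of identities.
\<close>

locale comma_cat =
  fixes f k :: "'u::universe func" and X Y Z :: "'u cat" and \<Phi> :: "'u set" and eo :: "'u \<times> 'u \<times> 'u \<Rightarrow> 'u" and ea :: "'u \<times> 'u \<times> 'u \<times> 'u \<Rightarrow> 'u"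
  assumes f: "func_betw f X Z" and k: "func_betw k Y Z"
    and eo: "inj_on eo (Objs X \<times> Objs Y \<times> Arrs Z)" and eo_small: "\<And>S. S \<subseteq> Objs X \<times> Objs Y \<times> Arrs Z \<Longrightarrow> eo ` S \<prec> (UNIV :: 'u set)"
    and ea: "inj_on ea (Arrs X \<times> Arrs Y \<times> Arrs Z \<times> Arrs Z)" and ea_small: "\<And>S. S \<subseteq> Arrs X \<times> Arrs Y \<times> Arrs Z \<times> Arrs Z \<Longrightarrow> ea ` S \<prec> (UNIV :: 'u set)"
    and \<Phi>: "\<Phi> \<subseteq> Arrs Z"
begin

lemmas F = func_betw_facts[OF f] and K = func_betw_facts[OF k]
lemmas X = category_facts[OF F(7)] and Y = category_facts[OF K(7)] and Z = category_facts[OF F(8)]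

definition OS where "OS = {(x, y, \<phi>). x \<in> Objs X \<and> y \<in> Objs Y \<and> \<phi> \<in> \<Phi> \<and> Dom Z \<phi> = fobj f x \<and> Cod Z \<phi> = fobj k y}"
text \<open>An arrow is recorded with the third components of both its ends, because a code must
  determine domain and codomain; the pair (\<open>a\<close>, \<open>b\<close>) alone would
  not.\<close>

definition AS where "AS = {(a, b, \<phi>, \<phi>'). a \<in> Arrs X \<and> b \<in> Arrs Y \<and> (Dom X a, Dom Y b, \<phi>) \<in> OS \<and> (Cod X a, Cod Y b, \<phi>') \<in> OS \<and>
  Comp Z (farr k b) \<phi> = Comp Z \<phi>' (farr f a)}"
definition uo where "uo = inv_into (Objs X \<times> Objs Y \<times> Arrs Z) eo"
definition ua where "ua = inv_into (Arrs X \<times> Arrs Y \<times> Arrs Z \<times> Arrs Z) ea"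

definition P where "P = \<lparr>Objs = eo ` OS, Arrs = ea ` AS,
  Dom = (\<lambda>r. case ua r of (a, b, \<phi>, \<phi>') \<Rightarrow> eo (Dom X a, Dom Y b, \<phi>)),
  Cod = (\<lambda>r. case ua r of (a, b, \<phi>, \<phi>') \<Rightarrow> eo (Cod X a, Cod Y b, \<phi>')),
  Id = (\<lambda>r. case uo r of (x, y, \<phi>) \<Rightarrow> ea (Id X x, Id Y y, \<phi>, \<phi>)),
  Comp = (\<lambda>r q. case ua r of (a', b', \<phi>1, \<phi>2) \<Rightarrow> case ua q of (a, b, \<phi>, \<phi>') \<Rightarrow> ea (Comp X a' a, Comp Y b' b, \<phi>, \<phi>2))\<rparr>"

lemma OS_sub: "OS \<subseteq> Objs X \<times> Objs Y \<times> Arrs Z" and AS_sub: "AS \<subseteq> Arrs X \<times> Arrs Y \<times> Arrs Z \<times> Arrs Z"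
  using \<Phi> by (auto simp: OS_def AS_def)

lemma OSD: "(x, y, \<phi>) \<in> OS \<Longrightarrow> x \<in> Objs X" "(x, y, \<phi>) \<in> OS \<Longrightarrow> y \<in> Objs Y" "(x, y, \<phi>) \<in> OS \<Longrightarrow> \<phi> \<in> Arrs Z" "(x, y, \<phi>) \<in> OS \<Longrightarrow> \<phi> \<in> \<Phi>"
  "(x, y, \<phi>) \<in> OS \<Longrightarrow> Dom Z \<phi> = fobj f x" "(x, y, \<phi>) \<in> OS \<Longrightarrow> Cod Z \<phi> = fobj k y"
  using \<Phi> by (auto simp: OS_def)

lemma ASD: assumes "(a, b, \<phi>, \<phi>') \<in> AS" shows "a \<in> Arrs X" "b \<in> Arrs Y" "(Dom X a, Dom Y b, \<phi>) \<in> OS" "(Cod X a, Cod Y b, \<phi>') \<in> OS"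
  "Comp Z (farr k b) \<phi> = Comp Z \<phi>' (farr f a)"
  using assms by (auto simp: AS_def)

lemma uo [simp]: "t \<in> OS \<Longrightarrow> uo (eo t) = t" unfolding uo_def using inv_into_f_f[OF eo] OS_sub by blast
lemma ua [simp]: "t \<in> AS \<Longrightarrow> ua (ea t) = t" unfolding ua_def using inv_into_f_f[OF ea] AS_sub by blast
lemma eo_eq: "t \<in> OS \<Longrightarrow> t' \<in> OS \<Longrightarrow> eo t = eo t' \<longleftrightarrow> t = t'" using uo by metis

lemma AS_id: "(x, y, \<phi>) \<in> OS \<Longrightarrow> (Id X x, Id Y y, \<phi>, \<phi>) \<in> AS"
  using OSD[of x y \<phi>] by (simp add: AS_def X Y Z F K)

lemma AS_comp:
  assumes t: "(a, b, \<phi>, \<phi>1) \<in> AS" and t': "(a', b', \<phi>1', \<phi>2) \<in> AS" and e: "Cod X a = Dom X a'" "Cod Y b = Dom Y b'" "\<phi>1 = \<phi>1'"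
  shows "(Comp X a' a, Comp Y b' b, \<phi>, \<phi>2) \<in> AS"
proof -
  note T = ASD[OF t] and T' = ASD[OF t']
  note O = OSD[OF T(3)] OSD[OF T(4)] OSD[OF T'(4)]
  have "Comp Z (farr k (Comp Y b' b)) \<phi> = Comp Z (farr k b') (Comp Z (farr k b) \<phi>)" using T T' e O by (simp add: K Z)
  also have "\<dots> = Comp Z (Comp Z (farr k b') \<phi>1) (farr f a)" unfolding T(5) using T T' e O by (intro Z(11)[symmetric]) (simp_all add: K F)
  also have "Comp Z (farr k b') \<phi>1 = Comp Z \<phi>2 (farr f a')" using T'(5) e by simp
  also have "Comp Z (Comp Z \<phi>2 (farr f a')) (farr f a) = Comp Z \<phi>2 (farr f (Comp X a' a))" using T T' e O by (simp add: K Z F)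
  finally show ?thesis using T T' e by (simp add: AS_def X Y)
qed

lemma P_simps: "Objs P = eo ` OS" "Arrs P = ea ` AS"
  "(a, b, \<phi>, \<phi>') \<in> AS \<Longrightarrow> Dom P (ea (a, b, \<phi>, \<phi>')) = eo (Dom X a, Dom Y b, \<phi>)"
  "(a, b, \<phi>, \<phi>') \<in> AS \<Longrightarrow> Cod P (ea (a, b, \<phi>, \<phi>')) = eo (Cod X a, Cod Y b, \<phi>')"
  "(x, y, \<phi>) \<in> OS \<Longrightarrow> Id P (eo (x, y, \<phi>)) = ea (Id X x, Id Y y, \<phi>, \<phi>)"
  "(a, b, \<phi>, \<phi>1) \<in> AS \<Longrightarrow> (a', b', \<phi>1', \<phi>2) \<in> AS \<Longrightarrow> Comp P (ea (a', b', \<phi>1', \<phi>2)) (ea (a, b, \<phi>, \<phi>1)) = ea (Comp X a' a, Comp Y b' b, \<phi>, \<phi>2)"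
  by (simp_all add: P_def)

lemma P_composable:
  assumes t: "(a, b, \<phi>, \<phi>1) \<in> AS" and t': "(a', b', \<phi>1', \<phi>2) \<in> AS" and e: "Cod P (ea (a, b, \<phi>, \<phi>1)) = Dom P (ea (a', b', \<phi>1', \<phi>2))"
  shows "Cod X a = Dom X a'" "Cod Y b = Dom Y b'" "\<phi>1 = \<phi>1'"
  using e eo_eq[OF ASD(4)[OF t] ASD(3)[OF t']] by (simp_all add: P_simps t t')

lemma category_P: "category P"
  unfolding category_def
proof (intro conjI ballI impI)
  show "Dom P \<in> Arrs P \<rightarrow> Objs P" "Cod P \<in> Arrs P \<rightarrow> Objs P" by (auto simp: P_simps dest: ASD)
next
  fix r assume "r \<in> Objs P"
  then obtain x y \<phi> where r: "r = eo (x, y, \<phi>)" and o: "(x, y, \<phi>) \<in> OS" by (auto simp: P_simps)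
  note O = OSD[OF o]
  show "Id P r \<in> Arrs P" "Dom P (Id P r) = r" "Cod P (Id P r) = r" using AS_id[OF o] o O unfolding r by (simp_all add: P_simps X Y)
next
  fix r q assume "r \<in> Arrs P" "q \<in> Arrs P" and e: "Cod P r = Dom P q"
  then obtain a b \<phi> \<phi>1 a' b' \<phi>1' \<phi>2 where r: "r = ea (a, b, \<phi>, \<phi>1)" "q = ea (a', b', \<phi>1', \<phi>2)" and t: "(a, b, \<phi>, \<phi>1) \<in> AS" "(a', b', \<phi>1', \<phi>2) \<in> AS"
    unfolding P_simps(1,2) by (auto simp: image_iff)
  note c = P_composable[OF t e[unfolded r]]
  note A = AS_comp[OF t c] and D = ASD[OF t(1)] ASD[OF t(2)]
  show "Comp P q r \<in> Arrs P" "Dom P (Comp P q r) = Dom P r" "Cod P (Comp P q r) = Cod P q"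
    using A D c t unfolding r by (simp_all add: P_simps X Y)
next
  fix r assume "r \<in> Arrs P"
  then obtain a b \<phi> \<phi>1 where r: "r = ea (a, b, \<phi>, \<phi>1)" and t: "(a, b, \<phi>, \<phi>1) \<in> AS" unfolding P_simps(1,2) by (auto simp: image_iff)
  note D = ASD[OF t] and I = AS_id[OF ASD(3)[OF t]] AS_id[OF ASD(4)[OF t]]
  show "Comp P r (Id P (Dom P r)) = r" "Comp P (Id P (Cod P r)) r = r" using D I t unfolding r by (simp_all add: P_simps X Y)
next
  fix r q s assume "r \<in> Arrs P" "q \<in> Arrs P" "s \<in> Arrs P" and e: "Cod P r = Dom P q \<and> Cod P q = Dom P s"
  then obtain a b \<phi> \<phi>1 a' b' \<phi>1' \<phi>2 a'' b'' \<phi>2' \<phi>3 where r: "r = ea (a, b, \<phi>, \<phi>1)" "q = ea (a', b', \<phi>1', \<phi>2)" "s = ea (a'', b'', \<phi>2', \<phi>3)"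
    and t: "(a, b, \<phi>, \<phi>1) \<in> AS" "(a', b', \<phi>1', \<phi>2) \<in> AS" "(a'', b'', \<phi>2', \<phi>3) \<in> AS"
    unfolding P_simps(1,2) by (auto simp: image_iff)
  note c = P_composable[OF t(1,2) e[unfolded r, THEN conjunct1]] and c' = P_composable[OF t(2,3) e[unfolded r, THEN conjunct2]]
  note A = AS_comp[OF t(1,2) c] AS_comp[OF t(2,3) c'] and D = ASD[OF t(1)] ASD[OF t(2)] ASD[OF t(3)]
  show "Comp P (Comp P s q) r = Comp P s (Comp P q r)" using A D c c' t unfolding r by (simp add: P_simps X Y)
qed

lemma small_P: "small_category P"
  unfolding small_category_def using category_P eo_small[OF OS_sub] ea_small[OF AS_sub] by (simp add: P_simps)

definition p where "p = \<lparr>fsrc = P, ftgt = X, fobj = (\<lambda>r\<in>Objs P. fst (uo r)), farr = (\<lambda>r\<in>Arrs P. fst (ua r))\<rparr>"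
definition q where "q = \<lparr>fsrc = P, ftgt = Y, fobj = (\<lambda>r\<in>Objs P. fst (snd (uo r))), farr = (\<lambda>r\<in>Arrs P. fst (snd (ua r)))\<rparr>"
definition l where "l = \<lparr>ndom = func_comp f p, ncod = func_comp k q, ncomp = (\<lambda>r\<in>Objs P. snd (snd (uo r)))\<rparr>"

lemma pq_apply: "(x, y, \<phi>) \<in> OS \<Longrightarrow> fobj p (eo (x, y, \<phi>)) = x" "(x, y, \<phi>) \<in> OS \<Longrightarrow> fobj q (eo (x, y, \<phi>)) = y" "(x, y, \<phi>) \<in> OS \<Longrightarrow> ncomp l (eo (x, y, \<phi>)) = \<phi>"
  "(a, b, \<phi>, \<phi>') \<in> AS \<Longrightarrow> farr p (ea (a, b, \<phi>, \<phi>')) = a" "(a, b, \<phi>, \<phi>') \<in> AS \<Longrightarrow> farr q (ea (a, b, \<phi>, \<phi>')) = b"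
  by (simp_all add: p_def q_def l_def P_simps)

lemma obj: assumes "r \<in> Objs P" shows "r = eo (fobj p r, fobj q r, ncomp l r)" "(fobj p r, fobj q r, ncomp l r) \<in> OS"
  using assms by (auto simp: P_simps pq_apply)

lemma arr: assumes "r \<in> Arrs P" shows "r = ea (farr p r, farr q r, ncomp l (Dom P r), ncomp l (Cod P r))"
    "(farr p r, farr q r, ncomp l (Dom P r), ncomp l (Cod P r)) \<in> AS"
proof -
  obtain a b \<phi> \<phi>1 where r: "r = ea (a, b, \<phi>, \<phi>1)" and t: "(a, b, \<phi>, \<phi>1) \<in> AS" using assms unfolding P_simps(1,2) by (auto simp: image_iff)
  note D = ASD[OF t]
  show "r = ea (farr p r, farr q r, ncomp l (Dom P r), ncomp l (Cod P r))" "(farr p r, farr q r, ncomp l (Dom P r), ncomp l (Cod P r)) \<in> AS"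
    using t D unfolding r by (simp_all add: P_simps pq_apply)
qed

lemma p_betw: "func_betw p P X" and q_betw: "func_betw q P Y"
proof -
  have o: "fobj p r \<in> Objs X \<and> farr p (Id P r) = Id X (fobj p r)" "fobj q r \<in> Objs Y \<and> farr q (Id P r) = Id Y (fobj q r)" if rP: "r \<in> Objs P" for r
  proof -
    obtain x y \<phi> where r: "r = eo (x, y, \<phi>)" and o: "(x, y, \<phi>) \<in> OS" using rP by (auto simp: P_simps)
    show "fobj p r \<in> Objs X \<and> farr p (Id P r) = Id X (fobj p r)" "fobj q r \<in> Objs Y \<and> farr q (Id P r) = Id Y (fobj q r)"
      using o OSD[OF o] AS_id[OF o] unfolding r by (simp_all add: P_simps pq_apply)
  qed
  have a: "farr p r \<in> Arrs X \<and> Dom X (farr p r) = fobj p (Dom P r) \<and> Cod X (farr p r) = fobj p (Cod P r)"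
      "farr q r \<in> Arrs Y \<and> Dom Y (farr q r) = fobj q (Dom P r) \<and> Cod Y (farr q r) = fobj q (Cod P r)"  if rP: "r \<in> Arrs P" for r
  proof -
    obtain a b \<phi> \<phi>1 where r: "r = ea (a, b, \<phi>, \<phi>1)" and t: "(a, b, \<phi>, \<phi>1) \<in> AS" using rP unfolding P_simps(1,2) by (auto simp: image_iff)
    show "farr p r \<in> Arrs X \<and> Dom X (farr p r) = fobj p (Dom P r) \<and> Cod X (farr p r) = fobj p (Cod P r)"
      "farr q r \<in> Arrs Y \<and> Dom Y (farr q r) = fobj q (Dom P r) \<and> Cod Y (farr q r) = fobj q (Cod P r)"
      using t ASD[OF t] unfolding r by (simp_all add: P_simps pq_apply)
  qed
  have c: "farr p (Comp P q' r) = Comp X (farr p q') (farr p r)" "farr q (Comp P q' r) = Comp Y (farr q q') (farr q r)"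
    if rq: "r \<in> Arrs P" "q' \<in> Arrs P" and e: "Cod P r = Dom P q'" for r q'
  proof -
    obtain a b \<phi> \<phi>1 a' b' \<phi>1' \<phi>2 where r: "r = ea (a, b, \<phi>, \<phi>1)" "q' = ea (a', b', \<phi>1', \<phi>2)" and t: "(a, b, \<phi>, \<phi>1) \<in> AS" "(a', b', \<phi>1', \<phi>2) \<in> AS"
      using rq unfolding P_simps(1,2) by (auto simp: image_iff)
    note c = P_composable[OF t e[unfolded r]]
    show "farr p (Comp P q' r) = Comp X (farr p q') (farr p r)" "farr q (Comp P q' r) = Comp Y (farr q q') (farr q r)"
      using AS_comp[OF t c] t unfolding r by (simp_all add: P_simps pq_apply)
  qed
  show "func_betw p P X" by (rule func_betwI[OF small_P F(7)]) (use o(1) a(1) c(1) in \<open>simp_all add: p_def\<close>)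
  show "func_betw q P Y" by (rule func_betwI[OF small_P K(7)]) (use o(2) a(2) c(2) in \<open>simp_all add: q_def\<close>)
qed

lemma l_betw: "ntrans_betw l (func_comp f p) (func_comp k q) P Z"
proof (rule ntrans_betwI[OF func_comp_betw[OF p_betw f] func_comp_betw[OF q_betw k]])
  show "ndom l = func_comp f p" "ncod l = func_comp k q" "ncomp l \<in> extensional (Objs P)" by (simp_all add: l_def)
next
  fix r assume r: "r \<in> Objs P"
  show "ncomp l r \<in> Arrs Z \<and> Dom Z (ncomp l r) = fobj (func_comp f p) r \<and> Cod Z (ncomp l r) = fobj (func_comp k q) r"
    using OSD[OF obj(2)[OF r]] func_comp_apply(1)[OF p_betw r] func_comp_apply(1)[OF q_betw r] by simp
next
  fix r assume r: "r \<in> Arrs P"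
  show "Comp Z (ncomp l (Cod P r)) (farr (func_comp f p) r) = Comp Z (farr (func_comp k q) r) (ncomp l (Dom P r))"
    using ASD(5)[OF arr(2)[OF r]] func_comp_apply(2)[OF p_betw r] func_comp_apply(2)[OF q_betw r] by simp
qed

lemma l_\<Phi>: "r \<in> Objs P \<Longrightarrow> ncomp l r \<in> \<Phi>" using OSD(4)[OF obj(2)] by blast

lemma P_obj_eqI: assumes "r \<in> Objs P" "r' \<in> Objs P" "fobj p r = fobj p r'" "fobj q r = fobj q r'" "ncomp l r = ncomp l r'" shows "r = r'"
  using obj(1)[OF assms(1)] obj(1)[OF assms(2)] assms(3-5) by simp

lemma P_arr_eqI: assumes "r \<in> Arrs P" "r' \<in> Arrs P" "farr p r = farr p r'" "farr q r = farr q r'" "Dom P r = Dom P r'" "Cod P r = Cod P r'" shows "r = r'"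
  using arr(1)[OF assms(1)] arr(1)[OF assms(2)] assms(3-6) by simp

text \<open>The functor is forced on objects by the triple of \<open>u\<close>, \<open>v\<close> and
  \<theta>, and on arrows by naturality of \<theta>. The condition \<theta>\<Phi> says that the
  triples belong to the full subcategory cut out by \<Phi>.\<close>

lemma UP1:
  assumes u: "func_betw u W X" and v: "func_betw v W Y" and th: "ntrans_betw \<theta> (func_comp f u) (func_comp k v) W Z"
    and \<theta>\<Phi>: "\<And>w. w \<in> Objs W \<Longrightarrow> ncomp \<theta> w \<in> \<Phi>"
  shows "\<exists>!w. func_betw w W P \<and> func_comp p w = u \<and> func_comp q w = v \<and> hcmp Cat l (id2 Cat w) = \<theta>"
proof -
  note U = func_betw_facts[OF u] and V = func_betw_facts[OF v] and T = ntrans_betw_facts[OF th]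
  note W = category_facts[OF U(7)]
  let ?o = "\<lambda>x. (fobj u x, fobj v x, ncomp \<theta> x)" and ?a = "\<lambda>a. (farr u a, farr v a, ncomp \<theta> (Dom W a), ncomp \<theta> (Cod W a))"
  have os: "?o x \<in> OS" if x: "x \<in> Objs W" for x
    using T(2,3)[OF x] U(1)[OF x] V(1)[OF x] \<theta>\<Phi>[OF x] func_comp_apply(1)[OF u x] func_comp_apply(1)[OF v x] by (simp add: OS_def)
  have as: "?a a \<in> AS" if a: "a \<in> Arrs W" for a
    using os[OF W(1)[OF a]] os[OF W(2)[OF a]] ntrans_betw_natural[OF th a refl refl] U(2-4)[OF a] V(2-4)[OF a] func_comp_apply(2)[OF u a] func_comp_apply(2)[OF v a]
    by (simp add: AS_def)
  define w where "w = \<lparr>fsrc = W, ftgt = P, fobj = (\<lambda>x\<in>Objs W. eo (?o x)), farr = (\<lambda>a\<in>Arrs W. ea (?a a))\<rparr>"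
  have w: "func_betw w W P"
  proof (rule func_betwI[OF U(7) small_P])
    fix x assume x: "x \<in> Objs W"
    show "fobj w x \<in> Objs P \<and> farr w (Id W x) = Id P (fobj w x)" using x os[OF x] W(3-5)[OF x] U(5)[OF x] V(5)[OF x] by (simp add: w_def P_simps)
  next
    fix a assume a: "a \<in> Arrs W"
    show "farr w a \<in> Arrs P \<and> Dom P (farr w a) = fobj w (Dom W a) \<and> Cod P (farr w a) = fobj w (Cod W a)"
      using a as[OF a] W(1,2)[OF a] U(3,4)[OF a] V(3,4)[OF a] by (simp add: w_def P_simps)
  next
    fix a b assume a: "a \<in> Arrs W" "b \<in> Arrs W" "Cod W a = Dom W b"
    show "farr w (Comp W b a) = Comp P (farr w b) (farr w a)"
      using a as[OF a(1)] as[OF a(2)] W(6-8)[OF a] U(6)[OF a] V(6)[OF a] by (simp add: w_def P_simps)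
  qed (simp_all add: w_def)
  have wa: "x \<in> Objs W \<Longrightarrow> fobj w x = eo (?o x)" "a \<in> Arrs W \<Longrightarrow> farr w a = ea (?a a)" for x a by (simp_all add: w_def)
  have up: "func_comp p w = u"
    by (rule func_eqI[OF func_comp_betw[OF w p_betw] u]) (use os as in \<open>simp_all add: func_comp_apply[OF w] wa pq_apply\<close>)
  have vq: "func_comp q w = v"
    by (rule func_eqI[OF func_comp_betw[OF w q_betw] v]) (use os as in \<open>simp_all add: func_comp_apply[OF w] wa pq_apply\<close>)
  have lw: "ntrans_betw (hcmp Cat l (id2 Cat w')) (func_comp f u) (func_comp k v) W Z" if "func_betw w' W P" "func_comp p w' = u" "func_comp q w' = v" for w'
    using hcmp_betw[OF id2_betw[OF that(1)] l_betw] func_comp_assoc[OF that(1) p_betw f] func_comp_assoc[OF that(1) q_betw k] that by simp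
  have lt: "hcmp Cat l (id2 Cat w) = \<theta>"
  proof (rule ntrans_eqI[OF lw[OF w up vq] th])
    fix x assume x: "x \<in> Objs W"
    show "ncomp (hcmp Cat l (id2 Cat w)) x = ncomp \<theta> x" unfolding whisker_apply(2)[OF l_betw w x] using x os[OF x] by (simp add: wa pq_apply)
  qed
  show ?thesis
  proof (rule ex1I[of _ w], intro conjI)
    show "func_betw w W P" "func_comp p w = u" "func_comp q w = v" "hcmp Cat l (id2 Cat w) = \<theta>" by fact+
    fix w' assume *: "func_betw w' W P \<and> func_comp p w' = u \<and> func_comp q w' = v \<and> hcmp Cat l (id2 Cat w') = \<theta>"
    then have w': "func_betw w' W P" and e: "func_comp p w' = func_comp p w" "func_comp q w' = func_comp q w" "hcmp Cat l (id2 Cat w') = hcmp Cat l (id2 Cat w)"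
      using up vq lt by simp_all
    note A = func_betw_facts[OF w] and A' = func_betw_facts[OF w']
    have o: "fobj w' x = fobj w x" if x: "x \<in> Objs W" for x
    proof (rule P_obj_eqI[OF A'(1)[OF x] A(1)[OF x]])
      show "fobj p (fobj w' x) = fobj p (fobj w x)" "fobj q (fobj w' x) = fobj q (fobj w x)"
        using arg_cong[OF e(1), of "\<lambda>g. fobj g x"] arg_cong[OF e(2), of "\<lambda>g. fobj g x"] func_comp_apply(1)[OF w x] func_comp_apply(1)[OF w' x] by simp_all
      show "ncomp l (fobj w' x) = ncomp l (fobj w x)"
        using arg_cong[OF e(3), of "\<lambda>g. ncomp g x"] whisker_apply(2)[OF l_betw w x] whisker_apply(2)[OF l_betw w' x] by simp
    qed
    show "w' = w"
    proof (rule func_eqI[OF w' w o])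
      fix x assume x: "x \<in> Arrs W"
      show "farr w' x = farr w x"
      proof (rule P_arr_eqI[OF A'(2)[OF x] A(2)[OF x]])
        show "farr p (farr w' x) = farr p (farr w x)" "farr q (farr w' x) = farr q (farr w x)"
          using arg_cong[OF e(1), of "\<lambda>g. farr g x"] arg_cong[OF e(2), of "\<lambda>g. farr g x"] func_comp_apply(2)[OF w x] func_comp_apply(2)[OF w' x] by simp_all
        show "Dom P (farr w' x) = Dom P (farr w x)" "Cod P (farr w' x) = Cod P (farr w x)"
          unfolding A(3,4)[OF x] A'(3,4)[OF x] using o W(1,2)[OF x] by simp_all
      qed
    qed
  qed
qed

text \<open>The hypothesis \<open>nat\<close> makes each pair of components of \<alpha> and \<beta>
  an arrow of \<open>P\<close>. Naturality of the resulting family is checked after the two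
  projections, which together with domain and codomain determine an arrow.\<close>

lemma UP2:
  assumes w: "func_betw w W P" and w': "func_betw w' W P" and al: "ntrans_betw \<alpha> (func_comp p w) (func_comp p w') W X" and be: "ntrans_betw \<beta> (func_comp q w) (func_comp q w') W Y"
    and nat: "\<And>x. x \<in> Objs W \<Longrightarrow> Comp Z (farr k (ncomp \<beta> x)) (ncomp l (fobj w x)) = Comp Z (ncomp l (fobj w' x)) (farr f (ncomp \<alpha> x))"
  shows "\<exists>!\<gamma>. ntrans_betw \<gamma> w w' W P \<and> hcmp Cat (id2 Cat p) \<gamma> = \<alpha> \<and> hcmp Cat (id2 Cat q) \<gamma> = \<beta>"
proof -
  note A = func_betw_facts[OF w] and A' = func_betw_facts[OF w'] and al' = ntrans_betw_facts[OF al] and be' = ntrans_betw_facts[OF be]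
  note W = category_facts[OF A(7)]
  let ?a = "\<lambda>x. (ncomp \<alpha> x, ncomp \<beta> x, ncomp l (fobj w x), ncomp l (fobj w' x))"
  have D: "Dom X (ncomp \<alpha> x) = fobj p (fobj w x)" "Cod X (ncomp \<alpha> x) = fobj p (fobj w' x)" "Dom Y (ncomp \<beta> x) = fobj q (fobj w x)" "Cod Y (ncomp \<beta> x) = fobj q (fobj w' x)"
    if "x \<in> Objs W" for x using al'(2,3)[OF that] be'(2,3)[OF that] func_comp_apply(1)[OF w that] func_comp_apply(1)[OF w' that] by simp_all
  have as: "?a x \<in> AS" if x: "x \<in> Objs W" for x
    using obj(2)[OF A(1)[OF x]] obj(2)[OF A'(1)[OF x]] nat[OF x] al'(1)[OF x] be'(1)[OF x] D[OF x] by (simp add: AS_def)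
  define \<gamma> where "\<gamma> = \<lparr>ndom = w, ncod = w', ncomp = (\<lambda>x\<in>Objs W. ea (?a x))\<rparr>"
  have g: "ncomp \<gamma> x \<in> Arrs P" "Dom P (ncomp \<gamma> x) = fobj w x" "Cod P (ncomp \<gamma> x) = fobj w' x" "farr p (ncomp \<gamma> x) = ncomp \<alpha> x" "farr q (ncomp \<gamma> x) = ncomp \<beta> x"
    if x: "x \<in> Objs W" for x
    using as[OF x] D[OF x] x obj(1)[OF A(1)[OF x], symmetric] obj(1)[OF A'(1)[OF x], symmetric] by (simp_all add: \<gamma>_def P_simps pq_apply)
  note cP = category_facts[OF small_P] and p' = func_betw_facts[OF p_betw] and q' = func_betw_facts[OF q_betw]
  have gam: "ntrans_betw \<gamma> w w' W P"
  proof (rule ntrans_betwI[OF w w'])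
    show "ndom \<gamma> = w" "ncod \<gamma> = w'" "ncomp \<gamma> \<in> extensional (Objs W)" by (simp_all add: \<gamma>_def)
    show "ncomp \<gamma> x \<in> Arrs P \<and> Dom P (ncomp \<gamma> x) = fobj w x \<and> Cod P (ncomp \<gamma> x) = fobj w' x" if "x \<in> Objs W" for x using g[OF that] by simp
    fix a assume a: "a \<in> Arrs W"
    note G1 = g[OF W(1)[OF a]] and G2 = g[OF W(2)[OF a]]
    have c1: "Cod P (farr w a) = Dom P (ncomp \<gamma> (Cod W a))" and c2: "Cod P (ncomp \<gamma> (Dom W a)) = Dom P (farr w' a)"
      unfolding A(4)[OF a] G2 A'(3)[OF a] G1 by simp_all
    note m1 = A(2)[OF a] G2(1) c1 and m2 = G1(1) A'(2)[OF a] c2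
    show "Comp P (ncomp \<gamma> (Cod W a)) (farr w a) = Comp P (farr w' a) (ncomp \<gamma> (Dom W a))"
    proof (rule P_arr_eqI[OF cP(6)[OF m1] cP(6)[OF m2]])
      show "farr p (Comp P (ncomp \<gamma> (Cod W a)) (farr w a)) = farr p (Comp P (farr w' a) (ncomp \<gamma> (Dom W a)))"
        unfolding p'(6)[OF m1] p'(6)[OF m2] G1(4) G2(4)
        using ntrans_betw_natural[OF al a refl refl] func_comp_apply(2)[OF w a] func_comp_apply(2)[OF w' a] by simp
      show "farr q (Comp P (ncomp \<gamma> (Cod W a)) (farr w a)) = farr q (Comp P (farr w' a) (ncomp \<gamma> (Dom W a)))"
        unfolding q'(6)[OF m1] q'(6)[OF m2] G1(5) G2(5)
        using ntrans_betw_natural[OF be a refl refl] func_comp_apply(2)[OF w a] func_comp_apply(2)[OF w' a] by simp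
      show "Dom P (Comp P (ncomp \<gamma> (Cod W a)) (farr w a)) = Dom P (Comp P (farr w' a) (ncomp \<gamma> (Dom W a)))"
        unfolding cP(7)[OF m1] cP(7)[OF m2] A(3)[OF a] G1(2) ..
      show "Cod P (Comp P (ncomp \<gamma> (Cod W a)) (farr w a)) = Cod P (Comp P (farr w' a) (ncomp \<gamma> (Dom W a)))"
        unfolding cP(8)[OF m1] cP(8)[OF m2] A'(4)[OF a] G2(3) ..
    qed
  qed
  show ?thesis
  proof (rule ex1I[of _ \<gamma>], intro conjI)
    show "ntrans_betw \<gamma> w w' W P" by fact
    show "hcmp Cat (id2 Cat p) \<gamma> = \<alpha>"
      by (rule ntrans_eqI[OF hcmp_betw[OF gam id2_betw[OF p_betw]] al]) (simp add: whisker_apply(1)[OF gam p_betw] g)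
    show "hcmp Cat (id2 Cat q) \<gamma> = \<beta>"
      by (rule ntrans_eqI[OF hcmp_betw[OF gam id2_betw[OF q_betw]] be]) (simp add: whisker_apply(1)[OF gam q_betw] g)
    fix \<delta> assume *: "ntrans_betw \<delta> w w' W P \<and> hcmp Cat (id2 Cat p) \<delta> = \<alpha> \<and> hcmp Cat (id2 Cat q) \<delta> = \<beta>"
    then have d: "ntrans_betw \<delta> w w' W P" by simp
    show "\<delta> = \<gamma>"
    proof (rule ntrans_eqI[OF d gam])
      fix x assume x: "x \<in> Objs W"
      note d' = ntrans_betw_facts(1-3)[OF d x]
      show "ncomp \<delta> x = ncomp \<gamma> x"
        by (rule P_arr_eqI[OF d'(1) g(1)[OF x]])
          (use d'(2,3) g[OF x] * whisker_apply(1)[OF d p_betw x] whisker_apply(1)[OF d q_betw x] in simp_all)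
    qed
  qed
qed

end

lemma comma_cat_exists:
  fixes f k :: "'u::universe func"
  assumes "func_betw f X Z" "func_betw k Y Z" "\<Phi> \<subseteq> Arrs Z"
  obtains eo ea where "comma_cat f k X Y Z \<Phi> eo ea"
proof -
  note s = small_lesspoll[OF func_betw_facts(7)[OF assms(1)]] small_lesspoll[OF func_betw_facts(7)[OF assms(2)]] small_lesspoll[OF func_betw_facts(8)[OF assms(1)]]
  note T = lesspoll_Times[OF infinite_universe]
  obtain eo :: "'u \<times> 'u \<times> 'u \<Rightarrow> 'u" where eo: "inj_on eo (Objs X \<times> Objs Y \<times> Arrs Z)" "\<And>S. S \<subseteq> Objs X \<times> Objs Y \<times> Arrs Z \<Longrightarrow> eo ` S \<prec> (UNIV :: 'u set)"
    using lesspoll_embedding[OF T[OF s(1) T[OF s(3) s(6)]]] by metis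
  obtain ea :: "'u \<times> 'u \<times> 'u \<times> 'u \<Rightarrow> 'u" where ea: "inj_on ea (Arrs X \<times> Arrs Y \<times> Arrs Z \<times> Arrs Z)"
     "\<And>S. S \<subseteq> Arrs X \<times> Arrs Y \<times> Arrs Z \<times> Arrs Z \<Longrightarrow> ea ` S \<prec> (UNIV :: 'u set)"
    using lesspoll_embedding[OF T[OF s(2) T[OF s(4) T[OF s(6) s(6)]]]] by metis
  show thesis by (rule that, rule comma_cat.intro[OF assms(1,2) eo ea assms(3)])
qed

lemma has_commas_Cat: "has_commas (Cat :: ('u::universe cat, 'u func, 'u ntrans) two_cat)"
  unfolding has_commas_def
proof (intro ballI impI)
  fix f k :: "'u func" assume fk: "f \<in> Mor Cat" "k \<in> Mor Cat" "tgt Cat f = tgt Cat k"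
  let ?X = "fsrc f" and ?Y = "fsrc k" and ?Z = "ftgt f"
  have f: "func_betw f ?X ?Z" and k: "func_betw k ?Y ?Z" using fk by (simp_all add: Cat_simps func_betw_def)
  obtain eo ea where c: "comma_cat f k ?X ?Y ?Z (Arrs ?Z) eo ea" using comma_cat_exists[OF f k subset_refl] by metis
  interpret comma_cat f k ?X ?Y ?Z "Arrs ?Z" eo ea by (rule c)
  have "comma_square Cat f k p q l"
    unfolding comma_square_def homCat cmpCat Cat_simps
  proof (intro conjI exI[of _ P] ballI impI)
    show "is_func f" "is_func k" "ftgt f = ftgt k" using fk by (simp_all add: Cat_simps)
    show "func_betw p P (fsrc f)" "func_betw q P (fsrc k)" by (rule p_betw q_betw)+
    show "l \<in> cells Cat (func_comp f p) (func_comp k q)" using l_betw cells_Cat_betw[OF func_comp_betw[OF p_betw f]] by blast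
  next
    fix W u v \<theta> assume u: "u \<in> hom Cat W (fsrc f)" and v: "v \<in> hom Cat W (fsrc k)" and th: "\<theta> \<in> cells Cat (func_comp f u) (func_comp k v)"
    note u = u[unfolded homCat] and v = v[unfolded homCat]
    have th: "ntrans_betw \<theta> (func_comp f u) (func_comp k v) W ?Z" using th cells_Cat_betw[OF func_comp_betw[OF u f]] by blast
    show "\<exists>!w. func_betw w W P \<and> func_comp p w = u \<and> func_comp q w = v \<and> hcmp Cat l (id2 Cat w) = \<theta>"
      by (rule UP1[OF u v th]) (rule ntrans_betw_facts(1)[OF th])
  next
    fix W w w' \<alpha> \<beta> assume w: "w \<in> hom Cat W P" and w': "w' \<in> hom Cat W P" and al: "\<alpha> \<in> cells Cat (func_comp p w) (func_comp p w')"
      and be: "\<beta> \<in> cells Cat (func_comp q w) (func_comp q w')"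
      and eq: "vcmp Cat (hcmp Cat (id2 Cat k) \<beta>) (hcmp Cat l (id2 Cat w)) = vcmp Cat (hcmp Cat l (id2 Cat w')) (hcmp Cat (id2 Cat f) \<alpha>)"
    note w = w[unfolded homCat] and w' = w'[unfolded homCat]
    have al: "ntrans_betw \<alpha> (func_comp p w) (func_comp p w') W ?X" using al cells_Cat_betw[OF func_comp_betw[OF w p_betw]] by blast
    have be: "ntrans_betw \<beta> (func_comp q w) (func_comp q w') W ?Y" using be cells_Cat_betw[OF func_comp_betw[OF w q_betw]] by blast
    have nat: "Comp ?Z (farr k (ncomp \<beta> x)) (ncomp l (fobj w x)) = Comp ?Z (ncomp l (fobj w' x)) (farr f (ncomp \<alpha> x))" if x: "x \<in> Objs W" for x
    proof -
      have "ncomp (vcmp Cat (hcmp Cat (id2 Cat k) \<beta>) (hcmp Cat l (id2 Cat w))) x = Comp ?Z (farr k (ncomp \<beta> x)) (ncomp l (fobj w x))"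
        unfolding vcmp_apply[OF hcmp_betw[OF id2_betw[OF w] l_betw] x] whisker_apply(1)[OF be k x] whisker_apply(2)[OF l_betw w x] ..
      moreover have "ncomp (vcmp Cat (hcmp Cat l (id2 Cat w')) (hcmp Cat (id2 Cat f) \<alpha>)) x = Comp ?Z (ncomp l (fobj w' x)) (farr f (ncomp \<alpha> x))"
        unfolding vcmp_apply[OF hcmp_betw[OF al id2_betw[OF f]] x] whisker_apply(1)[OF al f x] whisker_apply(2)[OF l_betw w' x] ..
      ultimately show ?thesis using eq by simp
    qed
    show "\<exists>!\<gamma>. \<gamma> \<in> cells Cat w w' \<and> hcmp Cat (id2 Cat p) \<gamma> = \<alpha> \<and> hcmp Cat (id2 Cat q) \<gamma> = \<beta>"
      unfolding cells_Cat_betw[OF w] by (rule UP2[OF w w' al be nat])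
  qed
  then show "\<exists>p q l. comma_square Cat f k p q l" by blast
qed

text \<open>With \<Phi> the set of identities, the universal 2-cell is an identity. Hence the comma
  square commutes, and the conditions on 2-cells in its universal property reduce to
  equations.\<close>

lemma has_pullbacks_Cat: "has_pullbacks (Cat :: ('u::universe cat, 'u func, 'u ntrans) two_cat)"
  unfolding has_pullbacks_def
proof (intro ballI impI)
  fix f k :: "'u func" assume fk: "f \<in> Mor Cat" "k \<in> Mor Cat" "tgt Cat f = tgt Cat k"
  let ?X = "fsrc f" and ?Y = "fsrc k" and ?Z = "ftgt f" and ?I = "Id (ftgt f) ` Objs (ftgt f)"
  have f: "func_betw f ?X ?Z" and k: "func_betw k ?Y ?Z" using fk by (simp_all add: Cat_simps func_betw_def)
  note Z' = category_facts[OF func_betw_facts(8)[OF f]]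
  have sub: "?I \<subseteq> Arrs ?Z" using Z'(3) by auto
  obtain eo ea where c: "comma_cat f k ?X ?Y ?Z ?I eo ea" using comma_cat_exists[OF f k sub] by metis
  interpret comma_cat f k ?X ?Y ?Z ?I eo ea by (rule c)
  have li: "ncomp l r = Id ?Z (fobj f (fobj p r))" "fobj k (fobj q r) = fobj f (fobj p r)" if r: "r \<in> Objs P" for r
  proof -
    obtain z where z: "z \<in> Objs ?Z" "ncomp l r = Id ?Z z" using l_\<Phi>[OF r] by blast
    note O = OSD[OF obj(2)[OF r]]
    have "z = fobj f (fobj p r)" "z = fobj k (fobj q r)" using O(5,6) z Z'(4,5)[OF z(1)] by simp_all
    then show "ncomp l r = Id ?Z (fobj f (fobj p r))" "fobj k (fobj q r) = fobj f (fobj p r)" using z by simp_all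
  qed
  have sq: "func_comp f p = func_comp k q"
  proof (rule func_eqI[OF func_comp_betw[OF p_betw f] func_comp_betw[OF q_betw k]])
    fix r assume "r \<in> Objs P" then show "fobj (func_comp f p) r = fobj (func_comp k q) r"
      using li(2) by (simp add: func_comp_apply[OF p_betw] func_comp_apply[OF q_betw])
  next
    fix r assume r: "r \<in> Arrs P"
    note A = ASD[OF arr(2)[OF r]]
    note o = category_facts(1,2)[OF small_P r]
    note pr = func_betw_facts(2-4)[OF p_betw r] and qr = func_betw_facts(2-4)[OF q_betw r]
    have "Comp ?Z (farr k (farr q r)) (Id ?Z (fobj f (fobj p (Dom P r)))) = Comp ?Z (Id ?Z (fobj f (fobj p (Cod P r)))) (farr f (farr p r))"
      using A(5) li(1)[OF o(1)] li(1)[OF o(2)] by simp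
    moreover have "Comp ?Z (farr k (farr q r)) (Id ?Z (fobj f (fobj p (Dom P r)))) = farr k (farr q r)"
      using qr li(2)[OF o(1)] K(2,3)[OF qr(1)] by (intro Z'(9)) simp_all
    moreover have "Comp ?Z (Id ?Z (fobj f (fobj p (Cod P r)))) (farr f (farr p r)) = farr f (farr p r)"
      using pr F(2,4)[OF pr(1)] by (intro Z'(10)) simp_all
    ultimately show "farr (func_comp f p) r = farr (func_comp k q) r" using r by (simp add: func_comp_apply[OF p_betw] func_comp_apply[OF q_betw])
  qed
  have "pullback Cat f k p q"
    unfolding pullback_def homCat cmpCat Cat_simps
  proof (intro conjI exI[of _ P] ballI impI)
    show "is_func f" "is_func k" "ftgt f = ftgt k" using fk by (simp_all add: Cat_simps)
    show "func_betw p P (fsrc f)" "func_betw q P (fsrc k)" by (rule p_betw q_betw)+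
    show "func_comp f p = func_comp k q" by (rule sq)
  next
    fix W u v assume u: "u \<in> hom Cat W (fsrc f)" and v: "v \<in> hom Cat W (fsrc k)" and e: "func_comp f u = func_comp k v"
    note u = u[unfolded homCat] and v = v[unfolded homCat]
    have th: "ntrans_betw (id2 Cat (func_comp f u)) (func_comp f u) (func_comp k v) W ?Z" using id2_betw[OF func_comp_betw[OF u f]] e by simp
    have "\<exists>!w. func_betw w W P \<and> func_comp p w = u \<and> func_comp q w = v \<and> hcmp Cat l (id2 Cat w) = id2 Cat (func_comp f u)"
    proof (rule UP1[OF u v th])
      fix w assume w: "w \<in> Objs W"
      show "ncomp (id2 Cat (func_comp f u)) w \<in> ?I" using w func_betw_facts(1)[OF func_comp_betw[OF u f] w] func_betw_facts(9,10)[OF func_comp_betw[OF u f]]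
        by (simp add: ncomp_simps)
    qed
    \<comment> \<open>The comma property also prescribes the whiskered 2-cell. Here this follows
      from the prescribed projections, so uniqueness holds with the projections alone.\<close>
    moreover have "hcmp Cat l (id2 Cat w) = id2 Cat (func_comp f u)" if w: "func_betw w W P" "func_comp p w = u" "func_comp q w = v" for w
    proof (rule ntrans_eqI)
      have "ntrans_betw (hcmp Cat l (id2 Cat w)) (func_comp (func_comp f p) w) (func_comp (func_comp k q) w) W ?Z" by (rule hcmp_betw[OF id2_betw[OF w(1)] l_betw])
      then show "ntrans_betw (hcmp Cat l (id2 Cat w)) (func_comp f u) (func_comp f u) W ?Z"
        unfolding sq[symmetric] func_comp_assoc[OF w(1) p_betw f] w(2) .
      show "ntrans_betw (id2 Cat (func_comp f u)) (func_comp f u) (func_comp f u) W ?Z" by (rule id2_betw[OF func_comp_betw[OF u f]])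
      fix x assume x: "x \<in> Objs W"
      have "fobj p (fobj w x) = fobj u x" using func_comp_apply(1)[OF w(1) x, of p] w(2) by simp
      then show "ncomp (hcmp Cat l (id2 Cat w)) x = ncomp (id2 Cat (func_comp f u)) x"
        unfolding whisker_apply(2)[OF l_betw w(1) x] li(1)[OF func_betw_facts(1)[OF w(1) x]]
        using x func_betw_facts(9,10)[OF func_comp_betw[OF u f]] func_comp_apply(1)[OF u x] by (simp add: ncomp_simps)
    qed
    ultimately show "\<exists>!w. func_betw w W P \<and> func_comp p w = u \<and> func_comp q w = v" unfolding Ex1_def by blast
  next
    fix W w w' \<alpha> \<beta> assume w: "w \<in> hom Cat W P" and w': "w' \<in> hom Cat W P" and al: "\<alpha> \<in> cells Cat (func_comp p w) (func_comp p w')"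
      and be: "\<beta> \<in> cells Cat (func_comp q w) (func_comp q w')" and eq: "hcmp Cat (id2 Cat f) \<alpha> = hcmp Cat (id2 Cat k) \<beta>"
    note w = w[unfolded homCat] and w' = w'[unfolded homCat]
    have al: "ntrans_betw \<alpha> (func_comp p w) (func_comp p w') W ?X" using al cells_Cat_betw[OF func_comp_betw[OF w p_betw]] by blast
    have be: "ntrans_betw \<beta> (func_comp q w) (func_comp q w') W ?Y" using be cells_Cat_betw[OF func_comp_betw[OF w q_betw]] by blast
    \<comment> \<open>The components of \<open>l\<close> are identities, so compatibility with it is
      equality of the images of \<alpha> and \<beta> under \<open>f\<close> and
      \<open>k\<close>.\<close>
    have nat: "Comp ?Z (farr k (ncomp \<beta> x)) (ncomp l (fobj w x)) = Comp ?Z (ncomp l (fobj w' x)) (farr f (ncomp \<alpha> x))" if x: "x \<in> Objs W" for x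
    proof -
      have e: "farr f (ncomp \<alpha> x) = farr k (ncomp \<beta> x)" using arg_cong[OF eq, of "\<lambda>a. ncomp a x"] whisker_apply(1)[OF al f x] whisker_apply(1)[OF be k x] by simp
      note o = func_betw_facts(1)[OF w x] func_betw_facts(1)[OF w' x]
      note A = ntrans_betw_facts(1-3)[OF al x]
      have d: "Dom ?Z (farr f (ncomp \<alpha> x)) = fobj f (fobj p (fobj w x))" "Cod ?Z (farr f (ncomp \<alpha> x)) = fobj f (fobj p (fobj w' x))"
        using F(3,4)[OF A(1)] A func_comp_apply(1)[OF w x] func_comp_apply(1)[OF w' x] by simp_all
      show ?thesis unfolding li(1)[OF o(1)] li(1)[OF o(2)] e[symmetric]
        using Z'(9)[OF F(2)[OF A(1)] d(1)[symmetric]] Z'(10)[OF F(2)[OF A(1)] d(2)[symmetric]] by simp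
    qed
    show "\<exists>!\<gamma>. \<gamma> \<in> cells Cat w w' \<and> hcmp Cat (id2 Cat p) \<gamma> = \<alpha> \<and> hcmp Cat (id2 Cat q) \<gamma> = \<beta>"
      unfolding cells_Cat_betw[OF w] by (rule UP2[OF w w' al be nat])
  qed
  then show "\<exists>p q. pullback Cat f k p q" by blast
qed

section \<open>Cleavages of functors, extended to generalised elements\<close>

text \<open>The value \<open>st e \<beta>\<close> is the domain of the pointwise cartesian lift of \<open>\<beta> : d \<Rightarrow> p e\<close>.\<close>

locale cleavage =
  fixes p :: "'u::universe func" and c :: "'u \<Rightarrow> 'u \<Rightarrow> 'u" and E B :: "'u cat"
  assumes p: "func_betw p E B"
    and lift: "\<And>e \<beta>. e \<in> Objs E \<Longrightarrow> \<beta> \<in> Arrs B \<Longrightarrow> Cod B \<beta> = fobj p e \<Longrightarrow> cartesian_arr p (c e \<beta>) \<and> Cod E (c e \<beta>) = e \<and> farr p (c e \<beta>) = \<beta>"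
    and norm: "\<And>e. e \<in> Objs E \<Longrightarrow> c e (Id B (fobj p e)) = Id E e"
begin

lemmas PF = func_betw_facts[OF p]
lemmas CE = category_facts[OF PF(7)] and CB = category_facts[OF PF(8)]

lemma c: assumes "e \<in> Objs E" "\<beta> \<in> Arrs B" "Cod B \<beta> = fobj p e"
  shows "c e \<beta> \<in> Arrs E" "Cod E (c e \<beta>) = e" "farr p (c e \<beta>) = \<beta>" "Dom E (c e \<beta>) \<in> Objs E" "fobj p (Dom E (c e \<beta>)) = Dom B \<beta>"
proof -
  show 1: "c e \<beta> \<in> Arrs E" "Cod E (c e \<beta>) = e" "farr p (c e \<beta>) = \<beta>" using lift[OF assms] by (simp_all add: cartesian_arr_def Let_def func_betw_facts(9,10)[OF p])
  show "Dom E (c e \<beta>) \<in> Objs E" by (rule CE(1)[OF 1(1)])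
  show "fobj p (Dom E (c e \<beta>)) = Dom B \<beta>" using PF(3)[OF 1(1)] 1(3) by simp
qed

lemma fill:
  assumes e: "e \<in> Objs E" "\<beta> \<in> Arrs B" "Cod B \<beta> = fobj p e" and h: "h \<in> Arrs E" "Cod E h = e" and g: "\<gamma> \<in> Arrs B" "Dom B \<gamma> = fobj p (Dom E h)" "Cod B \<gamma> = Dom B \<beta>"
    and eq: "farr p h = Comp B \<beta> \<gamma>"
  shows "\<exists>!k. k \<in> Arrs E \<and> Dom E k = Dom E h \<and> Cod E k = Dom E (c e \<beta>) \<and> farr p k = \<gamma> \<and> Comp E (c e \<beta>) k = h"
proof -
  have ca: "cartesian_arr p (c e \<beta>)" using lift[OF e] by simp
  note C = c[OF e]
  have "\<forall>h\<in>Arrs E. \<forall>\<gamma>\<in>Arrs B. Cod E h = Cod E (c e \<beta>) \<and> Dom B \<gamma> = fobj p (Dom E h) \<and> Cod B \<gamma> = fobj p (Dom E (c e \<beta>)) \<and> farr p h = Comp B (farr p (c e \<beta>)) \<gamma> \<longrightarrow>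
     (\<exists>!k. k \<in> Arrs E \<and> Dom E k = Dom E h \<and> Cod E k = Dom E (c e \<beta>) \<and> farr p k = \<gamma> \<and> Comp E (c e \<beta>) k = h)"
    using ca unfolding cartesian_arr_def Let_def PF(9,10) by blast
  from this[THEN bspec, THEN bspec, OF h(1) g(1)] show ?thesis using C h g eq by simp
qed

text \<open>The arrow part of \<open>st e \<beta>\<close>: the filler that makes the chosen lifts
  natural in the variable object.\<close>

definition sarr where "sarr e \<beta> a = (THE k. k \<in> Arrs E \<and> Dom E k = Dom E (c (fobj e (Dom (fsrc e) a)) (ncomp \<beta> (Dom (fsrc e) a))) \<and>
   Cod E k = Dom E (c (fobj e (Cod (fsrc e) a)) (ncomp \<beta> (Cod (fsrc e) a))) \<and> farr p k = farr (ndom \<beta>) a \<and>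
   Comp E (c (fobj e (Cod (fsrc e) a)) (ncomp \<beta> (Cod (fsrc e) a))) k =
     Comp E (farr e a) (c (fobj e (Dom (fsrc e) a)) (ncomp \<beta> (Dom (fsrc e) a))))"

definition st where "st e \<beta> = \<lparr>fsrc = fsrc e, ftgt = E, fobj = (\<lambda>v\<in>Objs (fsrc e). Dom E (c (fobj e v) (ncomp \<beta> v))), farr = (\<lambda>a\<in>Arrs (fsrc e). sarr e \<beta> a)\<rparr>"

context
  fixes e \<beta> V d assumes e: "func_betw e V E" and b: "ntrans_betw \<beta> d (func_comp p e) V B"
begin

lemmas eF = func_betw_facts[OF e]
lemmas CV = category_facts[OF eF(7)]
lemmas dF = func_betw_facts[OF ntrans_betw_facts(4)[OF b]]
abbreviation "cc v \<equiv> c (fobj e v) (ncomp \<beta> v)"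

lemma bc: assumes v: "v \<in> Objs V" shows "fobj e v \<in> Objs E" "ncomp \<beta> v \<in> Arrs B" "Cod B (ncomp \<beta> v) = fobj p (fobj e v)" "Dom B (ncomp \<beta> v) = fobj d v"
  using eF(1)[OF v] ntrans_betw_facts(1-3)[OF b v] func_comp_apply(1)[OF e v] by simp_all

lemma cv: assumes v: "v \<in> Objs V" shows "cc v \<in> Arrs E" "Cod E (cc v) = fobj e v" "farr p (cc v) = ncomp \<beta> v" "Dom E (cc v) \<in> Objs E" "fobj p (Dom E (cc v)) = fobj d v"
  using c[OF bc(1-3)[OF v]] bc(4)[OF v] by simp_all

text \<open>The lift at the codomain of \<open>a\<close> is cartesian, and naturality of \<beta>
  says that the arrow to be factored through it lies over the right composite.\<close>

lemma sarr_ex: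
  assumes a: "a \<in> Arrs V"
  shows "\<exists>!k. k \<in> Arrs E \<and> Dom E k = Dom E (cc (Dom V a)) \<and> Cod E k = Dom E (cc (Cod V a)) \<and> farr p k = farr d a \<and>
    Comp E (cc (Cod V a)) k = Comp E (farr e a) (cc (Dom V a))"
proof -
  note o = CV(1,2)[OF a]
  note C1 = cv[OF o(1)] and C2 = cv[OF o(2)]
  have m: "cc (Dom V a) \<in> Arrs E" "farr e a \<in> Arrs E" "Cod E (cc (Dom V a)) = Dom E (farr e a)" using C1 eF(2,3)[OF a] by simp_all
  note H = CE(6-8)[OF m]
  have "\<exists>!k. k \<in> Arrs E \<and> Dom E k = Dom E (Comp E (farr e a) (cc (Dom V a))) \<and> Cod E k = Dom E (cc (Cod V a)) \<and> farr p k = farr d a \<and>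
    Comp E (cc (Cod V a)) k = Comp E (farr e a) (cc (Dom V a))"
  proof (rule fill[OF bc(1-3)[OF o(2)] H(1)])
    show "Cod E (Comp E (farr e a) (cc (Dom V a))) = fobj e (Cod V a)" using H eF(4)[OF a] by simp
    show "farr d a \<in> Arrs B" "Dom B (farr d a) = fobj p (Dom E (Comp E (farr e a) (cc (Dom V a))))" "Cod B (farr d a) = Dom B (ncomp \<beta> (Cod V a))"
      using dF(2-4)[OF a] H C1 bc(4)[OF o(2)] by simp_all
    show "farr p (Comp E (farr e a) (cc (Dom V a))) = Comp B (ncomp \<beta> (Cod V a)) (farr d a)"
      unfolding PF(6)[OF m] C1(3) using ntrans_betw_natural[OF b a refl refl] func_comp_apply(2)[OF e a] by simp
  qed
  then show ?thesis unfolding H(2) .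
qed

lemma sarr: assumes a: "a \<in> Arrs V"
  shows "sarr e \<beta> a \<in> Arrs E" "Dom E (sarr e \<beta> a) = Dom E (cc (Dom V a))" "Cod E (sarr e \<beta> a) = Dom E (cc (Cod V a))" "farr p (sarr e \<beta> a) = farr d a"
    "Comp E (cc (Cod V a)) (sarr e \<beta> a) = Comp E (farr e a) (cc (Dom V a))"
proof -
  have "ndom \<beta> = d" by (rule ntrans_betw_facts(6)[OF b])
  then have "sarr e \<beta> a = (THE k. k \<in> Arrs E \<and> Dom E k = Dom E (cc (Dom V a)) \<and> Cod E k = Dom E (cc (Cod V a)) \<and> farr p k = farr d a \<and>
    Comp E (cc (Cod V a)) k = Comp E (farr e a) (cc (Dom V a)))" unfolding sarr_def eF(9) by simp
  then show "sarr e \<beta> a \<in> Arrs E" "Dom E (sarr e \<beta> a) = Dom E (cc (Dom V a))" "Cod E (sarr e \<beta> a) = Dom E (cc (Cod V a))" "farr p (sarr e \<beta> a) = farr d a"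
    "Comp E (cc (Cod V a)) (sarr e \<beta> a) = Comp E (farr e a) (cc (Dom V a))" using theI'[OF sarr_ex[OF a]] by simp_all
qed

lemma sarr_unique: assumes a: "a \<in> Arrs V" and k: "k \<in> Arrs E" "Dom E k = Dom E (cc (Dom V a))" "Cod E k = Dom E (cc (Cod V a))" "farr p k = farr d a"
    "Comp E (cc (Cod V a)) k = Comp E (farr e a) (cc (Dom V a))"
  shows "k = sarr e \<beta> a"
  using sarr_ex[OF a] sarr[OF a] k by blast

lemma st_apply: "v \<in> Objs V \<Longrightarrow> fobj (st e \<beta>) v = Dom E (cc v)" "a \<in> Arrs V \<Longrightarrow> farr (st e \<beta>) a = sarr e \<beta> a" "fsrc (st e \<beta>) = V" "ftgt (st e \<beta>) = E"
  by (simp_all add: st_def eF)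

lemma st_betw: "func_betw (st e \<beta>) V E"
proof (rule func_betwI[OF eF(7,8) st_apply(3,4)], goal_cases)
  case 3
  fix v assume v: "v \<in> Objs V"
  note I = CV(3-5)[OF v] and C = cv[OF v]
  have "Id E (Dom E (cc v)) = sarr e \<beta> (Id V v)"
  proof (rule sarr_unique[OF I(1)], unfold I(2,3) eF(5)[OF v] dF(5)[OF v])
    note J = CE(3-5)[OF C(4)]
    show "Id E (Dom E (cc v)) \<in> Arrs E" "Dom E (Id E (Dom E (cc v))) = Dom E (cc v)" "Cod E (Id E (Dom E (cc v))) = Dom E (cc v)" by (rule J)+
    show "farr p (Id E (Dom E (cc v))) = Id B (fobj d v)" unfolding PF(5)[OF C(4)] C(5) ..
    show "Comp E (cc v) (Id E (Dom E (cc v))) = Comp E (Id E (fobj e v)) (cc v)" using CE(9)[OF C(1) refl] CE(10)[OF C(1) C(2)[symmetric]] by simp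
  qed
  then show "fobj (st e \<beta>) v \<in> Objs E \<and> farr (st e \<beta>) (Id V v) = Id E (fobj (st e \<beta>) v)" using v I C by (simp add: st_apply)
next
  case 4
  fix a assume a: "a \<in> Arrs V" then show "farr (st e \<beta>) a \<in> Arrs E \<and> Dom E (farr (st e \<beta>) a) = fobj (st e \<beta>) (Dom V a) \<and> Cod E (farr (st e \<beta>) a) = fobj (st e \<beta>) (Cod V a)"
    using sarr(1-3)[OF a] CV(1,2)[OF a] by (simp add: st_apply)
next
  case 5
  fix a b assume a: "a \<in> Arrs V" "b \<in> Arrs V" "Cod V a = Dom V b"
  note ab = CV(6-8)[OF a] and S1 = sarr[OF a(1)] and S2 = sarr[OF a(2)]
  note o = CV(1)[OF a(1)] CV(2)[OF a(1)] CV(2)[OF a(2)]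
  have m: "Cod E (sarr e \<beta> a) = Dom E (sarr e \<beta> b)" using S1 S2 a by simp
  note k = CE(6-8)[OF S1(1) S2(1) m]
  have "Comp E (sarr e \<beta> b) (sarr e \<beta> a) = sarr e \<beta> (Comp V b a)"
  proof (rule sarr_unique[OF ab(1) k(1)], unfold ab(2,3) k(2,3))
    show "Dom E (sarr e \<beta> a) = Dom E (cc (Dom V a))" "Cod E (sarr e \<beta> b) = Dom E (cc (Cod V b))" by (rule S1 S2)+
    show "farr p (Comp E (sarr e \<beta> b) (sarr e \<beta> a)) = farr d (Comp V b a)" unfolding PF(6)[OF S1(1) S2(1) m] S1(4) S2(4) dF(6)[OF a] ..
    have "Comp E (cc (Cod V b)) (Comp E (sarr e \<beta> b) (sarr e \<beta> a)) = Comp E (Comp E (cc (Cod V b)) (sarr e \<beta> b)) (sarr e \<beta> a)"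
      by (rule CE(11)[symmetric]) (use S1 S2 m cv[OF o(3)] in simp_all)
    also have "\<dots> = Comp E (Comp E (farr e b) (cc (Cod V a))) (sarr e \<beta> a)" unfolding S2(5) a(3) ..
    also have "\<dots> = Comp E (farr e b) (Comp E (cc (Cod V a)) (sarr e \<beta> a))"
      by (rule CE(11)) (use S1 S2 m cv[OF o(2)] eF(2,3)[OF a(2)] a(3) in simp_all)
    also have "\<dots> = Comp E (farr e b) (Comp E (farr e a) (cc (Dom V a)))" unfolding S1(5) ..
    also have "\<dots> = Comp E (Comp E (farr e b) (farr e a)) (cc (Dom V a))"
      by (rule CE(11)[symmetric]) (use cv[OF o(1)] eF(2-4)[OF a(1)] eF(2-4)[OF a(2)] a(3) in simp_all)
    finally show "Comp E (cc (Cod V b)) (Comp E (sarr e \<beta> b) (sarr e \<beta> a)) = Comp E (farr e (Comp V b a)) (cc (Dom V a))" unfolding eF(6)[OF a] .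
  qed
  then show "farr (st e \<beta>) (Comp V b a) = Comp E (farr (st e \<beta>) b) (farr (st e \<beta>) a)" using a ab by (simp add: st_apply)
qed (simp_all add: st_def eF)

lemma p_st: "func_comp p (st e \<beta>) = d"
  by (rule func_eqI[OF func_comp_betw[OF st_betw p] ntrans_betw_facts(4)[OF b]])
    (simp_all add: func_comp_apply[OF st_betw] st_apply cv sarr)

text \<open>The chosen lifts are the components; their naturality is the defining equation of the
  fillers.\<close>

lemma st_cell: "\<exists>l. ntrans_betw l (st e \<beta>) e V E \<and> hcmp Cat (id2 Cat p) l = \<beta>"
proof -
  define l where "l = \<lparr>ndom = st e \<beta>, ncod = e, ncomp = (\<lambda>v\<in>Objs V. cc v)\<rparr>"
  have l: "ntrans_betw l (st e \<beta>) e V E"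
  proof (rule ntrans_betwI[OF st_betw e])
    show "ncomp l v \<in> Arrs E \<and> Dom E (ncomp l v) = fobj (st e \<beta>) v \<and> Cod E (ncomp l v) = fobj e v" if "v \<in> Objs V" for v
      using that cv[OF that] by (simp add: l_def st_apply)
    show "Comp E (ncomp l (Cod V a)) (farr (st e \<beta>) a) = Comp E (farr e a) (ncomp l (Dom V a))" if "a \<in> Arrs V" for a
      using that sarr(5)[OF that] CV(1,2)[OF that] by (simp add: l_def st_apply)
  qed (simp_all add: l_def)
  have "hcmp Cat (id2 Cat p) l = \<beta>"
  proof (rule ntrans_eqI)
    show "ntrans_betw (hcmp Cat (id2 Cat p) l) d (func_comp p e) V B" using hcmp_betw[OF l id2_betw[OF p]] unfolding p_st .
    show "ncomp (hcmp Cat (id2 Cat p) l) v = ncomp \<beta> v" if "v \<in> Objs V" for v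
      unfolding whisker_apply(1)[OF l p that] using that cv[OF that] by (simp add: l_def)
  qed (rule b)
  then show ?thesis using l by blast
qed

end

text \<open>Lifts are chosen object by object, hence commute with restriction along
  \<open>t\<close>; for arrows, uniqueness of fillers gives the same.\<close>

lemma st_precomp:
  assumes e: "func_betw e V E" and b: "ntrans_betw \<beta> d (func_comp p e) V B" and t: "func_betw t W V"
  shows "st (func_comp e t) (hcmp Cat \<beta> (id2 Cat t)) = func_comp (st e \<beta>) t"
proof -
  note tF = func_betw_facts[OF t] and W = category_facts[OF func_betw_facts(7)[OF t]]
  have et: "func_betw (func_comp e t) W E" by (rule func_comp_betw[OF t e])
  have bt: "ntrans_betw (hcmp Cat \<beta> (id2 Cat t)) (func_comp d t) (func_comp p (func_comp e t)) W B"
    using hcmp_betw[OF id2_betw[OF t] b] unfolding func_comp_assoc[OF t e p] .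
  have cce: "c (fobj (func_comp e t) w) (ncomp (hcmp Cat \<beta> (id2 Cat t)) w) = c (fobj e (fobj t w)) (ncomp \<beta> (fobj t w))" if "w \<in> Objs W" for w
    unfolding func_comp_apply(1)[OF t that] whisker_apply(2)[OF b t that] ..
  show ?thesis
  proof (rule func_eqI[OF st_betw[OF et bt] func_comp_betw[OF t st_betw[OF e b]]])
    fix w assume w: "w \<in> Objs W"
    show "fobj (st (func_comp e t) (hcmp Cat \<beta> (id2 Cat t))) w = fobj (func_comp (st e \<beta>) t) w"
      unfolding st_apply(1)[OF et bt w] func_comp_apply(1)[OF t w] whisker_apply(2)[OF b t w] st_apply(1)[OF e b tF(1)[OF w]] ..
  next
    fix a assume a: "a \<in> Arrs W"
    note S = sarr[OF e b tF(2)[OF a]] and o = W(1,2)[OF a]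
    have "sarr e \<beta> (farr t a) = sarr (func_comp e t) (hcmp Cat \<beta> (id2 Cat t)) a"
      by (rule sarr_unique[OF et bt a]) (use S tF(3,4)[OF a] in \<open>simp_all add: cce[OF o(1)] cce[OF o(2)] func_comp_apply(2)[OF t a]\<close>)
    then show "farr (st (func_comp e t) (hcmp Cat \<beta> (id2 Cat t))) a = farr (func_comp (st e \<beta>) t) a"
      unfolding st_apply(2)[OF et bt a] func_comp_apply(2)[OF t a] st_apply(2)[OF e b tF(2)[OF a]] by simp
  qed
qed

text \<open>By \<open>norm\<close> the lifts of identities are identities, so
  \<open>farr e a\<close> itself solves the filling problem for \<open>a\<close>.\<close>

lemma st_id:
  assumes e: "func_betw e V E"
  shows "st e (id2 Cat (func_comp p e)) = e"
proof -
  note eF = func_betw_facts[OF e] and V = category_facts[OF func_betw_facts(7)[OF e]]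
  have pe: "func_betw (func_comp p e) V B" by (rule func_comp_betw[OF e p])
  note b = id2_betw[OF pe]
  have i: "c (fobj e v) (ncomp (id2 Cat (func_comp p e)) v) = Id E (fobj e v)" if v: "v \<in> Objs V" for v
    using norm[OF eF(1)[OF v]] v func_betw_facts(9,10)[OF pe] func_comp_apply(1)[OF e v] by (simp add: ncomp_simps)
  show ?thesis
  proof (rule func_eqI[OF st_betw[OF e b] e])
    fix v assume v: "v \<in> Objs V"
    show "fobj (st e (id2 Cat (func_comp p e))) v = fobj e v" unfolding st_apply(1)[OF e b v] i[OF v] using CE(4)[OF eF(1)[OF v]] .
  next
    fix a assume a: "a \<in> Arrs V"
    note o = V(1,2)[OF a] and A = eF(2-4)[OF a]
    have "farr e a = sarr e (id2 Cat (func_comp p e)) a"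
    proof (rule sarr_unique[OF e b a A(1)], unfold i[OF o(1)] i[OF o(2)])
      show "Dom E (farr e a) = Dom E (Id E (fobj e (Dom V a)))" "Cod E (farr e a) = Dom E (Id E (fobj e (Cod V a)))"
        using A CE(4)[OF eF(1)[OF o(1)]] CE(4)[OF eF(1)[OF o(2)]] by simp_all
      show "farr p (farr e a) = farr (func_comp p e) a" by (simp add: func_comp_apply(2)[OF e a])
      show "Comp E (Id E (fobj e (Cod V a))) (farr e a) = Comp E (farr e a) (Id E (fobj e (Dom V a)))"
        using CE(9)[OF A(1) A(2)[symmetric]] CE(10)[OF A(1) A(3)[symmetric]] by simp
    qed
    then show "farr (st e (id2 Cat (func_comp p e))) a = farr e a" unfolding st_apply(2)[OF e b a] by simp
  qed
qed

lemma normal_cleavage: "normal_cleavage Cat p st"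
  unfolding normal_cleavage_def
proof (intro ballI impI conjI)
  fix e assume e: "e \<in> Mor Cat" "tgt Cat e = src Cat p"
  have eb: "func_betw e (fsrc e) E" using e PF(9) by (simp add: Cat_simps func_betw_def)
  show "st e (id2 Cat (cmp Cat p e)) = e" unfolding cmpCat by (rule st_id[OF eb])
  fix \<beta> assume b: "\<beta> \<in> Cell Cat" "cod2 Cat \<beta> = cmp Cat p e"
  have pe: "func_betw (func_comp p e) (fsrc e) B" by (rule func_comp_betw[OF eb p])
  note peF = func_betw_facts[OF pe]
  interpret C: two_category Cat by (rule two_category_Cat)
  have d: "ndom \<beta> \<in> Mor Cat" using C.dom2_Mor[OF b(1)] by (simp add: Cat_simps)
  have s: "fsrc (ndom \<beta>) = fsrc e" "ftgt (ndom \<beta>) = B"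
    using C.src_parallel[OF b(1)] C.tgt_parallel[OF b(1)] unfolding b(2) cmpCat by (simp_all add: Cat_simps peF(9,10))
  have db: "func_betw (ndom \<beta>) (fsrc e) B" using d s by (simp add: Cat_simps func_betw_def)
  have "\<beta> \<in> cells Cat (ndom \<beta>) (func_comp p e)" using b by (simp add: cells_def Cat_simps cmpCat)
  then have bb: "ntrans_betw \<beta> (ndom \<beta>) (func_comp p e) (fsrc e) B" using cells_Cat_betw[OF db] by blast
  note sb = st_betw[OF eb bb]
  show "st e \<beta> \<in> Mor Cat" "src Cat (st e \<beta>) = src Cat e" "tgt Cat (st e \<beta>) = src Cat p"
    using sb PF(9) by (simp_all add: func_betw_def Cat_simps)
  show "cmp Cat p (st e \<beta>) = dom2 Cat \<beta>" unfolding cmpCat Cat_simps by (rule p_st[OF eb bb])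
  show "\<exists>l\<in>cells Cat (st e \<beta>) e. hcmp Cat (id2 Cat p) l = \<beta>"
    using st_cell[OF eb bb] cells_Cat_betw[OF sb] by blast
  fix t assume t: "t \<in> Mor Cat" "tgt Cat t = src Cat e"
  have "func_betw t (fsrc t) (fsrc e)" using t by (simp add: Cat_simps func_betw_def)
  then show "st (cmp Cat e t) (hcmp Cat \<beta> (id2 Cat t)) = cmp Cat (st e \<beta>) t"
    unfolding cmpCat by (rule st_precomp[OF eb bb])
qed

end

lemma split_fibration_normal_cleavage:
  assumes "split_fibration p" "p \<in> Mor Cat"
  obtains st where "normal_cleavage Cat p st"
proof -
  obtain c where c: "\<forall>e\<in>Objs (fsrc p). \<forall>\<beta>\<in>Arrs (ftgt p). Cod (ftgt p) \<beta> = fobj p e \<longrightarrow>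
      cartesian_arr p (c e \<beta>) \<and> Cod (fsrc p) (c e \<beta>) = e \<and> farr p (c e \<beta>) = \<beta>"
    "\<forall>e\<in>Objs (fsrc p). c e (Id (ftgt p) (fobj p e)) = Id (fsrc p) e"
    using assms(1) unfolding split_fibration_def Let_def by blast
  have "cleavage p c (fsrc p) (ftgt p)"
  proof
    show "func_betw p (fsrc p) (ftgt p)" using assms(2) by (simp add: Cat_simps func_betw_def)
  qed (use c in \<open>blast+\<close>)
  then show thesis using that cleavage.normal_cleavage by blast
qed

section \<open>Algebraic cocompleteness of the restricted algebra\<close>

text \<open>Preservation of pointwise Kan extensions, taken as a property of squares: it holds for
  factoring squares when comma objects exist, and it is plainly closed under pasting.\<close>

definition kan_square :: "('o, 'f, 't) two_cat \<Rightarrow> 'f \<Rightarrow> 'f \<Rightarrow> 'f \<Rightarrow> 'f \<Rightarrow> bool" where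
  "kan_square K f k p q \<longleftrightarrow>
     (\<exists>X Y X' Y'. f \<in> hom K X Y \<and> q \<in> hom K X' Y' \<and> p \<in> hom K X' X \<and> k \<in> hom K Y' Y) \<and>
     f \<cdot>\<^bsub>K\<^esub> p = k \<cdot>\<^bsub>K\<^esub> q \<and>
     (\<forall>u h \<psi>. pointwise_left_kan K f u h \<psi> \<longrightarrow>
        pointwise_left_kan K q (u \<cdot>\<^bsub>K\<^esub> p) (h \<cdot>\<^bsub>K\<^esub> k) (\<psi> \<star>\<^bsub>K\<^esub> id2 K p))"

context twocat begin

lemma left_kan_facts:
  assumes "left_kan K f u h \<psi>"
  shows "f \<in> Mor K" "u \<in> Mor K" "h \<in> Mor K" "src K u = src K f" "src K h = tgt K f" "tgt K u = tgt K h"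
    "\<psi> \<in> Cell K" "dom2 K \<psi> = u" "cod2 K \<psi> = h \<cdot> f"
  using assms unfolding left_kan_def by (auto simp: hom_def cells_def)

lemma kan_square_facts:
  assumes "kan_square K f k p q"
  shows "f \<in> Mor K" "k \<in> Mor K" "p \<in> Mor K" "q \<in> Mor K" "src K p = src K q" "tgt K p = src K f"
    "tgt K q = src K k" "tgt K k = tgt K f" "f \<cdot> p = k \<cdot> q"
    "pointwise_left_kan K f u h \<psi> \<Longrightarrow> pointwise_left_kan K q (u \<cdot> p) (h \<cdot> k) (\<psi> \<star> id2 K p)"
  using assms unfolding kan_square_def by (auto simp: hom_def)

lemma kan_square_paste:
  assumes 1: "kan_square K f k p q" and 2: "kan_square K q k' p' q'"
  shows "kan_square K f (k \<cdot> k') (p \<cdot> p') q'"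
proof -
  note A = kan_square_facts[OF 1] and B = kan_square_facts[OF 2]
  note [simp] = A(1-8) B(1-8)
  show ?thesis unfolding kan_square_def
  proof (intro conjI allI impI exI)
    show "f \<cdot> p \<cdot> p' = (k \<cdot> k') \<cdot> q'" using A(9) B(9) cmp_assoc'[of p' p f] cmp_assoc'[of p' q k] by simp
    fix u h \<psi> assume pk: "pointwise_left_kan K f u h \<psi>"
    have [simp]: "u \<in> Mor K" "h \<in> Mor K" "src K u = src K f" "src K h = tgt K f" "\<psi> \<in> Cell K" "dom2 K \<psi> = u"
      using left_kan_facts[of f u h \<psi>] pk unfolding pointwise_left_kan_def by simp_all
    show "pointwise_left_kan K q' (u \<cdot> p \<cdot> p') (h \<cdot> k \<cdot> k') (\<psi> \<star> id2 K (p \<cdot> p'))"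
      using B(10)[OF A(10)[OF pk]] by simp
  qed (simp_all add: hom_def)
qed

lemma kan_square_factoring: "has_commas K \<Longrightarrow> factoring_square K f k p q \<Longrightarrow> kan_square K f k p q"
  using pointwise_left_kan_paste[of f k p q] unfolding kan_square_def factoring_square_def by (auto simp: hom_def)

lemma kan_square_iso:
  assumes "has_commas K" "f \<in> Mor K" "f' \<in> Mor K" "invertible1 K a" "invertible1 K b"
    "src K a = src K f'" "tgt K a = src K f" "src K b = tgt K f'" "tgt K b = tgt K f" "f \<cdot> a = b \<cdot> f'"
  shows "kan_square K f b a f'"
  by (rule kan_square_factoring[OF assms(1) factoring_square_iso[OF assms(2-10)]])

end

text \<open>Transposition turns both clauses for the restricted algebra into statements about
  \<open>\<A>\<close> along the image of \<open>g\<close> under the left adjoint. For the second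
  clause an extension along \<open>T F g\<close>, with \<open>F\<close> the left adjoint, has to
  become one along \<open>F S g\<close>; the naturality square of the colax structure at
  \<open>g\<close> does this.\<close>

theorem alg_cocomplete_Fbar:
  assumes L: "twocat L" and K: "twocat K" and madj: "monad_adjunction L S K T F"
    and A: "carrier \<A> \<in> Ob K" "act \<A> \<in> hom K (onob (endo T) (carrier \<A>)) (carrier \<A>)"
    and g: "g \<in> Mor L"
    and transpose: "\<And>g X Y u h \<psi> A. g \<in> hom L X Y \<Longrightarrow> u \<in> hom L X (onob (radj F) A) \<Longrightarrow> h \<in> hom L Y (onob (radj F) A) \<Longrightarrow>
      \<psi> \<in> cells L u (h \<cdot>\<^bsub>L\<^esub> g) \<Longrightarrow> A \<in> Ob K \<Longrightarrow> pointwise_left_kan L g u h \<psi> \<longleftrightarrow>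
      pointwise_left_kan K (onmor (ladj F) g) (adj_counit F A \<cdot>\<^bsub>K\<^esub> onmor (ladj F) u) (adj_counit F A \<cdot>\<^bsub>K\<^esub> onmor (ladj F) h) (id2 K (adj_counit F A) \<star>\<^bsub>K\<^esub> oncell (ladj F) \<psi>)"
    and colax: "kan_square K (onmor (endo T) (onmor (ladj F) g)) (colax F (tgt L g)) (colax F (src L g)) (onmor (ladj F) (onmor (endo S) g))"
    and ac: "alg_cocomplete K T \<A> (onmor (ladj F) g)"
  shows "alg_cocomplete L S (Fbar L S T F \<A>) g"
proof -
  interpret twoadj L K F
    using madj by (intro twoadj.intro L K twoadj_axioms.intro) (simp add: monad_adjunction_def)
  let ?A = "carrier \<A>" and ?a = "act \<A>" and ?X = "src L g" and ?Y = "tgt L g"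
  let ?T1 = "onmor (endo T)" and ?T2 = "oncell (endo T)" and ?S0 = "onob (endo S)" and ?S1 = "onmor (endo S)" and ?S2 = "oncell (endo S)" and ?c = "colax F"
  have Tf: "two_functor K K (endo T)" and Sf: "two_functor L L (endo S)" and cn: "two_natural L K (ladj F \<odot> endo S) (endo T \<odot> ladj F) ?c"
    using madj unfolding monad_adjunction_def two_monad_def by simp_all
  note [simp] = two_functor_facts[OF Tf] two_functor_facts[OF Sf] two_natural_facts(1-3)[OF cn, simplified] g A(1)
  note cnat = two_natural_facts(4,5)[OF cn, simplified]
  have a [simp]: "?a \<in> Mor K" "src K ?a = onob (endo T) ?A" "tgt K ?a = ?A" using A(2) by (simp_all add: hom_def)
  let ?b = "act (Fbar L S T F \<A>)"
  let ?d = "?a \<cdot>\<^bsub>K\<^esub> ?T1 (co ?A) \<cdot>\<^bsub>K\<^esub> ?c (GO ?A)"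
  have b: "?b = G1 ?d \<cdot>\<^bsub>L\<^esub> un (?S0 (GO ?A))" by (simp add: Fbar_def lax_mate_def)
  have bt [simp]: "?b \<in> Mor L" "src L ?b = ?S0 (GO ?A)" "tgt L ?b = GO ?A" unfolding b by simp_all
  \<comment> \<open>The action of the restricted algebra is by definition a transpose; untransposing
    gives the action of \<open>\<A>\<close> after \<open>T\<close> of the counit and the colax
    component.\<close>
  have d: "co ?A \<cdot>\<^bsub>K\<^esub> F1 ?b = ?d" unfolding b by (rule untranspose_transpose) simp_all
  \<comment> \<open>Naturality of the colax structure at \<open>u\<close> moves its component to the
    right, which exhibits the transpose of \<open>u\<close> inside \<open>T\<close>. The 2-cells of
    \<open>e2\<close> behave alike.\<close>
  have e1: "co ?A \<cdot>\<^bsub>K\<^esub> F1 (?b \<cdot>\<^bsub>L\<^esub> ?S1 u) = (?a \<cdot>\<^bsub>K\<^esub> ?T1 (co ?A \<cdot>\<^bsub>K\<^esub> F1 u)) \<cdot>\<^bsub>K\<^esub> ?c W"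
    if [simp]: "u \<in> Mor L" "src L u = W" "tgt L u = GO ?A" for u W
  proof -
    have W [simp]: "W \<in> Ob L" using L.Mor_facts(1)[OF that(1)] by simp
    have "co ?A \<cdot>\<^bsub>K\<^esub> F1 (?b \<cdot>\<^bsub>L\<^esub> ?S1 u) = (co ?A \<cdot>\<^bsub>K\<^esub> F1 ?b) \<cdot>\<^bsub>K\<^esub> F1 (?S1 u)" by (simp del: d)
    also have "\<dots> = ?a \<cdot>\<^bsub>K\<^esub> ?T1 (co ?A) \<cdot>\<^bsub>K\<^esub> ?c (GO ?A) \<cdot>\<^bsub>K\<^esub> F1 (?S1 u)" unfolding d by simp
    also have "\<dots> = ?a \<cdot>\<^bsub>K\<^esub> ?T1 (co ?A) \<cdot>\<^bsub>K\<^esub> ?T1 (F1 u) \<cdot>\<^bsub>K\<^esub> ?c W" using cnat(1)[OF that] by simp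
    finally show ?thesis by simp
  qed
  have e2: "id2 K (co ?A) \<star>\<^bsub>K\<^esub> F2 (id2 L ?b \<star>\<^bsub>L\<^esub> ?S2 \<psi>) = (id2 K ?a \<star>\<^bsub>K\<^esub> ?T2 (id2 K (co ?A) \<star>\<^bsub>K\<^esub> F2 \<psi>)) \<star>\<^bsub>K\<^esub> id2 K (?c W)"
    if [simp]: "\<psi> \<in> Cell L" "src L (dom2 L \<psi>) = W" "tgt L (dom2 L \<psi>) = GO ?A" for \<psi> W
  proof -
    have W [simp]: "W \<in> Ob L" using L.Mor_facts(1)[of "dom2 L \<psi>"] by simp
    have "id2 K (co ?A) \<star>\<^bsub>K\<^esub> F2 (id2 L ?b \<star>\<^bsub>L\<^esub> ?S2 \<psi>) = id2 K (co ?A \<cdot>\<^bsub>K\<^esub> F1 ?b) \<star>\<^bsub>K\<^esub> F2 (?S2 \<psi>)" by simp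
    also have "\<dots> = id2 K (?a \<cdot>\<^bsub>K\<^esub> ?T1 (co ?A)) \<star>\<^bsub>K\<^esub> id2 K (?c (GO ?A)) \<star>\<^bsub>K\<^esub> F2 (?S2 \<psi>)" unfolding d by simp
    also have "\<dots> = id2 K (?a \<cdot>\<^bsub>K\<^esub> ?T1 (co ?A)) \<star>\<^bsub>K\<^esub> ?T2 (F2 \<psi>) \<star>\<^bsub>K\<^esub> id2 K (?c W)" unfolding cnat(2)[OF that] ..
    finally show ?thesis by simp
  qed
  have srcs: "src K (F1 g) = FO ?X" by simp
  have ac1: "\<exists>h \<psi>. pointwise_left_kan K (F1 g) u h \<psi>" if "u \<in> hom K (FO ?X) ?A" for u
    using ac[unfolded alg_cocomplete_def srcs, THEN conjunct1, THEN bspec, OF that] .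
  have ac2: "pointwise_left_kan K (?T1 (F1 g)) (?a \<cdot>\<^bsub>K\<^esub> ?T1 u) (?a \<cdot>\<^bsub>K\<^esub> ?T1 h) (id2 K ?a \<star>\<^bsub>K\<^esub> ?T2 \<psi>)"
    if "u \<in> hom K (FO ?X) ?A" "pointwise_left_kan K (F1 g) u h \<psi>" for u h \<psi>
    using ac[unfolded alg_cocomplete_def srcs, THEN conjunct2, THEN bspec, OF that(1)] that(2) by blast
  have gh: "g \<in> hom L ?X ?Y" by (simp add: hom_def)
  have cF: "carrier (Fbar L S T F \<A>) = GO ?A" by (simp add: Fbar_def)
  show ?thesis unfolding alg_cocomplete_def cF
  proof (intro conjI ballI allI impI)
    fix u assume u: "u \<in> hom L ?X (GO ?A)"
    then have u' [simp]: "u \<in> Mor L" "src L u = ?X" "tgt L u = GO ?A" by (simp_all add: hom_def)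
    have uu: "co ?A \<cdot>\<^bsub>K\<^esub> F1 u \<in> hom K (FO ?X) ?A" by (simp add: hom_def)
    obtain h' \<psi>' where pk: "pointwise_left_kan K (F1 g) (co ?A \<cdot>\<^bsub>K\<^esub> F1 u) h' \<psi>'"
      using ac1[OF uu] by blast
    note f = K.left_kan_facts[OF pk[unfolded pointwise_left_kan_def, THEN conjunct1]]
    have h' [simp]: "h' \<in> Mor K" "src K h' = FO ?Y" "tgt K h' = ?A" using f(3,5,6) by simp_all
    \<comment> \<open>The extension found in \<open>K\<close> is brought back to \<open>L\<close>:
      its 1-cell with the unit, its 2-cell by surjectivity of
      \<open>transpose_cells_bij\<close>.\<close>
    let ?h = "G1 h' \<cdot>\<^bsub>L\<^esub> un ?Y"
    have hh: "co ?A \<cdot>\<^bsub>K\<^esub> F1 ?h = h'" by (rule untranspose_transpose) simp_all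
    have h: "?h \<in> hom L ?Y (GO ?A)" by (simp add: hom_def)
    have hg: "?h \<cdot>\<^bsub>L\<^esub> g \<in> hom L ?X (GO ?A)" by (simp add: hom_def)
    have "co ?A \<cdot>\<^bsub>K\<^esub> F1 (?h \<cdot>\<^bsub>L\<^esub> g) = (co ?A \<cdot>\<^bsub>K\<^esub> F1 ?h) \<cdot>\<^bsub>K\<^esub> F1 g" by simp
    then have hg': "co ?A \<cdot>\<^bsub>K\<^esub> F1 (?h \<cdot>\<^bsub>L\<^esub> g) = h' \<cdot>\<^bsub>K\<^esub> F1 g" unfolding hh .
    have "\<psi>' \<in> cells K (co ?A \<cdot>\<^bsub>K\<^esub> F1 u) (co ?A \<cdot>\<^bsub>K\<^esub> F1 (?h \<cdot>\<^bsub>L\<^esub> g))" unfolding hg' using f(7-9) by (simp add: cells_def)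
    then have "\<psi>' \<in> (\<lambda>\<alpha>. id2 K (co ?A) \<star>\<^bsub>K\<^esub> F2 \<alpha>) ` cells L u (?h \<cdot>\<^bsub>L\<^esub> g)"
      unfolding transpose_cells_bij[OF u hg A(1), THEN bij_betw_imp_surj_on] .
    then obtain \<psi> where "\<psi>' = id2 K (co ?A) \<star>\<^bsub>K\<^esub> F2 \<psi>" and psi: "\<psi> \<in> cells L u (?h \<cdot>\<^bsub>L\<^esub> g)" by (rule imageE)
    note psi = psi this(1)[symmetric]
    have "pointwise_left_kan L g u ?h \<psi>"
      by (rule transpose[OF gh u h psi(1) A(1), THEN iffD2], unfold hh psi(2)) (rule pk)
    then show "\<exists>h \<psi>. pointwise_left_kan L g u h \<psi>" by blast
  next
    fix u h \<psi> assume u: "u \<in> hom L ?X (GO ?A)" and pk: "pointwise_left_kan L g u h \<psi>"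
    then have u' [simp]: "u \<in> Mor L" "src L u = ?X" "tgt L u = GO ?A" by (simp_all add: hom_def)
    note f = L.left_kan_facts[OF pk[unfolded pointwise_left_kan_def, THEN conjunct1]]
    have h' [simp]: "h \<in> Mor L" "src L h = ?Y" "tgt L h = GO ?A" and psi [simp]: "\<psi> \<in> Cell L" "dom2 L \<psi> = u" "cod2 L \<psi> = h \<cdot>\<^bsub>L\<^esub> g"
      using f(3,5-9) by simp_all
    have h: "h \<in> hom L ?Y (GO ?A)" and ps: "\<psi> \<in> cells L u (h \<cdot>\<^bsub>L\<^esub> g)" by (simp_all add: hom_def cells_def)
    have uu: "co ?A \<cdot>\<^bsub>K\<^esub> F1 u \<in> hom K (FO ?X) ?A" by (simp add: hom_def)
    have "pointwise_left_kan K (F1 g) (co ?A \<cdot>\<^bsub>K\<^esub> F1 u) (co ?A \<cdot>\<^bsub>K\<^esub> F1 h) (id2 K (co ?A) \<star>\<^bsub>K\<^esub> F2 \<psi>)"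
      by (rule transpose[OF gh u h ps A(1), THEN iffD1]) (rule pk)
    \<comment> \<open>Cocompleteness of \<open>\<A>\<close> gives the extension along
      \<open>T F g\<close>, and \<open>colax\<close> restricts it; \<open>e1\<close> and
      \<open>e2\<close> recognize the outcome as a transpose.\<close>
    from K.kan_square_facts(10)[OF colax ac2[OF uu this]]
    have "pointwise_left_kan K (F1 (?S1 g)) (co ?A \<cdot>\<^bsub>K\<^esub> F1 (?b \<cdot>\<^bsub>L\<^esub> ?S1 u)) (co ?A \<cdot>\<^bsub>K\<^esub> F1 (?b \<cdot>\<^bsub>L\<^esub> ?S1 h)) (id2 K (co ?A) \<star>\<^bsub>K\<^esub> F2 (id2 L ?b \<star>\<^bsub>L\<^esub> ?S2 \<psi>))"
      using e1[OF u'] e1[OF h'] e2[OF psi(1), of ?X] by simp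
    moreover have "?S1 g \<in> hom L (?S0 ?X) (?S0 ?Y)" "?b \<cdot>\<^bsub>L\<^esub> ?S1 u \<in> hom L (?S0 ?X) (GO ?A)" "?b \<cdot>\<^bsub>L\<^esub> ?S1 h \<in> hom L (?S0 ?Y) (GO ?A)"
      "id2 L ?b \<star>\<^bsub>L\<^esub> ?S2 \<psi> \<in> cells L (?b \<cdot>\<^bsub>L\<^esub> ?S1 u) ((?b \<cdot>\<^bsub>L\<^esub> ?S1 h) \<cdot>\<^bsub>L\<^esub> ?S1 g)" by (simp_all add: hom_def cells_def)
    ultimately show "pointwise_left_kan L (?S1 g) (?b \<cdot>\<^bsub>L\<^esub> ?S1 u) (?b \<cdot>\<^bsub>L\<^esub> ?S1 h) (id2 L ?b \<star>\<^bsub>L\<^esub> ?S2 \<psi>)"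
      using transpose[OF _ _ _ _ A(1)] by blast
  qed
qed

section \<open>Polynomial adjunctions\<close>

context twocat begin

text \<open>Comma squares in either slice are comma squares of the underlying 1-cells together with
  a common structure map. \<Sigma> replaces that map \<open>y\<close> by \<open>f y\<close>, so one
  removes the structure and puts the other one on.\<close>

lemma comma_square_Sigma:
  assumes dI: "discrete_ob K I" and dJ: "discrete_ob K J" and f: "f \<in> Mor K" "src K f = I" "tgt K f = J"
  shows "comma_square (slice K I) g k p q l \<Longrightarrow>
      comma_square (slice K J) (onmor (Sigma_fun K f) g) (onmor (Sigma_fun K f) k) (onmor (Sigma_fun K f) p) (onmor (Sigma_fun K f) q) (oncell (Sigma_fun K f) l)"
    and "g \<in> Mor (slice K I) \<Longrightarrow> comma_square (slice K J) (onmor (Sigma_fun K f) g) m a b l' \<Longrightarrow>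
      \<exists>k p q l. comma_square (slice K I) g k p q l \<and> m = onmor (Sigma_fun K f) k \<and> a = onmor (Sigma_fun K f) p \<and> b = onmor (Sigma_fun K f) q \<and> l' = oncell (Sigma_fun K f) l"
proof -
  assume "comma_square (slice K I) g k p q l"
  then obtain y g' k' p' q' l' where y: "y \<in> Mor K" "tgt K y = I" "src K y = tgt K g'" and c: "comma_square K g' k' p' q' l'" and
     e: "g = (g', y)" "k = (k', y)" "p = (p', y \<cdot> g')" "q = (q', y \<cdot> k')" "l = (l', y)"
    using comma_square_unslice[OF dI] by metis
  have t: "g' \<in> Mor K" "k' \<in> Mor K" "tgt K k' = tgt K g'" using c unfolding comma_square_def by simp_all
  have "comma_square (slice K J) (g', f \<cdot> y) (k', f \<cdot> y) (p', (f \<cdot> y) \<cdot> g') (q', (f \<cdot> y) \<cdot> k') (l', f \<cdot> y)"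
    by (rule comma_square_slice[OF dJ _ _ _ c]) (use y f in simp_all)
  then show "comma_square (slice K J) (onmor (Sigma_fun K f) g) (onmor (Sigma_fun K f) k) (onmor (Sigma_fun K f) p) (onmor (Sigma_fun K f) q) (oncell (Sigma_fun K f) l)"
    unfolding e using y f t by simp
next
  assume g: "g \<in> Mor (slice K I)" and c: "comma_square (slice K J) (onmor (Sigma_fun K f) g) m a b l'"
  obtain g' y where e: "g = (g', y)" by (cases g)
  have y: "g' \<in> Mor K" "y \<in> Mor K" "tgt K y = I" "src K y = tgt K g'" using g unfolding e by simp_all
  obtain z g'' k p q l where c': "comma_square K g'' k p q l" and e': "(g', f \<cdot> y) = (g'', z)" "m = (k, z)" "a = (p, z \<cdot> g'')" "b = (q, z \<cdot> k)" "l' = (l, z)"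
    using comma_square_unslice[OF dJ c[unfolded e Sigma_fun_simps]] by metis
  have e2: "g'' = g'" "z = f \<cdot> y" using e'(1) by simp_all
  note c' = c'[unfolded e2] and e' = e'(2-5)[unfolded e2]
  have t: "k \<in> Mor K" "tgt K k = tgt K g'" using c' unfolding comma_square_def by simp_all
  have s: "comma_square (slice K I) g (k, y) (p, y \<cdot> g') (q, y \<cdot> k) (l, y)"
    unfolding e by (rule comma_square_slice[OF dI y(2-4) c'])
  show "\<exists>k p q l. comma_square (slice K I) g k p q l \<and> m = onmor (Sigma_fun K f) k \<and> a = onmor (Sigma_fun K f) p \<and> b = onmor (Sigma_fun K f) q \<and> l' = oncell (Sigma_fun K f) l"
    by (rule exI, rule exI, rule exI, rule exI, rule conjI[OF s]) (use y f t e' in simp)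
qed

end

context two_poly begin

text \<open>The square of underlying 1-cells is a factoring square, and this passes to the slice
  over \<open>I'\<close>. What remains is to recognize the structure maps of its corners;
  \<open>ft\<close> enters for the corners that come from \<open>P\<close>.\<close>

lemma kan_square_assoc_colax:
  assumes dI: "discrete_ob K I" and dI': "discrete_ob K I'" and hc: "has_commas K" and st: "normal_cleavage K (pp Q) st"
    and ft: "f \<cdot> pt P = pt Q \<cdot> g1" and f': "tgt K (pt P) = I" "tgt K (pt Q) = I'"
    and g: "g \<in> Mor (slice K I)" and M: "mpoly M = P" "mpoly N = Q"
  shows "kan_square (slice K I') (onmor (poly_fun K Q) (onmor (Sigma_fun K f) g))
     (assoc_colax K M N f (g1, g2) (tgt (slice K I) g)) (assoc_colax K M N f (g1, g2) (src (slice K I) g))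
     (onmor (Sigma_fun K f) (onmor (poly_fun K P) g))"
proof -
  obtain h y where e: "g = (h, y)" by (cases g)
  have h: "h \<in> Mor K" "tgt K h = src K y" and y: "y \<in> Mor K" "tgt K y = I" using g unfolding e by simp_all
  have hf: "tgt K h = src K (f \<cdot> y)" "f \<cdot> y \<in> Mor K" "tgt K (f \<cdot> y) = I'" using h y by simp_all
  let ?y = "pt Q \<cdot> Q.pr (f \<cdot> y)"
  have fs: "factoring_square (slice K I') (Tf h y, ?y) (kY y, ?y) (kX h y, ?y \<cdot> Tf h y) (Sf h y, ?y \<cdot> kY y)"
    by (rule P.factoring_square_slice[OF dI' _ _ _ factoring_square_colax[OF h y dI dI' hc st]])
      (use Tf[OF h y] hf f' Q.pr_facts[OF hf(2,3)] in simp_all)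
  note T = Tf(1-4)[OF h y] and kYf = poly_map_facts(1-4)[OF kY[OF h y]]
  have 1: "?y \<cdot> Tf h y = pt Q \<cdot> Q.pr (f \<cdot> y \<cdot> h)"
    using T Q.pr_facts[OF hf(2,3)] by simp
  have "?y \<cdot> kY y = pt Q \<cdot> Q.pr (f \<cdot> y) \<cdot> kY y" using kYf Q.pr_facts[OF hf(2,3)] by simp
  also have "\<dots> = (pt Q \<cdot> g1) \<cdot> P.pr y" unfolding kYf(4) using P.pr_facts[OF y] by simp
  also have "\<dots> = f \<cdot> pt P \<cdot> P.pr y" unfolding ft[symmetric] using P.pr_facts[OF y] f' by simp
  finally have 2: "?y \<cdot> kY y = f \<cdot> pt P \<cdot> P.pr y" .
  have "kan_square (slice K I') (Tf h y, ?y) (kY y, ?y) (kX h y, ?y \<cdot> Tf h y) (Sf h y, ?y \<cdot> kY y)"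
    by (rule twocat.kan_square_factoring[OF P.twocat_slice P.has_commas_slice[OF hc dI'] fs])
  then show ?thesis
    unfolding e slice_simps Sigma_fun_simps Q.act(1)[OF h(1) hf] P.act(1)[OF h y] assoc_colax_def M 1 2
    using h y by simp
qed

end

lemma (in twocat) two_functor_invertible1:
  assumes L: "twocat L" and T: "two_functor K L T" and f: "invertible1 K f"
  shows "invertible1 L (onmor T f)"
proof -
  interpret L: twocat L by (rule L)
  note [simp] = two_functor_facts[OF T]
  obtain f' where f: "f \<in> Mor K" "f' \<in> Mor K" "src K f' = tgt K f" "tgt K f' = src K f" "f' \<cdot> f = one K (src K f)" "f \<cdot> f' = one K (tgt K f)"
    by (rule invertible1E[OF f])
  have "onmor T f' \<cdot>\<^bsub>L\<^esub> onmor T f = onmor T (f' \<cdot> f)" "onmor T f \<cdot>\<^bsub>L\<^esub> onmor T f' = onmor T (f \<cdot> f')"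
    using f(1-4) by simp_all
  then show ?thesis unfolding invertible1_def by (intro conjI bexI[of _ "onmor T f'"]) (use f in \<open>simp_all add: hom_def\<close>)
qed

text \<open>Naturality squares whose invertible sides point the other way; in the final pasting
  \<tau> and the isomorphism of left adjoints under \<open>T\<close> have to be run
  backwards.\<close>

lemma (in twocat) kan_square_iso_inv:
  assumes hc: "has_commas K" and f: "f \<in> Mor K" "f' \<in> Mor K" and iso: "invertible1 K a" "invertible1 K b"
    and t: "src K a = src K f" "tgt K a = src K f'" "src K b = tgt K f" "tgt K b = tgt K f'" and sq: "b \<cdot> f = f' \<cdot> a"
  shows "kan_square K f (inv1 K b) (inv1 K a) f'"
proof (rule kan_square_iso[OF hc f iso[THEN invertible1_inv1]])
  note [simp] = f iso t inv1_facts(1-6)[OF iso(1)] inv1_facts(1-6)[OF iso(2)]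
  show "src K (inv1 K a) = src K f'" "tgt K (inv1 K a) = src K f" "src K (inv1 K b) = tgt K f'" "tgt K (inv1 K b) = tgt K f" by simp_all
  have "f \<cdot> inv1 K a = inv1 K b \<cdot> (b \<cdot> f) \<cdot> inv1 K a" using inv1_facts(7)[OF iso(2), of "f \<cdot> inv1 K a"] by simp
  also have "\<dots> = inv1 K b \<cdot> f'" unfolding sq by simp
  finally show "f \<cdot> inv1 K a = inv1 K b \<cdot> f'" .
qed

lemma (in polyn) poly_fun_facts:
  assumes "g \<in> Mor (slice K I)"
  shows "onmor (poly_fun K P) g \<in> Mor (slice K J)" "src (slice K J) (onmor (poly_fun K P) g) = onob (poly_fun K P) (src (slice K I) g)"
    "tgt (slice K J) (onmor (poly_fun K P) g) = onob (poly_fun K P) (tgt (slice K I) g)"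
proof -
  obtain h y where e: "g = (h, y)" by (cases g)
  have h: "h \<in> Mor K" "tgt K h = src K y" and y: "y \<in> Mor K" "tgt K y = I" using assms unfolding e by simp_all
  note A = act(1-5)[OF h y] and o = pr_facts[OF y]
  show "onmor (poly_fun K P) g \<in> Mor (slice K J)" "src (slice K J) (onmor (poly_fun K P) g) = onob (poly_fun K P) (src (slice K I) g)"
    "tgt (slice K J) (onmor (poly_fun K P) g) = onob (poly_fun K P) (tgt (slice K I) g)"
    unfolding e A(1) using A(2-5) o by (simp_all add: poly_fun_def poly_proj_def)
qed

text \<open>The colax structure of \<open>F\<close> is that of the polynomial morphism conjugated by
  the isomorphisms \<sigma>, \<tau> and \<phi>. Its naturality square at \<open>g\<close> is
  therefore a pasting of Kan squares, and \<open>alg_cocomplete_Fbar\<close> applies.\<close>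

theorem (in twocat) alg_cocomplete_polynomial_adjunction:
  assumes hc: "has_commas K" and hp: "has_pullbacks K" and dI: "discrete_ob K I" and dJ: "discrete_ob K J"
    and padj: "polynomial_adjunction K I S M J T N F" and alg: "pseudo_algebra (slice K J) T \<A>"
    and g: "g \<in> Mor (slice K I)" and st: "normal_cleavage K (pp (mpoly N)) st"
    and ac: "alg_cocomplete (slice K J) T \<A> (onmor (ladj F) g)"
  shows "alg_cocomplete (slice K I) S (Fbar (slice K I) S T F \<A>) g"
proof -
  let ?L = "slice K I" and ?K = "slice K J"
  let ?P = "mpoly M" and ?Q = "mpoly N"
  obtain f G \<sigma> \<tau> \<phi> where pm: "polynomial_monad_morphism K I M J N f G"
    and sg: "two_monad_iso ?L S (assoc_monad K M) \<sigma>" and ta: "two_monad_iso ?K T (assoc_monad K N) \<tau>"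
    and ph: "two_natural ?L ?K (ladj F) (Sigma_fun K f) \<phi>"
    and cx: "\<forall>x\<in>Ob ?L. invertible1 ?K (\<phi> x) \<and>
           \<tau> (f \<cdot> x) \<cdot>\<^bsub>?K\<^esub> onmor (endo T) (\<phi> x) \<cdot>\<^bsub>?K\<^esub> colax F x =
             assoc_colax K M N f G x \<cdot>\<^bsub>?K\<^esub> onmor (Sigma_fun K f) (\<sigma> x) \<cdot>\<^bsub>?K\<^esub> \<phi> (onob (endo S) x)"
    using padj unfolding polynomial_adjunction_def by (elim conjE exE)
  note pd = padj[unfolded polynomial_adjunction_def]
  note madj = pd[THEN conjunct1] and pM = pd[THEN conjunct2, THEN conjunct1] and pN = pd[THEN conjunct2, THEN conjunct2, THEN conjunct1]
  obtain g1 g2 where Gd: "G = (g1, g2)" by (cases G)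
  note P = pM[unfolded polynomial_monad_def Let_def, THEN conjunct1] and Q = pN[unfolded polynomial_monad_def Let_def, THEN conjunct1]
  interpret P: polyn K ?P I I by (intro polyn.intro pullbacks.intro pullbacks_axioms.intro polyn_axioms.intro twocat_axioms hp P)
  interpret Q: polyn K ?Q J J by (intro polyn.intro pullbacks.intro pullbacks_axioms.intro polyn_axioms.intro twocat_axioms hp Q)
  note pm' = pm[unfolded polynomial_monad_morphism_def Let_def Gd fst_conv snd_conv hom_def mem_Collect_eq]
  have fI: "f \<in> Mor K" "src K f = I" "tgt K f = J" and ft: "f \<cdot> pt ?P = pt ?Q \<cdot> g1"
    using pm' by simp_all
  interpret two_poly K ?P I I ?Q J J f g1 g2
    by (intro two_poly.intro P.polyn_axioms Q.polyn_axioms two_poly_axioms.intro) (use pm' in simp_all)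
  interpret L: twocat ?L by (rule twocat_slice)
  interpret K: twocat ?K by (rule twocat_slice)
  interpret A: twoadj ?L ?K F
    using madj by (intro twoadj.intro L.twocat_axioms K.twocat_axioms twoadj_axioms.intro) (simp add: monad_adjunction_def)
  have hcK: "has_commas ?K" by (rule has_commas_slice[OF hc dJ])
  note SF = two_functor_Sigma[OF fI]
  have phi: "invertible1 ?K (\<phi> x)" if "x \<in> Ob ?L" for x using cx that by blast
  have Tf: "two_functor ?K ?K (endo T)" and Sf: "two_functor ?L ?L (endo S)"
     and cn: "two_natural ?L ?K (ladj F \<odot> endo S) (endo T \<odot> ladj F) (colax F)"
    using madj unfolding monad_adjunction_def two_monad_def by simp_all
  have eP: "endo (assoc_monad K M) = poly_fun K ?P" and eQ: "endo (assoc_monad K N) = poly_fun K ?Q" by (simp_all add: assoc_monad_def Let_def)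
  have sn: "two_natural ?L ?L (endo S) (poly_fun K ?P) \<sigma>" and si: "\<And>x. x \<in> Ob ?L \<Longrightarrow> invertible1 ?L (\<sigma> x)"
    using sg unfolding two_monad_iso_def eP by blast+
  have tn: "two_natural ?K ?K (endo T) (poly_fun K ?Q) \<tau>" and ti: "\<And>x. x \<in> Ob ?K \<Longrightarrow> invertible1 ?K (\<tau> x)"
    using ta unfolding two_monad_iso_def eQ by blast+
  note TF = two_functor_facts[OF Tf] and SF' = two_functor_facts[OF Sf] and SiF = two_functor_facts[OF SF]
  note PN = two_natural_facts[OF ph] and SN = two_natural_facts[OF sn] and TN = two_natural_facts[OF tn] and CN = two_natural_facts[OF cn]
  let ?Si = "Sigma_fun K f" and ?T1 = "onmor (endo T)" and ?S1 = "onmor (endo S)"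
  \<comment> \<open>The compatibility of \<sigma>, \<tau> and \<phi> with the colax structures,
    solved for \<open>colax F x\<close>.\<close>
  have eq: "inv1 ?K (?T1 (\<phi> x)) \<cdot>\<^bsub>?K\<^esub> inv1 ?K (\<tau> (onob ?Si x)) \<cdot>\<^bsub>?K\<^esub> assoc_colax K M N f G x \<cdot>\<^bsub>?K\<^esub> onmor ?Si (\<sigma> x) \<cdot>\<^bsub>?K\<^esub> \<phi> (onob (endo S) x) = colax F x"
    if x: "x \<in> Ob ?L" for x
  proof -
    have o: "onob ?Si x \<in> Ob ?K" "\<phi> x \<in> Mor ?K" by (rule SiF(1)[OF x], rule PN(1)[OF x])
    note t = ti[OF o(1)] and p = K.two_functor_invertible1[OF K.twocat_axioms Tf phi[OF x]]
    have c: "colax F x \<in> Mor ?K" "tgt ?K (colax F x) = src ?K (?T1 (\<phi> x))" using CN(1,3)[OF x] TF(3)[OF o(2)] PN(2)[OF x] by simp_all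
    have d: "?T1 (\<phi> x) \<in> Mor ?K" "tgt ?K (?T1 (\<phi> x)) = src ?K (\<tau> (onob ?Si x))"
      using TF(2,4)[OF o(2)] PN(3)[OF x] TN(2)[OF o(1)] by simp_all
    have "assoc_colax K M N f G x \<cdot>\<^bsub>?K\<^esub> onmor ?Si (\<sigma> x) \<cdot>\<^bsub>?K\<^esub> \<phi> (onob (endo S) x) = \<tau> (onob ?Si x) \<cdot>\<^bsub>?K\<^esub> ?T1 (\<phi> x) \<cdot>\<^bsub>?K\<^esub> colax F x"
      using cx[THEN bspec, OF x] by simp
    then show ?thesis using K.inv1_facts(7)[OF t, of "?T1 (\<phi> x) \<cdot>\<^bsub>?K\<^esub> colax F x"] K.inv1_facts(7)[OF p c] K.cmp_facts[OF c(1) d(1) c(2)] d(2) by simp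
  qed
  show ?thesis
  proof (rule alg_cocomplete_Fbar[OF L.twocat_axioms K.twocat_axioms madj _ _ g _ _ ac])
    show "carrier \<A> \<in> Ob ?K" "act \<A> \<in> hom ?K (onob (endo T) (carrier \<A>)) (carrier \<A>)"
      by (rule alg[unfolded pseudo_algebra_def Let_def, THEN conjunct1] alg[unfolded pseudo_algebra_def Let_def, THEN conjunct2, THEN conjunct1])+
    show "pointwise_left_kan ?L g u h \<psi> \<longleftrightarrow>
      pointwise_left_kan ?K (onmor (ladj F) g) (adj_counit F A \<cdot>\<^bsub>?K\<^esub> onmor (ladj F) u) (adj_counit F A \<cdot>\<^bsub>?K\<^esub> onmor (ladj F) h) (id2 ?K (adj_counit F A) \<star>\<^bsub>?K\<^esub> oncell (ladj F) \<psi>)"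
      if "g \<in> hom ?L X Y" "u \<in> hom ?L X (onob (radj F) A)" "h \<in> hom ?L Y (onob (radj F) A)"
       "\<psi> \<in> cells ?L u (h \<cdot>\<^bsub>?L\<^esub> g)" "A \<in> Ob ?K" for g X Y u h \<psi> A
      by (rule A.pointwise_left_kan_transpose[OF hcK SF ph phi comma_square_Sigma[OF dI dJ fI] that])
    show "kan_square ?K (onmor (endo T) (onmor (ladj F) g)) (colax F (tgt ?L g)) (colax F (src ?L g)) (onmor (ladj F) (onmor (endo S) g))"
    proof -
      let ?X = "src ?L g" and ?Y = "tgt ?L g"
      have X: "?X \<in> Ob ?L" "?Y \<in> Ob ?L" using L.Mor_facts(1,2)[OF g] .
      have SX: "onob ?Si ?X \<in> Ob ?K" "onob ?Si ?Y \<in> Ob ?K" using SiF(1) X by blast+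
      have S0: "onob (endo S) ?X \<in> Ob ?L" "onob (endo S) ?Y \<in> Ob ?L" using SF'(1) X by blast+
      note Sig = SiF(2-4)[OF g] and Fg = A.lfun_facts(2-4)[OF g] and Sg = SF'(2-4)[OF g] and Pg = P.poly_fun_facts[OF g]
      note Qg = Q.poly_fun_facts[OF Sig(1)]
      \<comment> \<open>The five squares are the naturality squares at \<open>g\<close> of the
        factors in \<open>eq\<close>, from left to right: \<open>T\<close> of \<phi> reversed,
        \<tau> reversed, the polynomial colax structure, \<Sigma> of \<sigma>, and \<phi> at the
        values of \<open>S\<close>.\<close>
      have 1: "kan_square ?K (?T1 (onmor (ladj F) g)) (inv1 ?K (?T1 (\<phi> ?Y))) (inv1 ?K (?T1 (\<phi> ?X))) (?T1 (onmor ?Si g))"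
        by (rule K.kan_square_iso_inv[OF hcK TF(2)[OF Fg(1)] TF(2)[OF Sig(1)] K.two_functor_invertible1[OF K.twocat_axioms Tf phi[OF X(1)]]
            K.two_functor_invertible1[OF K.twocat_axioms Tf phi[OF X(2)]]])
          (use TF(3,4)[OF Fg(1)] TF(3,4)[OF Sig(1)] TF(3,4)[OF PN(1)[OF X(1)]] TF(3,4)[OF PN(1)[OF X(2)]] PN(2,3)[OF X(1)] PN(2,3)[OF X(2)] Fg Sig
             TF(9)[OF Fg(1) PN(1)[OF X(2)]] TF(9)[OF PN(1)[OF X(1)] Sig(1)] PN(4)[OF g refl refl] in simp_all)
      have 2: "kan_square ?K (?T1 (onmor ?Si g)) (inv1 ?K (\<tau> (onob ?Si ?Y))) (inv1 ?K (\<tau> (onob ?Si ?X))) (onmor (poly_fun K ?Q) (onmor ?Si g))"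
        by (rule K.kan_square_iso_inv[OF hcK TF(2)[OF Sig(1)] Qg(1) ti[OF SX(1)] ti[OF SX(2)]])
          (use TF(3,4)[OF Sig(1)] Qg Sig(2,3) TN(2,3)[OF SX(1)] TN(2,3)[OF SX(2)] TN(4)[OF Sig] in simp_all)
      have 3: "kan_square ?K (onmor (poly_fun K ?Q) (onmor ?Si g)) (assoc_colax K M N f G ?Y) (assoc_colax K M N f G ?X) (onmor ?Si (onmor (poly_fun K ?P) g))"
        unfolding Gd by (rule kan_square_assoc_colax[OF dI dJ hc st ft _ _ g refl refl]) simp_all
      have 4: "kan_square ?K (onmor ?Si (onmor (poly_fun K ?P) g)) (onmor ?Si (\<sigma> ?Y)) (onmor ?Si (\<sigma> ?X)) (onmor ?Si (?S1 g))"
        by (rule K.kan_square_iso[OF hcK SiF(2)[OF Pg(1)] SiF(2)[OF Sg(1)] L.two_functor_invertible1[OF K.twocat_axioms SF si[OF X(1)]]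
            L.two_functor_invertible1[OF K.twocat_axioms SF si[OF X(2)]]])
          (use SiF(3,4)[OF Pg(1)] SiF(3,4)[OF Sg(1)] SiF(3,4)[OF SN(1)[OF X(1)]] SiF(3,4)[OF SN(1)[OF X(2)]] SN(2,3)[OF X(1)] SN(2,3)[OF X(2)] Pg Sg
             SiF(9)[OF SN(1)[OF X(1)] Pg(1)] SiF(9)[OF Sg(1) SN(1)[OF X(2)]] SN(4)[OF g refl refl] in \<open>simp_all del: Sigma_fun_simps\<close>)
      have 5: "kan_square ?K (onmor ?Si (?S1 g)) (\<phi> (onob (endo S) ?Y)) (\<phi> (onob (endo S) ?X)) (onmor (ladj F) (?S1 g))"
        by (rule K.kan_square_iso[OF hcK SiF(2)[OF Sg(1)] A.lfun_facts(2)[OF Sg(1)] phi[OF S0(1)] phi[OF S0(2)]])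
          (use SiF(3,4)[OF Sg(1)] A.lfun_facts(3,4)[OF Sg(1)] PN(2,3)[OF S0(1)] PN(2,3)[OF S0(2)] Sg(2,3) PN(4)[OF Sg] in \<open>simp_all del: Sigma_fun_simps\<close>)
      show ?thesis
        using K.kan_square_paste[OF 1 K.kan_square_paste[OF 2 K.kan_square_paste[OF 3 K.kan_square_paste[OF 4 5]]]] unfolding eq[OF X(1)] eq[OF X(2)] .
    qed
  qed
qed

theorem proposition4p6p7:
  fixes I J :: "'u::universe cat"
    and S T :: "('u func, 'u func \<times> 'u func, 'u ntrans \<times> 'u func) monad2"
    and M N :: "'u func poly_mnd"
    and F :: "('u func, 'u func \<times> 'u func, 'u ntrans \<times> 'u func,
               'u func, 'u func \<times> 'u func, 'u ntrans \<times> 'u func) monad_adj"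
    and \<A> :: "('u func, 'u func \<times> 'u func, 'u ntrans \<times> 'u func) pseudo_alg"
    and g :: "'u func \<times> 'u func"
  assumes "I \<in> Ob Cat" and "J \<in> Ob Cat"
    and "polynomial_adjunction Cat I S M J T N F"
    and "pseudo_algebra (slice Cat J) T \<A>"
    and "g \<in> Mor (slice Cat I)"
    and "discrete I" and "discrete J"
    and "groupoid (tgt Cat (pp (mpoly N)))"
    and "split_fibration (pp (mpoly N))"
    and "alg_cocomplete (slice Cat J) T \<A> (onmor (ladj F) g)"
  shows "alg_cocomplete (slice Cat I) S (Fbar (slice Cat I) S T F \<A>) g"
proof (rule split_fibration_normal_cleavage[OF assms(9)])
  have T: "twocat (Cat :: ('u cat, 'u func, 'u ntrans) two_cat)" using two_category_Cat by (simp add: twocat_def)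
  have "polynomial Cat J J (mpoly N)"
    using assms(3)[unfolded polynomial_adjunction_def, THEN conjunct2, THEN conjunct2, THEN conjunct1] unfolding polynomial_monad_def Let_def by (rule conjunct1)
  then show "pp (mpoly N) \<in> Mor Cat" by (simp add: polynomial_def exponentiable_def)
  fix st assume st: "normal_cleavage Cat (pp (mpoly N)) st"
  show ?thesis
    by (rule twocat.alg_cocomplete_polynomial_adjunction[OF T has_commas_Cat has_pullbacks_Cat
        discrete_ob_Cat[OF assms(6)] discrete_ob_Cat[OF assms(7)] assms(3-5) st assms(10)])
qed

end
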